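(* Let $V^\bullet$ be a finite-dimensional graded $\mathbf k$-vector space, $D\in C(V^\bullet)$ a $\mathbf k$-point, and $[D]$ the stratum ($GL(V^\bullet)$-orbit) of $D$. (a) The fiber at $D$ of the normal cone $\mathrm{NC}_{[D]/C(V^\bullet)}$ is $$(\mathrm{NC}_{[D]/C(V^\bullet)})_D\simeq C(H_D^\bullet(V^\bullet))\subset\mathrm{Hom}_{\mathrm{gr}}\bigl(H_D^\bullet(V^\bullet),H_D^\bullet(V^\bullet)[1]\bigr).$$ (b) Suppose $D$ is contained in some $C_{\mathbf r}(V^\bullet)$, $\mathbf r\in R$. Then the fiber at $D$ of $\mathrm{NC}_{[D]/C_{\mathbf r}(V^\bullet)}$ is $$(\mathrm{NC}_{[D]/C_{\mathbf r}(V^\bullet)})_D\simeq C_{\mathbf r-\mathbf r_D}(H_D^\bullet(V^\bullet))\subset\mathrm{Hom}_{\mathrm{gr}}^{\le\mathbf r-\mathbf r_D}\bigl(H_D^\bullet(V^\bullet),H_D^\bullet(V^\bullet)[1]\bigr),$$ where $\mathbf r_D=(\operatorname{rk}D_0,\dots,\operatorname{rk}D_{m-1})$ is the sequence of ranks of the differential $D$.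
   Context: $\mathbf k$ is an algebraically closed field of characteristic $0$. $V^\bullet=\bigoplus_{i=0}^mV^i$, $n_i=\dim V^i$, $(W^\bullet[1])^i=W^{i+1}$; $\mathrm{Hom}_{\mathrm{gr}}$ denotes degree-preserving linear maps of graded spaces. $C(V^\bullet)\subset\prod_i\mathrm{Hom}(V^i,V^{i+1})=\mathrm{Hom}_{\mathrm{gr}}(V^\bullet,V^\bullet[1])$ is the closed subscheme of $D=(D_i)$ with $D_{i+1}D_i=0$ for all $i$. $GL(V^\bullet)=\prod_iGL(V^i)$ acts by $(gD)_i=g_{i+1}D_ig_i^{-1}$. $H_D^\bullet(V^\bullet)$ is the graded space of cohomology of $(V^\bullet,D)$. $R$ is the set of $\mathbf r=(r_1,\dots,r_m)\in\mathbb Z_{\ge0}^m$ with $r_i+r_{i+1}\le n_i$ for $i=0,\dots,m$, where $r_0=r_{m+1}=0$. $C_{\mathbf r}(V^\bullet)$ is the closed subvariety of $C(V^\bullet)$ given by $\operatorname{rk}D_i\le r_{i+1}$, $i=0,\dots,m-1$ (similarly for other graded spaces), and $\mathrm{Hom}_{\mathrm{gr}}^{\le\mathbf r}$ is the subvariety of $f=(f_i)$ with $\operatorname{rk}f_i\le r_{i+1}$ for all $i$. For a closed subscheme $Y\subset Z$ with ideal sheaf $I_Y$, $\mathrm{NC}_{Y/Z}=\mathrm{Spec}_{\mathcal O_Y}\bigl(\bigoplus_{n\ge0}I_Y^n/I_Y^{n+1}\bigr)$; for $Y$ locally closed, replace $Z$ by an open subset in which $Y$ is closed. *)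

theory Defs
  imports
    "Jordan_Normal_Form.VS_Connect"
    "HOL-Algebra.QuotRing"
    "HOL-Algebra.Ideal_Product"
    "HOL-Algebra.Generated_Rings"
    "HOL-Algebra.UnivPoly"
begin

section \<open>Graded vector spaces and complexes\<close>

text \<open>
  A graded vector space concentrated in degrees \<open>0, \<dots>, m\<close> is a family \<open>V\<close> of vector spaces, of
  which only the members \<open>V 0, \<dots>, V m\<close> matter. The field is the type \<open>'k\<close>, in the form
  \<^const>\<open>class_ring\<close>. In \<^typ>\<open>('k, 'v) module\<close> the fields \<open>mult\<close> and \<open>one\<close> carry no meaning.
\<close>

definition graded_space :: "nat \<Rightarrow> (nat \<Rightarrow> ('k::field, 'v) module) \<Rightarrow> bool" where
  "graded_space m V \<longleftrightarrow>
     (\<forall>i\<le>m. vectorspace class_ring (V i) \<and> vectorspace.fin_dim class_ring (V i))"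

definition lin_hom :: "('k::field, 'v) module \<Rightarrow> ('k, 'w) module \<Rightarrow> ('v \<Rightarrow> 'w) set" where
  "lin_hom V W = LinearCombinations.module_hom class_ring V W \<inter> extensional (carrier V)"

definition dual :: "('k::field, 'v) module \<Rightarrow> ('v \<Rightarrow> 'k) set" where
  "dual V = {\<xi> \<in> extensional (carrier V).
     (\<forall>x\<in>carrier V. \<forall>y\<in>carrier V. \<xi> (x \<oplus>\<^bsub>V\<^esub> y) = \<xi> x + \<xi> y) \<and>
     (\<forall>c. \<forall>x\<in>carrier V. \<xi> (c \<odot>\<^bsub>V\<^esub> x) = c * \<xi> x)}"

definition lin_rank :: "('k::field, 'v) module \<Rightarrow> ('k, 'w) module \<Rightarrow> ('v \<Rightarrow> 'w) \<Rightarrow> nat" where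
  "lin_rank V W T = vectorspace.dim class_ring (W\<lparr>carrier := T ` carrier V\<rparr>)"

definition quot_module :: "('k, 'v) module \<Rightarrow> 'v set \<Rightarrow> ('k, 'v set) module" where
  "quot_module M N =
     \<lparr>carrier = a_rcosets\<^bsub>M\<^esub> N, mult = undefined, one = undefined,
      zero = N, add = set_add M,
      smult = (\<lambda>c X. \<Union>x\<in>X. N +>\<^bsub>M\<^esub> (c \<odot>\<^bsub>M\<^esub> x))\<rparr>"

text \<open>
  The vector space \<open>Hom\<^sub>g\<^sub>r(V, V[1])\<close>. The factor of degree \<open>m\<close> is absent because \<open>V\<close> vanishes in
  degree \<open>m + 1\<close>.
\<close>

definition hom_gr1 ::
  "nat \<Rightarrow> (nat \<Rightarrow> ('k::field, 'v) module) \<Rightarrow> ('k, nat \<Rightarrow> 'v \<Rightarrow> 'v) module" where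
  "hom_gr1 m V =
     \<lparr>carrier = (\<Pi>\<^sub>E i\<in>{..<m}. lin_hom (V i) (V (Suc i))), mult = undefined, one = undefined,
      zero = (\<lambda>i\<in>{..<m}. \<lambda>x\<in>carrier (V i). \<zero>\<^bsub>V (Suc i)\<^esub>),
      add = (\<lambda>f g. \<lambda>i\<in>{..<m}. \<lambda>x\<in>carrier (V i). f i x \<oplus>\<^bsub>V (Suc i)\<^esub> g i x),
      smult = (\<lambda>c f. \<lambda>i\<in>{..<m}. \<lambda>x\<in>carrier (V i). c \<odot>\<^bsub>V (Suc i)\<^esub> f i x)\<rparr>"

definition complexes ::
  "nat \<Rightarrow> (nat \<Rightarrow> ('k::field, 'v) module) \<Rightarrow> (nat \<Rightarrow> 'v \<Rightarrow> 'v) set" where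
  "complexes m V = {D \<in> carrier (hom_gr1 m V).
     \<forall>i. Suc i < m \<longrightarrow> (\<forall>x\<in>carrier (V i). D (Suc i) (D i x) = \<zero>\<^bsub>V (Suc (Suc i))\<^esub>)}"

definition cycles ::
  "nat \<Rightarrow> (nat \<Rightarrow> ('k, 'v) module) \<Rightarrow> (nat \<Rightarrow> 'v \<Rightarrow> 'v) \<Rightarrow> nat \<Rightarrow> 'v set" where
  "cycles m V D i =
     (if i < m then {x \<in> carrier (V i). D i x = \<zero>\<^bsub>V (Suc i)\<^esub>} else carrier (V i))"

definition boundaries ::
  "(nat \<Rightarrow> ('k, 'v) module) \<Rightarrow> (nat \<Rightarrow> 'v \<Rightarrow> 'v) \<Rightarrow> nat \<Rightarrow> 'v set" where
  "boundaries V D i = (case i of 0 \<Rightarrow> {\<zero>\<^bsub>V 0\<^esub>} | Suc j \<Rightarrow> D j ` carrier (V j))"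

definition cohomology ::
  "nat \<Rightarrow> (nat \<Rightarrow> ('k, 'v) module) \<Rightarrow> (nat \<Rightarrow> 'v \<Rightarrow> 'v) \<Rightarrow> nat \<Rightarrow> ('k, 'v set) module" where
  "cohomology m V D i = quot_module ((V i)\<lparr>carrier := cycles m V D i\<rparr>) (boundaries V D i)"

definition gl :: "nat \<Rightarrow> (nat \<Rightarrow> ('k::field, 'v) module) \<Rightarrow> (nat \<Rightarrow> 'v \<Rightarrow> 'v) set" where
  "gl m V = (\<Pi>\<^sub>E i\<in>{..m}. {g \<in> lin_hom (V i) (V i). bij_betw g (carrier (V i)) (carrier (V i))})"

definition gl_act ::
  "nat \<Rightarrow> (nat \<Rightarrow> ('k, 'v) module) \<Rightarrow> (nat \<Rightarrow> 'v \<Rightarrow> 'v) \<Rightarrow> (nat \<Rightarrow> 'v \<Rightarrow> 'v) \<Rightarrow> nat \<Rightarrow> 'v \<Rightarrow> 'v" where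
  "gl_act m V g D =
     (\<lambda>i\<in>{..<m}. \<lambda>x\<in>carrier (V i). g (Suc i) (D i (the_inv_into (carrier (V i)) (g i) x)))"

definition stratum ::
  "nat \<Rightarrow> (nat \<Rightarrow> ('k::field, 'v) module) \<Rightarrow> (nat \<Rightarrow> 'v \<Rightarrow> 'v) \<Rightarrow> (nat \<Rightarrow> 'v \<Rightarrow> 'v) set" where
  "stratum m V D = (\<lambda>g. gl_act m V g D) ` gl m V"

text \<open>
  A sequence \<open>(r\<^sub>1, \<dots>, r\<^sub>m)\<close> is a function on the naturals that vanishes outside \<open>{1..m}\<close>, so that
  \<open>r\<^sub>0 = r\<^sub>m\<^sub>+\<^sub>1 = 0\<close>. The rank of \<open>D\<^sub>i\<close> is the entry with index \<open>i + 1\<close>.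
\<close>

definition rank_bounds :: "nat \<Rightarrow> (nat \<Rightarrow> ('k::field, 'v) module) \<Rightarrow> (nat \<Rightarrow> nat) set" where
  "rank_bounds m V = {r. (\<forall>j. j \<notin> {1..m} \<longrightarrow> r j = 0) \<and>
     (\<forall>i\<le>m. r i + r (Suc i) \<le> vectorspace.dim class_ring (V i))}"

definition ranks ::
  "nat \<Rightarrow> (nat \<Rightarrow> ('k::field, 'v) module) \<Rightarrow> (nat \<Rightarrow> 'v \<Rightarrow> 'v) \<Rightarrow> nat \<Rightarrow> nat" where
  "ranks m V D j = (if j \<in> {1..m} then lin_rank (V (j - 1)) (V j) (D (j - 1)) else 0)"

definition hom_gr1_le ::
  "nat \<Rightarrow> (nat \<Rightarrow> ('k::field, 'v) module) \<Rightarrow> (nat \<Rightarrow> nat) \<Rightarrow> (nat \<Rightarrow> 'v \<Rightarrow> 'v) set" where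
  "hom_gr1_le m V r = {f \<in> carrier (hom_gr1 m V).
     \<forall>i<m. lin_rank (V i) (V (Suc i)) (f i) \<le> r (Suc i)}"

definition complexes_le ::
  "nat \<Rightarrow> (nat \<Rightarrow> ('k::field, 'v) module) \<Rightarrow> (nat \<Rightarrow> nat) \<Rightarrow> (nat \<Rightarrow> 'v \<Rightarrow> 'v) set" where
  "complexes_le m V r = complexes m V \<inter> hom_gr1_le m V r"


section \<open>Closed subschemes of a vector space\<close>

text \<open>
  The affine space underlying a finite-dimensional vector space \<open>M\<close> has as coordinate ring the
  symmetric algebra of the dual of \<open>M\<close>. The field being infinite, this is the ring of polynomial
  functions on \<open>M\<close>, the subalgebra of all functions generated by the linear functionals. A closed
  subscheme is an ideal \<open>I\<close> of this ring, its coordinate ring the quotient by \<open>I\<close>.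
\<close>

definition fun_ring :: "'p set \<Rightarrow> ('p \<Rightarrow> 'k::field) ring" where
  "fun_ring P =
     \<lparr>carrier = P \<rightarrow>\<^sub>E UNIV, mult = (\<lambda>f g. \<lambda>p\<in>P. f p * g p), one = (\<lambda>p\<in>P. 1),
      zero = (\<lambda>p\<in>P. 0), add = (\<lambda>f g. \<lambda>p\<in>P. f p + g p)\<rparr>"

definition poly_ring :: "('k::field, 'p) module \<Rightarrow> ('p \<Rightarrow> 'k) ring" where
  "poly_ring M = (fun_ring (carrier M))
     \<lparr>carrier := generate_ring (fun_ring (carrier M)) (range (\<lambda>c. \<lambda>p\<in>carrier M. c) \<union> dual M)\<rparr>"

definition homogeneous :: "('k::field, 'p) module \<Rightarrow> nat \<Rightarrow> ('p \<Rightarrow> 'k) set" where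
  "homogeneous M n =
     {f \<in> carrier (poly_ring M). \<forall>c. \<forall>p\<in>carrier M. f (c \<odot>\<^bsub>M\<^esub> p) = c ^ n * f p}"

definition vanishing_ideal :: "('k::field, 'p) module \<Rightarrow> 'p set \<Rightarrow> ('p \<Rightarrow> 'k) set" where
  "vanishing_ideal M X = {f \<in> carrier (poly_ring M). \<forall>p\<in>X. f p = 0}"

definition coord_ring :: "('k::field, 'p) module \<Rightarrow> ('p \<Rightarrow> 'k) set \<Rightarrow> ('p \<Rightarrow> 'k) set ring" where
  "coord_ring M I = poly_ring M Quot I"

definition coord_scalar :: "('k::field, 'p) module \<Rightarrow> ('p \<Rightarrow> 'k) set \<Rightarrow> 'k \<Rightarrow> ('p \<Rightarrow> 'k) set" where
  "coord_scalar M I c = I +>\<^bsub>poly_ring M\<^esub> (\<lambda>p\<in>carrier M. c)"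

text \<open>
  The scheme \<open>C(V)\<close>: its ideal is generated by the matrix coefficients of the maps \<open>D\<^sub>i\<^sub>+\<^sub>1D\<^sub>i\<close>.
\<close>

definition complexes_ideal ::
  "nat \<Rightarrow> (nat \<Rightarrow> ('k::field, 'v) module) \<Rightarrow> ((nat \<Rightarrow> 'v \<Rightarrow> 'v) \<Rightarrow> 'k) set" where
  "complexes_ideal m V = Idl\<^bsub>poly_ring (hom_gr1 m V)\<^esub>
     {\<lambda>D\<in>carrier (hom_gr1 m V). \<xi> (D (Suc i) (D i x)) | i x \<xi>.
        Suc i < m \<and> x \<in> carrier (V i) \<and> \<xi> \<in> dual (V (Suc (Suc i)))}"

text \<open>The variety \<open>C\<^sub>r(V)\<close>, with its reduced structure.\<close>

definition complexes_le_ideal ::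
  "nat \<Rightarrow> (nat \<Rightarrow> ('k::field, 'v) module) \<Rightarrow> (nat \<Rightarrow> nat) \<Rightarrow> ((nat \<Rightarrow> 'v \<Rightarrow> 'v) \<Rightarrow> 'k) set" where
  "complexes_le_ideal m V r = vanishing_ideal (hom_gr1 m V) (complexes_le m V r)"


section \<open>Cones as graded algebras\<close>

text \<open>
  An affine cone over the field is given by its coordinate ring together with the structure map
  from the field and the homogeneous components.
\<close>

record ('k, 'a) graded_algebra = "'a ring" +
  scalar :: "'k \<Rightarrow> 'a"
  component :: "nat \<Rightarrow> 'a set"

definition graded_algebra_iso ::
  "('k, 'a) graded_algebra \<Rightarrow> ('k, 'b) graded_algebra \<Rightarrow> bool" (infix \<open>\<cong>\<^sub>g\<^sub>r\<close> 50) where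
  "A \<cong>\<^sub>g\<^sub>r B \<longleftrightarrow> (\<exists>\<phi>\<in>ring_iso A B.
     (\<forall>c. \<phi> (scalar A c) = scalar B c) \<and> (\<forall>n. \<phi> ` component A n = component B n))"

text \<open>The closed subscheme with ideal \<open>I\<close>, for a homogeneous ideal \<open>I\<close>.\<close>

definition subcone ::
  "('k::field, 'p) module \<Rightarrow> ('p \<Rightarrow> 'k) set \<Rightarrow> ('k, ('p \<Rightarrow> 'k) set) graded_algebra" where
  "subcone M I = ring.extend (coord_ring M I)
     \<lparr>scalar = coord_scalar M I,
      component = (\<lambda>n. (\<lambda>f. I +>\<^bsub>poly_ring M\<^esub> f) ` homogeneous M n)\<rparr>"


section \<open>Localization\<close>

definition loc_rel :: "'a ring \<Rightarrow> 'a set \<Rightarrow> (('a \<times> 'a) \<times> ('a \<times> 'a)) set" where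
  "loc_rel R S = {((a, s), (b, t)). a \<in> carrier R \<and> b \<in> carrier R \<and> s \<in> S \<and> t \<in> S \<and>
     (\<exists>u\<in>S. u \<otimes>\<^bsub>R\<^esub> (t \<otimes>\<^bsub>R\<^esub> a) = u \<otimes>\<^bsub>R\<^esub> (s \<otimes>\<^bsub>R\<^esub> b))}"

definition frac :: "'a ring \<Rightarrow> 'a set \<Rightarrow> 'a \<Rightarrow> 'a \<Rightarrow> ('a \<times> 'a) set" where
  "frac R S a s = loc_rel R S `` {(a, s)}"

definition localization :: "'a ring \<Rightarrow> 'a set \<Rightarrow> ('a \<times> 'a) set ring" where
  "localization R S =
     \<lparr>carrier = (carrier R \<times> S) // loc_rel R S,
      mult = (\<lambda>X Y. \<Union>(a, s)\<in>X. \<Union>(b, t)\<in>Y. frac R S (a \<otimes>\<^bsub>R\<^esub> b) (s \<otimes>\<^bsub>R\<^esub> t)),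
      one = frac R S \<one>\<^bsub>R\<^esub> \<one>\<^bsub>R\<^esub>,
      zero = frac R S \<zero>\<^bsub>R\<^esub> \<one>\<^bsub>R\<^esub>,
      add = (\<lambda>X Y. \<Union>(a, s)\<in>X. \<Union>(b, t)\<in>Y.
               frac R S ((t \<otimes>\<^bsub>R\<^esub> a) \<oplus>\<^bsub>R\<^esub> (s \<otimes>\<^bsub>R\<^esub> b)) (s \<otimes>\<^bsub>R\<^esub> t))\<rparr>"


section \<open>Associated graded rings\<close>

primrec ideal_pow :: "'a ring \<Rightarrow> 'a set \<Rightarrow> nat \<Rightarrow> 'a set" where
  "ideal_pow R I 0 = carrier R"
| "ideal_pow R I (Suc n) = I \<cdot>\<^bsub>R\<^esub> ideal_pow R I n"

definition rees :: "'a ring \<Rightarrow> 'a set \<Rightarrow> ('a, nat \<Rightarrow> 'a) up_ring" where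
  "rees R I = (UP R)
     \<lparr>carrier := {p \<in> carrier (UP R). \<forall>n. up_ring.coeff (UP R) p n \<in> ideal_pow R I n}\<rparr>"

text \<open>
  The ring \<open>\<Oplus>n. I\<^sup>n / I\<^sup>n\<^sup>+\<^sup>1\<close>, as the quotient of the Rees ring \<open>\<Oplus>n. I\<^sup>n\<close> by \<open>\<Oplus>n. I\<^sup>n\<^sup>+\<^sup>1\<close>.
\<close>

definition gr_kernel :: "'a ring \<Rightarrow> 'a set \<Rightarrow> (nat \<Rightarrow> 'a) set" where
  "gr_kernel R I =
     {p \<in> carrier (UP R). \<forall>n. up_ring.coeff (UP R) p n \<in> ideal_pow R I (Suc n)}"

definition gr_ring :: "'a ring \<Rightarrow> 'a set \<Rightarrow> (nat \<Rightarrow> 'a) set ring" where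
  "gr_ring R I = rees R I Quot gr_kernel R I"

definition gr_class :: "'a ring \<Rightarrow> 'a set \<Rightarrow> nat \<Rightarrow> 'a \<Rightarrow> (nat \<Rightarrow> 'a) set" where
  "gr_class R I n x = gr_kernel R I +>\<^bsub>rees R I\<^esub> up_ring.monom (UP R) x n"

text \<open>
  The tensor product of \<^term>\<open>gr_ring R I\<close> with \<open>R/J\<close> over \<open>R/I\<close>, for \<open>I \<subseteq> J\<close>: the quotient by the
  ideal that \<open>J/I\<close>, which sits in degree \<open>0\<close>, generates.
\<close>

definition gr_fiber_kernel :: "'a ring \<Rightarrow> 'a set \<Rightarrow> 'a set \<Rightarrow> (nat \<Rightarrow> 'a) set set" where
  "gr_fiber_kernel R I J = Idl\<^bsub>gr_ring R I\<^esub> (gr_class R I 0 ` J)"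

definition gr_fiber ::
  "'a ring \<Rightarrow> 'a set \<Rightarrow> 'a set \<Rightarrow> ('k \<Rightarrow> 'a) \<Rightarrow> ('k, (nat \<Rightarrow> 'a) set set) graded_algebra" where
  "gr_fiber R I J \<sigma> = ring.extend (gr_ring R I Quot gr_fiber_kernel R I J)
     \<lparr>scalar = (\<lambda>c. gr_fiber_kernel R I J +>\<^bsub>gr_ring R I\<^esub> gr_class R I 0 (\<sigma> c)),
      component = (\<lambda>n. (\<lambda>x. gr_fiber_kernel R I J +>\<^bsub>gr_ring R I\<^esub> gr_class R I n x)
                        ` ideal_pow R I n)\<rparr>"


section \<open>The fiber of a normal cone\<close>

text \<open>
  Let \<open>Z\<close> be the closed subscheme of \<open>M\<close> with ideal \<open>I\<close>, let \<open>Y\<close> be a locally closed set of points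
  of \<open>Z\<close>, with its reduced structure, and \<open>p \<in> Y\<close>. The fiber at \<open>p\<close> of the relative spectrum of a
  quasi-coherent algebra is the spectrum of the stalk at \<open>p\<close> tensored with the residue field. The
  stalks at \<open>p\<close> do not depend on the open subset of \<open>Z\<close> in which \<open>Y\<close> is closed.
\<close>

definition maximal_at ::
  "('k::field, 'p) module \<Rightarrow> ('p \<Rightarrow> 'k) set \<Rightarrow> 'p \<Rightarrow> ('p \<Rightarrow> 'k) set set" where
  "maximal_at M I p = {a \<in> carrier (coord_ring M I). \<forall>f\<in>a. f p = 0}"

definition units_at ::
  "('k::field, 'p) module \<Rightarrow> ('p \<Rightarrow> 'k) set \<Rightarrow> 'p \<Rightarrow> ('p \<Rightarrow> 'k) set set" where
  "units_at M I p = carrier (coord_ring M I) - maximal_at M I p"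

definition frac_at ::
  "('k::field, 'p) module \<Rightarrow> ('p \<Rightarrow> 'k) set \<Rightarrow> 'p \<Rightarrow> ('p \<Rightarrow> 'k) set \<Rightarrow> ('p \<Rightarrow> 'k) set \<Rightarrow>
   (('p \<Rightarrow> 'k) set \<times> ('p \<Rightarrow> 'k) set) set" where
  "frac_at M I p a s = frac (coord_ring M I) (units_at M I p) a s"

definition local_ring ::
  "('k::field, 'p) module \<Rightarrow> ('p \<Rightarrow> 'k) set \<Rightarrow> 'p \<Rightarrow>
   (('p \<Rightarrow> 'k) set \<times> ('p \<Rightarrow> 'k) set) set ring" where
  "local_ring M I p = localization (coord_ring M I) (units_at M I p)"

definition local_maximal ::
  "('k::field, 'p) module \<Rightarrow> ('p \<Rightarrow> 'k) set \<Rightarrow> 'p \<Rightarrow>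
   (('p \<Rightarrow> 'k) set \<times> ('p \<Rightarrow> 'k) set) set set" where
  "local_maximal M I p =
     {frac_at M I p a s | a s. a \<in> maximal_at M I p \<and> s \<in> units_at M I p}"

text \<open>
  The stalk at \<open>p\<close> of the ideal sheaf of \<open>Y\<close>: the germs \<open>a/s\<close> such that \<open>a\<close> vanishes on the part of
  \<open>Y\<close> in some principal open neighbourhood \<open>u \<noteq> 0\<close> of \<open>p\<close>, that is, such that \<open>ua\<close> vanishes on \<open>Y\<close>.
\<close>

definition local_ideal ::
  "('k::field, 'p) module \<Rightarrow> ('p \<Rightarrow> 'k) set \<Rightarrow> 'p set \<Rightarrow> 'p \<Rightarrow>
   (('p \<Rightarrow> 'k) set \<times> ('p \<Rightarrow> 'k) set) set set" where
  "local_ideal M I Y p =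
     {frac_at M I p a s | a s. a \<in> carrier (coord_ring M I) \<and> s \<in> units_at M I p \<and>
        (\<exists>u\<in>units_at M I p. \<forall>f\<in>u \<otimes>\<^bsub>coord_ring M I\<^esub> a. \<forall>y\<in>Y. f y = 0)}"

definition normal_cone_fiber ::
  "('k::field, 'p) module \<Rightarrow> ('p \<Rightarrow> 'k) set \<Rightarrow> 'p set \<Rightarrow> 'p \<Rightarrow>
   ('k, (nat \<Rightarrow> (('p \<Rightarrow> 'k) set \<times> ('p \<Rightarrow> 'k) set) set) set set) graded_algebra" where
  "normal_cone_fiber M I Y p =
     gr_fiber (local_ring M I p) (local_ideal M I Y p) (local_maximal M I p)
       (\<lambda>c. frac_at M I p (coord_scalar M I c) \<one>\<^bsub>coord_ring M I\<^esub>)"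

end

theory Submission
  imports Defs "HOL-Computational_Algebra.Polynomial" "HOL-Library.Function_Algebras"
begin

text \<open>
  Choose bases of the \<open>V i\<close> adapted to boundaries \<open>\<subseteq>\<close> cycles \<open>\<subseteq> V i\<close>, with index sets \<open>B i\<close>, \<open>H i\<close>,
  \<open>L i\<close>, so that \<open>D\<close> maps the basis vectors in \<open>L i\<close> to those in \<open>B (i + 1)\<close> and kills the others.
  For a point \<open>p\<close> near \<open>D\<close> the block of \<open>p\<^sub>i\<close> with rows \<open>B (i + 1)\<close> and columns \<open>L i\<close> is invertible;
  let \<open>S p\<close> be its Schur complement, restricted to the \<open>H\<close>-block. Then \<open>S\<close> maps complexes to
  complexes on the cohomology, lowers ranks by those of \<open>D\<close>, and vanishes on the orbit of \<open>D\<close>. Conversely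
  the entries of \<open>S\<close> generate the ideal of the orbit locally, because an automorphism with regular entries carries
  \<open>D\<close> to \<open>p\<close> modulo these entries and the entries of the \<open>p\<^sub>i\<^sub>+\<^sub>1p\<^sub>i\<close>. Hence \<open>f \<mapsto> f \<circ> S\<close> maps the forms of
  degree \<open>n\<close> onto \<open>J\<^sup>n\<close> modulo \<open>K J\<^sup>n\<close>, where \<open>J\<close> is the ideal of the orbit and \<open>K\<close> the maximal ideal
  of the local ring at \<open>D\<close>. Its kernel is the ideal of the cone, as restriction to the affine slice
  \<open>E \<mapsto> D + E\<close>, on which \<open>S\<close> is the identity, shows.
\<close>

section \<open>Fibers of associated graded rings\<close>

text \<open>The scheme of complexes is not assumed to be reduced, so vanishing at points proves
  nothing modulo its ideal. The relations needed there are derived as identities between matrix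
  entries up to combinations of the entries of the products of consecutive maps; only the orbit,
  which carries the reduced structure, may be tested pointwise. For the varieties of bounded rank,
  whose ideals are defined by vanishing, points suffice. Both cases meet in the axioms of
  \<open>normal_slice\<close>.

  In degree n the fiber is \<open>J^n / K J^n\<close>. Passing to this quotient freezes the
  coefficients of germs at their values in \<open>D\<close>, which gives surjectivity from the mere
  generation of \<open>J\<close>. The kernel is harder, since \<open>K J^n\<close> has no explicit
  description; on the slice it is bounded by an order of vanishing modulo the cone, and that order
  can be read off from homogeneous components.

  The localization in the statement consists of classes of pairs of cosets. The computations take
  place instead with total functions that are regular near \<open>D\<close>; \<open>germ\<close>
  relates the two.\<close>

locale filtered_ring = cring R for R :: "'a ring" (structure) +
  fixes J K :: "'a set"
  assumes J_ideal: "ideal J R" and K_ideal: "ideal K R" and J_le_K: "J \<subseteq> K"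
begin

abbreviation "P \<equiv> UP R"
abbreviation "T \<equiv> rees R J"
abbreviation "G \<equiv> gr_kernel R J"
abbreviation "S \<equiv> gr_ring R J"
abbreviation "F \<equiv> gr_fiber_kernel R J K"
abbreviation "KJ n \<equiv> K \<cdot> ideal_pow R J n"

lemma pow_ideal: "ideal (ideal_pow R J n) R"
  by (induction n) (auto intro: oneideal ideal_prod_is_ideal J_ideal)

lemma KJ_ideal: "ideal (KJ n) R"
  by (intro ideal_prod_is_ideal K_ideal pow_ideal)

lemma pow_carrier: "x \<in> ideal_pow R J n \<Longrightarrow> x \<in> carrier R"
  using pow_ideal ideal.Icarr by metis

lemma ideal_prod_mono: "A \<subseteq> A' \<Longrightarrow> B \<subseteq> B' \<Longrightarrow> A \<cdot> B \<subseteq> A' \<cdot> B'"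
proof
  fix x assume "A \<subseteq> A'" "B \<subseteq> B'" "x \<in> A \<cdot> B"
  from this(3) show "x \<in> A' \<cdot> B'"
    by (induction rule: ideal_prod.induct) (use \<open>A \<subseteq> A'\<close> \<open>B \<subseteq> B'\<close> in \<open>auto intro: ideal_prod.intros\<close>)
qed

lemma pow_Suc_KJ: "ideal_pow R J (Suc n) \<subseteq> KJ n"
  using ideal_prod_mono[OF J_le_K subset_refl] by simp

lemma KJ_pow: "KJ n \<subseteq> ideal_pow R J n"
  using ideal_prod_inter[OF K_ideal pow_ideal] by blast

text \<open>Multiplication by \<open>y\<close> passes through the sums of products that make up the
  ideal product, so only the right-hand factors have to be moved from \<open>A\<close> to
  \<open>B\<close>.\<close>

lemma prod_mult_mem:
  assumes "ideal I R" "x \<in> I \<cdot> A" "A \<subseteq> carrier R" "y \<in> carrier R" "\<And>a. a \<in> A \<Longrightarrow> a \<otimes> y \<in> B"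
  shows "x \<otimes> y \<in> I \<cdot> B"
  using assms(2)
proof (induction rule: ideal_prod.induct)
  case (prod i j)
  then have "i \<otimes> j \<otimes> y = i \<otimes> (j \<otimes> y)"
    using assms ideal.Icarr[OF assms(1)] by (intro m_assoc) auto
  then show ?case using prod assms by (auto intro: ideal_prod.prod)
next
  case (sum s1 s2)
  have "I \<cdot> A \<subseteq> carrier R"
  proof
    fix z assume "z \<in> I \<cdot> A" then show "z \<in> carrier R"
      by induction (use assms ideal.Icarr[OF assms(1)] in auto)
  qed
  then have "(s1 \<oplus> s2) \<otimes> y = s1 \<otimes> y \<oplus> s2 \<otimes> y"
    using sum assms by (intro l_distr) auto
  then show ?case using sum by (auto intro: ideal_prod.sum)
qed

lemma pow_mult:
  "x \<in> ideal_pow R J i \<Longrightarrow> y \<in> ideal_pow R J j \<Longrightarrow> x \<otimes> y \<in> ideal_pow R J (i + j)"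
proof (induction i arbitrary: x)
  case 0
  then show ?case using pow_ideal ideal.I_l_closed by fastforce
next
  case (Suc i)
  have "x \<otimes> y \<in> J \<cdot> ideal_pow R J (i + j)"
    by (rule prod_mult_mem[OF J_ideal, of _ "ideal_pow R J i"])
      (use Suc pow_carrier in auto)
  then show ?case by simp
qed

lemma KJ_mult:
  "x \<in> KJ i \<Longrightarrow> y \<in> ideal_pow R J j \<Longrightarrow> x \<otimes> y \<in> KJ (i + j)"
  by (rule prod_mult_mem[OF K_ideal, of _ "ideal_pow R J i"]) (use pow_mult pow_carrier in auto)

lemma finsum_ideal:
  assumes "ideal I R" "\<And>i. i \<in> A \<Longrightarrow> f i \<in> I"
  shows "finsum R f A \<in> I"
  using assms(2)
proof (induction A rule: infinite_finite_induct)
  case (insert x A)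
  then have "f \<in> A \<rightarrow> carrier R" "f x \<in> carrier R" using ideal.Icarr[OF assms(1)] by auto
  then show ?case using insert additive_subgroup.a_closed[OF ideal.axioms(1)[OF assms(1)]] by auto
qed (auto simp: additive_subgroup.zero_closed[OF ideal.axioms(1)[OF assms(1)]] finsum_infinite)

sublocale UP: UP_cring R P by unfold_locales simp_all

definition cf :: "(nat \<Rightarrow> 'a) \<Rightarrow> nat \<Rightarrow> 'a" where "cf = up_ring.coeff P"

lemma rees_carrier: "carrier T = {p \<in> carrier P. \<forall>n. cf p n \<in> ideal_pow R J n}"
  by (simp add: rees_def cf_def)

lemma rees_ops: "\<one>\<^bsub>T\<^esub> = \<one>\<^bsub>P\<^esub>" "\<zero>\<^bsub>T\<^esub> = \<zero>\<^bsub>P\<^esub>" "x \<oplus>\<^bsub>T\<^esub> y = x \<oplus>\<^bsub>P\<^esub> y" "x \<otimes>\<^bsub>T\<^esub> y = x \<otimes>\<^bsub>P\<^esub> y"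
  by (simp_all add: rees_def)

lemma zero_mem: "ideal I R \<Longrightarrow> \<zero> \<in> I"
  by (simp add: additive_subgroup.zero_closed ideal.axioms(1))

lemma rees_subcring: "subcring (carrier T) P"
proof (rule UP.P.subcringI'[OF UP.P.subringI])
  show "carrier T \<subseteq> carrier P" "\<one>\<^bsub>P\<^esub> \<in> carrier T"
    by (auto simp: rees_carrier cf_def zero_mem[OF pow_ideal])
  fix p q assume pq: "p \<in> carrier T" "q \<in> carrier T"
  show "\<ominus>\<^bsub>P\<^esub> p \<in> carrier T"
    using pq by (auto simp: rees_carrier cf_def intro: additive_subgroup.a_inv_closed ideal.axioms(1) pow_ideal)
  show "p \<oplus>\<^bsub>P\<^esub> q \<in> carrier T"
    using pq by (auto simp: rees_carrier cf_def intro: additive_subgroup.a_closed ideal.axioms(1) pow_ideal)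
  show "p \<otimes>\<^bsub>P\<^esub> q \<in> carrier T"
  proof -
    have "cf p i \<otimes> cf q (n - i) \<in> ideal_pow R J n" if "i \<in> {..n}" for i n
      using pow_mult[of "cf p i" i "cf q (n - i)" "n - i"] pq that by (auto simp: rees_carrier)
    then have "finsum R (\<lambda>i. cf p i \<otimes> cf q (n - i)) {..n} \<in> ideal_pow R J n" for n
      by (intro finsum_ideal pow_ideal)
    then show ?thesis using pq by (simp add: rees_carrier cf_def)
  qed
qed

sublocale T: cring T
  using UP.P.subcring_iff[of "carrier T"] rees_subcring subcringE(1)[OF rees_subcring]
  by (simp add: rees_def)

text \<open>The two instances are \<open>I n = J^(n+1)\<close>, which gives the associated graded
  ring, and \<open>I n = K J^n\<close>, which gives its fiber.\<close>

lemma rees_ideal: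
  assumes "\<And>n. ideal (I n) R" "\<And>n. I n \<subseteq> ideal_pow R J n"
    and "\<And>i j x y. x \<in> I i \<Longrightarrow> y \<in> ideal_pow R J j \<Longrightarrow> x \<otimes> y \<in> I (i + j)"
  shows "ideal {p \<in> carrier T. \<forall>n. cf p n \<in> I n} T"
proof (rule idealI)
  show "ring T" ..
  \<comment> \<open>Negation is described in each ring by its own carrier; that the two negatives
    agree follows from uniqueness of inverses.\<close>
  have ainv: "\<ominus>\<^bsub>T\<^esub> p = \<ominus>\<^bsub>P\<^esub> p" if "p \<in> carrier T" for p
    using that UP.P.l_neg rees_ops rees_carrier rees_subcring
    by (metis (no_types, lifting) UP.P.minus_equality T.a_inv_closed T.l_neg mem_Collect_eq)
  show "subgroup {p \<in> carrier T. \<forall>n. cf p n \<in> I n} (add_monoid T)"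
  proof (rule T.add.subgroupI)
    have "\<zero>\<^bsub>T\<^esub> \<in> {p \<in> carrier T. \<forall>n. cf p n \<in> I n}"
      using T.zero_closed by (simp add: rees_ops cf_def zero_mem[OF assms(1)])
    then show "{p \<in> carrier T. \<forall>n. cf p n \<in> I n} \<noteq> {}" by blast
    fix p q assume pq: "p \<in> {p \<in> carrier T. \<forall>n. cf p n \<in> I n}" "q \<in> {p \<in> carrier T. \<forall>n. cf p n \<in> I n}"
    then show "\<ominus>\<^bsub>T\<^esub> p \<in> {p \<in> carrier T. \<forall>n. cf p n \<in> I n}"
      using T.a_inv_closed[of p]
      by (auto simp: ainv) (auto simp: rees_carrier cf_def intro: additive_subgroup.a_inv_closed ideal.axioms(1) assms(1))
    show "p \<oplus>\<^bsub>T\<^esub> q \<in> {p \<in> carrier T. \<forall>n. cf p n \<in> I n}"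
      using T.a_closed[of p q] pq
      by (auto simp: rees_ops) (auto simp: rees_carrier cf_def intro: additive_subgroup.a_closed ideal.axioms(1) assms(1))
  qed auto
  fix p q assume p: "p \<in> {p \<in> carrier T. \<forall>n. cf p n \<in> I n}" and q: "q \<in> carrier T"
  have "p \<otimes>\<^bsub>T\<^esub> q \<in> carrier T" using p q by auto
  moreover have "cf (p \<otimes>\<^bsub>T\<^esub> q) n \<in> I n" for n
  proof -
    have "cf p i \<otimes> cf q (n - i) \<in> I n" if "i \<in> {..n}" for i
      using assms(3)[of "cf p i" i "cf q (n - i)" "n - i"] p q that by (auto simp: rees_carrier)
    then have "finsum R (\<lambda>i. cf p i \<otimes> cf q (n - i)) {..n} \<in> I n"
      by (intro finsum_ideal assms)
    then show ?thesis using p q by (simp add: rees_ops rees_carrier cf_def)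
  qed
  ultimately show "p \<otimes>\<^bsub>T\<^esub> q \<in> {p \<in> carrier T. \<forall>n. cf p n \<in> I n}" by blast
  then show "q \<otimes>\<^bsub>T\<^esub> p \<in> {p \<in> carrier T. \<forall>n. cf p n \<in> I n}"
    using p q T.m_comm[of p q] by auto
qed

text \<open>\<open>gr_kernel\<close> is cut out of all of \<open>UP R\<close>; since
  \<open>J^(n+1)\<close> lies in \<open>J^n\<close>, its elements are automatically in the Rees
  ring.\<close>

lemma G_eq: "G = {p \<in> carrier T. \<forall>n. cf p n \<in> ideal_pow R J (Suc n)}"
proof -
  have "ideal_pow R J (Suc n) \<subseteq> ideal_pow R J n" for n using pow_Suc_KJ KJ_pow by blast
  then show ?thesis
    unfolding gr_kernel_def rees_carrier cf_def by blast
qed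

lemma G_ideal: "ideal G T"
  unfolding G_eq
proof (rule rees_ideal[OF pow_ideal])
  show "ideal_pow R J (Suc n) \<subseteq> ideal_pow R J n" for n using pow_Suc_KJ KJ_pow by blast
  show "x \<otimes> y \<in> ideal_pow R J (Suc (i + j))" if "x \<in> ideal_pow R J (Suc i)" "y \<in> ideal_pow R J j" for x y i j
    using pow_mult[OF that] by simp
qed

abbreviation "N \<equiv> {p \<in> carrier T. \<forall>n. cf p n \<in> KJ n}"

lemma N_ideal: "ideal N T"
  by (rule rees_ideal[OF KJ_ideal KJ_pow KJ_mult])

lemma G_sub_N: "G \<subseteq> N"
  using pow_Suc_KJ by (auto simp: G_eq simp del: ideal_pow.simps)

sublocale S: cring S
  unfolding gr_ring_def by (rule ideal.quotient_is_cring[OF G_ideal T.is_cring])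

definition cls :: "(nat \<Rightarrow> 'a) \<Rightarrow> (nat \<Rightarrow> 'a) set" where "cls p = G +>\<^bsub>T\<^esub> p"

lemma cls_hom: "cls \<in> Ring.ring_hom T S"
  using ideal.rcos_ring_hom[OF G_ideal] by (simp add: gr_ring_def cls_def[abs_def])

lemma cls_surj: "carrier S = cls ` carrier T"
  by (auto simp: gr_ring_def FactRing_def A_RCOSETS_def' cls_def)

lemma monom_rees: "x \<in> ideal_pow R J n \<Longrightarrow> up_ring.monom P x n \<in> carrier T"
  using pow_carrier by (auto simp: rees_carrier cf_def zero_mem[OF pow_ideal])

lemma gr_class_eq: "gr_class R J n x = cls (up_ring.monom P x n)"
  by (simp add: gr_class_def cls_def)

lemma F_gens: "gr_class R J 0 ` K \<subseteq> carrier S"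
  using monom_rees[of _ 0] ideal.Icarr[OF K_ideal]
  by (auto simp: gr_class_eq cls_surj)

lemma F_ideal: "ideal F S"
  unfolding gr_fiber_kernel_def by (rule S.genideal_ideal[OF F_gens])

text \<open>A product \<open>i j\<close> with \<open>i\<close> in \<open>K\<close> and
  \<open>j\<close> in \<open>J^n\<close> sits in degree n as the product of \<open>i\<close> in
  degree 0, whose class generates part of \<open>F\<close>, and \<open>j\<close> in degree
  n.\<close>

lemma cls_monom_F:
  assumes "x \<in> KJ n"
  shows "cls (up_ring.monom P x n) \<in> F"
  using assms
proof (induction rule: ideal_prod.induct)
  case (prod i j)
  have c: "i \<in> carrier R" "j \<in> carrier R" using prod ideal.Icarr[OF K_ideal] pow_carrier by auto
  have m: "up_ring.monom P i 0 \<in> carrier T" "up_ring.monom P j n \<in> carrier T"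
    using monom_rees[of i 0] monom_rees[OF prod(2)] c by auto
  have "up_ring.monom P (i \<otimes> j) n = up_ring.monom P i 0 \<otimes>\<^bsub>T\<^esub> up_ring.monom P j n"
    using UP.monom_mult[OF c, of 0 n] by (simp add: rees_ops)
  then have "cls (up_ring.monom P (i \<otimes> j) n) = gr_class R J 0 i \<otimes>\<^bsub>S\<^esub> cls (up_ring.monom P j n)"
    using ring_hom_mult[OF cls_hom m] by (simp add: gr_class_eq)
  moreover have "gr_class R J 0 i \<in> F"
    unfolding gr_fiber_kernel_def using S.genideal_self[OF F_gens] prod by auto
  moreover have "cls (up_ring.monom P j n) \<in> carrier S" using m cls_surj by auto
  ultimately show ?case using ideal.I_r_closed[OF F_ideal] by simp
next
  case (sum x y)
  have c: "x \<in> carrier R" "y \<in> carrier R" using sum ideal.Icarr[OF KJ_ideal] by auto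
  have m: "up_ring.monom P x n \<in> carrier T" "up_ring.monom P y n \<in> carrier T"
    using sum KJ_pow monom_rees by blast+
  have "cls (up_ring.monom P (x \<oplus> y) n) = cls (up_ring.monom P x n) \<oplus>\<^bsub>S\<^esub> cls (up_ring.monom P y n)"
    using ring_hom_add[OF cls_hom m] c by (simp add: rees_ops)
  then show ?case using sum additive_subgroup.a_closed[OF ideal.axioms(1)[OF F_ideal]] by auto
qed

lemma N_imp_F:
  assumes "p \<in> N" shows "cls p \<in> F"
proof -
  have main: "cls p \<in> F" if "p \<in> N" "\<And>n. n \<ge> d \<Longrightarrow> cf p n = \<zero>" for p d
    using that
  proof (induction d arbitrary: p)
    case 0
    then have "p = \<zero>\<^bsub>T\<^esub>"
      by (auto simp: rees_ops rees_carrier cf_def intro!: UP.up_eqI)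
    then show ?case
      using ring_hom_zero[OF cls_hom T.ring_axioms S.ring_axioms] additive_subgroup.zero_closed[OF ideal.axioms(1)[OF F_ideal]] by simp
  next
    case (Suc d)
    let ?m = "up_ring.monom P (cf p d) d"
    have pP: "p \<in> carrier P" and pT: "p \<in> carrier T" using Suc.prems by (auto simp: rees_carrier)
    have mT: "?m \<in> carrier T" using pT by (auto simp: rees_carrier intro!: monom_rees[unfolded rees_carrier, simplified])
    have mN: "?m \<in> N" using Suc.prems mT pP by (auto simp: cf_def zero_mem[OF KJ_ideal])
    have mP: "?m \<in> carrier P" using mT by (auto simp: rees_carrier)
    \<comment> \<open>Removing the top monomial lowers the degree bound. Both pieces stay in
      \<open>N\<close>, because \<open>N\<close> is defined coefficientwise.\<close>
    define q where "q = p \<ominus>\<^bsub>T\<^esub> ?m"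
    have qN: "q \<in> N" unfolding q_def a_minus_def
      using Suc.prems mN N_ideal by (metis (no_types, lifting) additive_subgroup.a_closed additive_subgroup.a_inv_closed ideal.axioms(1))
    have qT: "q \<in> carrier T" using qN by auto
    have p_eq: "p = q \<oplus>\<^bsub>T\<^esub> ?m" unfolding q_def using pT mT by (simp add: T.a_assoc T.l_neg a_minus_def)
    have cfp: "cf p n = cf q n \<oplus> cf ?m n" for n
      using qT mP by (subst p_eq) (simp add: rees_ops rees_carrier cf_def)
    have "cf q n = \<zero>" if "n \<ge> d" for n
    proof -
      have cq: "cf q n \<in> carrier R" using qT by (auto simp: rees_carrier cf_def)
      have pc: "cf p d \<in> carrier R" "cf p n \<in> carrier R" using pP by (auto simp: cf_def)
      show ?thesis
      proof (cases "n = d")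
        case True
        then have "cf p d = cf q n \<oplus> cf p d" using cfp[of n] pc by (simp add: cf_def)
        then show ?thesis using cq pc by (metis add.r_cancel_one')
      next
        case False
        then have "cf p n = \<zero>" "cf ?m n = \<zero>" using that Suc.prems(2) pc by (auto simp: cf_def)
        then show ?thesis using cfp[of n] cq by simp
      qed
    qed
    then have "cls q \<in> F" using Suc.IH qN by blast
    moreover have "cls ?m \<in> F" using Suc.prems by (intro cls_monom_F) auto
    moreover have "cls p = cls q \<oplus>\<^bsub>S\<^esub> cls ?m"
      using ring_hom_add[OF cls_hom qT mT] p_eq by simp
    ultimately show ?case using additive_subgroup.a_closed[OF ideal.axioms(1)[OF F_ideal]] by auto
  qed
  obtain d where "bound \<zero> d (cf p)"
    using assms by (auto simp: rees_carrier cf_def UP_def up_def)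
  then have "cf p n = \<zero>" if "n \<ge> Suc d" for n using that by (auto simp: bound_def)
  then show ?thesis using main assms by blast
qed

text \<open>The image of \<open>N\<close> in the quotient by \<open>G\<close> is an ideal, and in
  degree 0 it contains \<open>K\<close>, because \<open>K J^0 = K\<close>.\<close>

lemma F_sub: "F \<subseteq> cls ` N"
  unfolding gr_fiber_kernel_def
proof (rule S.genideal_minimal)
  interpret h: ring_hom_ring T S cls
    by (rule ring_hom_ringI2[OF T.ring_axioms S.ring_axioms cls_hom])
  have "ideal (cls ` N) (T Quot G)"
    using T.ring_ideal_imp_quot_ideal[OF G_ideal N_ideal] by (simp add: cls_def[abs_def])
  then show "ideal (cls ` N) S" by (simp add: gr_ring_def)
  have "up_ring.monom P x 0 \<in> N" if "x \<in> K" for x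
  proof -
    have c: "x \<in> carrier R" using that ideal.Icarr[OF K_ideal] by auto
    have "KJ 0 = K" using ideal_prod_one[OF K_ideal] by simp
    then show ?thesis using monom_rees[of x 0] c that
      by (auto simp: cf_def zero_mem[OF K_ideal] zero_mem[OF KJ_ideal])
  qed
  then show "gr_class R J 0 ` K \<subseteq> cls ` N" by (auto simp: gr_class_eq)
qed

text \<open>\<open>G\<close> lies in \<open>N\<close>, so a class in the image of \<open>N\<close>
  has all its representatives in \<open>N\<close>. Hence the fiber is the direct sum of the
  \<open>J^n / K J^n\<close>.\<close>

lemma cls_mem_F:
  assumes "p \<in> carrier T" shows "cls p \<in> F \<longleftrightarrow> p \<in> N"
proof
  assume "cls p \<in> F"
  then obtain q where q: "q \<in> N" "cls p = cls q" using F_sub by auto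
  then have "p \<ominus>\<^bsub>T\<^esub> q \<in> G"
    using T.quotient_eq_iff_same_a_r_cos[OF G_ideal assms, of q] by (auto simp: cls_def)
  then have "p \<ominus>\<^bsub>T\<^esub> q \<in> N" using G_sub_N by blast
  then have "(p \<ominus>\<^bsub>T\<^esub> q) \<oplus>\<^bsub>T\<^esub> q \<in> N"
    using q N_ideal by (metis (no_types, lifting) additive_subgroup.a_closed ideal.axioms(1))
  then show "p \<in> N" using assms q by (simp add: a_minus_def T.a_assoc T.l_neg)
qed (rule N_imp_F)

definition fib :: "(nat \<Rightarrow> 'a) \<Rightarrow> (nat \<Rightarrow> 'a) set set" where "fib p = F +>\<^bsub>S\<^esub> cls p"

lemma fib_hom: "fib \<in> Ring.ring_hom T (S Quot F)"
  using ring_hom_trans[OF cls_hom ideal.rcos_ring_hom[OF F_ideal]] by (simp add: fib_def[abs_def] o_def)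

lemma fib_surj: "carrier (S Quot F) = fib ` carrier T"
  by (auto simp: FactRing_def A_RCOSETS_def' fib_def cls_surj)

sublocale Q: cring "S Quot F"
  by (rule ideal.quotient_is_cring[OF F_ideal S.is_cring])

lemma fib_eq_zero:
  assumes "p \<in> carrier T"
  shows "fib p = \<zero>\<^bsub>S Quot F\<^esub> \<longleftrightarrow> p \<in> N"
proof -
  have c: "cls p \<in> carrier S" using ring_hom_closed[OF cls_hom assms] .
  have z: "\<zero>\<^bsub>S Quot F\<^esub> = F" by (simp add: FactRing_def)
  have "fib p = F \<longleftrightarrow> cls p \<in> F"
    using S.a_rcos_zero[OF F_ideal] ideal.rcos_const_imp_mem[OF F_ideal c] by (auto simp: fib_def)
  then show ?thesis using cls_mem_F[OF assms] z by simp
qed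

lemma fib_eq:
  assumes "p \<in> carrier T" "q \<in> carrier T" "\<And>n. cf p n \<ominus> cf q n \<in> KJ n"
  shows "fib p = fib q"
proof -
  interpret h: ring_hom_ring T "S Quot F" fib
    by (rule ring_hom_ringI2[OF T.ring_axioms Q.ring_axioms fib_hom])
  have cP: "p \<in> carrier P" "q \<in> carrier P" "p \<ominus>\<^bsub>T\<^esub> q \<in> carrier P"
    using assms T.minus_closed[of p q] by (auto simp: rees_carrier)
  have "p = (p \<ominus>\<^bsub>T\<^esub> q) \<oplus>\<^bsub>T\<^esub> q" using assms by (simp add: a_minus_def T.a_assoc T.l_neg)
  then have "cf p n = cf (p \<ominus>\<^bsub>T\<^esub> q) n \<oplus> cf q n" for n
    using UP.coeff_add[OF cP(3) cP(2), of n] by (simp add: rees_ops cf_def)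
  then have "cf (p \<ominus>\<^bsub>T\<^esub> q) n = cf p n \<ominus> cf q n" for n
    using cP by (simp add: cf_def a_minus_def a_assoc r_neg)
  then have "p \<ominus>\<^bsub>T\<^esub> q \<in> N" using assms by auto
  then have "fib (p \<ominus>\<^bsub>T\<^esub> q) = \<zero>\<^bsub>S Quot F\<^esub>" using fib_eq_zero by auto
  then have "fib p \<ominus>\<^bsub>S Quot F\<^esub> fib q = \<zero>\<^bsub>S Quot F\<^esub>" using assms(1,2) by (simp add: a_minus_def)
  then show ?thesis using assms(1,2) by simp
qed

end

section \<open>Graded rings that present the fiber\<close>

locale graded_ring_decomp = cring B for B :: "'b ring" (structure) +
  fixes hc :: "nat \<Rightarrow> 'b \<Rightarrow> 'b"
  assumes hc_closed: "f \<in> carrier B \<Longrightarrow> hc n f \<in> carrier B"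
    and hc_add: "f \<in> carrier B \<Longrightarrow> g \<in> carrier B \<Longrightarrow> hc n (f \<oplus> g) = hc n f \<oplus> hc n g"
    and hc_mult: "f \<in> carrier B \<Longrightarrow> g \<in> carrier B \<Longrightarrow>
      hc n (f \<otimes> g) = (\<Oplus>i\<in>{..n}. hc i f \<otimes> hc (n - i) g)"
    and hc_one: "hc n \<one> = (if n = 0 then \<one> else \<zero>)"
    and hc_hc: "f \<in> carrier B \<Longrightarrow> hc k (hc n f) = (if k = n then hc n f else \<zero>)"
    and hc_finite: "f \<in> carrier B \<Longrightarrow> \<exists>d. \<forall>n>d. hc n f = \<zero>"
begin

lemma hc_zero: "hc n \<zero> = \<zero>"
  by (metis hc_add hc_closed r_zero zero_closed add.l_cancel_one')

lemma hc_sum: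
  assumes "\<And>i. h i \<in> hc i ` carrier B"
  shows "\<exists>f\<in>carrier B. \<forall>n. hc n f = (if n < d then h n else \<zero>)"
proof (induction d)
  case 0
  then show ?case using hc_zero by (intro bexI[of _ \<zero>]) auto
next
  case (Suc d)
  then obtain f where f: "f \<in> carrier B" "\<forall>n. hc n f = (if n < d then h n else \<zero>)" by blast
  obtain g where g: "g \<in> carrier B" "h d = hc d g" using assms[of d] by auto
  have c: "h i \<in> carrier B" for i using assms[of i] hc_closed by auto
  have "hc n (f \<oplus> h d) = (if n < Suc d then h n else \<zero>)" for n
  proof -
    have "hc n (f \<oplus> h d) = hc n f \<oplus> hc n (hc d g)"
      using f g by (simp add: hc_add hc_closed)
    also have "hc n (hc d g) = (if n = d then h d else \<zero>)" using g hc_hc by simp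
    finally show ?thesis using f c by auto
  qed
  then show ?case using f(1) c by (intro bexI[of _ "f \<oplus> h d"]) auto
qed

end

text \<open>Degree by degree, \<open>\<theta>\<close> maps the component n of \<open>B\<close> into
  \<open>J^n\<close> and onto it modulo \<open>K J^n\<close>, and \<open>I\<close> consists of the
  elements all of whose components become zero there. This is what an isomorphism of
  \<open>B Quot I\<close> with the fiber requires.\<close>

locale filtered_ring_presentation = filtered_ring R J K + B: graded_ring_decomp B hc
  for R :: "'a ring" (structure) and J K and B :: "'b ring" and hc +
  fixes \<theta> :: "'b \<Rightarrow> 'a" and I :: "'b set"
  assumes \<theta>_hom: "\<theta> \<in> Ring.ring_hom B R"
    and I_ideal: "ideal I B"
    and \<theta>_pow: "f \<in> carrier B \<Longrightarrow> \<theta> (hc n f) \<in> ideal_pow R J n"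
    and pow_\<theta>: "x \<in> ideal_pow R J n \<Longrightarrow> \<exists>f\<in>carrier B. x \<ominus> \<theta> (hc n f) \<in> K \<cdot> ideal_pow R J n"
    and I_iff: "f \<in> carrier B \<Longrightarrow> f \<in> I \<longleftrightarrow> (\<forall>n. \<theta> (hc n f) \<in> K \<cdot> ideal_pow R J n)"
begin

interpretation \<theta>: ring_hom_ring B R \<theta>
  by (rule ring_hom_ringI2[OF B.ring_axioms ring_axioms \<theta>_hom])

text \<open>The sum of the \<open>\<theta> (hc n f) t^n\<close> in the Rees ring: the grading of
  \<open>B\<close> becomes the power of the variable.\<close>

definition \<theta>s :: "'b \<Rightarrow> nat \<Rightarrow> 'a" where "\<theta>s f = (\<lambda>n. \<theta> (hc n f))"

lemma \<theta>s_UP: "f \<in> carrier B \<Longrightarrow> \<theta>s f \<in> carrier P"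
  using B.hc_finite[of f] B.hc_closed \<theta>.hom_zero by (fastforce simp: UP_def up_def \<theta>s_def bound_def)

lemma cf_\<theta>s: "f \<in> carrier B \<Longrightarrow> cf (\<theta>s f) n = \<theta> (hc n f)"
  using \<theta>s_UP[of f] by (simp add: cf_def \<theta>s_def UP_def)

lemma \<theta>s_closed: "f \<in> carrier B \<Longrightarrow> \<theta>s f \<in> carrier T"
  by (simp add: rees_carrier \<theta>s_UP cf_\<theta>s \<theta>_pow)

lemma \<theta>s_eqI:
  assumes "p \<in> carrier P" "f \<in> carrier B" "\<And>n. cf p n = \<theta> (hc n f)"
  shows "\<theta>s f = p"
  by (rule UP.up_eqI) (use assms \<theta>s_UP[of f] cf_\<theta>s[of f] in \<open>auto simp: cf_def\<close>)

lemma \<theta>s_hom: "\<theta>s \<in> Ring.ring_hom B T"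
proof (rule ring_hom_memI)
  show "\<theta>s f \<in> carrier T" if "f \<in> carrier B" for f by (rule \<theta>s_closed[OF that])
  show "\<theta>s \<one>\<^bsub>B\<^esub> = \<one>\<^bsub>T\<^esub>"
    unfolding rees_ops by (rule \<theta>s_eqI) (auto simp: cf_def B.hc_one)
  fix f g assume fg: "f \<in> carrier B" "g \<in> carrier B"
  then have c: "\<theta>s f \<in> carrier P" "\<theta>s g \<in> carrier P" using \<theta>s_UP by auto
  show "\<theta>s (f \<oplus>\<^bsub>B\<^esub> g) = \<theta>s f \<oplus>\<^bsub>T\<^esub> \<theta>s g"
    unfolding rees_ops
    by (rule \<theta>s_eqI) (use fg c in \<open>auto simp: cf_def B.hc_add B.hc_closed cf_\<theta>s[unfolded cf_def]\<close>)
  have "\<theta> (hc n (f \<otimes>\<^bsub>B\<^esub> g)) = (\<Oplus>i\<in>{..n}. \<theta> (hc i f) \<otimes> \<theta> (hc (n - i) g))" for n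
  proof -
    have "\<theta> (hc n (f \<otimes>\<^bsub>B\<^esub> g)) = finsum R (\<theta> \<circ> (\<lambda>i. hc i f \<otimes>\<^bsub>B\<^esub> hc (n - i) g)) {..n}"
      using fg by (subst B.hc_mult) (auto intro!: \<theta>.hom_finsum B.hc_closed)
    also have "\<dots> = (\<Oplus>i\<in>{..n}. \<theta> (hc i f) \<otimes> \<theta> (hc (n - i) g))"
      using fg \<theta>.hom_closed[OF B.hc_closed] \<theta>.hom_mult[OF B.hc_closed B.hc_closed]
      by (intro finsum_cong') auto
    finally show ?thesis .
  qed
  then show "\<theta>s (f \<otimes>\<^bsub>B\<^esub> g) = \<theta>s f \<otimes>\<^bsub>T\<^esub> \<theta>s g"
    unfolding rees_ops
    by (intro \<theta>s_eqI) (use fg c in \<open>auto simp: cf_def cf_\<theta>s[unfolded cf_def]\<close>)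
qed

definition h :: "'b \<Rightarrow> (nat \<Rightarrow> 'a) set set" where "h f = fib (\<theta>s f)"

lemma h_hom: "h \<in> Ring.ring_hom B (S Quot F)"
  using ring_hom_trans[OF \<theta>s_hom fib_hom] by (simp add: h_def[abs_def] o_def)

interpretation h: ring_hom_ring B "S Quot F" h
  by (rule ring_hom_ringI2[OF B.ring_axioms Q.ring_axioms h_hom])

lemma h_kernel: "a_kernel B (S Quot F) h = I"
proof -
  have "f \<in> I \<longleftrightarrow> h f = \<zero>\<^bsub>S Quot F\<^esub>" if "f \<in> carrier B" for f
    using that \<theta>s_closed[OF that] fib_eq_zero[OF \<theta>s_closed[OF that]]
    by (simp add: h_def I_iff cf_\<theta>s)
  moreover have "I \<subseteq> carrier B" using ideal.Icarr[OF I_ideal] by blast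
  ultimately show ?thesis unfolding a_kernel_def' by blast
qed

lemma h_surj: "h ` carrier B = carrier (S Quot F)"
proof
  show "h ` carrier B \<subseteq> carrier (S Quot F)" using h.hom_closed by blast
  show "carrier (S Quot F) \<subseteq> h ` carrier B"
  proof
    fix X assume "X \<in> carrier (S Quot F)"
    then obtain p where p: "p \<in> carrier T" "X = fib p" by (auto simp: fib_surj)
    then have "\<forall>n. \<exists>f\<in>carrier B. cf p n \<ominus> \<theta> (hc n f) \<in> KJ n"
      using pow_\<theta> by (auto simp: rees_carrier)
    then obtain f where f: "\<And>n. f n \<in> carrier B" "\<And>n. cf p n \<ominus> \<theta> (hc n (f n)) \<in> KJ n" by metis
    obtain d where d: "bound \<zero> d (cf p)"
      using p by (auto simp: rees_carrier cf_def UP_def up_def)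
    \<comment> \<open>Each coefficient of the polynomial is approximated separately. One element
      \<open>g\<close> has these finitely many components, and beyond the bound \<open>d\<close>
      both sides vanish.\<close>
    obtain g where g: "g \<in> carrier B" "\<And>n. hc n g = (if n < Suc d then hc n (f n) else \<zero>\<^bsub>B\<^esub>)"
      using B.hc_sum[of "\<lambda>n. hc n (f n)" "Suc d"] f(1) by blast
    have "cf p n \<ominus> cf (\<theta>s g) n \<in> KJ n" for n
    proof (cases "n < Suc d")
      case True
      then show ?thesis using f g by (simp add: cf_\<theta>s)
    next
      case False
      then have "cf p n = \<zero>" using d by (auto simp: bound_def)
      then show ?thesis using False g by (simp add: cf_\<theta>s zero_mem[OF KJ_ideal] a_minus_def)
    qed
    then have "fib p = fib (\<theta>s g)" using p g \<theta>s_closed by (intro fib_eq) auto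
    then show "X \<in> h ` carrier B" using p g by (auto simp: h_def)
  qed
qed

lemma \<theta>s_hc: "f \<in> carrier B \<Longrightarrow> \<theta>s (hc n f) = up_ring.monom P (\<theta> (hc n f)) n"
  by (rule \<theta>s_eqI) (auto simp: cf_def B.hc_hc B.hc_closed)

theorem gr_fiber_iso:
  assumes const: "\<And>c. const c \<in> carrier B" "\<And>c. hc 0 (const c) = const c"
    and \<sigma>: "\<And>c. \<sigma> c = \<theta> (const c)"
  shows "gr_fiber R J K \<sigma> \<cong>\<^sub>g\<^sub>r ring.extend (B Quot I)
    \<lparr>scalar = \<lambda>c. I +>\<^bsub>B\<^esub> const c, component = \<lambda>n. (\<lambda>f. I +>\<^bsub>B\<^esub> f) ` hc n ` carrier B\<rparr>"
    (is "?A \<cong>\<^sub>g\<^sub>r ?C")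
proof -
  \<comment> \<open>The homomorphism theorem gives a map out of \<open>B Quot I\<close>, whereas the
    isomorphism of graded algebras starts at the fiber; hence the inverse \<open>\<phi>\<close>
    below.\<close>
  define \<psi> where "\<psi> = (\<lambda>X. the_elem (h ` X))"
  have \<psi>: "\<psi> \<in> ring_iso (B Quot I) (S Quot F)"
    using h.FactRing_iso_set[OF h_surj] by (simp add: h_kernel \<psi>_def)
  have \<psi>_h: "\<psi> (I +>\<^bsub>B\<^esub> f) = h f" if "f \<in> carrier B" for f
    using h.the_elem_simp[OF that] by (simp add: h_kernel \<psi>_def)
  have cos: "I +>\<^bsub>B\<^esub> f \<in> carrier (B Quot I)" if "f \<in> carrier B" for f
    using that by (auto simp: FactRing_def A_RCOSETS_def')
  define \<phi> where "\<phi> = inv_into (carrier (B Quot I)) \<psi>"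
  have \<phi>: "\<phi> \<in> ring_iso (S Quot F) (B Quot I)"
    unfolding \<phi>_def using ring_iso_set_sym[OF ideal.quotient_is_ring[OF I_ideal] \<psi>] .
  have inj: "inj_on \<psi> (carrier (B Quot I))" using \<psi> by (auto simp: ring_iso_def bij_betw_def)
  have \<phi>_h: "\<phi> (h f) = I +>\<^bsub>B\<^esub> f" if "f \<in> carrier B" for f
    unfolding \<phi>_def using inv_into_f_f[OF inj cos[OF that]] \<psi>_h[OF that] by simp
  have cls_h: "F +>\<^bsub>S\<^esub> gr_class R J n (\<theta> (hc n f)) = h (hc n f)" if "f \<in> carrier B" for n f
    using that by (simp add: h_def fib_def gr_class_eq \<theta>s_hc)
  have comp: "(\<lambda>x. F +>\<^bsub>S\<^esub> gr_class R J n x) ` ideal_pow R J n = h ` hc n ` carrier B" for n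
  proof
    show "(\<lambda>x. F +>\<^bsub>S\<^esub> gr_class R J n x) ` ideal_pow R J n \<subseteq> h ` hc n ` carrier B"
    proof
      fix X assume "X \<in> (\<lambda>x. F +>\<^bsub>S\<^esub> gr_class R J n x) ` ideal_pow R J n"
      then obtain x where x: "x \<in> ideal_pow R J n" "X = fib (up_ring.monom P x n)"
        by (auto simp: gr_class_eq fib_def)
      obtain f where f: "f \<in> carrier B" "x \<ominus> \<theta> (hc n f) \<in> KJ n" using pow_\<theta>[OF x(1)] by blast
      have "fib (up_ring.monom P x n) = fib (up_ring.monom P (\<theta> (hc n f)) n)"
        using f x monom_rees[OF x(1)] monom_rees[OF \<theta>_pow[OF f(1)]] pow_carrier[OF x(1)]
        by (intro fib_eq) (auto simp: cf_def B.hc_closed zero_mem[OF KJ_ideal] a_minus_def)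
      then have "X = h (hc n f)" using x f by (simp add: h_def \<theta>s_hc)
      then show "X \<in> h ` hc n ` carrier B" using f by blast
    qed
    show "h ` hc n ` carrier B \<subseteq> (\<lambda>x. F +>\<^bsub>S\<^esub> gr_class R J n x) ` ideal_pow R J n"
      using \<theta>_pow cls_h by (auto simp: image_iff) metis
  qed
  have "\<phi> \<in> ring_iso ?A ?C"
    using \<phi> by (simp add: ring_iso_def Ring.ring_hom_def gr_fiber_def ring.defs)
  moreover have "\<phi> (scalar ?A c) = scalar ?C c" for c
    using \<phi>_h[OF const(1), of c] cls_h[OF const(1), of 0 c] const \<sigma>
    by (simp add: gr_fiber_def ring.defs)
  moreover have "\<phi> ` component ?A n = component ?C n" for n
  proof -
    have "\<phi> ` component ?A n = \<phi> ` h ` hc n ` carrier B"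
      by (simp add: gr_fiber_def ring.defs comp)
    also have "\<dots> = (\<lambda>f. I +>\<^bsub>B\<^esub> f) ` hc n ` carrier B"
      using B.hc_closed \<phi>_h by (auto simp: image_iff)
    finally show ?thesis by (simp add: ring.defs)
  qed
  ultimately show ?thesis unfolding graded_algebra_iso_def by blast
qed

end

section \<open>Polynomial functions in coordinates\<close>

lemma fun_ring_cring: "cring (fun_ring P :: ('p \<Rightarrow> 'k::field) ring)"
proof (rule cringI)
  show "abelian_group (fun_ring P :: ('p \<Rightarrow> 'k) ring)"
  proof (rule abelian_groupI)
    fix f :: "'p \<Rightarrow> 'k" assume "f \<in> carrier (fun_ring P)"
    then show "\<exists>g\<in>carrier (fun_ring P). g \<oplus>\<^bsub>fun_ring P\<^esub> f = \<zero>\<^bsub>fun_ring P\<^esub>"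
      by (intro bexI[of _ "\<lambda>p\<in>P. - f p"]) (auto simp: fun_ring_def fun_eq_iff)
  qed (auto simp: fun_ring_def fun_eq_iff PiE_def extensional_def algebra_simps)
  show "comm_monoid (fun_ring P :: ('p \<Rightarrow> 'k) ring)"
    by (rule comm_monoidI) (auto simp: fun_ring_def fun_eq_iff PiE_def extensional_def algebra_simps)
qed (auto simp: fun_ring_def fun_eq_iff algebra_simps)

text \<open>The vector space is known through a finite dual basis \<open>x\<close>. As the
  coordinates separate points, every vector space law is checked on coordinates, and the index type
  is free; the same locale serves \<open>V i\<close>, its subspaces, the cohomology and the spaces
  of graded maps.\<close>

locale coordinates =
  fixes M :: "('k::field_char_0, 'p) module" and X :: "'j set" and x :: "'j \<Rightarrow> 'p \<Rightarrow> 'k"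
  assumes finite_X: "finite X"
    and zero_closed: "\<zero>\<^bsub>M\<^esub> \<in> carrier M"
    and add_closed: "p \<in> carrier M \<Longrightarrow> q \<in> carrier M \<Longrightarrow> p \<oplus>\<^bsub>M\<^esub> q \<in> carrier M"
    and smult_closed: "p \<in> carrier M \<Longrightarrow> c \<odot>\<^bsub>M\<^esub> p \<in> carrier M"
    and x_zero: "j \<in> X \<Longrightarrow> x j \<zero>\<^bsub>M\<^esub> = 0"
    and x_add: "j \<in> X \<Longrightarrow> p \<in> carrier M \<Longrightarrow> q \<in> carrier M \<Longrightarrow> x j (p \<oplus>\<^bsub>M\<^esub> q) = x j p + x j q"
    and x_smult: "j \<in> X \<Longrightarrow> p \<in> carrier M \<Longrightarrow> x j (c \<odot>\<^bsub>M\<^esub> p) = c * x j p"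
    and x_eqI: "p \<in> carrier M \<Longrightarrow> q \<in> carrier M \<Longrightarrow> (\<And>j. j \<in> X \<Longrightarrow> x j p = x j q) \<Longrightarrow> p = q"
    and x_ex: "\<exists>p\<in>carrier M. \<forall>j\<in>X. x j p = f j"
begin

definition pt :: "('j \<Rightarrow> 'k) \<Rightarrow> 'p" where
  "pt f = (SOME p. p \<in> carrier M \<and> (\<forall>j\<in>X. x j p = f j))"

lemma pt: "pt f \<in> carrier M" "j \<in> X \<Longrightarrow> x j (pt f) = f j"
  using someI_ex[OF x_ex[of f, unfolded Bex_def]] by (auto simp: pt_def)

definition unit_pt :: "'j \<Rightarrow> 'p" where "unit_pt j = pt (\<lambda>i. of_bool (i = j))"

lemma unit_pt: "unit_pt j \<in> carrier M" "i \<in> X \<Longrightarrow> x i (unit_pt j) = of_bool (i = j)"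
  by (simp_all add: unit_pt_def pt)

lemma linear_expand:
  assumes add: "\<And>p q. p \<in> carrier M \<Longrightarrow> q \<in> carrier M \<Longrightarrow> val (p \<oplus>\<^bsub>M\<^esub> q) = val p + val q"
    and smult: "\<And>c p. p \<in> carrier M \<Longrightarrow> val (c \<odot>\<^bsub>M\<^esub> p) = c * (val p :: 'k)"
    and p: "p \<in> carrier M"
  shows "val p = (\<Sum>j\<in>X. x j p * val (unit_pt j))"
proof -
  have "val (pt (\<lambda>j. if j \<in> Y then f j else 0)) = (\<Sum>j\<in>Y. f j * val (unit_pt j))"
    if "Y \<subseteq> X" for Y f
  proof -
    have "finite Y" using that finite_X finite_subset by blast
    then show ?thesis using that
    proof induction
      case empty
      \<comment> \<open>The zero vector is written as 0 times itself, so that homogeneity of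
        \<open>val\<close> gives the value 0.\<close>
      have "pt (\<lambda>j. if j \<in> {} then f j else 0) = 0 \<odot>\<^bsub>M\<^esub> \<zero>\<^bsub>M\<^esub>"
        by (rule x_eqI) (auto simp: pt zero_closed smult_closed x_smult)
      then show ?case using smult[OF zero_closed, of 0] by simp
    next
      case (insert a Y)
      have "pt (\<lambda>j. if j \<in> insert a Y then f j else 0)
        = f a \<odot>\<^bsub>M\<^esub> unit_pt a \<oplus>\<^bsub>M\<^esub> pt (\<lambda>j. if j \<in> Y then f j else 0)"
        using insert by (intro x_eqI) (auto simp: pt unit_pt add_closed smult_closed x_smult x_add)
      then show ?case using insert by (simp add: add smult pt unit_pt smult_closed)
    qed
  qed
  from this[OF subset_refl, of "\<lambda>j. x j p"]
  have "val (pt (\<lambda>j. if j \<in> X then x j p else 0)) = (\<Sum>j\<in>X. x j p * val (unit_pt j))" .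
  moreover have "pt (\<lambda>j. if j \<in> X then x j p else 0) = p"
    by (rule x_eqI) (auto simp: pt p)
  ultimately show ?thesis by simp
qed

abbreviation "A \<equiv> poly_ring M"

lemma A_gens: "range (\<lambda>c. \<lambda>p\<in>carrier M. c) \<union> dual M \<subseteq> carrier (fun_ring (carrier M))"
  by (auto simp: fun_ring_def dual_def PiE_def)

lemma A_ops:
  "f \<oplus>\<^bsub>A\<^esub> g = (\<lambda>p\<in>carrier M. f p + g p)" "f \<otimes>\<^bsub>A\<^esub> g = (\<lambda>p\<in>carrier M. f p * g p)"
  "\<one>\<^bsub>A\<^esub> = (\<lambda>p\<in>carrier M. 1)" "\<zero>\<^bsub>A\<^esub> = (\<lambda>p\<in>carrier M. 0)"
  by (simp_all add: poly_ring_def fun_ring_def)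

lemma F_ops:
  "f \<oplus>\<^bsub>fun_ring P\<^esub> g = (\<lambda>p\<in>P. f p + g p)" "f \<otimes>\<^bsub>fun_ring P\<^esub> g = (\<lambda>p\<in>P. f p * g p)"
  "\<one>\<^bsub>fun_ring P\<^esub> = (\<lambda>p\<in>P. 1)" "\<zero>\<^bsub>fun_ring P\<^esub> = (\<lambda>p\<in>P. 0)"
  by (simp_all add: fun_ring_def)

lemma A_carrier: "carrier A = generate_ring (fun_ring (carrier M)) (range (\<lambda>c. \<lambda>p\<in>carrier M. c) \<union> dual M)"
  by (simp add: poly_ring_def)

sublocale A: cring A
proof -
  interpret F: cring "fun_ring (carrier M) :: ('p \<Rightarrow> 'k) ring" by (rule fun_ring_cring)
  have sub: "subring (carrier A) (fun_ring (carrier M))"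
    unfolding A_carrier by (rule F.generate_ring_is_subring[OF A_gens])
  then have "subcring (carrier A) (fun_ring (carrier M))"
    by (rule F.subcringI')
  moreover have "carrier A \<subseteq> carrier (fun_ring (carrier M))" using sub by (rule subringE(1))
  ultimately show "cring A" using F.subcring_iff[of "carrier A"] by (simp add: poly_ring_def)
qed

lemma A_ext: "f \<in> carrier A \<Longrightarrow> f \<in> extensional (carrier M)"
proof -
  interpret F: cring "fun_ring (carrier M) :: ('p \<Rightarrow> 'k) ring" by (rule fun_ring_cring)
  assume "f \<in> carrier A"
  then have "f \<in> carrier (fun_ring (carrier M))"
    unfolding A_carrier by (rule F.generate_ring_in_carrier[OF A_gens])
  then show "f \<in> extensional (carrier M)" by (simp add: fun_ring_def PiE_iff)
qed

lemma A_eqI: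
  "f \<in> carrier A \<Longrightarrow> g \<in> carrier A \<Longrightarrow> (\<And>p. p \<in> carrier M \<Longrightarrow> f p = g p) \<Longrightarrow> f = g"
  using A_ext extensionalityI by metis

lemma A_const: "(\<lambda>p\<in>carrier M. c) \<in> carrier A"
  unfolding A_carrier by (rule generate_ring.incl) auto

lemma x_dual: "j \<in> X \<Longrightarrow> (\<lambda>p\<in>carrier M. x j p) \<in> dual M"
  by (auto simp: dual_def add_closed smult_closed x_add x_smult)

lemma A_dual: "\<xi> \<in> dual M \<Longrightarrow> \<xi> \<in> carrier A"
  unfolding A_carrier by (rule generate_ring.incl) auto

lemma A_coord: "j \<in> X \<Longrightarrow> (\<lambda>p\<in>carrier M. x j p) \<in> carrier A"
  by (intro A_dual x_dual)

lemma A_add: "f \<in> carrier A \<Longrightarrow> g \<in> carrier A \<Longrightarrow> (\<lambda>p\<in>carrier M. f p + g p) \<in> carrier A"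
  using A.a_closed[of f g] by (simp add: A_ops)

lemma A_mult: "f \<in> carrier A \<Longrightarrow> g \<in> carrier A \<Longrightarrow> (\<lambda>p\<in>carrier M. f p * g p) \<in> carrier A"
  using A.m_closed[of f g] by (simp add: A_ops)

lemma A_sum: "(\<And>i. i \<in> S \<Longrightarrow> f i \<in> carrier A) \<Longrightarrow> (\<lambda>p\<in>carrier M. \<Sum>i\<in>S. f i p) \<in> carrier A"
proof (induction S rule: infinite_finite_induct)
  case (insert i S)
  then show ?case using A_add[of "f i" "\<lambda>p\<in>carrier M. \<Sum>i\<in>S. f i p"]
    by (simp flip: restrict_def cong: restrict_cong)
qed (use A_const[of 0] in \<open>auto simp flip: restrict_def\<close>)

lemma A_finsum:
  "(\<And>i. i \<in> S \<Longrightarrow> f i \<in> carrier A) \<Longrightarrow> finsum A f S = (\<lambda>p\<in>carrier M. \<Sum>i\<in>S. f i p)"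
proof (induction S rule: infinite_finite_induct)
  case (insert i S)
  then have "finsum A f (insert i S) = f i \<oplus>\<^bsub>A\<^esub> finsum A f S"
    by (intro A.finsum_insert) auto
  then show ?case using insert by (simp add: A_ops flip: restrict_def cong: restrict_cong)
qed (simp_all add: A_ops flip: restrict_def)

lemma A_uminus: "f \<in> carrier A \<Longrightarrow> \<ominus>\<^bsub>A\<^esub> f = (\<lambda>p\<in>carrier M. - f p)"
  using A_mult[OF A_const[of "-1"], of f]
  by (intro A.minus_equality) (auto simp: A_ops cong: restrict_cong)

lemma A_diff: "f \<in> carrier A \<Longrightarrow> g \<in> carrier A \<Longrightarrow> f \<ominus>\<^bsub>A\<^esub> g = (\<lambda>p\<in>carrier M. f p - g p)"
  by (simp add: a_minus_def A_uminus) (simp add: A_ops cong: restrict_cong)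

lemma dual_expand:
  assumes "\<xi> \<in> dual M" "p \<in> carrier M"
  shows "\<xi> p = (\<Sum>j\<in>X. x j p * \<xi> (unit_pt j))"
  using assms by (intro linear_expand) (auto simp: dual_def)

text \<open>The ring is generated by constants and all functionals, and closed under negation. A
  functional is a combination of coordinates and negation is multiplication by the constant -1, so
  these four cases suffice.\<close>

lemma A_induct [consumes 1, case_names const coord add mult]:
  assumes "f \<in> carrier A"
    and const: "\<And>c. Q (\<lambda>p\<in>carrier M. c)"
    and coord: "\<And>j. j \<in> X \<Longrightarrow> Q (\<lambda>p\<in>carrier M. x j p)"
    and add: "\<And>f g. f \<in> carrier A \<Longrightarrow> g \<in> carrier A \<Longrightarrow> Q f \<Longrightarrow> Q g \<Longrightarrow> Q (\<lambda>p\<in>carrier M. f p + g p)"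
    and mult: "\<And>f g. f \<in> carrier A \<Longrightarrow> g \<in> carrier A \<Longrightarrow> Q f \<Longrightarrow> Q g \<Longrightarrow> Q (\<lambda>p\<in>carrier M. f p * g p)"
  shows "Q f"
proof -
  interpret F: cring "fun_ring (carrier M) :: ('p \<Rightarrow> 'k) ring" by (rule fun_ring_cring)
  have dualQ: "Q \<xi>" if "\<xi> \<in> dual M" for \<xi>
  proof -
    have "Q (\<lambda>p\<in>carrier M. \<Sum>j\<in>Y. x j p * \<xi> (unit_pt j))" if "Y \<subseteq> X" for Y
    proof -
      have "finite Y" using that finite_X finite_subset by blast
      then show ?thesis using that
      proof induction
        case empty
        then show ?case using const[of 0] by (simp flip: restrict_def)
      next
        case (insert a Y)
        let ?s = "\<lambda>p\<in>carrier M. \<Sum>j\<in>Y. x j p * \<xi> (unit_pt j)"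
        let ?t = "\<lambda>p\<in>carrier M. x a p * \<xi> (unit_pt a)"
        have a: "a \<in> X" using insert by auto
        have t: "?t \<in> carrier A" "Q ?t"
          using mult[OF A_coord[OF a] A_const coord[OF a] const, of "\<xi> (unit_pt a)"]
            A_mult[OF A_coord[OF a] A_const, of "\<xi> (unit_pt a)"]
          by (auto cong: restrict_cong)
        have "?s \<in> carrier A"
          using A_sum[of Y "\<lambda>j. \<lambda>p\<in>carrier M. x j p * \<xi> (unit_pt j)"] insert.prems
            A_mult[OF A_coord A_const] by (force cong: restrict_cong)
        then show ?case
          using add[OF t(1) _ t(2), of ?s] insert by (simp flip: restrict_def cong: restrict_cong)
      qed
    qed
    from this[OF subset_refl] have "Q (\<lambda>p\<in>carrier M. \<Sum>j\<in>X. x j p * \<xi> (unit_pt j))" .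
    moreover have "\<xi> = (\<lambda>p\<in>carrier M. \<Sum>j\<in>X. x j p * \<xi> (unit_pt j))"
      using that dual_expand[OF that] by (intro extensionalityI[of _ "carrier M"]) (auto simp: dual_def)
    ultimately show ?thesis by simp
  qed
  have uminus_F: "\<ominus>\<^bsub>fun_ring (carrier M)\<^esub> h = (\<lambda>p\<in>carrier M. (-1) * h p)" if "h \<in> carrier A" for h
  proof -
    have h: "h \<in> carrier (fun_ring (carrier M))"
      using that F.generate_ring_in_carrier[OF A_gens] by (simp add: A_carrier)
    show ?thesis
      by (rule F.minus_equality) (use h in \<open>auto simp: fun_ring_def cong: restrict_cong\<close>)
  qed
  have "f \<in> carrier A \<and> Q f"
    using assms(1)[unfolded A_carrier]
  proof (induction rule: generate_ring.induct)
    case one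
    then show ?case unfolding F_ops using A_const[of 1] const[of 1] by blast
  next
    case (incl h)
    then show ?case using dualQ const A_const A_dual by blast
  next
    case (a_inv h)
    then have "\<ominus>\<^bsub>fun_ring (carrier M)\<^esub> h = (\<lambda>p\<in>carrier M. (\<lambda>p\<in>carrier M. -1) p * h p)"
      using uminus_F[of h] by (simp cong: restrict_cong)
    then show ?case using a_inv mult[OF A_const _ const, of h "-1"] A_mult[OF A_const, of h "-1"] by metis
  next
    case (eng_add f g)
    then show ?case unfolding F_ops using add A_add by blast
  next
    case (eng_mult f g)
    then show ?case unfolding F_ops using mult A_mult by blast
  qed
  then show ?thesis by blast
qed

lemma smult_smult: "p \<in> carrier M \<Longrightarrow> c \<odot>\<^bsub>M\<^esub> (d \<odot>\<^bsub>M\<^esub> p) = (c * d) \<odot>\<^bsub>M\<^esub> p"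
  by (rule x_eqI) (auto simp: smult_closed x_smult)

lemma smult_one: "p \<in> carrier M \<Longrightarrow> 1 \<odot>\<^bsub>M\<^esub> p = p"
  by (rule x_eqI) (auto simp: smult_closed x_smult)

lemma smult_zero: "p \<in> carrier M \<Longrightarrow> 0 \<odot>\<^bsub>M\<^esub> p = \<zero>\<^bsub>M\<^esub>"
  by (rule x_eqI) (auto simp: smult_closed x_smult x_zero zero_closed)

subsection \<open>Homogeneous components\<close>

text \<open>The restriction of \<open>f\<close> to the line through the origin and \<open>p\<close>,
  as a polynomial in the scalar. It is unique because the field, being of characteristic 0, is
  infinite.\<close>

definition line :: "('p \<Rightarrow> 'k) \<Rightarrow> 'p \<Rightarrow> 'k poly" where
  "line f p = (THE q. \<forall>c. f (c \<odot>\<^bsub>M\<^esub> p) = poly q c)"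

definition hc :: "nat \<Rightarrow> ('p \<Rightarrow> 'k) \<Rightarrow> 'p \<Rightarrow> 'k" where
  "hc n f = (\<lambda>p\<in>carrier M. Polynomial.coeff (line f p) n)"

lemma line_eqI: "(\<And>c. f (c \<odot>\<^bsub>M\<^esub> p) = poly q c) \<Longrightarrow> line f p = q"
  unfolding line_def by (rule the_equality) (auto simp: poly_eq_poly_eq_iff[symmetric] fun_eq_iff)

text \<open>Besides existence, the induction carries that the coefficients are again polynomial in
  \<open>p\<close> and that the degree is bounded independently of \<open>p\<close>; these become
  \<open>hc_closed\<close> and \<open>hc_finite\<close>.\<close>

lemma line_ex:
  assumes "f \<in> carrier A"
  shows "\<exists>q. (\<forall>p\<in>carrier M. \<forall>c. f (c \<odot>\<^bsub>M\<^esub> p) = poly (q p) c)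
    \<and> (\<forall>n. (\<lambda>p\<in>carrier M. Polynomial.coeff (q p) n) \<in> carrier A)
    \<and> (\<exists>d. \<forall>p\<in>carrier M. Polynomial.degree (q p) \<le> d)"
  using assms
proof (induction rule: A_induct)
  case (const c)
  have "(\<lambda>p\<in>carrier M. Polynomial.coeff [:c:] n) \<in> carrier A" for n by (rule A_const)
  then show ?case by (intro exI[of _ "\<lambda>p. [:c:]"]) (auto simp: smult_closed simp flip: restrict_def)
next
  case (coord j)
  have "(\<lambda>p\<in>carrier M. Polynomial.coeff [:0, x j p:] n) \<in> carrier A" for n
  proof -
    have "(\<lambda>p\<in>carrier M. Polynomial.coeff [:0, x j p:] n) =
      (if n = 1 then (\<lambda>p\<in>carrier M. x j p) else (\<lambda>p\<in>carrier M. 0))"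
      by (auto simp: coeff_pCons fun_eq_iff split: nat.splits)
    then show ?thesis using A_const[of 0] A_coord[OF coord] by simp
  qed
  then show ?case using coord
    by (intro exI[of _ "\<lambda>p. [:0, x j p:]"]) (auto simp: smult_closed x_smult simp flip: restrict_def intro!: exI[of _ 1])
next
  case (add f g)
  then obtain q r d e where qr: "\<forall>p\<in>carrier M. \<forall>c. f (c \<odot>\<^bsub>M\<^esub> p) = poly (q p) c"
    "\<And>n. (\<lambda>p\<in>carrier M. Polynomial.coeff (q p) n) \<in> carrier A" "\<forall>p\<in>carrier M. Polynomial.degree (q p) \<le> d"
    "\<forall>p\<in>carrier M. \<forall>c. g (c \<odot>\<^bsub>M\<^esub> p) = poly (r p) c"
    "\<And>n. (\<lambda>p\<in>carrier M. Polynomial.coeff (r p) n) \<in> carrier A" "\<forall>p\<in>carrier M. Polynomial.degree (r p) \<le> e" by blast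
  have "(\<lambda>p\<in>carrier M. Polynomial.coeff (q p + r p) n) \<in> carrier A" for n
    using A_add[OF qr(2)[of n] qr(5)[of n]] by (simp cong: restrict_cong)
  moreover have "\<forall>p\<in>carrier M. Polynomial.degree (q p + r p) \<le> max d e"
    using qr(3,6) by (meson degree_add_le_max le_max_iff_disj max.mono order_trans)
  ultimately show ?case using qr(1,4)
    by (intro exI[of _ "\<lambda>p. q p + r p"]) (auto simp: smult_closed simp flip: restrict_def)
next
  case (mult f g)
  then obtain q r d e where qr: "\<forall>p\<in>carrier M. \<forall>c. f (c \<odot>\<^bsub>M\<^esub> p) = poly (q p) c"
    "\<And>n. (\<lambda>p\<in>carrier M. Polynomial.coeff (q p) n) \<in> carrier A" "\<forall>p\<in>carrier M. Polynomial.degree (q p) \<le> d"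
    "\<forall>p\<in>carrier M. \<forall>c. g (c \<odot>\<^bsub>M\<^esub> p) = poly (r p) c"
    "\<And>n. (\<lambda>p\<in>carrier M. Polynomial.coeff (r p) n) \<in> carrier A" "\<forall>p\<in>carrier M. Polynomial.degree (r p) \<le> e" by blast
  have "(\<lambda>p\<in>carrier M. Polynomial.coeff (q p * r p) n) \<in> carrier A" for n
    using A_sum[of "{..n}", OF A_mult[OF qr(2) qr(5)], of "\<lambda>i. i" "\<lambda>i. n - i"]
    by (simp add: coeff_mult cong: restrict_cong)
  moreover have "\<forall>p\<in>carrier M. Polynomial.degree (q p * r p) \<le> d + e"
    using qr(3,6) by (meson add_mono degree_mult_le order_trans)
  ultimately show ?case using qr(1,4)
    by (intro exI[of _ "\<lambda>p. q p * r p"]) (auto simp: smult_closed simp flip: restrict_def)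
qed

lemma line:
  assumes "f \<in> carrier A" "p \<in> carrier M"
  shows "poly (line f p) c = f (c \<odot>\<^bsub>M\<^esub> p)"
proof -
  obtain q where q: "\<And>p c. p \<in> carrier M \<Longrightarrow> f (c \<odot>\<^bsub>M\<^esub> p) = poly (q p) c" using line_ex[OF assms(1)] by blast
  then have "line f p = q p" using assms by (intro line_eqI)
  then show ?thesis using q assms by simp
qed

lemma hc_closed: "f \<in> carrier A \<Longrightarrow> hc n f \<in> carrier A"
proof -
  assume f: "f \<in> carrier A"
  obtain q where q: "\<And>p c. p \<in> carrier M \<Longrightarrow> f (c \<odot>\<^bsub>M\<^esub> p) = poly (q p) c"
    "\<And>n. (\<lambda>p\<in>carrier M. Polynomial.coeff (q p) n) \<in> carrier A" using line_ex[OF f] by blast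
  have "line f p = q p" if "p \<in> carrier M" for p using that q by (intro line_eqI)
  then show ?thesis using q(2)[of n] by (simp add: hc_def cong: restrict_cong)
qed

lemma hc_finite: "f \<in> carrier A \<Longrightarrow> \<exists>d. \<forall>n>d. hc n f = \<zero>\<^bsub>A\<^esub>"
proof -
  assume f: "f \<in> carrier A"
  obtain q d where q: "\<And>p c. p \<in> carrier M \<Longrightarrow> f (c \<odot>\<^bsub>M\<^esub> p) = poly (q p) c"
    "\<forall>p\<in>carrier M. Polynomial.degree (q p) \<le> d" using line_ex[OF f] by blast
  have "line f p = q p" if "p \<in> carrier M" for p using that q by (intro line_eqI)
  then have "\<forall>n>d. hc n f = \<zero>\<^bsub>A\<^esub>"
    using q(2) by (auto simp: hc_def A_ops coeff_eq_0 intro!: restrict_ext)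
  then show ?thesis by blast
qed

lemma line_add:
  assumes "f \<in> carrier A" "g \<in> carrier A" "p \<in> carrier M"
  shows "line (\<lambda>p\<in>carrier M. f p + g p) p = line f p + line g p"
  by (rule line_eqI) (use assms in \<open>auto simp: line smult_closed\<close>)

lemma line_mult:
  assumes "f \<in> carrier A" "g \<in> carrier A" "p \<in> carrier M"
  shows "line (\<lambda>p\<in>carrier M. f p * g p) p = line f p * line g p"
  by (rule line_eqI) (use assms in \<open>auto simp: line smult_closed\<close>)

lemma hc_const: "hc n (\<lambda>p\<in>carrier M. c) = (if n = 0 then \<lambda>p\<in>carrier M. c else \<zero>\<^bsub>A\<^esub>)"
proof -
  have "line (\<lambda>p\<in>carrier M. c) p = [:c:]" if "p \<in> carrier M" for p
    by (rule line_eqI) (auto simp: smult_closed that)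
  then show ?thesis by (auto simp: hc_def A_ops coeff_pCons split: nat.splits intro!: restrict_ext)
qed

text \<open>Scaling \<open>p\<close> by \<open>c\<close> substitutes \<open>c\<close> times the
  variable into \<open>line f p\<close>.\<close>

lemma hc_smult:
  assumes "f \<in> carrier A" "p \<in> carrier M" shows "hc n f (c \<odot>\<^bsub>M\<^esub> p) = c ^ n * hc n f p"
proof -
  have "line f (c \<odot>\<^bsub>M\<^esub> p) = pcompose (line f p) [:0, c:]"
    by (rule line_eqI) (use assms in \<open>auto simp: line smult_closed smult_smult poly_pcompose\<close>)
  then show ?thesis using assms by (simp add: hc_def smult_closed coeff_pcompose_linear)
qed

lemma hc_homogeneous: "f \<in> carrier A \<Longrightarrow> hc n f \<in> homogeneous M n"
  using hc_closed hc_smult by (simp add: homogeneous_def)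

lemma hc_of_homogeneous:
  assumes "f \<in> homogeneous M n" shows "hc k f = (if k = n then f else \<zero>\<^bsub>A\<^esub>)"
proof -
  have f: "f \<in> carrier A" "\<And>c p. p \<in> carrier M \<Longrightarrow> f (c \<odot>\<^bsub>M\<^esub> p) = c ^ n * f p"
    using assms by (auto simp: homogeneous_def)
  have "line f p = Polynomial.monom (f p) n" if "p \<in> carrier M" for p
    by (rule line_eqI) (use that f in \<open>auto simp: poly_monom\<close>)
  then have "hc k f = (\<lambda>p\<in>carrier M. if k = n then f p else 0)"
    by (auto simp: hc_def intro!: restrict_ext)
  then show ?thesis using extensional_restrict[OF A_ext[OF f(1)]] by (auto simp: A_ops)
qed

lemma homogeneous_eq: "homogeneous M n = hc n ` carrier A"
proof
  show "homogeneous M n \<subseteq> hc n ` carrier A"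
  proof
    fix f assume f: "f \<in> homogeneous M n"
    then have "f = hc n f" using hc_of_homogeneous[OF f, of n] by simp
    moreover have "f \<in> carrier A" using f by (simp add: homogeneous_def)
    ultimately show "f \<in> hc n ` carrier A" by (rule image_eqI)
  qed
  show "hc n ` carrier A \<subseteq> homogeneous M n" using hc_homogeneous by blast
qed

sublocale graded_ring_decomp A hc
proof
  fix f g n assume fg: "f \<in> carrier A" "g \<in> carrier A"
  show "hc n (f \<oplus>\<^bsub>A\<^esub> g) = hc n f \<oplus>\<^bsub>A\<^esub> hc n g"
    using fg by (auto simp: A_ops hc_def line_add cong: restrict_cong)
  have "(\<Oplus>\<^bsub>A\<^esub>i\<in>{..n}. hc i f \<otimes>\<^bsub>A\<^esub> hc (n - i) g) = (\<lambda>p\<in>carrier M. \<Sum>i\<in>{..n}. (hc i f \<otimes>\<^bsub>A\<^esub> hc (n - i) g) p)"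
    using fg by (intro A_finsum) (auto intro: hc_closed)
  also have "\<dots> = hc n (f \<otimes>\<^bsub>A\<^esub> g)"
    using fg by (auto simp: A_ops hc_def line_mult coeff_mult intro!: restrict_ext)
  finally show "hc n (f \<otimes>\<^bsub>A\<^esub> g) = (\<Oplus>\<^bsub>A\<^esub>i\<in>{..n}. hc i f \<otimes>\<^bsub>A\<^esub> hc (n - i) g)" ..
next
  show "hc n \<one>\<^bsub>A\<^esub> = (if n = 0 then \<one>\<^bsub>A\<^esub> else \<zero>\<^bsub>A\<^esub>)" for n
    using hc_const[of n 1] by (simp add: A_ops)
qed (use hc_closed hc_finite hc_of_homogeneous[OF hc_homogeneous] in auto)

text \<open>Evaluation of \<open>line f p\<close> at 1.\<close>

lemma hc_decomp:
  assumes "f \<in> carrier A" "\<And>n. n > d \<Longrightarrow> hc n f = \<zero>\<^bsub>A\<^esub>" "p \<in> carrier M"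
  shows "f p = (\<Sum>n\<le>d. hc n f p)"
proof -
  have "Polynomial.degree (line f p) \<le> d"
  proof (rule degree_le, intro allI impI)
    fix i assume "i > d"
    then show "Polynomial.coeff (line f p) i = 0"
      using fun_cong[OF assms(2), of i p] assms(3) by (simp add: hc_def A_ops)
  qed
  then have "poly (line f p) 1 = (\<Sum>n\<le>d. Polynomial.coeff (line f p) n)"
    by (simp add: poly_altdef) (rule sum.mono_neutral_left, auto simp: coeff_eq_0)
  then show ?thesis using assms by (simp add: line smult_one hc_def)
qed

definition homogeneous_ideal :: "('p \<Rightarrow> 'k) set \<Rightarrow> bool" where
  "homogeneous_ideal I \<longleftrightarrow> ideal I A \<and> (\<forall>f\<in>I. \<forall>n. hc n f \<in> I)"

lemma homogeneous_ideal_iff: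
  assumes "homogeneous_ideal I" "f \<in> carrier A"
  shows "f \<in> I \<longleftrightarrow> (\<forall>n. hc n f \<in> I)"
proof
  assume *: "\<forall>n. hc n f \<in> I"
  interpret I: ideal I A using assms by (simp add: homogeneous_ideal_def)
  obtain d where d: "\<And>n. n > d \<Longrightarrow> hc n f = \<zero>\<^bsub>A\<^esub>" using hc_finite[OF assms(2)] by blast
  have fs: "finsum A (\<lambda>n. hc n f) S \<in> I" if "finite S" for S
    using that
  proof induction
    case (insert a S)
    then show ?case using * hc_closed[OF assms(2)] by simp
  qed simp
  have "f = finsum A (\<lambda>n. hc n f) {..d}"
    using A_finsum[of "{..d}" "\<lambda>n. hc n f"] hc_closed[OF assms(2)] hc_decomp[OF assms(2) d] A_ext[OF assms(2)]
    by (auto intro!: extensionalityI[of _ "carrier M"])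
  then show "f \<in> I" using fs[of "{..d}"] by simp
qed (use assms in \<open>auto simp: homogeneous_ideal_def\<close>)

lemma vanishing_ideal: "Y \<subseteq> carrier M \<Longrightarrow> ideal (vanishing_ideal M Y) A"
proof (rule idealI)
  assume Y: "Y \<subseteq> carrier M"
  show "ring A" ..
  show "subgroup (vanishing_ideal M Y) (add_monoid A)"
  proof (rule A.add.subgroupI)
    show "vanishing_ideal M Y \<noteq> {}"
      using A.zero_closed Y by (auto simp: vanishing_ideal_def A_ops intro!: exI[of _ "\<zero>\<^bsub>A\<^esub>"])
  qed (use Y A.a_inv_closed A.a_closed in \<open>auto simp: vanishing_ideal_def A_uminus A_add A_ops subset_iff\<close>)
qed (use A.m_closed in \<open>auto simp: vanishing_ideal_def A_ops A_mult subset_iff\<close>)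

text \<open>At a point of a set stable under scalars the polynomial \<open>line f p\<close> vanishes
  identically, hence so does each of its coefficients.\<close>

lemma vanishing_ideal_homogeneous:
  assumes "Y \<subseteq> carrier M" "\<And>c p. p \<in> Y \<Longrightarrow> c \<odot>\<^bsub>M\<^esub> p \<in> Y"
  shows "homogeneous_ideal (vanishing_ideal M Y)"
  unfolding homogeneous_ideal_def
proof (intro conjI ballI allI)
  show "ideal (vanishing_ideal M Y) A" using assms by (intro vanishing_ideal)
  fix f n assume "f \<in> vanishing_ideal M Y"
  then have f: "f \<in> carrier A" "\<And>p. p \<in> Y \<Longrightarrow> f p = 0" by (auto simp: vanishing_ideal_def)
  have "line f p = 0" if "p \<in> Y" for p by (rule line_eqI) (use f assms that in auto)
  then show "hc n f \<in> vanishing_ideal M Y" using hc_closed[OF f(1)] assms(1) by (auto simp: vanishing_ideal_def hc_def)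
qed

text \<open>The elements all of whose components lie in the generated ideal form an ideal
  themselves, and it contains the homogeneous generators.\<close>

lemma genideal_homogeneous:
  assumes "\<And>h. h \<in> H \<Longrightarrow> \<exists>d. h \<in> homogeneous M d"
  shows "homogeneous_ideal (Idl\<^bsub>A\<^esub> H)"
proof -
  have H: "H \<subseteq> carrier A" using assms by (auto simp: homogeneous_def)
  interpret I: ideal "Idl\<^bsub>A\<^esub> H" A by (rule A.genideal_ideal[OF H])
  let ?S = "{f \<in> carrier A. \<forall>n. hc n f \<in> Idl\<^bsub>A\<^esub> H}"
  have "ideal ?S A"
  proof (rule idealI)
    show "ring A" ..
    show "subgroup ?S (add_monoid A)"
    proof (rule A.add.subgroupI)
      show "?S \<noteq> {}" using hc_zero by (auto intro!: exI[of _ "\<zero>\<^bsub>A\<^esub>"])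
      fix f assume f: "f \<in> ?S"
      have "hc n (\<ominus>\<^bsub>A\<^esub> f) = \<ominus>\<^bsub>A\<^esub> hc n f" for n
        using f hc_add[of "\<ominus>\<^bsub>A\<^esub> f" f n] hc_zero
        by (intro A.minus_equality[symmetric]) (auto simp: A.l_neg hc_closed)
      then show "\<ominus>\<^bsub>A\<^esub> f \<in> ?S" using f by auto
    qed (auto simp: hc_add)
    fix f g assume f: "f \<in> ?S" and g: "g \<in> carrier A"
    have "finsum A (\<lambda>i. hc i f \<otimes>\<^bsub>A\<^esub> hc (n - i) g) S \<in> Idl\<^bsub>A\<^esub> H" if "finite S" for n S
      using that
    proof induction
      case (insert a S)
      then show ?case using f g I.I_r_closed hc_closed by simp
    qed simp
    then have "hc n (f \<otimes>\<^bsub>A\<^esub> g) \<in> Idl\<^bsub>A\<^esub> H" for n using f g by (simp add: hc_mult)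
    then show "f \<otimes>\<^bsub>A\<^esub> g \<in> ?S" using f g by auto
    then show "g \<otimes>\<^bsub>A\<^esub> f \<in> ?S" using f g A.m_comm[of g f] by auto
  qed
  moreover have "H \<subseteq> ?S"
  proof
    fix h assume h: "h \<in> H"
    then obtain d where "h \<in> homogeneous M d" using assms by blast
    then show "h \<in> ?S" using h H A.genideal_self[OF H] by (auto simp: hc_of_homogeneous)
  qed
  ultimately have "Idl\<^bsub>A\<^esub> H \<subseteq> ?S" by (rule A.genideal_minimal)
  then show ?thesis using I.is_ideal by (auto simp: homogeneous_ideal_def)
qed

end

section \<open>Regular functions and the local ring\<close>

locale local_point = coordinates M X x
  for M :: "('k::field_char_0, 'p) module" and X :: "'j set" and x +
  fixes I :: "('p \<Rightarrow> 'k) set" and p0 :: 'p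
  assumes I_ideal: "ideal I (poly_ring M)" and p0: "p0 \<in> carrier M"
    and I_p0: "f \<in> I \<Longrightarrow> f p0 = 0"
begin

sublocale I: ideal I A by (rule I_ideal)

text \<open>The filter of Zariski neighbourhoods of \<open>p0\<close>, generated by the principal
  open sets \<open>s \<noteq> 0\<close>. Shrinking a neighbourhood becomes reasoning with
  \<open>eventually\<close>.\<close>

definition zar :: "'p filter" where
  "zar = Abs_filter (\<lambda>Q. \<exists>s\<in>carrier A. s p0 \<noteq> 0 \<and> (\<forall>p\<in>carrier M. s p \<noteq> 0 \<longrightarrow> Q p))"

lemma eventually_zar:
  "eventually Q zar \<longleftrightarrow> (\<exists>s\<in>carrier A. s p0 \<noteq> 0 \<and> (\<forall>p\<in>carrier M. s p \<noteq> 0 \<longrightarrow> Q p))"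
  unfolding zar_def
proof (rule eventually_Abs_filter, rule is_filter.intro)
  show "\<exists>s\<in>carrier A. s p0 \<noteq> 0 \<and> (\<forall>p\<in>carrier M. s p \<noteq> 0 \<longrightarrow> True)"
    using A_const[of 1] p0 by (intro bexI[of _ "\<lambda>p\<in>carrier M. 1"]) auto
next
  fix Q R assume "\<exists>s\<in>carrier A. s p0 \<noteq> 0 \<and> (\<forall>p\<in>carrier M. s p \<noteq> 0 \<longrightarrow> Q p)"
    "\<exists>s\<in>carrier A. s p0 \<noteq> 0 \<and> (\<forall>p\<in>carrier M. s p \<noteq> 0 \<longrightarrow> R p)"
  then obtain s t where "s \<in> carrier A" "s p0 \<noteq> 0" "\<forall>p\<in>carrier M. s p \<noteq> 0 \<longrightarrow> Q p"
    "t \<in> carrier A" "t p0 \<noteq> 0" "\<forall>p\<in>carrier M. t p \<noteq> 0 \<longrightarrow> R p" by blast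
  then show "\<exists>s\<in>carrier A. s p0 \<noteq> 0 \<and> (\<forall>p\<in>carrier M. s p \<noteq> 0 \<longrightarrow> Q p \<and> R p)"
    using p0 by (intro bexI[OF _ A_mult[of s t]]) auto
qed blast

lemma eventually_zarI:
  "s \<in> carrier A \<Longrightarrow> s p0 \<noteq> 0 \<Longrightarrow> (\<And>p. p \<in> carrier M \<Longrightarrow> s p \<noteq> 0 \<Longrightarrow> Q p) \<Longrightarrow> eventually Q zar"
  by (auto simp: eventually_zar)

lemma eventually_p0: "eventually Q zar \<Longrightarrow> Q p0"
  using p0 by (auto simp: eventually_zar)

lemma eventually_carrier: "\<forall>\<^sub>F p in zar. p \<in> carrier M"
  using A_const[of 1] p0 by (intro eventually_zarI[of "\<lambda>p\<in>carrier M. 1"]) auto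

text \<open>Total functions that agree near \<open>p0\<close> with a fraction. Their values
  elsewhere are arbitrary, so \<open>inverse\<close> may be used freely, and they form a ring
  without a passage to classes.\<close>

definition Reg :: "('p \<Rightarrow> 'k) set" where
  "Reg = {f. \<exists>a\<in>carrier A. \<exists>s\<in>carrier A. s p0 \<noteq> 0 \<and> (\<forall>\<^sub>F p in zar. f p * s p = a p)}"

text \<open>Functions that near \<open>p0\<close> are fractions with numerator in \<open>I\<close>.
  Those vanishing near \<open>p0\<close> are among them, so \<open>Reg\<close> modulo
  \<open>locI\<close> is the local ring of the subscheme at \<open>p0\<close>.\<close>

definition locI :: "('p \<Rightarrow> 'k) set" where
  "locI = {f. \<exists>a\<in>I. \<exists>s\<in>carrier A. s p0 \<noteq> 0 \<and> (\<forall>\<^sub>F p in zar. f p * s p = a p)}"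

text \<open>After enlarging the denominator the equation of a regular function holds everywhere.\<close>

lemma RegE:
  assumes "f \<in> Reg"
  obtains a s where "a \<in> carrier A" "s \<in> carrier A" "s p0 \<noteq> 0" "\<And>p. p \<in> carrier M \<Longrightarrow> f p * s p = a p"
proof -
  from assms obtain a s w where *: "a \<in> carrier A" "s \<in> carrier A" "s p0 \<noteq> 0"
    "w \<in> carrier A" "w p0 \<noteq> 0" "\<And>p. p \<in> carrier M \<Longrightarrow> w p \<noteq> 0 \<Longrightarrow> f p * s p = a p"
    by (auto simp: Reg_def eventually_zar)
  show ?thesis
  proof (rule that)
    show "(\<lambda>p\<in>carrier M. w p * a p) \<in> carrier A" "(\<lambda>p\<in>carrier M. w p * s p) \<in> carrier A"
      using * by (auto intro: A_mult)
    show "(\<lambda>p\<in>carrier M. w p * s p) p0 \<noteq> 0" using * p0 by simp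
    show "f p * (\<lambda>p\<in>carrier M. w p * s p) p = (\<lambda>p\<in>carrier M. w p * a p) p" if "p \<in> carrier M" for p
      using *(6)[OF that] that by (cases "w p = 0") (auto simp: algebra_simps)
  qed
qed

lemma locIE:
  assumes "f \<in> locI"
  obtains a s where "a \<in> I" "s \<in> carrier A" "s p0 \<noteq> 0" "\<And>p. p \<in> carrier M \<Longrightarrow> f p * s p = a p"
proof -
  from assms obtain a s w where *: "a \<in> I" "s \<in> carrier A" "s p0 \<noteq> 0"
    "w \<in> carrier A" "w p0 \<noteq> 0" "\<And>p. p \<in> carrier M \<Longrightarrow> w p \<noteq> 0 \<Longrightarrow> f p * s p = a p"
    by (auto simp: locI_def eventually_zar)
  show ?thesis
  proof (rule that)
    show "(\<lambda>p\<in>carrier M. w p * a p) \<in> I"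
      using I.I_l_closed[OF *(1) *(4)] by (simp add: A_ops)
    show "(\<lambda>p\<in>carrier M. w p * s p) \<in> carrier A"
      using * by (auto intro: A_mult)
    show "(\<lambda>p\<in>carrier M. w p * s p) p0 \<noteq> 0" using * p0 by simp
    show "f p * (\<lambda>p\<in>carrier M. w p * s p) p = (\<lambda>p\<in>carrier M. w p * a p) p" if "p \<in> carrier M" for p
      using *(6)[OF that] that by (cases "w p = 0") (auto simp: algebra_simps)
  qed
qed

lemma RegI: "a \<in> carrier A \<Longrightarrow> s \<in> carrier A \<Longrightarrow> s p0 \<noteq> 0 \<Longrightarrow> (\<And>p. p \<in> carrier M \<Longrightarrow> f p * s p = a p) \<Longrightarrow> f \<in> Reg"
proof -
  assume as: "a \<in> carrier A" "s \<in> carrier A" "s p0 \<noteq> 0" and eq: "\<And>p. p \<in> carrier M \<Longrightarrow> f p * s p = a p"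
  have "\<forall>\<^sub>F p in zar. f p * s p = a p" using eventually_carrier by eventually_elim (rule eq)
  then show "f \<in> Reg" using as unfolding Reg_def by blast
qed

lemma locI_I: "a \<in> I \<Longrightarrow> s \<in> carrier A \<Longrightarrow> s p0 \<noteq> 0 \<Longrightarrow> (\<And>p. p \<in> carrier M \<Longrightarrow> f p * s p = a p) \<Longrightarrow> f \<in> locI"
proof -
  assume as: "a \<in> I" "s \<in> carrier A" "s p0 \<noteq> 0" and eq: "\<And>p. p \<in> carrier M \<Longrightarrow> f p * s p = a p"
  have "\<forall>\<^sub>F p in zar. f p * s p = a p" using eventually_carrier by eventually_elim (rule eq)
  then show "f \<in> locI" using as unfolding locI_def by blast
qed

lemma locI_Reg: "f \<in> locI \<Longrightarrow> f \<in> Reg"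
  by (elim locIE) (blast intro: RegI I.Icarr)

lemma Reg_poly: "f \<in> carrier A \<Longrightarrow> f \<in> Reg"
  using A_const[of 1] p0 by (intro RegI[of f "\<lambda>p\<in>carrier M. 1"]) auto

lemma locI_poly: "f \<in> I \<Longrightarrow> f \<in> locI"
  using A_const[of 1] p0 by (intro locI_I[of f "\<lambda>p\<in>carrier M. 1"]) auto

lemma locI_cong: "f \<in> locI \<Longrightarrow> (\<forall>\<^sub>F p in zar. f p = g p) \<Longrightarrow> g \<in> locI"
proof -
  assume "f \<in> locI" and eq: "\<forall>\<^sub>F p in zar. f p = g p"
  then obtain a s where as: "a \<in> I" "s \<in> carrier A" "s p0 \<noteq> 0" and fs: "\<forall>\<^sub>F p in zar. f p * s p = a p"
    unfolding locI_def by blast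
  from fs eq have "\<forall>\<^sub>F p in zar. g p * s p = a p" by eventually_elim simp
  then show "g \<in> locI" using as unfolding locI_def by blast
qed

lemma locI_restrict:
  assumes "restrict h (carrier M) \<in> I" shows "h \<in> locI"
  using locI_poly[OF assms]
proof (rule locI_cong)
  show "\<forall>\<^sub>F p in zar. restrict h (carrier M) p = h p" using eventually_carrier by eventually_elim simp
qed

lemma Reg_const: "(\<lambda>p. c) \<in> Reg"
  using A_const[of c] A_const[of 1] p0 by (intro RegI[of "\<lambda>p\<in>carrier M. c" "\<lambda>p\<in>carrier M. 1"]) auto

lemma Reg_coord: "j \<in> X \<Longrightarrow> x j \<in> Reg"
  using A_coord[of j] A_const[of 1] p0 by (intro RegI[of "\<lambda>p\<in>carrier M. x j p" "\<lambda>p\<in>carrier M. 1"]) auto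

lemma Reg_add:
  assumes "f \<in> Reg" "g \<in> Reg" shows "(\<lambda>p. f p + g p) \<in> Reg"
proof -
  obtain a s b t where *: "a \<in> carrier A" "s \<in> carrier A" "s p0 \<noteq> 0" "\<And>p. p \<in> carrier M \<Longrightarrow> f p * s p = a p"
    "b \<in> carrier A" "t \<in> carrier A" "t p0 \<noteq> 0" "\<And>p. p \<in> carrier M \<Longrightarrow> g p * t p = b p"
    using assms by (auto elim!: RegE)
  then have "(\<lambda>p\<in>carrier M. (\<lambda>p\<in>carrier M. a p * t p) p + (\<lambda>p\<in>carrier M. b p * s p) p) \<in> carrier A"
    by (intro A_add A_mult)
  then show ?thesis
    by (rule RegI[OF _ A_mult[OF *(2,6)]]) (use *(3,7) p0 in \<open>auto simp: algebra_simps simp flip: *(4,8)\<close>)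
qed

lemma Reg_mult:
  assumes "f \<in> Reg" "g \<in> Reg" shows "(\<lambda>p. f p * g p) \<in> Reg"
proof -
  obtain a s b t where *: "a \<in> carrier A" "s \<in> carrier A" "s p0 \<noteq> 0" "\<And>p. p \<in> carrier M \<Longrightarrow> f p * s p = a p"
    "b \<in> carrier A" "t \<in> carrier A" "t p0 \<noteq> 0" "\<And>p. p \<in> carrier M \<Longrightarrow> g p * t p = b p"
    using assms by (auto elim!: RegE)
  show ?thesis
    by (rule RegI[OF A_mult[OF *(1,5)] A_mult[OF *(2,6)]]) (use *(3,7) p0 in \<open>auto simp: algebra_simps simp flip: *(4,8)\<close>)
qed

lemma locI_add:
  assumes "f \<in> locI" "g \<in> locI" shows "(\<lambda>p. f p + g p) \<in> locI"
proof -
  obtain a s b t where *: "a \<in> I" "s \<in> carrier A" "s p0 \<noteq> 0" "\<And>p. p \<in> carrier M \<Longrightarrow> f p * s p = a p"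
    "b \<in> I" "t \<in> carrier A" "t p0 \<noteq> 0" "\<And>p. p \<in> carrier M \<Longrightarrow> g p * t p = b p"
    using assms by (auto elim!: locIE)
  then have "a \<otimes>\<^bsub>A\<^esub> t \<oplus>\<^bsub>A\<^esub> b \<otimes>\<^bsub>A\<^esub> s \<in> I" by (simp add: I.I_r_closed)
  then have "(\<lambda>p\<in>carrier M. (\<lambda>p\<in>carrier M. a p * t p) p + (\<lambda>p\<in>carrier M. b p * s p) p) \<in> I"
    by (simp only: A_ops)
  then show ?thesis
    by (rule locI_I[OF _ A_mult[OF *(2,6)]]) (use *(3,7) p0 in \<open>auto simp: algebra_simps simp flip: *(4,8)\<close>)
qed

lemma locI_mult:
  assumes "f \<in> locI" "g \<in> Reg" shows "(\<lambda>p. f p * g p) \<in> locI"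
proof -
  obtain a s where *: "a \<in> I" "s \<in> carrier A" "s p0 \<noteq> 0" "\<And>p. p \<in> carrier M \<Longrightarrow> f p * s p = a p"
    using assms by (auto elim!: locIE)
  obtain b t where **: "b \<in> carrier A" "t \<in> carrier A" "t p0 \<noteq> 0" "\<And>p. p \<in> carrier M \<Longrightarrow> g p * t p = b p"
    using assms by (auto elim!: RegE)
  have "(\<lambda>p\<in>carrier M. a p * b p) \<in> I" using I.I_r_closed[OF *(1) **(1)] by (simp only: A_ops)
  then show ?thesis
    by (rule locI_I[OF _ A_mult[OF *(2) **(2)]]) (use *(3) **(3) p0 in \<open>auto simp: algebra_simps simp flip: *(4) **(4)\<close>)
qed

lemma Reg_uminus: "f \<in> Reg \<Longrightarrow> (\<lambda>p. - f p) \<in> Reg"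
  using Reg_mult[OF Reg_const[of "-1"], of f] by simp

lemma Reg_diff: "f \<in> Reg \<Longrightarrow> g \<in> Reg \<Longrightarrow> (\<lambda>p. f p - g p) \<in> Reg"
  using Reg_add[OF _ Reg_uminus, of f g] by simp

lemma Reg_sum: "(\<And>i. i \<in> S \<Longrightarrow> f i \<in> Reg) \<Longrightarrow> (\<lambda>p. \<Sum>i\<in>S. f i p) \<in> Reg"
  by (induction S rule: infinite_finite_induct) (auto simp: Reg_const intro: Reg_add)

lemma Reg_prod: "(\<And>i. i \<in> S \<Longrightarrow> f i \<in> Reg) \<Longrightarrow> (\<lambda>p. \<Prod>i\<in>S. f i p) \<in> Reg"
  by (induction S rule: infinite_finite_induct) (auto simp: Reg_const intro: Reg_mult)

lemma Reg_nonzero: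
  assumes "f \<in> Reg" "f p0 \<noteq> 0" shows "\<forall>\<^sub>F p in zar. f p \<noteq> 0"
proof -
  obtain a s where *: "a \<in> carrier A" "s \<in> carrier A" "s p0 \<noteq> 0" "\<And>p. p \<in> carrier M \<Longrightarrow> f p * s p = a p"
    using assms by (auto elim!: RegE)
  show ?thesis by (rule eventually_zarI[OF *(1)]) (use *(3) p0 assms(2) in \<open>auto simp flip: *(4)\<close>)
qed

lemma Reg_inverse:
  assumes "f \<in> Reg" "f p0 \<noteq> 0" shows "(\<lambda>p. inverse (f p)) \<in> Reg"
proof -
  obtain a s where *: "a \<in> carrier A" "s \<in> carrier A" "s p0 \<noteq> 0" "\<And>p. p \<in> carrier M \<Longrightarrow> f p * s p = a p"
    using assms by (auto elim!: RegE)
  have "\<forall>\<^sub>F p in zar. inverse (f p) * a p = s p"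
    using Reg_nonzero[OF assms] eventually_carrier by eventually_elim (simp flip: *(4))
  moreover have "a p0 \<noteq> 0" using *(3) *(4)[OF p0] assms(2) by auto
  ultimately show ?thesis using * by (auto simp: Reg_def)
qed

lemma Reg_quot: "b \<in> carrier A \<Longrightarrow> t \<in> carrier A \<Longrightarrow> t p0 \<noteq> 0 \<Longrightarrow> (\<lambda>p. b p * inverse (t p)) \<in> Reg"
  by (rule Reg_mult[OF Reg_poly Reg_inverse[OF Reg_poly]])

text \<open>The ideals of \<open>Reg\<close> above \<open>locI\<close>, that is, the ideals of the
  local ring seen in \<open>Reg\<close>.\<close>

definition reg_ideal :: "('p \<Rightarrow> 'k) set \<Rightarrow> bool" where
  "reg_ideal b \<longleftrightarrow> b \<subseteq> Reg \<and> locI \<subseteq> b \<and> (\<forall>f\<in>b. \<forall>g\<in>b. (\<lambda>p. f p + g p) \<in> b) \<and>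
     (\<forall>f\<in>b. \<forall>g\<in>Reg. (\<lambda>p. f p * g p) \<in> b)"

lemma locI_zero: "(\<lambda>p. 0) \<in> locI"
  using I.zero_closed A_const[of 1] p0
  by (intro locI_I[of "\<zero>\<^bsub>A\<^esub>" "\<lambda>p\<in>carrier M. 1"]) (auto simp: A_ops)

lemma locI_eventually: "(\<forall>\<^sub>F p in zar. f p = 0) \<Longrightarrow> f \<in> locI"
  by (rule locI_cong[OF locI_zero]) (auto elim: eventually_mono)

lemma reg_ideal_locI: "reg_ideal locI"
  using locI_Reg locI_add locI_mult by (auto simp: reg_ideal_def)

context
  fixes b assumes b: "reg_ideal b"
begin

lemma reg_ideal_Reg: "f \<in> b \<Longrightarrow> f \<in> Reg" using b by (auto simp: reg_ideal_def)
lemma reg_ideal_locI_le: "f \<in> locI \<Longrightarrow> f \<in> b" using b by (auto simp: reg_ideal_def)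
lemma reg_ideal_add: "f \<in> b \<Longrightarrow> g \<in> b \<Longrightarrow> (\<lambda>p. f p + g p) \<in> b" using b by (simp add: reg_ideal_def)
lemma reg_ideal_mult: "f \<in> b \<Longrightarrow> g \<in> Reg \<Longrightarrow> (\<lambda>p. f p * g p) \<in> b" using b by (simp add: reg_ideal_def)
lemma reg_ideal_mult_left: "f \<in> b \<Longrightarrow> g \<in> Reg \<Longrightarrow> (\<lambda>p. g p * f p) \<in> b"
  using reg_ideal_mult[of f g] by (simp add: mult.commute)
lemma reg_ideal_uminus: "f \<in> b \<Longrightarrow> (\<lambda>p. - f p) \<in> b"
  using reg_ideal_mult_left[of f, OF _ Reg_const[of "-1"]] by simp
lemma reg_ideal_diff: "f \<in> b \<Longrightarrow> g \<in> b \<Longrightarrow> (\<lambda>p. f p - g p) \<in> b"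
  using reg_ideal_add[OF _ reg_ideal_uminus, of f g] by simp
lemma reg_ideal_zero: "(\<lambda>p. 0) \<in> b" by (rule reg_ideal_locI_le[OF locI_zero])
lemma reg_ideal_sum: "(\<And>i. i \<in> S \<Longrightarrow> f i \<in> b) \<Longrightarrow> (\<lambda>p. \<Sum>i\<in>S. f i p) \<in> b"
  by (induction S rule: infinite_finite_induct) (auto simp: reg_ideal_zero intro: reg_ideal_add)
lemma reg_ideal_cong: assumes "f \<in> b" "\<forall>\<^sub>F p in zar. f p = g p" shows "g \<in> b"
proof -
  have "(\<lambda>p. g p - f p) \<in> locI" by (rule locI_eventually) (use assms(2) in \<open>auto elim: eventually_mono\<close>)
  from reg_ideal_add[OF reg_ideal_locI_le[OF this] assms(1)] show ?thesis by simp
qed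

end

subsection \<open>The local ring as a quotient of the ring of regular functions\<close>

abbreviation cos :: "('p \<Rightarrow> 'k) \<Rightarrow> ('p \<Rightarrow> 'k) set" where "cos f \<equiv> I +>\<^bsub>A\<^esub> f"
abbreviation "C \<equiv> coord_ring M I"
abbreviation "L \<equiv> local_ring M I p0"

lemma C_carrier: "carrier C = cos ` carrier A"
  by (auto simp: coord_ring_def FactRing_def A_RCOSETS_def')

lemma C_mult: "f \<in> carrier A \<Longrightarrow> g \<in> carrier A \<Longrightarrow> cos f \<otimes>\<^bsub>C\<^esub> cos g = cos (\<lambda>p\<in>carrier M. f p * g p)"
  using ring_hom_mult[OF I.rcos_ring_hom] by (simp add: coord_ring_def A_ops)

lemma C_add: "f \<in> carrier A \<Longrightarrow> g \<in> carrier A \<Longrightarrow> cos f \<oplus>\<^bsub>C\<^esub> cos g = cos (\<lambda>p\<in>carrier M. f p + g p)"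
  using ring_hom_add[OF I.rcos_ring_hom] by (simp add: coord_ring_def A_ops)

lemma C_one: "\<one>\<^bsub>C\<^esub> = cos (\<lambda>p\<in>carrier M. 1)"
  using ring_hom_one[OF I.rcos_ring_hom] by (simp add: coord_ring_def A_ops)

lemma C_zero: "\<zero>\<^bsub>C\<^esub> = cos (\<lambda>p\<in>carrier M. 0)"
  using A.a_rcos_zero[OF I_ideal I.zero_closed] by (simp add: coord_ring_def FactRing_def A_ops)

lemma cos_eq: "f \<in> carrier A \<Longrightarrow> g \<in> carrier A \<Longrightarrow> cos f = cos g \<longleftrightarrow> (\<lambda>p\<in>carrier M. f p - g p) \<in> I"
  using A.quotient_eq_iff_same_a_r_cos[OF I_ideal, of f g] by (simp add: A_diff)

lemma cos_mem: "g \<in> cos f \<Longrightarrow> f \<in> carrier A \<Longrightarrow> \<exists>i\<in>I. g = (\<lambda>p\<in>carrier M. i p + f p)"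
  by (auto simp: a_r_coset_def' A_ops)

lemma cos_self: "f \<in> carrier A \<Longrightarrow> f \<in> cos f"
  using I.a_rcos_self by blast

lemma maximal_at_iff: "f \<in> carrier A \<Longrightarrow> cos f \<in> maximal_at M I p0 \<longleftrightarrow> f p0 = 0"
proof -
  assume f: "f \<in> carrier A"
  have "h p0 = f p0" if mem: "h \<in> cos f" for h
  proof -
    obtain i where i: "i \<in> I" "h = (\<lambda>p\<in>carrier M. i p + f p)" using cos_mem[OF mem f] by blast
    then show ?thesis using I_p0[OF i(1)] p0 by simp
  qed
  moreover have "cos f \<in> carrier C" using f by (simp add: C_carrier)
  ultimately show ?thesis unfolding maximal_at_def mem_Collect_eq using cos_self[OF f] by metis
qed

lemma units_at_eq: "units_at M I p0 = cos ` {t \<in> carrier A. t p0 \<noteq> 0}"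
  unfolding units_at_def using maximal_at_iff by (auto simp: C_carrier)

text \<open>All pairs of cosets that represent \<open>f\<close> modulo \<open>I\<close>. For regular
  \<open>f\<close> this is a class of the localization, described without choosing a numerator and a
  denominator.\<close>

definition germ :: "('p \<Rightarrow> 'k) \<Rightarrow> (('p \<Rightarrow> 'k) set \<times> ('p \<Rightarrow> 'k) set) set" where
  "germ f = {(cos b, cos t) | b t. b \<in> carrier A \<and> t \<in> carrier A \<and> t p0 \<noteq> 0 \<and> (\<lambda>p. f p * t p - b p) \<in> locI}"

lemma germ_eqI:
  assumes "(\<lambda>p. f p - g p) \<in> locI"
  shows "germ f = germ g"
proof -
  have *: "germ f \<subseteq> germ g" if "(\<lambda>p. f p - g p) \<in> locI" for f g
  proof -
    have "(\<lambda>p. g p * t p - b p) \<in> locI" if t: "t \<in> carrier A" and fb: "(\<lambda>p. f p * t p - b p) \<in> locI" for t b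
    proof -
      have "(\<lambda>p. (f p * t p - b p) - (f p - g p) * t p) \<in> locI"
        by (rule reg_ideal_diff[OF reg_ideal_locI fb locI_mult[OF \<open>(\<lambda>p. f p - g p) \<in> locI\<close> Reg_poly[OF t]]])
      then show ?thesis by (simp add: algebra_simps)
    qed
    then show ?thesis unfolding germ_def by blast
  qed
  have "(\<lambda>p. g p - f p) \<in> locI" using reg_ideal_uminus[OF reg_ideal_locI assms] by simp
  then show ?thesis using *[OF assms] * by blast
qed

text \<open>The factor \<open>u\<close> in the equivalence relation of the localization plays the
  same role as the denominator that turns a member of \<open>locI\<close> into a member of
  \<open>I\<close>.\<close>

lemma frac_germ:
  assumes "a \<in> carrier A" "s \<in> carrier A" "s p0 \<noteq> 0" "\<forall>\<^sub>F p in zar. f p * s p = a p"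
  shows "frac C (units_at M I p0) (cos a) (cos s) = germ f"
proof -
  have key: "(\<exists>u\<in>carrier A. u p0 \<noteq> 0 \<and> cos u \<otimes>\<^bsub>C\<^esub> (cos t \<otimes>\<^bsub>C\<^esub> cos a) = cos u \<otimes>\<^bsub>C\<^esub> (cos s \<otimes>\<^bsub>C\<^esub> cos b))
    \<longleftrightarrow> (\<lambda>p. f p * t p - b p) \<in> locI" if "b \<in> carrier A" "t \<in> carrier A" "t p0 \<noteq> 0" for b t
  proof -
    have eq: "cos u \<otimes>\<^bsub>C\<^esub> (cos t \<otimes>\<^bsub>C\<^esub> cos a) = cos u \<otimes>\<^bsub>C\<^esub> (cos s \<otimes>\<^bsub>C\<^esub> cos b)
      \<longleftrightarrow> (\<lambda>p\<in>carrier M. u p * (t p * a p) - u p * (s p * b p)) \<in> I" if u: "u \<in> carrier A" for u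
    proof -
      note ta = A_mult[OF \<open>t \<in> carrier A\<close> assms(1)] and sb = A_mult[OF assms(2) \<open>b \<in> carrier A\<close>]
      have "cos u \<otimes>\<^bsub>C\<^esub> (cos t \<otimes>\<^bsub>C\<^esub> cos a) = cos (\<lambda>p\<in>carrier M. u p * (\<lambda>p\<in>carrier M. t p * a p) p)"
        "cos u \<otimes>\<^bsub>C\<^esub> (cos s \<otimes>\<^bsub>C\<^esub> cos b) = cos (\<lambda>p\<in>carrier M. u p * (\<lambda>p\<in>carrier M. s p * b p) p)"
        using assms u ta sb \<open>b \<in> carrier A\<close> \<open>t \<in> carrier A\<close> by (simp_all add: C_mult)
      then show ?thesis using cos_eq[OF A_mult[OF u ta] A_mult[OF u sb]] by (simp cong: restrict_cong)
    qed
    have Rs: "(\<lambda>p. inverse (s p)) \<in> Reg" using assms by (intro Reg_inverse Reg_poly)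
    have fs: "\<forall>\<^sub>F p in zar. s p \<noteq> 0" using assms by (intro Reg_nonzero Reg_poly)
    show ?thesis
    proof
      assume "\<exists>u\<in>carrier A. u p0 \<noteq> 0 \<and> cos u \<otimes>\<^bsub>C\<^esub> (cos t \<otimes>\<^bsub>C\<^esub> cos a) = cos u \<otimes>\<^bsub>C\<^esub> (cos s \<otimes>\<^bsub>C\<^esub> cos b)"
      then obtain u where u: "u \<in> carrier A" "u p0 \<noteq> 0" "(\<lambda>p\<in>carrier M. u p * (t p * a p) - u p * (s p * b p)) \<in> I"
        using eq by blast
      have "(\<lambda>p. (\<lambda>p\<in>carrier M. u p * (t p * a p) - u p * (s p * b p)) p * (inverse (u p) * inverse (s p))) \<in> locI"
        by (rule locI_mult[OF locI_poly[OF u(3)] Reg_mult[OF Reg_inverse[OF Reg_poly[OF u(1)] u(2)] Rs]])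
      then show "(\<lambda>p. f p * t p - b p) \<in> locI"
      proof (rule locI_cong)
        show "\<forall>\<^sub>F p in zar. (\<lambda>p\<in>carrier M. u p * (t p * a p) - u p * (s p * b p)) p * (inverse (u p) * inverse (s p)) = f p * t p - b p"
          using fs Reg_nonzero[OF Reg_poly[OF u(1)] u(2)] eventually_carrier assms(4)
          by eventually_elim (simp add: field_simps)
      qed
    next
      assume mem: "(\<lambda>p. f p * t p - b p) \<in> locI"
      obtain c v where c: "c \<in> I" "v \<in> carrier A" "v p0 \<noteq> 0" "\<And>p. p \<in> carrier M \<Longrightarrow> (f p * t p - b p) * v p = c p"
        using locIE[OF mem] by blast
      obtain w where w: "w \<in> carrier A" "w p0 \<noteq> 0" "\<And>p. p \<in> carrier M \<Longrightarrow> w p \<noteq> 0 \<Longrightarrow> f p * s p = a p"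
        using assms(4) by (auto simp: eventually_zar)
      \<comment> \<open>\<open>v\<close> clears the denominator in \<open>locI\<close>. The further
        factor \<open>w\<close> makes the equation \<open>f s = a\<close>, valid only where
        \<open>w \<noteq> 0\<close>, usable on all of \<open>carrier M\<close>.\<close>
      define u where "u = (\<lambda>p\<in>carrier M. w p * v p)"
      have u: "u \<in> carrier A" "u p0 \<noteq> 0" using c w p0 by (auto simp: u_def intro: A_mult)
      have "(\<lambda>p\<in>carrier M. w p * s p) \<otimes>\<^bsub>A\<^esub> c \<in> I" using c w assms by (intro I.I_l_closed A_mult) auto
      moreover have "(\<lambda>p\<in>carrier M. w p * s p) \<otimes>\<^bsub>A\<^esub> c = (\<lambda>p\<in>carrier M. u p * (t p * a p) - u p * (s p * b p))"
        unfolding A_ops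
      proof (rule restrict_ext)
        fix p assume p: "p \<in> carrier M"
        show "(\<lambda>p\<in>carrier M. w p * s p) p * c p = u p * (t p * a p) - u p * (s p * b p)"
        proof (cases "w p = 0")
          case False
          have "w p * s p * ((f p * t p - b p) * v p) = w p * v p * (t p * a p) - w p * v p * (s p * b p)"
            by (simp add: w(3)[OF p False, symmetric] algebra_simps)
          then show ?thesis using p c(4)[OF p] by (simp add: u_def)
        qed (use p in \<open>simp add: u_def\<close>)
      qed
      ultimately show "\<exists>u\<in>carrier A. u p0 \<noteq> 0 \<and> cos u \<otimes>\<^bsub>C\<^esub> (cos t \<otimes>\<^bsub>C\<^esub> cos a) = cos u \<otimes>\<^bsub>C\<^esub> (cos s \<otimes>\<^bsub>C\<^esub> cos b)"
        using u eq by auto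
    qed
  qed
  have "frac C (units_at M I p0) (cos a) (cos s) = {(\<beta>, \<tau>). \<beta> \<in> carrier C \<and> \<tau> \<in> units_at M I p0 \<and>
      (\<exists>u\<in>units_at M I p0. u \<otimes>\<^bsub>C\<^esub> (\<tau> \<otimes>\<^bsub>C\<^esub> cos a) = u \<otimes>\<^bsub>C\<^esub> (cos s \<otimes>\<^bsub>C\<^esub> \<beta>))}"
    unfolding frac_def loc_rel_def using assms by (auto simp: C_carrier units_at_eq)
  also have "\<dots> = {(cos b, cos t) | b t. b \<in> carrier A \<and> t \<in> carrier A \<and> t p0 \<noteq> 0 \<and>
      (\<exists>u\<in>carrier A. u p0 \<noteq> 0 \<and> cos u \<otimes>\<^bsub>C\<^esub> (cos t \<otimes>\<^bsub>C\<^esub> cos a) = cos u \<otimes>\<^bsub>C\<^esub> (cos s \<otimes>\<^bsub>C\<^esub> cos b))}"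
    unfolding C_carrier units_at_eq by blast
  also have "\<dots> = germ f" unfolding germ_def by (intro Collect_cong ex_cong1 conj_cong refl key)
  finally show ?thesis .
qed

lemma germ_frac:
  assumes "a \<in> carrier A" "s \<in> carrier A" "s p0 \<noteq> 0" "\<And>p. p \<in> carrier M \<Longrightarrow> f p * s p = a p"
  shows "germ f = frac C (units_at M I p0) (cos a) (cos s)"
  using frac_germ[OF assms(1-3), of f] assms(4) eventually_mono[OF eventually_carrier] by simp

lemma germ_self:
  assumes "f \<in> Reg"
  obtains b t where "b \<in> carrier A" "t \<in> carrier A" "t p0 \<noteq> 0" "(cos b, cos t) \<in> germ f"
proof -
  obtain a s where *: "a \<in> carrier A" "s \<in> carrier A" "s p0 \<noteq> 0" "\<And>p. p \<in> carrier M \<Longrightarrow> f p * s p = a p"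
    using assms by (auto elim!: RegE)
  have "(\<lambda>p. f p * s p - a p) \<in> locI"
    by (rule locI_eventually) (use * eventually_carrier in \<open>auto elim: eventually_mono\<close>)
  then show ?thesis using that * unfolding germ_def by blast
qed

lemma germ_memD:
  assumes "z \<in> germ f"
  obtains b t where "z = (cos b, cos t)" "b \<in> carrier A" "t \<in> carrier A" "t p0 \<noteq> 0"
    "(\<lambda>p. f p - b p * inverse (t p)) \<in> locI"
proof -
  obtain b t where *: "z = (cos b, cos t)" "b \<in> carrier A" "t \<in> carrier A" "t p0 \<noteq> 0" "(\<lambda>p. f p * t p - b p) \<in> locI"
    using assms by (auto simp: germ_def)
  have "(\<lambda>p. (f p * t p - b p) * inverse (t p)) \<in> locI"
    using * by (intro locI_mult Reg_inverse Reg_poly)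
  then have "(\<lambda>p. f p - b p * inverse (t p)) \<in> locI"
  proof (rule locI_cong)
    show "\<forall>\<^sub>F p in zar. (f p * t p - b p) * inverse (t p) = f p - b p * inverse (t p)"
      using Reg_nonzero[OF Reg_poly[OF *(3)] *(4)] by eventually_elim (simp add: field_simps)
  qed
  then show ?thesis using that * by blast
qed

lemma frac_inverse:
  assumes "a \<in> carrier A" "s \<in> carrier A" "s p0 \<noteq> 0"
  shows "frac C (units_at M I p0) (cos a) (cos s) = germ (\<lambda>p. a p * inverse (s p))"
  by (rule frac_germ[OF assms])
    (use Reg_nonzero[OF Reg_poly[OF assms(2)] assms(3)] in \<open>auto elim: eventually_mono\<close>)

lemma germ_eq_iff:
  assumes "f \<in> Reg" "g \<in> Reg"
  shows "germ f = germ g \<longleftrightarrow> (\<lambda>p. f p - g p) \<in> locI"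
proof
  assume eq: "germ f = germ g"
  obtain b t where bt: "b \<in> carrier A" "t \<in> carrier A" "t p0 \<noteq> 0" "(cos b, cos t) \<in> germ g"
    using germ_self[OF assms(2)] by blast
  obtain b1 t1 where 1: "cos b = cos b1" "cos t = cos t1" "b1 \<in> carrier A" "t1 \<in> carrier A" "t1 p0 \<noteq> 0"
    "(\<lambda>p. f p * t1 p - b1 p) \<in> locI" using bt(4)[folded eq] unfolding germ_def by blast
  obtain b2 t2 where 2: "cos b = cos b2" "cos t = cos t2" "b2 \<in> carrier A" "t2 \<in> carrier A" "t2 p0 \<noteq> 0"
    "(\<lambda>p. g p * t2 p - b2 p) \<in> locI" using bt(4) unfolding germ_def by blast
  \<comment> \<open>The common pair consists of cosets, so its representatives for \<open>f\<close>
    and for \<open>g\<close> may differ by elements of \<open>I\<close>.\<close>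
  have "(\<lambda>p\<in>carrier M. b1 p - b2 p) \<in> I" "(\<lambda>p\<in>carrier M. t1 p - t2 p) \<in> I"
    using cos_eq[OF 1(3) 2(3)] cos_eq[OF 1(4) 2(4)] 1(1,2) 2(1,2) by simp_all
  then have d: "(\<lambda>p. b1 p - b2 p) \<in> locI" "(\<lambda>p. t1 p - t2 p) \<in> locI"
    by (simp_all add: locI_restrict)
  \<comment> \<open>The bracket equals \<open>(f - g) t1\<close>, written through members of
    \<open>locI\<close>.\<close>
  have "(\<lambda>p. ((f p * t1 p - b1 p) - (g p * t2 p - b2 p) + (b1 p - b2 p) - (t1 p - t2 p) * g p) * inverse (t1 p)) \<in> locI"
    by (rule locI_mult[OF reg_ideal_diff[OF reg_ideal_locI locI_add[OF reg_ideal_diff[OF reg_ideal_locI 1(6) 2(6)] d(1)]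
          locI_mult[OF d(2) assms(2)]] Reg_inverse[OF Reg_poly[OF 1(4)] 1(5)]])
  then show "(\<lambda>p. f p - g p) \<in> locI"
  proof (rule locI_cong)
    show "\<forall>\<^sub>F p in zar. ((f p * t1 p - b1 p) - (g p * t2 p - b2 p) + (b1 p - b2 p) - (t1 p - t2 p) * g p) * inverse (t1 p) = f p - g p"
      using Reg_nonzero[OF Reg_poly[OF 1(4)] 1(5)] by eventually_elim (simp add: field_simps)
  qed
qed (rule germ_eqI)

definition Reg_ring :: "('p \<Rightarrow> 'k) ring" where
  "Reg_ring = \<lparr>carrier = Reg, mult = (\<lambda>f g p. f p * g p), one = (\<lambda>p. 1), zero = (\<lambda>p. 0),
     add = (\<lambda>f g p. f p + g p)\<rparr>"

lemma Reg_ring: "cring Reg_ring"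
proof (rule cringI)
  show "abelian_group Reg_ring"
  proof (rule abelian_groupI)
    fix f assume "f \<in> carrier Reg_ring"
    then show "\<exists>g\<in>carrier Reg_ring. g \<oplus>\<^bsub>Reg_ring\<^esub> f = \<zero>\<^bsub>Reg_ring\<^esub>"
      by (intro bexI[of _ "\<lambda>p. - f p"]) (auto simp: Reg_ring_def Reg_uminus)
  qed (auto simp: Reg_ring_def Reg_add Reg_const algebra_simps)
  show "comm_monoid Reg_ring"
    by (rule comm_monoidI) (auto simp: Reg_ring_def Reg_mult Reg_const algebra_simps)
qed (auto simp: Reg_ring_def algebra_simps)

text \<open>Multiplication in \<open>localization\<close> is a union over all representatives. All
  of them give the same class, and there is at least one because the functions are regular.\<close>

lemma germ_mult:
  assumes "f \<in> Reg" "g \<in> Reg"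
  shows "germ f \<otimes>\<^bsub>L\<^esub> germ g = germ (\<lambda>p. f p * g p)"
proof -
  have *: "frac C (units_at M I p0) (fst z \<otimes>\<^bsub>C\<^esub> fst w) (snd z \<otimes>\<^bsub>C\<^esub> snd w) = germ (\<lambda>p. f p * g p)"
    if zw: "z \<in> germ f" "w \<in> germ g" for z w
  proof -
    obtain b t where z: "z = (cos b, cos t)" "b \<in> carrier A" "t \<in> carrier A" "t p0 \<noteq> 0"
      "(\<lambda>p. f p - b p * inverse (t p)) \<in> locI" using zw(1) by (rule germ_memD)
    obtain b' t' where w: "w = (cos b', cos t')" "b' \<in> carrier A" "t' \<in> carrier A" "t' p0 \<noteq> 0"
      "(\<lambda>p. g p - b' p * inverse (t' p)) \<in> locI" using zw(2) by (rule germ_memD)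
    have R: "(\<lambda>p. b p * inverse (t p)) \<in> Reg" "g \<in> Reg"
      using z assms by (auto intro: Reg_quot)
    have "frac C (units_at M I p0) (cos (\<lambda>p\<in>carrier M. b p * b' p)) (cos (\<lambda>p\<in>carrier M. t p * t' p)) = germ (\<lambda>p. (b p * inverse (t p)) * (b' p * inverse (t' p)))"
    proof (rule frac_germ)
      show "\<forall>\<^sub>F p in zar. b p * inverse (t p) * (b' p * inverse (t' p)) * (\<lambda>p\<in>carrier M. t p * t' p) p = (\<lambda>p\<in>carrier M. b p * b' p) p"
        using Reg_nonzero[OF Reg_poly[OF z(3)] z(4)] Reg_nonzero[OF Reg_poly[OF w(3)] w(4)] eventually_carrier
        by eventually_elim (simp add: field_simps)
    qed (use z w p0 in \<open>auto intro: A_mult\<close>)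
    also have "\<dots> = germ (\<lambda>p. f p * g p)"
    proof (rule germ_eqI)
      have "(\<lambda>p. - ((f p - b p * inverse (t p)) * g p + (g p - b' p * inverse (t' p)) * (b p * inverse (t p)))) \<in> locI"
        by (rule reg_ideal_uminus[OF reg_ideal_locI locI_add[OF locI_mult[OF z(5) R(2)] locI_mult[OF w(5) R(1)]]])
      then show "(\<lambda>p. b p * inverse (t p) * (b' p * inverse (t' p)) - f p * g p) \<in> locI"
        by (simp add: algebra_simps)
    qed
    finally show ?thesis using z w by (simp add: C_mult)
  qed
  obtain z w where "z \<in> germ f" "w \<in> germ g" using germ_self assms by metis
  then have "(\<Union>z\<in>germ f. \<Union>w\<in>germ g. frac C (units_at M I p0) (fst z \<otimes>\<^bsub>C\<^esub> fst w) (snd z \<otimes>\<^bsub>C\<^esub> snd w)) = germ (\<lambda>p. f p * g p)"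
    using * by auto
  then show ?thesis by (simp add: local_ring_def localization_def case_prod_beta)
qed

lemma germ_add:
  assumes "f \<in> Reg" "g \<in> Reg"
  shows "germ f \<oplus>\<^bsub>L\<^esub> germ g = germ (\<lambda>p. f p + g p)"
proof -
  have *: "frac C (units_at M I p0) ((snd w \<otimes>\<^bsub>C\<^esub> fst z) \<oplus>\<^bsub>C\<^esub> (snd z \<otimes>\<^bsub>C\<^esub> fst w)) (snd z \<otimes>\<^bsub>C\<^esub> snd w) = germ (\<lambda>p. f p + g p)"
    if zw: "z \<in> germ f" "w \<in> germ g" for z w
  proof -
    obtain b t where z: "z = (cos b, cos t)" "b \<in> carrier A" "t \<in> carrier A" "t p0 \<noteq> 0"
      "(\<lambda>p. f p - b p * inverse (t p)) \<in> locI" using zw(1) by (rule germ_memD)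
    obtain b' t' where w: "w = (cos b', cos t')" "b' \<in> carrier A" "t' \<in> carrier A" "t' p0 \<noteq> 0"
      "(\<lambda>p. g p - b' p * inverse (t' p)) \<in> locI" using zw(2) by (rule germ_memD)
    let ?n = "\<lambda>p\<in>carrier M. (\<lambda>p\<in>carrier M. t' p * b p) p + (\<lambda>p\<in>carrier M. t p * b' p) p"
    have n: "?n \<in> carrier A" using z w by (intro A_add A_mult)
    have "frac C (units_at M I p0) (cos ?n) (cos (\<lambda>p\<in>carrier M. t p * t' p)) = germ (\<lambda>p. (b p * inverse (t p)) + (b' p * inverse (t' p)))"
    proof (rule frac_germ[OF n])
      show "\<forall>\<^sub>F p in zar. (b p * inverse (t p) + b' p * inverse (t' p)) * (\<lambda>p\<in>carrier M. t p * t' p) p = ?n p"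
        using Reg_nonzero[OF Reg_poly[OF z(3)] z(4)] Reg_nonzero[OF Reg_poly[OF w(3)] w(4)] eventually_carrier
        by eventually_elim (simp add: field_simps)
    qed (use z w p0 in \<open>auto intro: A_mult\<close>)
    also have "\<dots> = germ (\<lambda>p. f p + g p)"
    proof (rule germ_eqI)
      have "(\<lambda>p. - ((f p - b p * inverse (t p)) + (g p - b' p * inverse (t' p)))) \<in> locI"
        by (rule reg_ideal_uminus[OF reg_ideal_locI locI_add[OF z(5) w(5)]])
      then show "(\<lambda>p. b p * inverse (t p) + (b' p * inverse (t' p)) - (f p + g p)) \<in> locI"
        by (simp add: algebra_simps)
    qed
    finally show ?thesis using z w by (simp add: C_mult C_add A_mult)
  qed
  obtain z w where "z \<in> germ f" "w \<in> germ g" using germ_self assms by metis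
  then have "(\<Union>z\<in>germ f. \<Union>w\<in>germ g. frac C (units_at M I p0) ((snd w \<otimes>\<^bsub>C\<^esub> fst z) \<oplus>\<^bsub>C\<^esub> (snd z \<otimes>\<^bsub>C\<^esub> fst w)) (snd z \<otimes>\<^bsub>C\<^esub> snd w)) = germ (\<lambda>p. f p + g p)"
    using * by auto
  then show ?thesis by (simp add: local_ring_def localization_def case_prod_beta)
qed

lemma frac_const: "frac C (units_at M I p0) (cos (\<lambda>p\<in>carrier M. c)) (cos (\<lambda>p\<in>carrier M. 1)) = germ (\<lambda>p. c)"
proof (rule frac_germ[OF A_const A_const])
  show "\<forall>\<^sub>F p in zar. c * (\<lambda>p\<in>carrier M. 1) p = (\<lambda>p\<in>carrier M. c) p"
    using eventually_carrier by eventually_elim simp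
qed (simp add: p0)

lemma L_one: "\<one>\<^bsub>L\<^esub> = germ (\<lambda>p. 1)"
  by (simp add: local_ring_def localization_def C_one frac_const)

lemma L_zero: "\<zero>\<^bsub>L\<^esub> = germ (\<lambda>p. 0)"
  by (simp add: local_ring_def localization_def C_one C_zero frac_const)

lemma L_carrier: "carrier L = germ ` Reg"
proof
  have "carrier L = {frac C (units_at M I p0) (cos a) (cos s) | a s. a \<in> carrier A \<and> s \<in> carrier A \<and> s p0 \<noteq> 0}"
    unfolding local_ring_def localization_def partial_object.simps quotient_def frac_def C_carrier units_at_eq
    by blast
  then show "carrier L \<subseteq> germ ` Reg"
    using frac_inverse Reg_quot by auto
  show "germ ` Reg \<subseteq> carrier L"
  proof
    fix z assume "z \<in> germ ` Reg"
    then obtain f where f: "f \<in> Reg" "z = germ f" by blast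
    then obtain a s where *: "a \<in> carrier A" "s \<in> carrier A" "s p0 \<noteq> 0" "\<And>p. p \<in> carrier M \<Longrightarrow> f p * s p = a p"
      by (auto elim!: RegE)
    then have "z = frac C (units_at M I p0) (cos a) (cos s)"
      using f(2) germ_frac[OF *] by simp
    then show "z \<in> carrier L"
      using * by (auto simp: local_ring_def localization_def quotient_def frac_def C_carrier units_at_eq)
  qed
qed

lemma germ_hom: "germ \<in> Ring.ring_hom Reg_ring L"
  by (rule ring_hom_memI) (auto simp: Reg_ring_def L_carrier germ_mult germ_add L_one)

text \<open>The ring laws are inherited from \<open>Reg_ring\<close> along the surjection
  \<open>germ\<close>.\<close>

lemma L_cring: "cring L"
proof -
  interpret R: cring Reg_ring by (rule Reg_ring)
  have "ring (L \<lparr>carrier := germ ` carrier Reg_ring, zero := germ \<zero>\<^bsub>Reg_ring\<^esub>\<rparr>)"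
    using R.ring_hom_imp_img_ring[OF germ_hom] .
  moreover have "L \<lparr>carrier := germ ` carrier Reg_ring, zero := germ \<zero>\<^bsub>Reg_ring\<^esub>\<rparr> = L"
    using L_carrier L_zero by (simp add: Reg_ring_def)
  ultimately interpret L: ring L by simp
  show ?thesis
  proof
    fix y z assume "y \<in> carrier L" "z \<in> carrier L"
    then obtain f g where "f \<in> Reg" "g \<in> Reg" "y = germ f" "z = germ g" by (auto simp: L_carrier)
    then show "y \<otimes>\<^bsub>L\<^esub> z = z \<otimes>\<^bsub>L\<^esub> y" by (simp add: germ_mult mult.commute)
  qed
qed

lemma L_ideal:
  assumes "reg_ideal b" shows "ideal (germ ` b) L"
proof -
  interpret L: cring L by (rule L_cring)
  have bR: "f \<in> Reg" if "f \<in> b" for f using reg_ideal_Reg[OF assms that] .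
  show ?thesis
  proof (rule idealI)
    show "ring L" ..
    show "subgroup (germ ` b) (add_monoid L)"
    proof (rule L.add.subgroupI)
      show "germ ` b \<subseteq> carrier L" using bR by (auto simp: L_carrier)
      show "germ ` b \<noteq> {}" using reg_ideal_zero[OF assms] by blast
      fix y assume "y \<in> germ ` b"
      then obtain f where f: "f \<in> b" "y = germ f" by blast
      have "germ (\<lambda>p. - f p) \<oplus>\<^bsub>L\<^esub> y = \<zero>\<^bsub>L\<^esub>" using f bR by (simp add: germ_add Reg_uminus L_zero)
      then have "\<ominus>\<^bsub>L\<^esub> y = germ (\<lambda>p. - f p)"
        using f bR Reg_uminus by (intro L.minus_equality) (auto simp: L_carrier)
      then show "\<ominus>\<^bsub>L\<^esub> y \<in> germ ` b" using reg_ideal_uminus[OF assms f(1)] by simp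
      fix z assume "z \<in> germ ` b"
      then obtain g where "g \<in> b" "z = germ g" by blast
      then show "y \<oplus>\<^bsub>L\<^esub> z \<in> germ ` b" using f bR reg_ideal_add[OF assms] by (simp add: germ_add)
    qed
    fix y z assume "y \<in> germ ` b" "z \<in> carrier L"
    then obtain f g where fg: "f \<in> b" "g \<in> Reg" "y = germ f" "z = germ g" by (auto simp: L_carrier)
    then show "z \<otimes>\<^bsub>L\<^esub> y \<in> germ ` b" using bR reg_ideal_mult_left[OF assms] by (simp add: germ_mult)
    from fg show "y \<otimes>\<^bsub>L\<^esub> z \<in> germ ` b" using bR reg_ideal_mult[OF assms] by (simp add: germ_mult)
  qed
qed

section \<open>Maximal ideal and ideal of a locally closed set in the local ring\<close>

definition m0 :: "('p \<Rightarrow> 'k) set" where "m0 = {f \<in> Reg. f p0 = 0}"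

lemma locI_p0: "f \<in> locI \<Longrightarrow> f p0 = 0"
  using p0 I_p0 by (elim locIE) (metis mult_eq_0_iff)

lemma m0_reg_ideal: "reg_ideal m0"
  using locI_p0 by (auto simp: reg_ideal_def m0_def locI_Reg Reg_add Reg_mult)

lemma local_maximal_eq: "local_maximal M I p0 = germ ` m0"
proof
  show "local_maximal M I p0 \<subseteq> germ ` m0"
  proof
    fix z assume "z \<in> local_maximal M I p0"
    then obtain a s where "a \<in> maximal_at M I p0" "s \<in> units_at M I p0" "z = frac_at M I p0 a s"
      by (auto simp: local_maximal_def)
    moreover from this(1) obtain a' where "a = cos a'" "a' \<in> carrier A" by (auto simp: maximal_at_def C_carrier)
    moreover from calculation obtain s' where "s = cos s'" "s' \<in> carrier A" "s' p0 \<noteq> 0" by (auto simp: units_at_eq)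
    ultimately have "z = germ (\<lambda>p. a' p * inverse (s' p))" "(\<lambda>p. a' p * inverse (s' p)) \<in> m0"
      by (auto simp: frac_at_def frac_inverse m0_def maximal_at_iff Reg_mult Reg_inverse Reg_poly)
    then show "z \<in> germ ` m0" by blast
  qed
  show "germ ` m0 \<subseteq> local_maximal M I p0"
  proof
    fix z assume "z \<in> germ ` m0"
    then obtain f where f: "f \<in> Reg" "f p0 = 0" "z = germ f" by (auto simp: m0_def)
    then obtain a s where *: "a \<in> carrier A" "s \<in> carrier A" "s p0 \<noteq> 0" "\<And>p. p \<in> carrier M \<Longrightarrow> f p * s p = a p"
      by (auto elim!: RegE)
    then have "z = frac C (units_at M I p0) (cos a) (cos s)"
      using f(3) germ_frac[OF *] by simp
    moreover have "a p0 = 0" using f(2) *(4)[OF p0] by simp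
    moreover have "cos a \<in> maximal_at M I p0" "cos s \<in> units_at M I p0"
      using calculation * by (auto simp: maximal_at_iff units_at_eq)
    ultimately show "z \<in> local_maximal M I p0"
      unfolding local_maximal_def frac_at_def by blast
  qed
qed

definition vanY :: "'p set \<Rightarrow> ('p \<Rightarrow> 'k) set" where
  "vanY Y = {f \<in> Reg. \<forall>\<^sub>F p in zar. p \<in> Y \<longrightarrow> f p = 0}"

context
  fixes Y assumes Y: "Y \<subseteq> carrier M" "\<And>f y. f \<in> I \<Longrightarrow> y \<in> Y \<Longrightarrow> f y = 0" "p0 \<in> Y"
begin

lemma vanY_reg_ideal: "reg_ideal (vanY Y)"
proof -
  have "\<forall>\<^sub>F p in zar. p \<in> Y \<longrightarrow> f p = 0" if "f \<in> locI" for f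
  proof -
    obtain a s where as: "a \<in> I" "s \<in> carrier A" "s p0 \<noteq> 0" "\<And>p. p \<in> carrier M \<Longrightarrow> f p * s p = a p"
      using locIE[OF \<open>f \<in> locI\<close>] by blast
    show ?thesis
    proof (rule eventually_zarI[OF as(2,3)], intro impI)
      fix p assume p: "p \<in> carrier M" "s p \<noteq> 0" "p \<in> Y"
      then have "f p * s p = 0" using as(4)[OF p(1)] Y(2)[OF as(1) p(3)] by simp
      then show "f p = 0" using p by simp
    qed
  qed
  then show ?thesis
    unfolding reg_ideal_def vanY_def
    by (auto simp: locI_Reg Reg_add Reg_mult elim: eventually_elim2 eventually_mono)
qed

lemma vanY_m0: "vanY Y \<subseteq> m0"
proof
  fix f assume "f \<in> vanY Y"
  then have "f \<in> Reg" "p0 \<in> Y \<longrightarrow> f p0 = 0" by (auto simp: vanY_def dest: eventually_p0)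
  then show "f \<in> m0" using Y(3) by (simp add: m0_def)
qed

text \<open>A neighbourhood of \<open>p0\<close> on which a germ vanishes along \<open>Y\<close> may
  be taken principal; its equation is the unit \<open>u\<close> in the definition of
  \<open>local_ideal\<close>.\<close>

lemma local_ideal_eq: "local_ideal M I Y p0 = germ ` vanY Y"
proof
  show "local_ideal M I Y p0 \<subseteq> germ ` vanY Y"
  proof
    fix z assume "z \<in> local_ideal M I Y p0"
    then obtain a s u where "a \<in> carrier C" "s \<in> units_at M I p0" "u \<in> units_at M I p0" "z = frac_at M I p0 a s"
      "\<forall>f\<in>u \<otimes>\<^bsub>C\<^esub> a. \<forall>y\<in>Y. f y = 0"
      by (auto simp: local_ideal_def)
    moreover from this(1) obtain a' where a': "a = cos a'" "a' \<in> carrier A" by (auto simp: C_carrier)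
    moreover from calculation obtain s' where s': "s = cos s'" "s' \<in> carrier A" "s' p0 \<noteq> 0" by (auto simp: units_at_eq)
    moreover from calculation obtain u' where u': "u = cos u'" "u' \<in> carrier A" "u' p0 \<noteq> 0" by (auto simp: units_at_eq)
    ultimately have z: "z = germ (\<lambda>p. a' p * inverse (s' p))" and van: "\<forall>f\<in>cos (\<lambda>p\<in>carrier M. u' p * a' p). \<forall>y\<in>Y. f y = 0"
      by (auto simp: frac_at_def frac_inverse C_mult)
    from van have "\<forall>y\<in>Y. u' y * a' y = 0" using cos_self[OF A_mult[OF u'(2) a'(2)]] Y(1) by fastforce
    then have "\<forall>\<^sub>F p in zar. p \<in> Y \<longrightarrow> a' p * inverse (s' p) = 0"
      by (intro eventually_zarI[OF u'(2,3)]) auto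
    then have "(\<lambda>p. a' p * inverse (s' p)) \<in> vanY Y"
      using a' s' by (auto simp: vanY_def Reg_mult Reg_inverse Reg_poly)
    then show "z \<in> germ ` vanY Y" using z by blast
  qed
  show "germ ` vanY Y \<subseteq> local_ideal M I Y p0"
  proof
    fix z assume "z \<in> germ ` vanY Y"
    then obtain f where f: "f \<in> Reg" "\<forall>\<^sub>F p in zar. p \<in> Y \<longrightarrow> f p = 0" "z = germ f" by (auto simp: vanY_def)
    then obtain a s where *: "a \<in> carrier A" "s \<in> carrier A" "s p0 \<noteq> 0" "\<And>p. p \<in> carrier M \<Longrightarrow> f p * s p = a p"
      by (auto elim!: RegE)
    have z: "z = frac C (units_at M I p0) (cos a) (cos s)"
      using f(3) germ_frac[OF *] by simp
    obtain u where u: "u \<in> carrier A" "u p0 \<noteq> 0" "\<And>p. p \<in> carrier M \<Longrightarrow> u p \<noteq> 0 \<Longrightarrow> p \<in> Y \<Longrightarrow> f p = 0"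
      using f(2) by (auto simp: eventually_zar)
    have "h y = 0" if mem: "h \<in> cos (\<lambda>p\<in>carrier M. u p * a p)" and "y \<in> Y" for h y
    proof -
      obtain i where i: "i \<in> I" "h = (\<lambda>p\<in>carrier M. i p + (\<lambda>p\<in>carrier M. u p * a p) p)"
        using cos_mem[OF mem A_mult[OF u(1) *(1)]] by blast
      have y: "y \<in> carrier M" using \<open>y \<in> Y\<close> Y by auto
      have "u y * a y = 0" using u(3)[OF y _ \<open>y \<in> Y\<close>] *(4)[OF y, symmetric] by (cases "u y = 0") auto
      then show ?thesis using i y Y(2)[OF i(1) \<open>y \<in> Y\<close>] by simp
    qed
    then have "\<forall>f\<in>cos u \<otimes>\<^bsub>C\<^esub> cos a. \<forall>y\<in>Y. f y = 0" using u * by (simp add: C_mult)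
    then show "z \<in> local_ideal M I Y p0"
      unfolding local_ideal_def frac_at_def mem_Collect_eq
      using z * u(1,2)
      by (intro exI[of _ "cos a"] exI[of _ "cos s"] conjI bexI[of _ "cos u"]) (auto simp: C_carrier units_at_eq)
  qed
qed

end

end

section \<open>Normal cones from transversal slices\<close>

text \<open>\<open>S\<close> and \<open>e\<close> relate the scheme of \<open>I\<close> near
  \<open>p0\<close> and the cone of \<open>IN\<close> in both directions: \<open>IN_S\<close> and
  \<open>e_I\<close> say that they respect the ideals, \<open>S_e\<close> that \<open>S\<close>
  retracts onto the slice \<open>e\<close>. By \<open>S_van\<close> and \<open>van_S\<close> the
  functions \<open>S j\<close> generate the ideal of \<open>Y\<close> near \<open>p0\<close> modulo
  \<open>I\<close>.\<close>

locale normal_slice = M: local_point M X x I p0 + N: coordinates N Z y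
  for M :: "('k::field_char_0, 'p) module" and X :: "'j set" and x and I and p0
    and N :: "('k, 'q) module" and Z :: "'i set" and y +
  fixes IN :: "('q \<Rightarrow> 'k) set" and Y :: "'p set" and S :: "'i \<Rightarrow> 'p \<Rightarrow> 'k" and e :: "'q \<Rightarrow> 'p"
  assumes IN: "N.homogeneous_ideal IN"
    and Y: "Y \<subseteq> carrier M" "\<And>f y. f \<in> I \<Longrightarrow> y \<in> Y \<Longrightarrow> f y = 0" "p0 \<in> Y"
    and S_van: "j \<in> Z \<Longrightarrow> S j \<in> M.vanY Y"
    and van_S: "\<And>f. f \<in> M.vanY Y \<Longrightarrow>
      \<exists>c. (\<forall>j\<in>Z. c j \<in> M.Reg) \<and> (\<lambda>p. f p - (\<Sum>j\<in>Z. c j p * S j p)) \<in> M.locI"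
    and IN_S: "\<And>f. f \<in> IN \<Longrightarrow> (\<lambda>p. f (N.pt (\<lambda>j. S j p))) \<in> M.locI"
    and e_zero: "e \<zero>\<^bsub>N\<^esub> = p0"
    and e_closed: "q \<in> carrier N \<Longrightarrow> e q \<in> carrier M"
    and e_poly: "\<And>f. f \<in> carrier (poly_ring M) \<Longrightarrow> (\<lambda>q\<in>carrier N. f (e q)) \<in> carrier (poly_ring N)"
    and e_I: "\<And>f. f \<in> I \<Longrightarrow> (\<lambda>q\<in>carrier N. f (e q)) \<in> IN"
    and S_e: "q \<in> carrier N \<Longrightarrow> j \<in> Z \<Longrightarrow> S j (e q) = y j q"
begin

sublocale IN: ideal IN "poly_ring N" using IN by (simp add: N.homogeneous_ideal_def)

abbreviation "L \<equiv> local_ring M I p0"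
abbreviation "J \<equiv> local_ideal M I Y p0"
abbreviation "K \<equiv> local_maximal M I p0"

sublocale L: cring L by (rule M.L_cring)

lemma J_eq: "J = M.germ ` M.vanY Y" by (rule M.local_ideal_eq) (use Y in auto)
lemma K_eq: "K = M.germ ` M.m0" by (rule M.local_maximal_eq)
lemma vanY_ideal: "M.reg_ideal (M.vanY Y)" by (rule M.vanY_reg_ideal) (use Y in auto)
lemma vanY_m0: "M.vanY Y \<subseteq> M.m0" by (rule M.vanY_m0) (use Y in auto)

sublocale filtered_ring L J K
proof (intro filtered_ring.intro filtered_ring_axioms.intro)
  show "cring L" ..
  show "ideal J L" unfolding J_eq by (rule M.L_ideal[OF vanY_ideal])
  show "ideal K L" unfolding K_eq by (rule M.L_ideal[OF M.m0_reg_ideal])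
  show "J \<subseteq> K" unfolding J_eq K_eq using vanY_m0 by (rule image_mono)
qed

section \<open>The graded map into the local ring\<close>

definition Sm :: "'p \<Rightarrow> 'q" where "Sm p = N.pt (\<lambda>j. S j p)"

lemma Sm: "Sm p \<in> carrier N" "j \<in> Z \<Longrightarrow> y j (Sm p) = S j p"
  by (simp_all add: Sm_def N.pt)

lemma Sm_e: "q \<in> carrier N \<Longrightarrow> Sm (e q) = q"
  by (rule N.x_eqI) (auto simp: Sm S_e)

lemma S_Reg: "j \<in> Z \<Longrightarrow> S j \<in> M.Reg"
  using S_van by (simp add: M.vanY_def)

lemma Reg_Sm:
  assumes "f \<in> carrier (poly_ring N)" shows "(\<lambda>p. f (Sm p)) \<in> M.Reg"
  using assms
proof (induction rule: N.A_induct)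
  case (const c) then show ?case using M.Reg_const[of c] by (simp add: Sm)
next
  case (coord j) then show ?case using S_Reg[of j] by (simp add: Sm)
next
  case (add f g) then show ?case using M.Reg_add by (simp add: Sm)
next
  case (mult f g) then show ?case using M.Reg_mult by (simp add: Sm)
qed

definition \<theta> :: "('q \<Rightarrow> 'k) \<Rightarrow> (('p \<Rightarrow> 'k) set \<times> ('p \<Rightarrow> 'k) set) set" where
  "\<theta> f = M.germ (\<lambda>p. f (Sm p))"

lemma \<theta>_hom: "\<theta> \<in> Ring.ring_hom (poly_ring N) L"
proof (rule ring_hom_memI)
  show "\<theta> f \<in> carrier L" if "f \<in> carrier (poly_ring N)" for f
    using Reg_Sm[OF that] by (simp add: \<theta>_def M.L_carrier)
  show "\<theta> \<one>\<^bsub>poly_ring N\<^esub> = \<one>\<^bsub>L\<^esub>" by (simp add: \<theta>_def N.A_ops Sm M.L_one)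
  fix f g assume "f \<in> carrier (poly_ring N)" "g \<in> carrier (poly_ring N)"
  then show "\<theta> (f \<otimes>\<^bsub>poly_ring N\<^esub> g) = \<theta> f \<otimes>\<^bsub>L\<^esub> \<theta> g" "\<theta> (f \<oplus>\<^bsub>poly_ring N\<^esub> g) = \<theta> f \<oplus>\<^bsub>L\<^esub> \<theta> g"
    by (simp_all add: \<theta>_def N.A_ops Sm M.germ_mult M.germ_add Reg_Sm)
qed

interpretation \<theta>: ring_hom_ring "poly_ring N" L \<theta>
  by (rule ring_hom_ringI2[OF N.A.ring_axioms L.ring_axioms \<theta>_hom])

text \<open>Coordinates go to germs in \<open>J\<close>, so forms of degree n go to
  \<open>J^n\<close>; the induction follows the components of sums and products.\<close>

lemma \<theta>_hc_pow:
  assumes "f \<in> carrier (poly_ring N)" shows "\<theta> (N.hc n f) \<in> ideal_pow L J n"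
  using assms
proof (induction arbitrary: n rule: N.A_induct)
  case (const c)
  show ?case
  proof (cases "n = 0")
    case True
    then show ?thesis using \<theta>.hom_closed[OF N.A_const[of c]] by (simp only: N.hc_const if_True ideal_pow.simps simp_thms)
  next
    case False
    then show ?thesis using zero_mem[OF pow_ideal] by (simp only: N.hc_const if_False \<theta>.hom_zero)
  qed
next
  case (coord j)
  have h: "(\<lambda>p\<in>carrier N. y j p) \<in> homogeneous N 1"
    using N.A_coord[OF coord] coord by (auto simp: homogeneous_def N.x_smult N.smult_closed)
  show ?case
  proof (cases "n = 1")
    case True
    have "\<theta> (\<lambda>p\<in>carrier N. y j p) = M.germ (S j)" using coord by (simp add: \<theta>_def Sm)
    then have "\<theta> (\<lambda>p\<in>carrier N. y j p) \<in> J" using S_van[OF coord] by (auto simp: J_eq)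
    then show ?thesis using True N.hc_of_homogeneous[OF h, of n] L.ideal_prod_one[OF J_ideal]
      by (simp flip: restrict_def)
  next
    case False
    then show ?thesis using zero_mem[OF pow_ideal] N.hc_of_homogeneous[OF h, of n] by (simp only: if_False \<theta>.hom_zero)
  qed
next
  case (add f g)
  have "\<theta> (N.hc n (\<lambda>p\<in>carrier N. f p + g p)) = \<theta> (N.hc n f) \<oplus>\<^bsub>L\<^esub> \<theta> (N.hc n g)"
    using N.hc_add[OF add(1,2), of n] \<theta>.hom_add[OF N.hc_closed N.hc_closed, OF add(1,2)] by (simp add: N.A_ops)
  then show ?case
    using add additive_subgroup.a_closed[OF ideal.axioms(1)[OF pow_ideal]] by (simp flip: restrict_def)
next
  case (mult f g)
  have c: "N.hc i f \<in> carrier (poly_ring N)" "N.hc i g \<in> carrier (poly_ring N)" for i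
    using mult N.hc_closed by auto
  have "\<theta> (N.hc n (\<lambda>p\<in>carrier N. f p * g p)) = \<theta> (\<Oplus>\<^bsub>poly_ring N\<^esub>i\<in>{..n}. N.hc i f \<otimes>\<^bsub>poly_ring N\<^esub> N.hc (n - i) g)"
    using N.hc_mult[OF mult(1,2), of n] by (simp add: N.A_ops)
  also have "\<dots> = finsum L (\<theta> \<circ> (\<lambda>i. N.hc i f \<otimes>\<^bsub>poly_ring N\<^esub> N.hc (n - i) g)) {..n}"
    using c by (intro \<theta>.hom_finsum) auto
  also have "\<dots> \<in> ideal_pow L J n"
  proof (rule finsum_ideal[OF pow_ideal])
    fix i assume i: "i \<in> {..n}"
    have "\<theta> (N.hc i f) \<otimes>\<^bsub>L\<^esub> \<theta> (N.hc (n - i) g) \<in> ideal_pow L J (i + (n - i))"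
      using mult by (intro pow_mult)
    then show "(\<theta> \<circ> (\<lambda>i. N.hc i f \<otimes>\<^bsub>poly_ring N\<^esub> N.hc (n - i) g)) i \<in> ideal_pow L J n"
      using i c by simp
  qed
  finally show ?case .
qed

text \<open>A germ in \<open>J\<close> is a combination of the \<open>S j\<close> with regular
  coefficients \<open>c j\<close>. Replacing these by the constants \<open>c j p0\<close> costs the
  terms \<open>(c j - c j p0) S j\<close>, which lie in \<open>K J\<close>.\<close>

lemma J_approx:
  assumes "z \<in> J"
  shows "\<exists>f\<in>homogeneous N 1. z \<ominus>\<^bsub>L\<^esub> \<theta> f \<in> K \<cdot>\<^bsub>L\<^esub> J"
proof -
  obtain f where f: "f \<in> M.vanY Y" "z = M.germ f" using assms by (auto simp: J_eq)
  obtain c where c: "\<And>j. j \<in> Z \<Longrightarrow> c j \<in> M.Reg" "(\<lambda>p. f p - (\<Sum>j\<in>Z. c j p * S j p)) \<in> M.locI"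
    using van_S[OF f(1)] by blast
  define g where "g = (\<lambda>q\<in>carrier N. \<Sum>j\<in>Z. c j p0 * y j q)"
  have gA: "g \<in> carrier (poly_ring N)"
  proof -
    have "(\<lambda>q\<in>carrier N. \<Sum>j\<in>Z. (\<lambda>q\<in>carrier N. (\<lambda>q\<in>carrier N. c j p0) q * (\<lambda>q\<in>carrier N. y j q) q) q) \<in> carrier (poly_ring N)"
      by (intro N.A_sum N.A_mult N.A_const N.A_coord)
    then show ?thesis unfolding g_def by (simp cong: restrict_cong)
  qed
  have g1: "g \<in> homogeneous N 1"
    using gA by (auto simp: homogeneous_def g_def N.x_smult N.smult_closed sum_distrib_left intro!: sum.cong)
  have dR: "(\<lambda>p. c j p - c j p0) \<in> M.m0" if "j \<in> Z" for j
    using M.Reg_diff[OF c(1)[OF that] M.Reg_const] by (simp add: M.m0_def)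
  have zg: "z \<ominus>\<^bsub>L\<^esub> \<theta> g = M.germ (\<lambda>p. \<Sum>j\<in>Z. (c j p - c j p0) * S j p)"
  proof -
    have R: "(\<lambda>p. \<Sum>j\<in>Z. (c j p - c j p0) * S j p) \<in> M.Reg"
      using dR S_Reg by (intro M.Reg_sum M.Reg_mult) (auto simp: M.m0_def)
    have "M.germ (\<lambda>p. \<Sum>j\<in>Z. (c j p - c j p0) * S j p) \<oplus>\<^bsub>L\<^esub> \<theta> g = M.germ (\<lambda>p. (\<Sum>j\<in>Z. (c j p - c j p0) * S j p) + g (Sm p))"
      unfolding \<theta>_def by (rule M.germ_add[OF R Reg_Sm[OF gA]])
    also have "\<dots> = M.germ (\<lambda>p. \<Sum>j\<in>Z. c j p * S j p)"
      by (simp add: g_def Sm sum.distrib[symmetric] algebra_simps)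
    also have "\<dots> = z" using M.germ_eqI[OF c(2)] f by simp
    finally have "z = M.germ (\<lambda>p. \<Sum>j\<in>Z. (c j p - c j p0) * S j p) \<oplus>\<^bsub>L\<^esub> \<theta> g" ..
    moreover have "M.germ (\<lambda>p. \<Sum>j\<in>Z. (c j p - c j p0) * S j p) \<in> carrier L"
      using R by (simp add: M.L_carrier)
    ultimately show ?thesis using \<theta>.hom_closed[OF gA]
      by (simp add: a_minus_def L.a_assoc L.r_neg)
  qed
  have "M.germ (\<lambda>p. \<Sum>j\<in>Z'. (c j p - c j p0) * S j p) \<in> K \<cdot>\<^bsub>L\<^esub> J" if "finite Z'" "Z' \<subseteq> Z" for Z'
    using that
  proof induction
    case empty
    have "M.germ (\<lambda>p. 0) \<in> K \<cdot>\<^bsub>L\<^esub> J" using zero_mem[OF L.ideal_prod_is_ideal[OF K_ideal J_ideal]] by (simp add: M.L_zero)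
    then show ?case by simp
  next
    case (insert j Z')
    then have j: "j \<in> Z" "Z' \<subseteq> Z" by auto
    have "M.germ (\<lambda>p. c j p - c j p0) \<otimes>\<^bsub>L\<^esub> M.germ (S j) \<in> K \<cdot>\<^bsub>L\<^esub> J"
      using dR[OF j(1)] S_van[OF j(1)] by (intro ideal_prod.prod) (auto simp: K_eq J_eq)
    then have 1: "M.germ (\<lambda>p. (c j p - c j p0) * S j p) \<in> K \<cdot>\<^bsub>L\<^esub> J"
      using dR[OF j(1)] S_Reg[OF j(1)] by (simp add: M.germ_mult M.m0_def)
    have R: "(\<lambda>p. (c i p - c i p0) * S i p) \<in> M.Reg" if "i \<in> Z" for i
      using dR[OF that] S_Reg[OF that] by (intro M.Reg_mult) (auto simp: M.m0_def)
    have Rs: "(\<lambda>p. \<Sum>j\<in>Z'. (c j p - c j p0) * S j p) \<in> M.Reg"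
      using R j by (intro M.Reg_sum) auto
    from ideal_prod.sum[OF 1 insert.IH[OF j(2)]] show ?case
      using insert(1,2) by (simp add: M.germ_add[OF R[OF j(1)] Rs])
  qed
  from this[OF N.finite_X subset_refl] have "z \<ominus>\<^bsub>L\<^esub> \<theta> g \<in> K \<cdot>\<^bsub>L\<^esub> J" using zg by simp
  then show ?thesis using g1 by blast
qed

text \<open>Evaluation at \<open>p0\<close> identifies the residue field with the ground
  field.\<close>

lemma K_approx:
  assumes "z \<in> carrier L"
  shows "\<exists>c. z \<ominus>\<^bsub>L\<^esub> \<theta> (\<lambda>q\<in>carrier N. c) \<in> K"
proof -
  obtain f where f: "f \<in> M.Reg" "z = M.germ f" using assms by (auto simp: M.L_carrier)
  have "M.germ (\<lambda>p. f p - f p0) \<oplus>\<^bsub>L\<^esub> M.germ (\<lambda>p. f p0) = z"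
    using f M.germ_add[OF M.Reg_diff[OF f(1) M.Reg_const[of "f p0"]] M.Reg_const[of "f p0"]] by simp
  moreover have "\<theta> (\<lambda>q\<in>carrier N. f p0) = M.germ (\<lambda>p. f p0)" by (simp add: \<theta>_def Sm)
  moreover have "M.germ (\<lambda>p. f p - f p0) \<in> carrier L" "M.germ (\<lambda>p. f p0) \<in> carrier L"
    using M.Reg_diff[OF f(1) M.Reg_const[of "f p0"]] M.Reg_const[of "f p0"] by (auto simp: M.L_carrier)
  ultimately have "z \<ominus>\<^bsub>L\<^esub> \<theta> (\<lambda>q\<in>carrier N. f p0) = M.germ (\<lambda>p. f p - f p0)"
    by (metis L.a_assoc L.a_inv_closed L.minus_eq L.r_neg L.r_zero)
  moreover have "(\<lambda>p. f p - f p0) \<in> M.m0" using M.Reg_diff[OF f(1) M.Reg_const] by (simp add: M.m0_def)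
  ultimately show ?thesis by (auto simp: K_eq)
qed

lemma homogeneous_mult:
  "f \<in> homogeneous N i \<Longrightarrow> g \<in> homogeneous N j \<Longrightarrow> f \<otimes>\<^bsub>poly_ring N\<^esub> g \<in> homogeneous N (i + j)"
  using N.A_mult by (auto simp: homogeneous_def N.A_ops N.smult_closed power_add)

lemma homogeneous_add:
  "f \<in> homogeneous N i \<Longrightarrow> g \<in> homogeneous N i \<Longrightarrow> f \<oplus>\<^bsub>poly_ring N\<^esub> g \<in> homogeneous N i"
  using N.A_add by (auto simp: homogeneous_def N.A_ops N.smult_closed algebra_simps)

lemma homogeneous_closed: "f \<in> homogeneous N i \<Longrightarrow> f \<in> carrier (poly_ring N)"
  by (simp add: homogeneous_def)

lemma pow_approx:
  assumes "z \<in> ideal_pow L J n"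
  shows "\<exists>f\<in>homogeneous N n. z \<ominus>\<^bsub>L\<^esub> \<theta> f \<in> KJ n"
  using assms
proof (induction n arbitrary: z)
  case 0
  then obtain c where c: "z \<ominus>\<^bsub>L\<^esub> \<theta> (\<lambda>q\<in>carrier N. c) \<in> K" using K_approx by auto
  have "(\<lambda>q\<in>carrier N. c) \<in> homogeneous N 0" using N.A_const by (auto simp: homogeneous_def N.smult_closed)
  then show ?case using c L.ideal_prod_one[OF K_ideal] by auto
next
  case (Suc n)
  interpret KJ: ideal "KJ (Suc n)" L by (rule KJ_ideal)
  have "z \<in> J \<cdot>\<^bsub>L\<^esub> ideal_pow L J n" using Suc.prems by simp
  then show ?case
  proof (induction rule: ideal_prod.induct)
    case (prod a b)
    obtain f where f: "f \<in> homogeneous N 1" "a \<ominus>\<^bsub>L\<^esub> \<theta> f \<in> K \<cdot>\<^bsub>L\<^esub> J" using J_approx[OF prod(1)] by blast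
    obtain g where g: "g \<in> homogeneous N n" "b \<ominus>\<^bsub>L\<^esub> \<theta> g \<in> KJ n" using Suc.IH[OF prod(2)] by blast
    have J1: "ideal_pow L J 1 = J" using L.ideal_prod_one[OF J_ideal] by simp
    have ac: "a \<in> carrier L" "b \<in> carrier L" using prod ideal.Icarr[OF J_ideal] pow_carrier by auto
    have fc: "\<theta> f \<in> carrier L" "\<theta> g \<in> carrier L" using f g homogeneous_closed \<theta>.hom_closed by auto
    have fJ: "\<theta> f \<in> ideal_pow L J 1" using \<theta>_hc_pow[of f 1] N.hc_of_homogeneous[OF f(1), of 1] f(1) homogeneous_closed by simp
    have "(a \<ominus>\<^bsub>L\<^esub> \<theta> f) \<otimes>\<^bsub>L\<^esub> b \<in> KJ (1 + n)"
      using KJ_mult[of "a \<ominus>\<^bsub>L\<^esub> \<theta> f" 1 b n] f prod J1 by simp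
    moreover have "(b \<ominus>\<^bsub>L\<^esub> \<theta> g) \<otimes>\<^bsub>L\<^esub> \<theta> f \<in> KJ (n + 1)"
      using KJ_mult[OF g(2) fJ] .
    \<comment> \<open>The error of a product of approximations is
      \<open>a b - f g = (a - f) b + (b - g) f\<close>, with \<open>f\<close> and \<open>g\<close>
      standing for their images. Each summand pairs an error with a factor in the complementary
      power of \<open>J\<close>.\<close>
    ultimately have "(a \<ominus>\<^bsub>L\<^esub> \<theta> f) \<otimes>\<^bsub>L\<^esub> b \<oplus>\<^bsub>L\<^esub> (b \<ominus>\<^bsub>L\<^esub> \<theta> g) \<otimes>\<^bsub>L\<^esub> \<theta> f \<in> KJ (Suc n)"
      using KJ.a_closed by simp
    moreover have "(a \<ominus>\<^bsub>L\<^esub> \<theta> f) \<otimes>\<^bsub>L\<^esub> b \<oplus>\<^bsub>L\<^esub> (b \<ominus>\<^bsub>L\<^esub> \<theta> g) \<otimes>\<^bsub>L\<^esub> \<theta> f = a \<otimes>\<^bsub>L\<^esub> b \<ominus>\<^bsub>L\<^esub> \<theta> f \<otimes>\<^bsub>L\<^esub> \<theta> g"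
      using ac fc by algebra
    moreover have "\<theta> f \<otimes>\<^bsub>L\<^esub> \<theta> g = \<theta> (f \<otimes>\<^bsub>poly_ring N\<^esub> g)" using f g homogeneous_closed by simp
    ultimately show ?case using homogeneous_mult[OF f(1) g(1)] by auto
  next
    case (sum a b)
    then obtain f g where fg: "f \<in> homogeneous N (Suc n)" "g \<in> homogeneous N (Suc n)"
      "a \<ominus>\<^bsub>L\<^esub> \<theta> f \<in> KJ (Suc n)" "b \<ominus>\<^bsub>L\<^esub> \<theta> g \<in> KJ (Suc n)" by blast
    have ac: "a \<in> carrier L" "b \<in> carrier L" using sum(1,2) ideal.Icarr[OF L.ideal_prod_is_ideal[OF J_ideal pow_ideal]] by auto
    have fc: "\<theta> f \<in> carrier L" "\<theta> g \<in> carrier L" using fg homogeneous_closed \<theta>.hom_closed by auto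
    have "(a \<ominus>\<^bsub>L\<^esub> \<theta> f) \<oplus>\<^bsub>L\<^esub> (b \<ominus>\<^bsub>L\<^esub> \<theta> g) \<in> KJ (Suc n)" using fg(3,4) by (rule KJ.a_closed)
    moreover have "(a \<ominus>\<^bsub>L\<^esub> \<theta> f) \<oplus>\<^bsub>L\<^esub> (b \<ominus>\<^bsub>L\<^esub> \<theta> g) = (a \<oplus>\<^bsub>L\<^esub> b) \<ominus>\<^bsub>L\<^esub> (\<theta> f \<oplus>\<^bsub>L\<^esub> \<theta> g)"
      using ac fc by algebra
    moreover have "\<theta> f \<oplus>\<^bsub>L\<^esub> \<theta> g = \<theta> (f \<oplus>\<^bsub>poly_ring N\<^esub> g)" using fg homogeneous_closed by simp
    ultimately show ?case using homogeneous_add[OF fg(1,2)] by auto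
  qed
qed

subsection \<open>Restriction to the slice\<close>

text \<open>Polynomials that have order at least n at the vertex modulo the cone ideal.\<close>

definition Fil :: "nat \<Rightarrow> ('q \<Rightarrow> 'k) set" where
  "Fil n = {g \<in> carrier (poly_ring N). \<forall>k<n. N.hc k g \<in> IN}"

lemma Fil_add:
  assumes "f \<in> Fil n" "g \<in> Fil n" shows "(\<lambda>q\<in>carrier N. f q + g q) \<in> Fil n"
  using assms N.A_add[of f g] N.hc_add[of f g] IN.a_closed by (auto simp: Fil_def N.A_ops)

text \<open>In a component of degree below \<open>i + j\<close> every summand has a factor of degree
  below \<open>i\<close> or below \<open>j\<close>.\<close>

lemma Fil_mult:
  assumes "f \<in> Fil i" "g \<in> Fil j" shows "(\<lambda>q\<in>carrier N. f q * g q) \<in> Fil (i + j)"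
proof -
  have c: "f \<in> carrier (poly_ring N)" "g \<in> carrier (poly_ring N)" using assms by (auto simp: Fil_def)
  have hcI: "N.hc l f \<otimes>\<^bsub>poly_ring N\<^esub> N.hc (k - l) g \<in> IN" if "k < i + j" "l \<le> k" for k l
  proof (cases "l < i")
    case True
    then show ?thesis using assms c N.hc_closed by (intro IN.I_r_closed) (auto simp: Fil_def)
  next
    case False
    then have "k - l < j" using that by simp
    then show ?thesis using assms c N.hc_closed by (intro IN.I_l_closed) (auto simp: Fil_def)
  qed
  have fs: "finsum (poly_ring N) h A \<in> IN" if "finite A" "\<And>a. a \<in> A \<Longrightarrow> h a \<in> IN" for h and A :: "nat set"
    using that
  proof induction
    case (insert a A)
    then have "h \<in> A \<rightarrow> carrier (poly_ring N)" "h a \<in> carrier (poly_ring N)" using IN.Icarr by auto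
    then show ?case using insert by simp
  qed simp
  have "N.hc k (f \<otimes>\<^bsub>poly_ring N\<^esub> g) \<in> IN" if "k < i + j" for k
    unfolding N.hc_mult[OF c] using hcI[OF that] by (intro fs) auto
  then show ?thesis using N.A_mult[OF c] by (simp add: Fil_def N.A_ops)
qed

lemma IN_Fil: "IN \<subseteq> Fil n"
  using IN IN.Icarr by (auto simp: Fil_def N.homogeneous_ideal_def)

lemma Fil_zero: "Fil 0 = carrier (poly_ring N)" by (simp add: Fil_def)

text \<open>Regular functions whose restriction to the slice has order at least n modulo the cone
  ideal. The factor \<open>u\<close>, nonzero at the vertex, clears denominators.\<close>

definition LFil :: "nat \<Rightarrow> ('p \<Rightarrow> 'k) set" where
  "LFil n = {f \<in> M.Reg. \<exists>u\<in>carrier (poly_ring N). u \<zero>\<^bsub>N\<^esub> \<noteq> 0 \<and>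
     (\<exists>a\<in>Fil n. \<forall>q\<in>carrier N. u q * f (e q) = a q)}"

lemma LFil_add:
  assumes "f \<in> LFil n" "g \<in> LFil n" shows "(\<lambda>p. f p + g p) \<in> LFil n"
proof -
  obtain u a v b where *: "u \<in> carrier (poly_ring N)" "u \<zero>\<^bsub>N\<^esub> \<noteq> 0" "a \<in> Fil n" "\<And>q. q \<in> carrier N \<Longrightarrow> u q * f (e q) = a q"
    "v \<in> carrier (poly_ring N)" "v \<zero>\<^bsub>N\<^esub> \<noteq> 0" "b \<in> Fil n" "\<And>q. q \<in> carrier N \<Longrightarrow> v q * g (e q) = b q"
    using assms by (auto simp: LFil_def)
  have 1: "(\<lambda>q\<in>carrier N. a q * v q) \<in> Fil n" "(\<lambda>q\<in>carrier N. b q * u q) \<in> Fil n"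
    using Fil_mult[of a n v 0] Fil_mult[of b n u 0] * by (auto simp: Fil_zero)
  show ?thesis
    unfolding LFil_def mem_Collect_eq
  proof (intro conjI bexI[OF _ N.A_mult[OF *(1,5)]] bexI[OF _ Fil_add[OF 1]] ballI)
    show "(\<lambda>p. f p + g p) \<in> M.Reg" using assms by (auto simp: LFil_def M.Reg_add)
    show "(\<lambda>q\<in>carrier N. u q * v q) \<zero>\<^bsub>N\<^esub> \<noteq> 0" using * N.zero_closed by simp
    fix q assume q: "q \<in> carrier N"
    have "u q * v q * (f (e q) + g (e q)) = (u q * f (e q)) * v q + (v q * g (e q)) * u q" by (simp add: algebra_simps)
    then show "(\<lambda>q\<in>carrier N. u q * v q) q * (f (e q) + g (e q))
      = (\<lambda>q\<in>carrier N. (\<lambda>q\<in>carrier N. a q * v q) q + (\<lambda>q\<in>carrier N. b q * u q) q) q"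
      using q by (simp add: *(4,8))
  qed
qed

lemma LFil_mult:
  assumes "f \<in> LFil i" "g \<in> LFil j" shows "(\<lambda>p. f p * g p) \<in> LFil (i + j)"
proof -
  obtain u a v b where *: "u \<in> carrier (poly_ring N)" "u \<zero>\<^bsub>N\<^esub> \<noteq> 0" "a \<in> Fil i" "\<And>q. q \<in> carrier N \<Longrightarrow> u q * f (e q) = a q"
    "v \<in> carrier (poly_ring N)" "v \<zero>\<^bsub>N\<^esub> \<noteq> 0" "b \<in> Fil j" "\<And>q. q \<in> carrier N \<Longrightarrow> v q * g (e q) = b q"
    using assms by (auto simp: LFil_def)
  show ?thesis
    unfolding LFil_def mem_Collect_eq
  proof (intro conjI bexI[OF _ N.A_mult[OF *(1,5)]] bexI[OF _ Fil_mult[OF *(3,7)]] ballI)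
    show "(\<lambda>p. f p * g p) \<in> M.Reg" using assms by (auto simp: LFil_def M.Reg_mult)
    show "(\<lambda>q\<in>carrier N. u q * v q) \<zero>\<^bsub>N\<^esub> \<noteq> 0" using * N.zero_closed by simp
    fix q assume q: "q \<in> carrier N"
    have "u q * v q * (f (e q) * g (e q)) = (u q * f (e q)) * (v q * g (e q))" by (simp add: algebra_simps)
    then show "(\<lambda>q\<in>carrier N. u q * v q) q * (f (e q) * g (e q)) = (\<lambda>q\<in>carrier N. a q * b q) q"
      using q by (simp add: *(4,8))
  qed
qed

lemma LFil_quot:
  assumes "a \<in> carrier (poly_ring M)" "s \<in> carrier (poly_ring M)" "s p0 \<noteq> 0"
    and "\<And>p. p \<in> carrier M \<Longrightarrow> f p * s p = a p" and "(\<lambda>q\<in>carrier N. a (e q)) \<in> Fil n"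
  shows "f \<in> LFil n"
  unfolding LFil_def mem_Collect_eq
proof (intro conjI bexI[OF _ e_poly[OF assms(2)]] bexI[OF _ assms(5)] ballI)
  show "f \<in> M.Reg" by (rule M.RegI[OF assms(1-4)])
  show "(\<lambda>q\<in>carrier N. s (e q)) \<zero>\<^bsub>N\<^esub> \<noteq> 0" using assms(3) by (simp add: e_zero N.zero_closed)
  show "(\<lambda>q\<in>carrier N. s (e q)) q * f (e q) = (\<lambda>q\<in>carrier N. a (e q)) q" if "q \<in> carrier N" for q
    using assms(4)[OF e_closed[OF that]] that by (simp add: mult.commute)
qed

lemma Reg_LFil: "M.Reg \<subseteq> LFil 0"
  using LFil_quot e_poly by (auto simp: Fil_zero elim!: M.RegE)

text \<open>Elements of \<open>I\<close> restrict into \<open>IN\<close>, and modulo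
  \<open>IN\<close> zero has every order.\<close>

lemma locI_LFil: "f \<in> M.locI \<Longrightarrow> f \<in> LFil n"
proof (erule M.locIE)
  fix a s assume *: "a \<in> I" "s \<in> carrier (poly_ring M)" "s p0 \<noteq> 0" "\<And>p. p \<in> carrier M \<Longrightarrow> f p * s p = a p"
  have F: "(\<lambda>q\<in>carrier N. a (e q)) \<in> Fil n" using e_I[OF *(1)] IN_Fil by blast
  show "f \<in> LFil n" by (rule LFil_quot[OF M.I.Icarr[OF *(1)] *(2,3) _ F]) (rule *(4))
qed

lemma hc_0: "f \<in> carrier (poly_ring N) \<Longrightarrow> N.hc 0 f = (\<lambda>q\<in>carrier N. f \<zero>\<^bsub>N\<^esub>)"
  using N.line[of f _ 0] N.smult_zero by (auto simp: N.hc_def poly_0_coeff_0 intro!: restrict_ext)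

text \<open>The vertex of the cone goes to \<open>p0\<close>, so a numerator vanishing there loses
  its component of degree 0 on the slice.\<close>

lemma m0_LFil: "M.m0 \<subseteq> LFil 1"
proof
  fix f assume "f \<in> M.m0"
  then obtain a s where *: "a \<in> carrier (poly_ring M)" "s \<in> carrier (poly_ring M)" "s p0 \<noteq> 0"
    "\<And>p. p \<in> carrier M \<Longrightarrow> f p * s p = a p" and f0: "f p0 = 0" by (auto simp: M.m0_def elim!: M.RegE)
  have "a p0 = 0" using f0 *(4)[OF M.p0] by simp
  then have "N.hc 0 (\<lambda>q\<in>carrier N. a (e q)) = \<zero>\<^bsub>poly_ring N\<^esub>"
    using hc_0[OF e_poly[OF *(1)]] by (simp add: e_zero N.zero_closed N.A_ops)
  then have F: "(\<lambda>q\<in>carrier N. a (e q)) \<in> Fil 1"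
    using e_poly[OF *(1)] IN.zero_closed by (simp add: Fil_def del: restrict_apply)
  show "f \<in> LFil 1" by (rule LFil_quot[OF *(1-3) _ F]) (rule *(4))
qed

lemma prod_LFil:
  assumes "A \<subseteq> M.germ ` LFil i" "B \<subseteq> M.germ ` LFil j"
  shows "A \<cdot>\<^bsub>L\<^esub> B \<subseteq> M.germ ` LFil (i + j)"
proof
  fix z assume "z \<in> A \<cdot>\<^bsub>L\<^esub> B"
  then show "z \<in> M.germ ` LFil (i + j)"
  proof (induction rule: ideal_prod.induct)
    case (prod a b)
    obtain f g where "f \<in> LFil i" "g \<in> LFil j" "a = M.germ f" "b = M.germ g" using prod assms by blast
    then show ?case using LFil_mult[of f i g j] by (auto simp: LFil_def M.germ_mult)
  next
    case (sum a b)
    then obtain f g where "f \<in> LFil (i + j)" "g \<in> LFil (i + j)" "a = M.germ f" "b = M.germ g" by blast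
    then show ?case using LFil_add[of f "i + j" g] by (auto simp: LFil_def M.germ_add)
  qed
qed

text \<open>\<open>K\<close> restricts to order at least 1, and so does \<open>J\<close>, being
  contained in \<open>K\<close>; hence each further factor raises the order by one.\<close>

lemma KJ_LFil: "KJ n \<subseteq> M.germ ` LFil (Suc n)"
proof -
  have "ideal_pow L J n \<subseteq> M.germ ` LFil n"
  proof (induction n)
    case 0
    then show ?case using Reg_LFil by (auto simp: M.L_carrier)
  next
    case (Suc n)
    have "J \<subseteq> M.germ ` LFil 1" using vanY_m0 m0_LFil by (auto simp: J_eq)
    from prod_LFil[OF this Suc.IH] show ?case by simp
  qed
  moreover have "K \<subseteq> M.germ ` LFil 1" using m0_LFil by (auto simp: K_eq)
  ultimately show ?thesis using prod_LFil[of K 1 "ideal_pow L J n" n] by simp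
qed

lemma \<theta>_IN:
  assumes "g \<in> IN" shows "\<theta> g = \<zero>\<^bsub>L\<^esub>"
  using M.germ_eqI[of "\<lambda>p. g (Sm p)" "\<lambda>p. 0"] IN_S[OF assms] by (simp add: \<theta>_def Sm_def M.L_zero)

text \<open>On the slice \<open>\<theta> g\<close> becomes \<open>g\<close> again, because
  \<open>Sm\<close> is a left inverse of \<open>e\<close>. A form of degree n that has order at
  least n + 1 modulo \<open>IN\<close>, up to a unit, lies in \<open>IN\<close>.\<close>

lemma \<theta>_KJ:
  assumes g: "g \<in> homogeneous N n" and "\<theta> g \<in> KJ n"
  shows "g \<in> IN"
proof -
  have gA: "g \<in> carrier (poly_ring N)" using g by (rule homogeneous_closed)
  obtain f where f: "f \<in> LFil (Suc n)" "\<theta> g = M.germ f" using assms KJ_LFil by blast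
  have fR: "f \<in> M.Reg" using f by (simp add: LFil_def)
  have "(\<lambda>p. g (Sm p) - f p) \<in> M.locI"
    using M.germ_eq_iff[OF Reg_Sm[OF gA] fR] f(2) by (simp add: \<theta>_def)
  from LFil_add[OF locI_LFil[OF this] f(1)] have "(\<lambda>p. g (Sm p)) \<in> LFil (Suc n)" by simp
  then obtain u a where u: "u \<in> carrier (poly_ring N)" "u \<zero>\<^bsub>N\<^esub> \<noteq> 0" "a \<in> Fil (Suc n)" "\<And>q. q \<in> carrier N \<Longrightarrow> u q * g (Sm (e q)) = a q"
    by (auto simp: LFil_def)
  have aA: "a \<in> carrier (poly_ring N)" using u by (simp add: Fil_def)
  have a_eq: "a = u \<otimes>\<^bsub>poly_ring N\<^esub> g"
    by (rule N.A_eqI[OF aA N.A.m_closed[OF u(1) gA]]) (simp add: N.A_ops u(4)[symmetric] Sm_e)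
  \<comment> \<open>Since \<open>g\<close> is homogeneous of degree n, only the constant term of
    \<open>u\<close> contributes to this component.\<close>
  have "N.hc n a = (\<Oplus>\<^bsub>poly_ring N\<^esub>i\<in>{..n}. if i = 0 then N.hc 0 u \<otimes>\<^bsub>poly_ring N\<^esub> g else \<zero>\<^bsub>poly_ring N\<^esub>)"
    unfolding a_eq N.hc_mult[OF u(1) gA]
    by (rule N.A.finsum_cong')
      (use gA u(1) N.hc_closed N.hc_of_homogeneous[OF g] in auto)
  also have "\<dots> = N.hc 0 u \<otimes>\<^bsub>poly_ring N\<^esub> g"
    using N.A.finsum_singleton[of 0 "{..n}" "\<lambda>i. N.hc 0 u \<otimes>\<^bsub>poly_ring N\<^esub> g"] gA u(1) N.hc_closed by (simp add: eq_commute)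
  finally have "N.hc n a = N.hc 0 u \<otimes>\<^bsub>poly_ring N\<^esub> g" .
  moreover have "N.hc n a \<in> IN" using u(3) by (simp add: Fil_def)
  ultimately have "N.hc 0 u \<otimes>\<^bsub>poly_ring N\<^esub> g \<in> IN" by simp
  from IN.I_l_closed[OF this N.A_const[of "inverse (u \<zero>\<^bsub>N\<^esub>)"]]
  have "(\<lambda>q\<in>carrier N. inverse (u \<zero>\<^bsub>N\<^esub>)) \<otimes>\<^bsub>poly_ring N\<^esub> (N.hc 0 u \<otimes>\<^bsub>poly_ring N\<^esub> g) \<in> IN" .
  moreover have "(\<lambda>q\<in>carrier N. inverse (u \<zero>\<^bsub>N\<^esub>)) \<otimes>\<^bsub>poly_ring N\<^esub> (N.hc 0 u \<otimes>\<^bsub>poly_ring N\<^esub> g) = g"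
  proof (rule N.A_eqI[OF _ gA])
    show "(\<lambda>q\<in>carrier N. inverse (u \<zero>\<^bsub>N\<^esub>)) \<otimes>\<^bsub>poly_ring N\<^esub> (N.hc 0 u \<otimes>\<^bsub>poly_ring N\<^esub> g) \<in> carrier (poly_ring N)"
      by (intro N.A.m_closed N.A_const N.hc_closed u(1) gA)
  qed (use u(2) hc_0[OF u(1)] in \<open>simp add: N.A_ops\<close>)
  ultimately show ?thesis by simp
qed

sublocale filtered_ring_presentation L J K "poly_ring N" N.hc \<theta> IN
proof
  show "\<theta> \<in> Ring.ring_hom (poly_ring N) L" by (rule \<theta>_hom)
  show "\<theta> (N.hc n f) \<in> ideal_pow L J n" if "f \<in> carrier (poly_ring N)" for f n by (rule \<theta>_hc_pow[OF that])
  show "\<exists>f\<in>carrier (poly_ring N). z \<ominus>\<^bsub>L\<^esub> \<theta> (N.hc n f) \<in> KJ n" if mem: "z \<in> ideal_pow L J n" for z n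
  proof -
    obtain f where f: "f \<in> homogeneous N n" "z \<ominus>\<^bsub>L\<^esub> \<theta> f \<in> KJ n" using pow_approx[OF mem] by blast
    then show ?thesis using N.hc_of_homogeneous[OF f(1), of n] homogeneous_closed[OF f(1)]
      by (intro bexI[of _ f]) simp_all
  qed
  fix f assume f: "f \<in> carrier (poly_ring N)"
  show "f \<in> IN \<longleftrightarrow> (\<forall>n. \<theta> (N.hc n f) \<in> KJ n)"
  proof
    assume "f \<in> IN"
    then have "N.hc n f \<in> IN" for n using IN by (simp add: N.homogeneous_ideal_def)
    then show "\<forall>n. \<theta> (N.hc n f) \<in> KJ n" using \<theta>_IN zero_mem[OF KJ_ideal] by simp
  next
    assume "\<forall>n. \<theta> (N.hc n f) \<in> KJ n"
    then have "\<forall>n. N.hc n f \<in> IN" using \<theta>_KJ N.hc_homogeneous[OF f] by blast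
    then show "f \<in> IN" using N.homogeneous_ideal_iff[OF IN f] by blast
  qed
qed

theorem normal_cone_iso: "normal_cone_fiber M I Y p0 \<cong>\<^sub>g\<^sub>r subcone N IN"
proof -
  have "frac_at M I p0 (coord_scalar M I c) \<one>\<^bsub>coord_ring M I\<^esub> = \<theta> (\<lambda>q\<in>carrier N. c)" for c
    using M.frac_const[of c] by (simp add: frac_at_def coord_scalar_def M.C_one \<theta>_def Sm)
  then have "gr_fiber L J K (\<lambda>c. frac_at M I p0 (coord_scalar M I c) \<one>\<^bsub>coord_ring M I\<^esub>) \<cong>\<^sub>g\<^sub>r
    ring.extend (poly_ring N Quot IN) \<lparr>scalar = \<lambda>c. IN +>\<^bsub>poly_ring N\<^esub> (\<lambda>q\<in>carrier N. c),
      component = \<lambda>n. (\<lambda>f. IN +>\<^bsub>poly_ring N\<^esub> f) ` N.hc n ` carrier (poly_ring N)\<rparr>"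
    by (intro gr_fiber_iso) (auto simp: N.A_const N.hc_const)
  then show ?thesis
    by (simp add: normal_cone_fiber_def subcone_def coord_ring_def coord_scalar_def[abs_def] N.homogeneous_eq)
qed

end

section \<open>Bases and ranks\<close>

text \<open>Independence and the exchange bound are taken from the space of functions into the
  field; every space with coordinates embeds there by \<open>vec\<close>.\<close>

interpretation fs: vector_space "\<lambda>(c::'k::field) (f::'a \<Rightarrow> 'k) t. c * f t"
  by standard (auto simp: fun_eq_iff algebra_simps)

lemma sum_fun_apply: "(\<Sum>i\<in>S. f i) t = (\<Sum>i\<in>S. f i t)" for f :: "'i \<Rightarrow> 'a \<Rightarrow> 'k::field"
  by (induction S rule: infinite_finite_induct) auto

section \<open>Bases of subspaces\<close>

definition lin_sub :: "('k::field, 'v) module \<Rightarrow> 'v set \<Rightarrow> bool" where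
  "lin_sub W S \<longleftrightarrow> S \<subseteq> carrier W \<and> \<zero>\<^bsub>W\<^esub> \<in> S \<and> (\<forall>u\<in>S. \<forall>v\<in>S. u \<oplus>\<^bsub>W\<^esub> v \<in> S) \<and>
     (\<forall>c. \<forall>u\<in>S. c \<odot>\<^bsub>W\<^esub> u \<in> S)"

text \<open>The coordinates are indexed by the basis vectors themselves, so that compatible bases of
  nested subspaces are nested sets.\<close>

definition basis_coords :: "('k::field_char_0, 'v) module \<Rightarrow> 'v set \<Rightarrow> ('v \<Rightarrow> 'v \<Rightarrow> 'k) \<Rightarrow> bool" where
  "basis_coords M b \<epsilon> \<longleftrightarrow> coordinates M b \<epsilon> \<and> b \<subseteq> carrier M \<and> (\<forall>u\<in>b. \<forall>v\<in>b. \<epsilon> u v = of_bool (u = v))"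

lemma basis_coords_unit:
  assumes "basis_coords M b \<epsilon>" "v \<in> b" shows "coordinates.unit_pt M b \<epsilon> v = v"
proof -
  interpret coordinates M b \<epsilon> using assms by (simp add: basis_coords_def)
  show ?thesis by (rule x_eqI) (use assms in \<open>auto simp: basis_coords_def unit_pt\<close>)
qed

lemma basis_coords_expand:
  assumes "basis_coords M b \<epsilon>" "p \<in> carrier M"
    and "\<And>p q. p \<in> carrier M \<Longrightarrow> q \<in> carrier M \<Longrightarrow> val (p \<oplus>\<^bsub>M\<^esub> q) = val p + val q"
    and "\<And>c p. p \<in> carrier M \<Longrightarrow> val (c \<odot>\<^bsub>M\<^esub> p) = c * val p"
  shows "val p = (\<Sum>v\<in>b. \<epsilon> v p * val v)"
proof -
  interpret coordinates M b \<epsilon> using assms by (simp add: basis_coords_def)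
  show ?thesis using linear_expand[OF assms(3,4,2)] basis_coords_unit[OF assms(1)] by (simp cong: sum.cong)
qed

lemma basis_coords_empty:
  assumes "coordinates W Z y"
  shows "basis_coords (W\<lparr>carrier := {\<zero>\<^bsub>W\<^esub>}\<rparr>) {} \<epsilon>"
proof -
  interpret W: coordinates W Z y by (rule assms)
  have "\<zero>\<^bsub>W\<^esub> \<oplus>\<^bsub>W\<^esub> \<zero>\<^bsub>W\<^esub> = \<zero>\<^bsub>W\<^esub>" "c \<odot>\<^bsub>W\<^esub> \<zero>\<^bsub>W\<^esub> = \<zero>\<^bsub>W\<^esub>" for c
    by (auto intro!: W.x_eqI simp: W.zero_closed W.add_closed W.smult_closed W.x_zero W.x_add W.x_smult)
  then show ?thesis by (auto simp: basis_coords_def coordinates_def)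
qed

context coordinates
begin

definition vec :: "'p \<Rightarrow> 'j \<Rightarrow> 'k" where "vec p = (\<lambda>j. if j \<in> X then x j p else 0)"

lemma vec_add: "p \<in> carrier M \<Longrightarrow> q \<in> carrier M \<Longrightarrow> vec (p \<oplus>\<^bsub>M\<^esub> q) = vec p + vec q"
  by (auto simp: vec_def fun_eq_iff x_add)

lemma vec_smult: "p \<in> carrier M \<Longrightarrow> vec (c \<odot>\<^bsub>M\<^esub> p) = (\<lambda>t. c * vec p t)"
  by (auto simp: vec_def fun_eq_iff x_smult)

lemma vec_zero: "vec \<zero>\<^bsub>M\<^esub> = 0"
  by (auto simp: vec_def fun_eq_iff x_zero)

lemma vec_inj: "inj_on vec (carrier M)"
proof (rule inj_onI)
  fix p q assume p: "p \<in> carrier M" and q: "q \<in> carrier M" and eq: "vec p = vec q"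
  show "p = q"
  proof (rule x_eqI[OF p q])
    fix j assume "j \<in> X" then show "x j p = x j q" using fun_cong[OF eq, of j] by (simp add: vec_def)
  qed
qed

lemma vec_span:
  assumes "p \<in> carrier M" shows "vec p \<in> fs.span (vec ` unit_pt ` X)"
proof -
  have "vec p = (\<Sum>j\<in>X. (\<lambda>t. x j p * vec (unit_pt j) t))"
  proof
    fix t
    have "vec p t = (\<Sum>j\<in>X. x j p * vec (unit_pt j) t)"
      by (rule linear_expand[OF _ _ assms]) (auto simp: vec_add vec_smult)
    then show "vec p t = (\<Sum>j\<in>X. (\<lambda>t. x j p * vec (unit_pt j) t)) t" by (simp add: sum_fun_apply)
  qed
  also have "\<dots> \<in> fs.span (vec ` unit_pt ` X)"
    by (intro fs.span_sum fs.span_scale fs.span_base) auto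
  finally show ?thesis .
qed

lemma vec_independent:
  assumes "S \<subseteq> carrier M" "basis_coords (M\<lparr>carrier := S\<rparr>) b \<epsilon>"
  shows "fs.independent (vec ` b)"
proof -
  interpret S: coordinates "M\<lparr>carrier := S\<rparr>" b \<epsilon> using assms by (simp add: basis_coords_def)
  have b: "b \<subseteq> S" "finite b" using assms S.finite_X by (auto simp: basis_coords_def)
  have inj: "inj_on vec b" using vec_inj b assms by (meson inj_on_subset subset_trans)
  show ?thesis
    unfolding fs.independent_explicit_finite_subsets
  proof (intro allI impI ballI)
    fix B u v assume B: "B \<subseteq> vec ` b" "finite B" and zero: "(\<Sum>v\<in>B. (\<lambda>t. u v * v t)) = 0" and v: "v \<in> B"
    \<comment> \<open>A linear relation among the \<open>vec w\<close> is turned into the vector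
      with these coordinates, which must then be zero.\<close>
    define c where "c w = (if vec w \<in> B then u (vec w) else 0)" for w
    have "vec (S.pt c) = 0"
    proof
      fix t
      have pS: "S.pt c \<in> S" using S.pt(1) by simp
      have "vec (S.pt c) t = (\<Sum>w\<in>b. \<epsilon> w (S.pt c) * vec w t)"
        by (rule basis_coords_expand[OF assms(2)]) (use pS assms(1) vec_add vec_smult in \<open>auto simp: subset_iff\<close>)
      also have "\<dots> = (\<Sum>w\<in>b. c w * vec w t)" by (simp add: S.pt)
      also have "\<dots> = (\<Sum>w\<in>vec ` b. (if w \<in> B then u w * w t else 0))"
        using inj by (subst sum.reindex) (auto simp: c_def intro!: sum.cong)
      also have "\<dots> = (\<Sum>w\<in>B. u w * w t)"
        using B b by (intro sum.mono_neutral_cong_right) auto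
      also have "\<dots> = 0" using fun_cong[OF zero, of t] by (simp add: sum_fun_apply)
      finally show "vec (S.pt c) t = 0 t" by simp
    qed
    then have "S.pt c = \<zero>\<^bsub>M\<^esub>"
      using inj_onD[OF vec_inj, of "S.pt c" "\<zero>\<^bsub>M\<^esub>"] vec_zero zero_closed S.pt(1) assms(1) by auto
    moreover obtain w where "w \<in> b" "v = vec w" using B v by auto
    ultimately show "u v = 0" using S.pt(2)[of w c] S.x_zero[of w] v by (simp add: c_def)
  qed
qed

text \<open>The image of \<open>b1\<close> under \<open>vec\<close> extends to a maximal independent
  subset of the image of \<open>S\<close>. Pulled back it is the basis, and its representation
  coefficients are the coordinates.\<close>

lemma subspace_basis:
  assumes S: "lin_sub M S" and S1: "S1 \<subseteq> S" "basis_coords (M\<lparr>carrier := S1\<rparr>) b1 \<epsilon>1"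
  shows "\<exists>b \<epsilon>. b1 \<subseteq> b \<and> basis_coords (M\<lparr>carrier := S\<rparr>) b \<epsilon>"
proof -
  have SM: "S \<subseteq> carrier M" using S by (simp add: lin_sub_def)
  have b1: "b1 \<subseteq> S" using S1 by (auto simp: basis_coords_def)
  have "fs.independent (vec ` b1)" using vec_independent[OF _ S1(2)] S1(1) SM by blast
  moreover have "vec ` b1 \<subseteq> vec ` S" using b1 by blast
  ultimately obtain B where B: "vec ` b1 \<subseteq> B" "B \<subseteq> vec ` S" "fs.independent B" "vec ` S \<subseteq> fs.span B"
    using fs.maximal_independent_subset_extend by metis
  have finB: "finite B"
    using fs.independent_span_bound[of "vec ` unit_pt ` X" B] B vec_span SM finite_X by blast
  define b where "b = {v \<in> S. vec v \<in> B}"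
  have injS: "inj_on vec S" using vec_inj SM by (meson inj_on_subset)
  have vb: "vec ` b = B" using B by (auto simp: b_def)
  have finb: "finite b" using finB vb injS by (metis (no_types, lifting) b_def finite_imageD inj_on_subset mem_Collect_eq subsetI)
  define \<epsilon> where "\<epsilon> v w = fs.representation B (vec w) (vec v)" for v w
  have sp: "vec v \<in> fs.span B" if "v \<in> S" for v using B that by blast
  have SS: "u \<oplus>\<^bsub>M\<^esub> v \<in> S" "c \<odot>\<^bsub>M\<^esub> u \<in> S" "\<zero>\<^bsub>M\<^esub> \<in> S" if "u \<in> S" "v \<in> S" for u v c
    using S that by (auto simp: lin_sub_def)
  have zS: "\<zero>\<^bsub>M\<^esub> \<in> S" using S by (simp add: lin_sub_def)
  have "coordinates (M\<lparr>carrier := S\<rparr>) b \<epsilon>"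
  proof (rule coordinates.intro)
    show "finite b" by (rule finb)
    show "\<epsilon> j \<zero>\<^bsub>M\<lparr>carrier := S\<rparr>\<^esub> = 0" for j by (simp add: \<epsilon>_def vec_zero fs.representation_zero)
    show "\<epsilon> j (p \<oplus>\<^bsub>M\<lparr>carrier := S\<rparr>\<^esub> q) = \<epsilon> j p + \<epsilon> j q"
      if "p \<in> carrier (M\<lparr>carrier := S\<rparr>)" "q \<in> carrier (M\<lparr>carrier := S\<rparr>)" for j p q
      using that SM fs.representation_add[OF B(3) sp sp] by (simp add: \<epsilon>_def vec_add subset_iff)
    show "\<epsilon> j (c \<odot>\<^bsub>M\<lparr>carrier := S\<rparr>\<^esub> p) = c * \<epsilon> j p" if "p \<in> carrier (M\<lparr>carrier := S\<rparr>)" for j p c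
      using that SM fs.representation_scale[OF B(3) sp] by (simp add: \<epsilon>_def vec_smult subset_iff)
    show "p = q" if "p \<in> carrier (M\<lparr>carrier := S\<rparr>)" "q \<in> carrier (M\<lparr>carrier := S\<rparr>)"
      and eq: "\<And>j. j \<in> b \<Longrightarrow> \<epsilon> j p = \<epsilon> j q" for p q
    proof -
      have pq: "p \<in> S" "q \<in> S" using that by auto
      have "fs.representation B (vec p) w = fs.representation B (vec q) w" if "w \<in> B" for w
        using eq that vb by (auto simp: \<epsilon>_def)
      then have "(\<Sum>w\<in>B. (\<lambda>t. fs.representation B (vec p) w * w t)) = (\<Sum>w\<in>B. (\<lambda>t. fs.representation B (vec q) w * w t))"
        by (intro sum.cong) auto
      then have "vec p = vec q"
        unfolding fs.sum_representation_eq[OF B(3) sp[OF pq(1)] finB subset_refl]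
          fs.sum_representation_eq[OF B(3) sp[OF pq(2)] finB subset_refl] .
      then show ?thesis using injS pq by (auto dest: inj_onD)
    qed
    show "\<exists>p\<in>carrier (M\<lparr>carrier := S\<rparr>). \<forall>j\<in>b. \<epsilon> j p = f j" for f
    proof -
      have "\<exists>p\<in>S. vec p = (\<Sum>v\<in>A. (\<lambda>t. f v * vec v t))" if "A \<subseteq> b" for A
      proof -
        have "finite A" using that finb finite_subset by blast
        then show ?thesis using that
        proof induction
          case empty
          then show ?case using zS vec_zero by (intro bexI[of _ "\<zero>\<^bsub>M\<^esub>"]) (auto simp: fun_eq_iff)
        next
          case (insert v A)
          then obtain p where p: "p \<in> S" "vec p = (\<Sum>v\<in>A. (\<lambda>t. f v * vec v t))" by auto
          have v: "v \<in> S" using insert by (auto simp: b_def)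
          have "vec (f v \<odot>\<^bsub>M\<^esub> v \<oplus>\<^bsub>M\<^esub> p) = (\<Sum>v\<in>insert v A. (\<lambda>t. f v * vec v t))"
            using insert p v SM SS(2)[OF v v] by (subst vec_add) (auto simp: vec_smult subset_iff)
          then show ?case using SS(1)[OF SS(2)[OF v v] p(1)] by blast
        qed
      qed
      then obtain p where p: "p \<in> S" "vec p = (\<Sum>v\<in>b. (\<lambda>t. f v * vec v t))" by blast
      have "\<epsilon> j p = f j" if j: "j \<in> b" for j
      proof -
        have vB: "vec v \<in> B" if "v \<in> b" for v using that by (simp add: b_def)
        have "\<epsilon> j p = (\<Sum>v\<in>b. fs.representation B (\<lambda>t. f v * vec v t) (vec j))"
          unfolding \<epsilon>_def p(2)
          by (subst fs.representation_sum[OF B(3)]) (auto intro: fs.span_scale fs.span_base vB)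
        also have "\<dots> = (\<Sum>v\<in>b. f v * of_bool (vec j = vec v))"
          using fs.representation_scale[OF B(3) fs.span_base[OF vB]] fs.representation_basis[OF B(3) vB]
          by (intro sum.cong) auto
        also have "\<dots> = (\<Sum>v\<in>b. if v = j then f v else 0)"
        proof (intro sum.cong refl)
          fix v assume v: "v \<in> b"
          have "vec j = vec v \<longleftrightarrow> v = j" using inj_on_eq_iff[OF injS, of j v] j v by (auto simp: b_def)
          then show "f v * of_bool (vec j = vec v) = (if v = j then f v else 0)" by simp
        qed
        also have "\<dots> = f j" using j finb by simp
        finally show ?thesis .
      qed
      then show ?thesis using p by auto
    qed
  qed (use SS zS in auto)
  moreover have "\<epsilon> u v = of_bool (u = v)" if "u \<in> b" "v \<in> b" for u v
    using that fs.representation_basis[OF B(3), of "vec v"] inj_on_eq_iff[OF injS, of u v]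
    by (auto simp: \<epsilon>_def b_def)
  moreover have "b1 \<subseteq> b" using b1 B(1) by (auto simp: b_def)
  ultimately show ?thesis
    by (intro exI[of _ b] exI[of _ \<epsilon>]) (auto simp: basis_coords_def b_def)
qed

lemma vectorspace: "vectorspace class_ring M"
proof (rule vs_criteria)
  show "field (class_ring :: 'k ring)" by (rule class_field)
  have neg: "(-1) \<odot>\<^bsub>M\<^esub> v \<in> carrier M" "v \<oplus>\<^bsub>M\<^esub> (-1) \<odot>\<^bsub>M\<^esub> v = \<zero>\<^bsub>M\<^esub>" if "v \<in> carrier M" for v
    using that by (auto intro!: x_eqI simp: zero_closed add_closed smult_closed x_zero x_add x_smult)
  then show "\<forall>v\<in>carrier M. \<exists>neg_v\<in>carrier M. v \<oplus>\<^bsub>M\<^esub> neg_v = \<zero>\<^bsub>M\<^esub>" by blast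
qed (auto intro!: x_eqI simp: zero_closed add_closed smult_closed x_zero x_add x_smult algebra_simps class_ring_simps)

end

lemma basis_coords_dim:
  assumes "basis_coords M b \<epsilon>"
  shows "vectorspace.dim class_ring M = card b"
proof -
  interpret coordinates M b \<epsilon> using assms by (simp add: basis_coords_def)
  interpret V: vectorspace class_ring M by (rule vectorspace)
  have b: "finite b" "b \<subseteq> carrier M" using assms finite_X by (auto simp: basis_coords_def)
  have lc: "\<epsilon> j (V.lincomb a A) = (\<Sum>v\<in>A. a v * \<epsilon> j v)" if "A \<subseteq> b" "j \<in> b" for a A j
  proof -
    have "finite A" using that b finite_subset by blast
    then show ?thesis using that
    proof induction
      case empty
      then show ?case by (simp add: V.lincomb_def x_zero)
    next
      case (insert v A)
      have c: "A \<subseteq> carrier M" "v \<in> carrier M" using insert.prems b by auto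
      have "V.lincomb a (insert v A) = a v \<odot>\<^bsub>M\<^esub> v \<oplus>\<^bsub>M\<^esub> V.lincomb a A"
        using V.lincomb_insert[OF insert(1) c(1) _ insert(2) c(2), of a] by (simp add: class_ring_simps)
      moreover have "V.lincomb a A \<in> carrier M" using c by (intro V.lincomb_closed) (auto simp: class_ring_simps)
      ultimately show ?case using insert c by (simp add: x_add x_smult smult_closed)
    qed
  qed
  have lcj: "\<epsilon> j (V.lincomb a b) = a j" if "j \<in> b" for a j
  proof -
    have "\<epsilon> j (V.lincomb a b) = (\<Sum>v\<in>b. if v = j then a v else 0)"
      unfolding lc[OF subset_refl that] using assms that
      by (intro sum.cong) (auto simp: basis_coords_def)
    then show ?thesis using that b by simp
  qed
  have lcC: "V.lincomb a b \<in> carrier M" for a using b by (intro V.lincomb_closed) (auto simp: class_ring_simps)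
  have "V.basis b"
    unfolding V.basis_criterion[OF b]
  proof (intro allI impI)
    fix v assume v: "v \<in> carrier M"
    show "\<exists>!a. a \<in> b \<rightarrow>\<^sub>E carrier class_ring \<and> V.lincomb a b = v"
    proof (rule ex1I[of _ "\<lambda>j\<in>b. \<epsilon> j v"])
      show "(\<lambda>j\<in>b. \<epsilon> j v) \<in> b \<rightarrow>\<^sub>E carrier class_ring \<and> V.lincomb (\<lambda>j\<in>b. \<epsilon> j v) b = v"
        using lcj lcC v by (auto simp: class_ring_simps intro!: x_eqI)
      fix a assume a: "a \<in> b \<rightarrow>\<^sub>E carrier class_ring \<and> V.lincomb a b = v"
      show "a = (\<lambda>j\<in>b. \<epsilon> j v)"
        by (rule extensionalityI[of _ b]) (use a lcj in \<open>auto simp: PiE_def\<close>)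
    qed
  qed
  then show ?thesis by (rule V.dim_basis[OF b(1)])
qed

lemma vectorspace_coordinates:
  fixes U :: "('k::field_char_0, 'v) module"
  assumes "vectorspace class_ring U" "vectorspace.fin_dim class_ring U"
  shows "\<exists>X x. coordinates U (X :: 'v set) x"
proof -
  interpret V: vectorspace class_ring U by (rule assms)
  obtain b where b: "finite b" "V.basis b" using V.finite_basis_exists assms by blast
  then have bc: "b \<subseteq> carrier U" by (simp add: V.basis_def)
  have crit: "\<exists>!a. a \<in> b \<rightarrow>\<^sub>E UNIV \<and> V.lincomb a b = v" if "v \<in> carrier U" for v
    using V.basis_criterion[OF b(1) bc] b(2) that by (simp add: class_ring_simps)
  have lc_restrict: "V.lincomb (restrict a b) b = V.lincomb a b" for a
    using bc by (intro V.lincomb_cong) (auto simp: class_ring_simps)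
  define co where "co v = (THE a. a \<in> b \<rightarrow>\<^sub>E UNIV \<and> V.lincomb a b = v)" for v
  have co: "co v \<in> b \<rightarrow>\<^sub>E UNIV" "V.lincomb (co v) b = v" if "v \<in> carrier U" for v
    using theI'[OF crit[OF that]] by (simp_all add: co_def)
  have co_eq: "co (V.lincomb a b) = restrict a b" for a
  proof -
    have c: "V.lincomb a b \<in> carrier U" using bc by (intro V.lincomb_closed) (auto simp: class_ring_simps)
    show ?thesis unfolding co_def
      by (rule the1_equality[OF crit[OF c]]) (auto simp: lc_restrict)
  qed
  have "coordinates U b (\<lambda>j v. co v j)"
  proof (rule coordinates.intro)
    fix j p q assume j: "j \<in> b" and p: "p \<in> carrier U" and q: "q \<in> carrier U"
    have "p \<oplus>\<^bsub>U\<^esub> q = V.lincomb (\<lambda>v. co p v + co q v) b"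
      using V.lincomb_sum[OF b(1) bc, of "co p" "co q"] co p q by (simp add: class_ring_simps)
    then show "co (p \<oplus>\<^bsub>U\<^esub> q) j = co p j + co q j" using j by (simp add: co_eq)
  next
    fix j p c assume j: "j \<in> b" and p: "p \<in> carrier U"
    have "c \<odot>\<^bsub>U\<^esub> p = V.lincomb (\<lambda>v. c * co p v) b"
      using V.lincomb_smult[OF bc, of "co p" c] co p by (simp add: class_ring_simps)
    then show "co (c \<odot>\<^bsub>U\<^esub> p) j = c * co p j" using j by (simp add: co_eq)
  next
    fix j assume j: "j \<in> b"
    have "\<zero>\<^bsub>U\<^esub> = V.lincomb (\<lambda>v. 0) b"
      using V.lincomb_smult[OF bc, of "\<lambda>v. 0" 0] V.lmult_0 V.lincomb_closed[OF bc, of "\<lambda>v. 0"]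
      by (simp add: class_ring_simps)
    then show "co \<zero>\<^bsub>U\<^esub> j = 0" using j by (simp add: co_eq)
  next
    fix p q assume p: "p \<in> carrier U" and q: "q \<in> carrier U" and eq: "\<And>j. j \<in> b \<Longrightarrow> co p j = co q j"
    have "co p = co q" using co p q eq by (intro extensionalityI[of _ b]) (auto simp: PiE_def)
    then show "p = q" using co p q by metis
  next
    fix f
    have "V.lincomb f b \<in> carrier U" using bc by (intro V.lincomb_closed) (auto simp: class_ring_simps)
    then show "\<exists>p\<in>carrier U. \<forall>j\<in>b. co p j = f j" by (intro bexI[of _ "V.lincomb f b"]) (auto simp: co_eq)
  qed (use b in \<open>auto simp: class_ring_simps\<close>)
  then show ?thesis by blast
qed

subsection \<open>Rank as factorization\<close>

text \<open>Rank as a factorization through a space of dimension \<open>k\<close>. In this form the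
  bound passes to submatrices and products by rewriting sums, and for \<open>k = 0\<close> it says
  that the matrix vanishes.\<close>

definition rk_le :: "('b \<Rightarrow> 'a \<Rightarrow> 'k::field) \<Rightarrow> 'b set \<Rightarrow> 'a set \<Rightarrow> nat \<Rightarrow> bool" where
  "rk_le A R C k \<longleftrightarrow> (\<exists>u w. \<forall>b\<in>R. \<forall>a\<in>C. A b a = (\<Sum>t<k. u b t * w t a))"

text \<open>The index set of the factorization is enumerated and padded with zeros up to
  \<open>k\<close>.\<close>

lemma rk_le_card:
  assumes "finite T" "card T \<le> k" "\<And>b a. b \<in> R \<Longrightarrow> a \<in> C \<Longrightarrow> A b a = (\<Sum>t\<in>T. u b t * w t a)"
  shows "rk_le A R C k"
proof -
  obtain h where h: "bij_betw h {..<card T} T" using ex_bij_betw_nat_finite[OF assms(1)] by (auto simp: atLeast0LessThan)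
  have "A b a = (\<Sum>t<k. (if t < card T then u b (h t) else 0) * w (h t) a)" if "b \<in> R" "a \<in> C" for b a
  proof -
    have "A b a = (\<Sum>t<card T. u b (h t) * w (h t) a)"
      using assms(3)[OF that] sum.reindex_bij_betw[OF h, of "\<lambda>t. u b t * w t a"] by simp
    also have "\<dots> = (\<Sum>t<k. (if t < card T then u b (h t) else 0) * w (h t) a)"
      using assms(2) by (intro sum.mono_neutral_cong_left) auto
    finally show ?thesis .
  qed
  then show ?thesis unfolding rk_le_def
    by (intro exI[of _ "\<lambda>b t. if t < card T then u b (h t) else 0"] exI[of _ "\<lambda>t a. w (h t) a"]) blast
qed

lemma lin_hom_iff:
  "f \<in> lin_hom U W \<longleftrightarrow> f \<in> extensional (carrier U) \<and> (\<forall>u\<in>carrier U. f u \<in> carrier W) \<and>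
     (\<forall>u\<in>carrier U. \<forall>v\<in>carrier U. f (u \<oplus>\<^bsub>U\<^esub> v) = f u \<oplus>\<^bsub>W\<^esub> f v) \<and>
     (\<forall>c. \<forall>u\<in>carrier U. f (c \<odot>\<^bsub>U\<^esub> u) = c \<odot>\<^bsub>W\<^esub> f u)"
  by (auto simp: lin_hom_def LinearCombinations.module_hom_def class_ring_simps)

lemma lin_hom_zero:
  assumes "coordinates U X x" "coordinates W Z y" "f \<in> lin_hom U W"
  shows "f \<zero>\<^bsub>U\<^esub> = \<zero>\<^bsub>W\<^esub>"
proof -
  interpret U: coordinates U X x by fact
  interpret W: coordinates W Z y by fact
  have "f \<zero>\<^bsub>U\<^esub> = f (0 \<odot>\<^bsub>U\<^esub> \<zero>\<^bsub>U\<^esub>)" using U.smult_zero[OF U.zero_closed] by simp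
  also have "\<dots> = \<zero>\<^bsub>W\<^esub>" using assms(3) U.zero_closed W.smult_zero by (simp add: lin_hom_iff)
  finally show ?thesis .
qed

lemma lin_sub_image:
  assumes "coordinates U X x" "coordinates W Z y" "f \<in> lin_hom U W"
  shows "lin_sub W (f ` carrier U)"
proof -
  interpret U: coordinates U X x by fact
  show ?thesis using assms(3) lin_hom_zero[OF assms] U.zero_closed U.add_closed U.smult_closed
    unfolding lin_sub_def lin_hom_iff by (auto 0 4 simp: image_iff) metis+
qed

lemma lin_hom_expand:
  assumes "coordinates U X x" "coordinates W Z y" "f \<in> lin_hom U W" "u \<in> carrier U" "b \<in> Z"
  shows "y b (f u) = (\<Sum>a\<in>X. x a u * y b (f (coordinates.unit_pt U X x a)))"
proof -
  interpret U: coordinates U X x by fact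
  interpret W: coordinates W Z y by fact
  show ?thesis
    by (rule U.linear_expand[of "\<lambda>u. y b (f u)"]) (use assms in \<open>auto simp: lin_hom_iff W.x_add W.x_smult\<close>)
qed

text \<open>A basis of the image gives a factorization of its size. Conversely a factorization puts
  the image into the span of \<open>k\<close> vectors, which bounds the size of an independent set
  in it.\<close>

lemma lin_rank_le_iff:
  assumes U: "coordinates U X x" and W: "coordinates W Z y" and f: "f \<in> lin_hom U W"
  shows "lin_rank U W f \<le> k \<longleftrightarrow> rk_le (\<lambda>b a. y b (f (coordinates.unit_pt U X x a))) Z X k"
proof -
  interpret U: coordinates U X x by fact
  interpret W: coordinates W Z y by fact
  define S where "S = f ` carrier U"
  have S: "lin_sub W S" unfolding S_def by (rule lin_sub_image[OF assms])
  obtain b \<epsilon> where b: "basis_coords (W\<lparr>carrier := S\<rparr>) b \<epsilon>"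
    using W.subspace_basis[OF S _ basis_coords_empty[OF W]] S by (auto simp: lin_sub_def)
  have rank: "lin_rank U W f = card b"
    unfolding lin_rank_def S_def[symmetric] by (rule basis_coords_dim[OF b])
  have SW: "S \<subseteq> carrier W" and bS: "b \<subseteq> S" using S b by (auto simp: lin_sub_def basis_coords_def)
  have finb: "finite b" using b by (auto simp: basis_coords_def coordinates_def)
  show ?thesis
  proof
    assume "lin_rank U W f \<le> k"
    then have k: "card b \<le> k" using rank by simp
    show "rk_le (\<lambda>b a. y b (f (U.unit_pt a))) Z X k"
    proof (rule rk_le_card[OF finb k])
      fix c a assume "c \<in> Z" "a \<in> X"
      have fS: "f (U.unit_pt a) \<in> S" using U.unit_pt by (simp add: S_def)
      have "y c (f (U.unit_pt a)) = (\<Sum>v\<in>b. \<epsilon> v (f (U.unit_pt a)) * y c v)"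
        by (rule basis_coords_expand[OF b]) (use fS SW \<open>c \<in> Z\<close> in \<open>auto simp: W.x_add W.x_smult subset_iff\<close>)
      then show "y c (f (U.unit_pt a)) = (\<Sum>v\<in>b. y c v * \<epsilon> v (f (U.unit_pt a)))"
        by (simp add: mult.commute)
    qed
  next
    assume "rk_le (\<lambda>b a. y b (f (U.unit_pt a))) Z X k"
    then obtain u w where uw: "\<And>b a. b \<in> Z \<Longrightarrow> a \<in> X \<Longrightarrow> y b (f (U.unit_pt a)) = (\<Sum>t<k. u b t * w t a)"
      unfolding rk_le_def by blast
    define ut where "ut t = (\<lambda>b. if b \<in> Z then u b t else 0)" for t
    have "W.vec v \<in> fs.span (ut ` {..<k})" if vS: "v \<in> S" for v
    proof -
      obtain p where p: "p \<in> carrier U" "v = f p" using vS by (auto simp: S_def)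
      have "W.vec v = (\<Sum>t<k. (\<lambda>c. (\<Sum>a\<in>X. x a p * w t a) * ut t c))"
      proof
        fix c
        have "y c (f p) = (\<Sum>t<k. (\<Sum>a\<in>X. x a p * w t a) * u c t)" if "c \<in> Z"
        proof -
          have "y c (f p) = (\<Sum>a\<in>X. \<Sum>t<k. x a p * w t a * u c t)"
            unfolding lin_hom_expand[OF U W f p(1) that]
            by (intro sum.cong) (simp_all add: uw[OF that] sum_distrib_left algebra_simps)
          also have "\<dots> = (\<Sum>t<k. (\<Sum>a\<in>X. x a p * w t a) * u c t)"
            by (subst sum.swap) (simp add: sum_distrib_right)
          finally show ?thesis .
        qed
        then show "W.vec v c = (\<Sum>t<k. (\<lambda>c. (\<Sum>a\<in>X. x a p * w t a) * ut t c)) c"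
          by (simp add: W.vec_def p(2) sum_fun_apply ut_def)
      qed
      also have "\<dots> \<in> fs.span (ut ` {..<k})"
        by (intro fs.span_sum fs.span_scale fs.span_base) auto
      finally show ?thesis .
    qed
    then have "W.vec ` b \<subseteq> fs.span (ut ` {..<k})" using bS by blast
    with fs.independent_span_bound[OF _ W.vec_independent[OF SW b], of "ut ` {..<k}"]
    have "card (W.vec ` b) \<le> card (ut ` {..<k})" by blast
    also have "\<dots> \<le> k" using card_image_le[of "{..<k}" ut] by simp
    also have "card (W.vec ` b) = card b"
      using W.vec_inj bS SW by (intro card_image) (meson inj_on_subset subset_trans)
    finally show "lin_rank U W f \<le> k" using rank by simp
  qed
qed

text \<open>The factorization attaches to each column a vector \<open>wv a\<close> of length r. The
  inverse pivot block gives functionals \<open>\<phi> l\<close> that are dual to the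
  \<open>wv l\<close> and vanish on the vectors \<open>w' h\<close> of the eliminated columns. So
  the \<open>wv l\<close> are independent modulo the span of the \<open>w' h\<close>, whose
  dimension is therefore at most \<open>r - card L\<close>.\<close>

lemma rk_le_schur:
  fixes x :: "'b \<Rightarrow> 'a \<Rightarrow> 'k::field"
  assumes rk: "rk_le x R C r" and L: "finite L" "L \<subseteq> C" "d ` L \<subseteq> R" and H: "finite H" "H \<subseteq> C"
    and inv: "\<And>l l''. l \<in> L \<Longrightarrow> l'' \<in> L \<Longrightarrow> (\<Sum>l'\<in>L. ninv l l' * x (d l') l'') = of_bool (l = l'')"
    and y: "\<And>b h. b \<in> R \<Longrightarrow> h \<in> H \<Longrightarrow> y b h = x b h - (\<Sum>l\<in>L. x b l * lam l h)"
    and y0: "\<And>l h. l \<in> L \<Longrightarrow> h \<in> H \<Longrightarrow> y (d l) h = 0"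
  shows "card L \<le> r" "rk_le y R H (r - card L)"
proof -
  obtain u w where uw: "\<And>b a. b \<in> R \<Longrightarrow> a \<in> C \<Longrightarrow> x b a = (\<Sum>t<r. u b t * w t a)"
    using rk by (auto simp: rk_le_def)
  define wv where "wv a = (\<lambda>t. if t < r then w t a else 0)" for a
  define w' where "w' h = (\<lambda>t. wv h t - (\<Sum>l\<in>L. lam l h * wv l t))" for h
  define pair where "pair b v = (\<Sum>t<r. u b t * v t)" for b v
  define \<phi> where "\<phi> l v = (\<Sum>l'\<in>L. ninv l l' * pair (d l') v)" for l v
  have pair_add: "pair b (f + g) = pair b f + pair b g" for b f g
    by (simp add: pair_def sum.distrib algebra_simps)
  have pair_scale: "pair b (\<lambda>t. c * f t) = c * pair b f" for b c f
    by (simp add: pair_def sum_distrib_left algebra_simps)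
  have pair_sum: "pair b (\<Sum>i\<in>S. f i) = (\<Sum>i\<in>S. pair b (f i))" for b S and f :: "'i \<Rightarrow> nat \<Rightarrow> 'k"
    unfolding pair_def sum_fun_apply by (subst sum.swap) (simp add: sum_distrib_left)
  have pair_wv: "pair b (wv a) = x b a" if "b \<in> R" "a \<in> C" for a b
    using uw[OF that] by (simp add: pair_def wv_def)
  have pair_w': "pair b (w' h) = y b h" if "b \<in> R" "h \<in> H" for b h
  proof -
    have "pair b (w' h) = pair b (wv h) - (\<Sum>l\<in>L. lam l h * pair b (wv l))"
      by (simp add: pair_def w'_def right_diff_distrib sum_subtractf sum_distrib_left)
        (subst sum.swap, simp add: algebra_simps)
    then show ?thesis using that L H y[OF that] by (simp add: pair_wv subset_iff mult.commute)
  qed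
  have \<phi>_wv: "\<phi> l (wv l'') = of_bool (l = l'')" if "l \<in> L" "l'' \<in> L" for l l''
  proof -
    have "\<phi> l (wv l'') = (\<Sum>l'\<in>L. ninv l l' * x (d l') l'')"
      unfolding \<phi>_def using that L by (intro sum.cong) (auto simp: pair_wv subset_iff)
    then show ?thesis using inv[OF that] by simp
  qed
  have \<phi>_w': "\<phi> l (w' h) = 0" if "l \<in> L" "h \<in> H" for l h
    unfolding \<phi>_def using that L y0 by (intro sum.neutral) (auto simp: pair_w' subset_iff)
  \<comment> \<open>A basis of the span of the \<open>w' h\<close>; its size bounds the rank of
    \<open>y\<close>, which factors through it.\<close>
  obtain B where B: "B \<subseteq> w' ` H" "fs.independent B" "w' ` H \<subseteq> fs.span B"
    using fs.maximal_independent_subset[of "w' ` H"] by metis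
  have finB: "finite B" using B(1) H(1) finite_subset by blast
  have sub: "fs.subspace {v. \<phi> l v = 0}" for l
    by (auto simp: fs.subspace_def \<phi>_def pair_add pair_scale pair_def[of _ 0] sum.distrib distrib_left
        sum_distrib_left[symmetric] mult.left_commute[of _ _ "pair _ _"])
  \<comment> \<open>The \<open>wv l\<close> join \<open>B\<close> one at a time:
    \<open>\<phi> l\<close> vanishes on everything already present but takes the value 1 on
    \<open>wv l\<close>.\<close>
  have ind: "fs.independent (wv ` L' \<union> B) \<and> card (wv ` L' \<union> B) = card L' + card B" if "L' \<subseteq> L" for L'
  proof -
    have "finite L'" using that L finite_subset by blast
    then show ?thesis using that
    proof induction
      case empty
      then show ?case using B by simp
    next
      case (insert l L')
      have l: "l \<in> L" "l \<notin> L'" "L' \<subseteq> L" using insert by auto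
      have "\<phi> l (wv l') = 0" if "l' \<in> L'" for l' using \<phi>_wv[of l l'] that l by auto
      moreover have "\<phi> l v = 0" if "v \<in> B" for v
      proof -
        have "v \<in> w' ` H" using that B(1) by blast
        then show ?thesis using \<phi>_w'[OF l(1)] by blast
      qed
      ultimately have "wv ` L' \<union> B \<subseteq> {v. \<phi> l v = 0}" by blast
      then have "fs.span (wv ` L' \<union> B) \<subseteq> {v. \<phi> l v = 0}" by (rule fs.span_minimal[OF _ sub])
      moreover have "\<phi> l (wv l) = 1" using \<phi>_wv insert by simp
      ultimately have ns: "wv l \<notin> fs.span (wv ` L' \<union> B)" by auto
      then have "fs.independent (insert (wv l) (wv ` L' \<union> B))"
        using insert by (intro fs.independent_insertI) auto
      moreover have "wv l \<notin> wv ` L' \<union> B" using ns fs.span_base[of "wv l" "wv ` L' \<union> B"] by metis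
      moreover have "finite (wv ` L' \<union> B)" using insert finB by simp
      ultimately show ?case using insert by (simp add: card_insert_disjoint)
    qed
  qed
  \<comment> \<open>The standard basis of the vectors supported below r, which bounds the number of
    independent ones by r.\<close>
  define un where "un s = (\<lambda>t. of_bool (t = s) :: 'k)" for s :: nat
  have span_un: "v \<in> fs.span (un ` {..<r})" if "\<And>t. t \<ge> r \<Longrightarrow> v t = 0" for v
  proof -
    have "v = (\<Sum>s<r. (\<lambda>t. v s * un s t))"
    proof
      fix t
      have "v t = (\<Sum>s<r. if t = s then v s else 0)" using that[of t] by simp
      also have "\<dots> = (\<Sum>s<r. v s * un s t)" by (intro sum.cong) (auto simp: un_def)
      finally show "v t = (\<Sum>s<r. (\<lambda>t. v s * un s t)) t" by (simp add: sum_fun_apply)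
    qed
    also have "\<dots> \<in> fs.span (un ` {..<r})" by (intro fs.span_sum fs.span_scale fs.span_base) auto
    finally show ?thesis .
  qed
  have "wv ` L \<union> B \<subseteq> fs.span (un ` {..<r})"
    using B(1) by (auto intro!: span_un simp: wv_def w'_def)
  with fs.independent_span_bound[of "un ` {..<r}" "wv ` L \<union> B"] ind[OF subset_refl]
  have "card L + card B \<le> card (un ` {..<r})" by simp
  also have "\<dots> \<le> r" using card_image_le[of "{..<r}" un] by simp
  finally have le: "card L + card B \<le> r" .
  then show "card L \<le> r" by simp
  show "rk_le y R H (r - card L)"
  proof (rule rk_le_card[OF finB])
    show "card B \<le> r - card L" using le by simp
    fix b h assume bh: "b \<in> R" "h \<in> H"
    have "w' h = (\<Sum>v\<in>B. (\<lambda>t. fs.representation B (w' h) v * v t))"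
      using fs.sum_representation_eq[OF B(2) _ finB subset_refl, of "w' h"] B(3) bh by auto
    then have "pair b (w' h) = pair b (\<Sum>v\<in>B. (\<lambda>t. fs.representation B (w' h) v * v t))" by simp
    also have "\<dots> = (\<Sum>v\<in>B. pair b v * fs.representation B (w' h) v)"
      unfolding pair_sum pair_scale by (rule sum.cong) (simp_all add: mult.commute)
    finally show "y b h = (\<Sum>v\<in>B. pair b v * fs.representation B (w' h) v)"
      using pair_w'[OF bh] by simp
  qed
qed

lemma rk_le_mono: "rk_le A R C k \<Longrightarrow> R' \<subseteq> R \<Longrightarrow> C' \<subseteq> C \<Longrightarrow> rk_le A R' C' k"
  unfolding rk_le_def by (meson subsetD)

lemma rk_le_cong: "(\<And>b a. b \<in> R \<Longrightarrow> a \<in> C \<Longrightarrow> A b a = A' b a) \<Longrightarrow> rk_le A R C k = rk_le A' R C k"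
  by (simp add: rk_le_def)

lemma rk_le_zero: "rk_le A R C 0 \<longleftrightarrow> (\<forall>b\<in>R. \<forall>a\<in>C. A b a = 0)"
  by (simp add: rk_le_def)

lemma rk_le_smult:
  assumes "rk_le A R C k" shows "rk_le (\<lambda>b a. c * A b a) R C k"
proof -
  obtain u w where uw: "\<forall>b\<in>R. \<forall>a\<in>C. A b a = (\<Sum>t<k. u b t * w t a)" using assms unfolding rk_le_def by blast
  then show ?thesis unfolding rk_le_def
    by (intro exI[of _ "\<lambda>b t. c * u b t"] exI[of _ w]) (simp add: sum_distrib_left mult.assoc)
qed

lemma rk_le_mult:
  assumes "finite R" "finite C" "rk_le A R C k"
  shows "rk_le (\<lambda>b a. \<Sum>b'\<in>R. \<Sum>a'\<in>C. P b b' * A b' a' * Q a' a) R' C' k"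
proof -
  obtain u w where uw: "\<And>b a. b \<in> R \<Longrightarrow> a \<in> C \<Longrightarrow> A b a = (\<Sum>t<k. u b t * w t a)"
    using assms(3) unfolding rk_le_def by blast
  have "(\<Sum>b'\<in>R. \<Sum>a'\<in>C. P b b' * A b' a' * Q a' a) = (\<Sum>t<k. (\<Sum>b'\<in>R. P b b' * u b' t) * (\<Sum>a'\<in>C. w t a' * Q a' a))" for a b
  proof -
    have "(\<Sum>b'\<in>R. \<Sum>a'\<in>C. P b b' * A b' a' * Q a' a) = (\<Sum>b'\<in>R. \<Sum>a'\<in>C. \<Sum>t<k. P b b' * u b' t * (w t a' * Q a' a))"
      by (intro sum.cong refl) (simp add: uw sum_distrib_left sum_distrib_right mult.assoc)
    also have "\<dots> = (\<Sum>b'\<in>R. \<Sum>t<k. \<Sum>a'\<in>C. P b b' * u b' t * (w t a' * Q a' a))"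
      by (intro sum.cong refl sum.swap)
    also have "\<dots> = (\<Sum>t<k. \<Sum>b'\<in>R. \<Sum>a'\<in>C. P b b' * u b' t * (w t a' * Q a' a))"
      by (rule sum.swap)
    finally show ?thesis by (simp add: sum_product)
  qed
  then show ?thesis unfolding rk_le_def
    by (intro exI[of _ "\<lambda>b t. \<Sum>b'\<in>R. P b b' * u b' t"] exI[of _ "\<lambda>t a. \<Sum>a'\<in>C. w t a' * Q a' a"]) simp
qed

subsection \<open>Inverse matrices of regular functions\<close>

definition enum_of :: "'i set \<Rightarrow> nat \<Rightarrow> 'i" where
  "enum_of X = (SOME h. bij_betw h {0..<card X} X)"

definition mat_of :: "'i set \<Rightarrow> ('i \<Rightarrow> 'i \<Rightarrow> 'k::field) \<Rightarrow> 'k mat" where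
  "mat_of X A = mat (card X) (card X) (\<lambda>(i, j). A (enum_of X i) (enum_of X j))"

definition mdet :: "'i set \<Rightarrow> ('i \<Rightarrow> 'i \<Rightarrow> 'k::field) \<Rightarrow> 'k" where
  "mdet X A = det (mat_of X A)"

text \<open>Adjugate times inverse determinant, so that regularity of the entries can be read off.
  The enumeration transports the index set to an initial segment of the naturals.\<close>

definition minv :: "'i set \<Rightarrow> ('i \<Rightarrow> 'i \<Rightarrow> 'k::field) \<Rightarrow> 'i \<Rightarrow> 'i \<Rightarrow> 'k" where
  "minv X A a b = adj_mat (mat_of X A) $$
     (the_inv_into {0..<card X} (enum_of X) a, the_inv_into {0..<card X} (enum_of X) b) * inverse (mdet X A)"

lemma enum_of: "finite X \<Longrightarrow> bij_betw (enum_of X) {0..<card X} X"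
  unfolding enum_of_def by (rule someI_ex[OF ex_bij_betw_nat_finite])

lemma minv:
  assumes X: "finite X" and d: "mdet X A \<noteq> 0" and ab: "a \<in> X" "b \<in> X"
  shows "(\<Sum>c\<in>X. A a c * minv X A c b) = of_bool (a = b)" "(\<Sum>c\<in>X. minv X A a c * A c b) = of_bool (a = b)"
proof -
  let ?n = "card X" and ?e = "enum_of X"
  let ?i = "the_inv_into {0..<?n} ?e"
  have e: "bij_betw ?e {0..<?n} X" by (rule enum_of[OF X])
  have inj: "inj_on ?e {0..<?n}" using e by (simp add: bij_betw_def)
  have M: "mat_of X A \<in> carrier_mat ?n ?n" by (simp add: mat_of_def)
  note adj = adj_mat[OF M]
  have i: "?i a < ?n" "?i b < ?n" "?e (?i a) = a" "?e (?i b) = b"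
    using the_inv_into_into[OF inj _ subset_refl] f_the_inv_into_f[OF inj] e ab by (auto simp: bij_betw_def)
  have ie: "?i (?e j) = j" if "j < ?n" for j using the_inv_into_f_f[OF inj, of j] that by simp
  have iab: "?i a = ?i b \<longleftrightarrow> a = b" using i by metis
  have "(\<Sum>c\<in>X. A a c * minv X A c b) = (\<Sum>j\<in>{0..<?n}. A a (?e j) * minv X A (?e j) b)"
    by (rule sum.reindex_bij_betw[OF e, symmetric])
  also have "\<dots> = (\<Sum>j\<in>{0..<?n}. mat_of X A $$ (?i a, j) * adj_mat (mat_of X A) $$ (j, ?i b)) * inverse (mdet X A)"
    unfolding sum_distrib_right by (intro sum.cong refl) (use i ie in \<open>simp add: minv_def mat_of_def\<close>)
  also have "\<dots> = (mat_of X A * adj_mat (mat_of X A)) $$ (?i a, ?i b) * inverse (mdet X A)"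
    using M adj(1) i by (simp add: scalar_prod_def)
  also have "\<dots> = of_bool (a = b)" using i d iab unfolding adj(2) by (simp add: mdet_def)
  finally show "(\<Sum>c\<in>X. A a c * minv X A c b) = of_bool (a = b)" .
  have "(\<Sum>c\<in>X. minv X A a c * A c b) = (\<Sum>j\<in>{0..<?n}. minv X A a (?e j) * A (?e j) b)"
    by (rule sum.reindex_bij_betw[OF e, symmetric])
  also have "\<dots> = (\<Sum>j\<in>{0..<?n}. adj_mat (mat_of X A) $$ (?i a, j) * mat_of X A $$ (j, ?i b)) * inverse (mdet X A)"
    unfolding sum_distrib_right by (intro sum.cong refl) (use i ie in \<open>simp add: minv_def mat_of_def\<close>)
  also have "\<dots> = (adj_mat (mat_of X A) * mat_of X A) $$ (?i a, ?i b) * inverse (mdet X A)"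
    using M adj(1) i by (simp add: scalar_prod_def)
  also have "\<dots> = of_bool (a = b)" using i d iab unfolding adj(3) by (simp add: mdet_def)
  finally show "(\<Sum>c\<in>X. minv X A a c * A c b) = of_bool (a = b)" .
qed

lemma mdet_id:
  assumes X: "finite X" and id: "\<And>a b. a \<in> X \<Longrightarrow> b \<in> X \<Longrightarrow> A a b = of_bool (a = b)"
  shows "mdet X A = 1"
proof -
  have e: "bij_betw (enum_of X) {0..<card X} X" by (rule enum_of[OF X])
  have "mat_of X A = 1\<^sub>m (card X)"
  proof (rule eq_matI)
    fix i j assume "i < dim_row (1\<^sub>m (card X) :: 'b mat)" "j < dim_col (1\<^sub>m (card X) :: 'b mat)"
    then have ij: "i < card X" "j < card X" by auto
    have "enum_of X i = enum_of X j \<longleftrightarrow> i = j"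
      using e ij by (auto simp: bij_betw_def dest: inj_onD)
    then show "mat_of X A $$ (i, j) = 1\<^sub>m (card X) $$ (i, j)"
      using ij e by (auto simp: mat_of_def id bij_betw_apply)
  qed (auto simp: mat_of_def)
  then show ?thesis by (simp add: mdet_def)
qed

lemma minv_id:
  assumes X: "finite X" and id: "\<And>a b. a \<in> X \<Longrightarrow> b \<in> X \<Longrightarrow> A a b = of_bool (a = b)" and ab: "a \<in> X" "b \<in> X"
  shows "minv X A a b = of_bool (a = b)"
proof -
  have "of_bool (a = b) = (\<Sum>c\<in>X. A a c * minv X A c b)"
    using minv(1)[OF X _ ab, of A] mdet_id[OF X id] by simp
  also have "\<dots> = (\<Sum>c\<in>X. if c = a then minv X A c b else 0)"
    using id ab by (intro sum.cong) auto
  finally show ?thesis using X ab by simp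
qed

context local_point
begin

text \<open>By the Leibniz formula the determinant is a sum of products of entries.\<close>

lemma Reg_det:
  assumes "\<And>i j. i < n \<Longrightarrow> j < n \<Longrightarrow> F i j \<in> Reg"
  shows "(\<lambda>p. det (mat n n (\<lambda>(i, j). F i j p))) \<in> Reg"
proof -
  have "(\<lambda>p. \<Sum>\<pi>\<in>{\<pi>. \<pi> permutes {0..<n}}. signof \<pi> * (\<Prod>i\<in>{0..<n}. F i (\<pi> i) p)) \<in> Reg"
  proof (rule Reg_sum, rule Reg_mult[OF Reg_const], rule Reg_prod)
    fix \<pi> i assume "\<pi> \<in> {\<pi>. \<pi> permutes {0..<n}}" "i \<in> {0..<n}"
    then show "F i (\<pi> i) \<in> Reg" using assms[of i "\<pi> i"] permutes_in_image[of \<pi> "{0..<n}" i] by auto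
  qed
  moreover have "det (mat n n (\<lambda>(i, j). F i j p)) = (\<Sum>\<pi>\<in>{\<pi>. \<pi> permutes {0..<n}}. signof \<pi> * (\<Prod>i\<in>{0..<n}. F i (\<pi> i) p))" for p
  proof -
    have "mat n n (\<lambda>(i, j). F i j p) $$ (i, \<pi> i) = F i (\<pi> i) p" if "\<pi> permutes {0..<n}" "i < n" for i \<pi>
      using permutes_in_image[OF that(1), of i] that by simp
    then show ?thesis by (simp add: det_def)
  qed
  ultimately show ?thesis by simp
qed

lemma Reg_mdet:
  assumes "finite X0" "\<And>a b. a \<in> X0 \<Longrightarrow> b \<in> X0 \<Longrightarrow> (\<lambda>p. F p a b) \<in> Reg"
  shows "(\<lambda>p. mdet X0 (F p)) \<in> Reg"
proof -
  have "(\<lambda>p. F p (enum_of X0 i) (enum_of X0 j)) \<in> Reg" if "i < card X0" "j < card X0" for i j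
    using assms(2) bij_betw_apply[OF enum_of[OF assms(1)]] that by auto
  from Reg_det[OF this, of "card X0"] show ?thesis by (simp add: mdet_def mat_of_def)
qed

lemma Reg_minv:
  assumes X0: "finite X0" and F: "\<And>a b. a \<in> X0 \<Longrightarrow> b \<in> X0 \<Longrightarrow> (\<lambda>p. F p a b) \<in> Reg"
    and nz: "mdet X0 (F p0) \<noteq> 0" and ab: "a \<in> X0" "b \<in> X0"
  shows "(\<lambda>p. minv X0 (F p) a b) \<in> Reg"
proof -
  let ?n = "card X0" and ?e = "enum_of X0"
  let ?i = "the_inv_into {0..<?n} ?e"
  have e: "bij_betw ?e {0..<?n} X0" by (rule enum_of[OF X0])
  have inj: "inj_on ?e {0..<?n}" using e by (simp add: bij_betw_def)
  have i: "?i a < ?n" "?i b < ?n"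
    using the_inv_into_into[OF inj _ subset_refl] e ab by (auto simp: bij_betw_def)
  have R: "(\<lambda>p. F p (?e i) (?e j)) \<in> Reg" if "i < ?n" "j < ?n" for i j
    using F bij_betw_apply[OF e] that by auto
  \<comment> \<open>The adjugate transposes the cofactors, so row \<open>?i b\<close> and column
    \<open>?i a\<close> are deleted; \<open>insert_index\<close> lists the remaining
    positions.\<close>
  let ?ii = "insert_index (?i b)" and ?jj = "insert_index (?i a)"
  have ins: "insert_index k j < ?n" if "j < ?n - 1" for k j using that by (auto simp: insert_index_def)
  have "(\<lambda>p. det (mat (?n - 1) (?n - 1) (\<lambda>(i, j). F p (?e (?ii i)) (?e (?jj j))))) \<in> Reg"
    by (rule Reg_det) (use R ins in auto)
  moreover have "adj_mat (mat_of X0 (F p)) $$ (?i a, ?i b)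
    = (-1) ^ (?i b + ?i a) * det (mat (?n - 1) (?n - 1) (\<lambda>(i, j). F p (?e (?ii i)) (?e (?jj j))))" for p
  proof -
    have "mat_delete (mat_of X0 (F p)) (?i b) (?i a) = mat (?n - 1) (?n - 1) (\<lambda>(i, j). F p (?e (?ii i)) (?e (?jj j)))"
      by (rule eq_matI) (use ins in \<open>auto simp: mat_delete_def mat_of_def insert_index_def\<close>)
    then show ?thesis using i by (simp add: adj_mat_def cofactor_def mat_of_def)
  qed
  ultimately have "(\<lambda>p. adj_mat (mat_of X0 (F p)) $$ (?i a, ?i b)) \<in> Reg"
    using Reg_mult[OF Reg_const] by simp
  from Reg_mult[OF this Reg_inverse[OF Reg_mdet[OF X0 F]]] show ?thesis
    using nz by (simp add: minv_def)
qed

end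

section \<open>Coordinates on the space of graded maps\<close>

lemma lin_homI:
  "f \<in> extensional (carrier U) \<Longrightarrow> (\<And>u. u \<in> carrier U \<Longrightarrow> f u \<in> carrier W) \<Longrightarrow>
   (\<And>u v. u \<in> carrier U \<Longrightarrow> v \<in> carrier U \<Longrightarrow> f (u \<oplus>\<^bsub>U\<^esub> v) = f u \<oplus>\<^bsub>W\<^esub> f v) \<Longrightarrow>
   (\<And>c u. u \<in> carrier U \<Longrightarrow> f (c \<odot>\<^bsub>U\<^esub> u) = c \<odot>\<^bsub>W\<^esub> f u) \<Longrightarrow> f \<in> lin_hom U W"
  by (simp add: lin_hom_iff)

lemma lin_hom_apply:
  assumes "f \<in> lin_hom U W"
  shows "u \<in> carrier U \<Longrightarrow> f u \<in> carrier W"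
    and "u \<in> carrier U \<Longrightarrow> v \<in> carrier U \<Longrightarrow> f (u \<oplus>\<^bsub>U\<^esub> v) = f u \<oplus>\<^bsub>W\<^esub> f v"
    and "u \<in> carrier U \<Longrightarrow> f (c \<odot>\<^bsub>U\<^esub> u) = c \<odot>\<^bsub>W\<^esub> f u"
  using assms by (simp_all add: lin_hom_iff)

lemma lin_hom_matrix:
  fixes F :: "'b \<Rightarrow> 'a \<Rightarrow> 'k::field_char_0"
  assumes U: "coordinates U X x" and W: "coordinates W Z y"
  defines "f \<equiv> \<lambda>u\<in>carrier U. coordinates.pt W Z y (\<lambda>b. \<Sum>a\<in>X. F b a * x a u)"
  shows "f \<in> lin_hom U W" "u \<in> carrier U \<Longrightarrow> b \<in> Z \<Longrightarrow> y b (f u) = (\<Sum>a\<in>X. F b a * x a u)"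
proof -
  interpret U: coordinates U X x by fact
  interpret W: coordinates W Z y by fact
  show *: "y b (f u) = (\<Sum>a\<in>X. F b a * x a u)" if "u \<in> carrier U" "b \<in> Z" for u b
    using that by (simp add: f_def W.pt)
  have c: "f u \<in> carrier W" if "u \<in> carrier U" for u using that W.pt by (simp add: f_def)
  show "f \<in> lin_hom U W"
  proof (rule lin_homI)
    show "f (u \<oplus>\<^bsub>U\<^esub> v) = f u \<oplus>\<^bsub>W\<^esub> f v" if "u \<in> carrier U" "v \<in> carrier U" for u v
      using that by (intro W.x_eqI)
        (auto simp: c U.add_closed W.add_closed W.x_add * U.x_add sum.distrib algebra_simps)
    show "f (k \<odot>\<^bsub>U\<^esub> u) = k \<odot>\<^bsub>W\<^esub> f u" if "u \<in> carrier U" for u k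
      using that by (intro W.x_eqI)
        (auto simp: c U.smult_closed W.smult_closed W.x_smult * U.x_smult sum_distrib_left algebra_simps)
  qed (use c in \<open>auto simp: f_def\<close>)
qed

locale graded_coords =
  fixes m :: nat and V :: "nat \<Rightarrow> ('k::field_char_0, 'v) module"
    and T :: "nat \<Rightarrow> 'b set" and \<epsilon> :: "nat \<Rightarrow> 'b \<Rightarrow> 'v \<Rightarrow> 'k"
  assumes C: "i \<le> m \<Longrightarrow> coordinates (V i) (T i) (\<epsilon> i)"
begin

abbreviation "M \<equiv> hom_gr1 m V"
abbreviation "un i \<equiv> coordinates.unit_pt (V i) (T i) (\<epsilon> i)"

definition idx :: "(nat \<times> 'b \<times> 'b) set" where
  "idx = {(i, b, a). i < m \<and> b \<in> T (Suc i) \<and> a \<in> T i}"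

definition ent :: "nat \<times> 'b \<times> 'b \<Rightarrow> (nat \<Rightarrow> 'v \<Rightarrow> 'v) \<Rightarrow> 'k" where
  "ent = (\<lambda>(i, b, a) f. \<epsilon> (Suc i) b (f i (un i a)))"

lemma idx_iff: "(i, b, a) \<in> idx \<longleftrightarrow> i < m \<and> b \<in> T (Suc i) \<and> a \<in> T i"
  by (simp add: idx_def)

lemma finite_T: "i \<le> m \<Longrightarrow> finite (T i)" using C coordinates.finite_X by blast

lemma finite_idx: "finite idx"
proof -
  have "idx = (SIGMA i:{..<m}. T (Suc i) \<times> T i)" by (auto simp: idx_def)
  then show ?thesis using finite_T by auto
qed

lemma un: "i \<le> m \<Longrightarrow> un i a \<in> carrier (V i)" "i \<le> m \<Longrightarrow> b \<in> T i \<Longrightarrow> \<epsilon> i b (un i a) = of_bool (b = a)"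
  using coordinates.unit_pt[OF C] by blast+

lemma M_carrier_iff:
  "f \<in> carrier M \<longleftrightarrow> f \<in> extensional {..<m} \<and> (\<forall>i<m. f i \<in> lin_hom (V i) (V (Suc i)))"
  by (auto simp: hom_gr1_def PiE_def)

lemma M_lin: "f \<in> carrier M \<Longrightarrow> i < m \<Longrightarrow> f i \<in> lin_hom (V i) (V (Suc i))"
  by (simp add: M_carrier_iff)

lemma M_apply_closed: "f \<in> carrier M \<Longrightarrow> i < m \<Longrightarrow> u \<in> carrier (V i) \<Longrightarrow> f i u \<in> carrier (V (Suc i))"
  using lin_hom_apply(1)[OF M_lin] .

lemma comp:
  assumes "f \<in> carrier M" "i < m" "u \<in> carrier (V i)" "b \<in> T (Suc i)"
  shows "\<epsilon> (Suc i) b (f i u) = (\<Sum>a\<in>T i. \<epsilon> i a u * ent (i, b, a) f)"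
  using lin_hom_expand[OF C C M_lin[OF assms(1,2)] assms(3,4)] assms(2) by (simp add: ent_def)

text \<open>Each identity between values is verified on coordinates of the target; a graded map is
  determined by its matrix, and every matrix occurs.\<close>

lemma hom_coords: "coordinates M idx ent"
proof (rule coordinates.intro)
  show "finite idx" by (rule finite_idx)
  have lin_ext: "f \<in> carrier M" if "f \<in> extensional {..<m}" "\<And>i. i < m \<Longrightarrow> f i \<in> lin_hom (V i) (V (Suc i))" for f
    using that by (simp add: M_carrier_iff)
  show "\<zero>\<^bsub>M\<^esub> \<in> carrier M"
  proof (rule lin_ext)
    fix i assume i: "i < m"
    interpret U: coordinates "V i" "T i" "\<epsilon> i" using C i by simp
    interpret W: coordinates "V (Suc i)" "T (Suc i)" "\<epsilon> (Suc i)" using C i by simp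
    have "\<zero>\<^bsub>V (Suc i)\<^esub> \<oplus>\<^bsub>V (Suc i)\<^esub> \<zero>\<^bsub>V (Suc i)\<^esub> = \<zero>\<^bsub>V (Suc i)\<^esub>"
      "c \<odot>\<^bsub>V (Suc i)\<^esub> \<zero>\<^bsub>V (Suc i)\<^esub> = \<zero>\<^bsub>V (Suc i)\<^esub>" for c
      by (auto intro!: W.x_eqI simp: W.zero_closed W.add_closed W.smult_closed W.x_zero W.x_add W.x_smult)
    then show "\<zero>\<^bsub>M\<^esub> i \<in> lin_hom (V i) (V (Suc i))"
      using i by (intro lin_homI) (auto simp: hom_gr1_def W.zero_closed U.add_closed U.smult_closed)
  qed (simp add: hom_gr1_def)
  show "p \<oplus>\<^bsub>M\<^esub> q \<in> carrier M" if pq: "p \<in> carrier M" "q \<in> carrier M" for p q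
  proof (rule lin_ext)
    fix i assume i: "i < m"
    interpret U: coordinates "V i" "T i" "\<epsilon> i" using C i by simp
    interpret W: coordinates "V (Suc i)" "T (Suc i)" "\<epsilon> (Suc i)" using C i by simp
    note p = lin_hom_apply[OF M_lin[OF pq(1) i]] and q = lin_hom_apply[OF M_lin[OF pq(2) i]]
    show "(p \<oplus>\<^bsub>M\<^esub> q) i \<in> lin_hom (V i) (V (Suc i))"
    proof (rule lin_homI)
      fix u v assume uv: "u \<in> carrier (V i)" "v \<in> carrier (V i)"
      then have "(p \<oplus>\<^bsub>M\<^esub> q) i (u \<oplus>\<^bsub>V i\<^esub> v)
        = (p i u \<oplus>\<^bsub>V (Suc i)\<^esub> p i v) \<oplus>\<^bsub>V (Suc i)\<^esub> (q i u \<oplus>\<^bsub>V (Suc i)\<^esub> q i v)"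
        using i by (simp add: hom_gr1_def p q U.add_closed)
      also have "\<dots> = (p i u \<oplus>\<^bsub>V (Suc i)\<^esub> q i u) \<oplus>\<^bsub>V (Suc i)\<^esub> (p i v \<oplus>\<^bsub>V (Suc i)\<^esub> q i v)"
        using uv by (intro W.x_eqI) (simp_all add: p(1) q(1) W.add_closed W.x_add)
      finally show "(p \<oplus>\<^bsub>M\<^esub> q) i (u \<oplus>\<^bsub>V i\<^esub> v) = (p \<oplus>\<^bsub>M\<^esub> q) i u \<oplus>\<^bsub>V (Suc i)\<^esub> (p \<oplus>\<^bsub>M\<^esub> q) i v"
        using i uv by (simp add: hom_gr1_def)
    next
      fix c u assume u: "u \<in> carrier (V i)"
      then have "(p \<oplus>\<^bsub>M\<^esub> q) i (c \<odot>\<^bsub>V i\<^esub> u) = c \<odot>\<^bsub>V (Suc i)\<^esub> p i u \<oplus>\<^bsub>V (Suc i)\<^esub> c \<odot>\<^bsub>V (Suc i)\<^esub> q i u"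
        using i by (simp add: hom_gr1_def p q U.smult_closed)
      also have "\<dots> = c \<odot>\<^bsub>V (Suc i)\<^esub> (p i u \<oplus>\<^bsub>V (Suc i)\<^esub> q i u)"
        using u by (intro W.x_eqI) (simp_all add: p(1) q(1) W.add_closed W.smult_closed W.x_add W.x_smult algebra_simps)
      finally show "(p \<oplus>\<^bsub>M\<^esub> q) i (c \<odot>\<^bsub>V i\<^esub> u) = c \<odot>\<^bsub>V (Suc i)\<^esub> (p \<oplus>\<^bsub>M\<^esub> q) i u"
        using i u by (simp add: hom_gr1_def)
    qed (use i in \<open>simp_all add: hom_gr1_def p(1) q(1) W.add_closed\<close>)
  qed (simp add: hom_gr1_def)
  show "c \<odot>\<^bsub>M\<^esub> p \<in> carrier M" if p: "p \<in> carrier M" for c p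
  proof (rule lin_ext)
    fix i assume i: "i < m"
    interpret U: coordinates "V i" "T i" "\<epsilon> i" using C i by simp
    interpret W: coordinates "V (Suc i)" "T (Suc i)" "\<epsilon> (Suc i)" using C i by simp
    note p = lin_hom_apply[OF M_lin[OF p i]]
    show "(c \<odot>\<^bsub>M\<^esub> p) i \<in> lin_hom (V i) (V (Suc i))"
    proof (rule lin_homI)
      fix u v assume uv: "u \<in> carrier (V i)" "v \<in> carrier (V i)"
      then have "(c \<odot>\<^bsub>M\<^esub> p) i (u \<oplus>\<^bsub>V i\<^esub> v) = c \<odot>\<^bsub>V (Suc i)\<^esub> (p i u \<oplus>\<^bsub>V (Suc i)\<^esub> p i v)"
        using i by (simp add: hom_gr1_def p U.add_closed)
      also have "\<dots> = c \<odot>\<^bsub>V (Suc i)\<^esub> p i u \<oplus>\<^bsub>V (Suc i)\<^esub> c \<odot>\<^bsub>V (Suc i)\<^esub> p i v"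
        using uv by (intro W.x_eqI) (simp_all add: p(1) W.add_closed W.smult_closed W.x_add W.x_smult algebra_simps)
      finally show "(c \<odot>\<^bsub>M\<^esub> p) i (u \<oplus>\<^bsub>V i\<^esub> v) = (c \<odot>\<^bsub>M\<^esub> p) i u \<oplus>\<^bsub>V (Suc i)\<^esub> (c \<odot>\<^bsub>M\<^esub> p) i v"
        using i uv by (simp add: hom_gr1_def)
    next
      fix k u assume u: "u \<in> carrier (V i)"
      then have "(c \<odot>\<^bsub>M\<^esub> p) i (k \<odot>\<^bsub>V i\<^esub> u) = c \<odot>\<^bsub>V (Suc i)\<^esub> (k \<odot>\<^bsub>V (Suc i)\<^esub> p i u)"
        using i by (simp add: hom_gr1_def p U.smult_closed)
      also have "\<dots> = k \<odot>\<^bsub>V (Suc i)\<^esub> (c \<odot>\<^bsub>V (Suc i)\<^esub> p i u)"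
        using u by (intro W.x_eqI) (simp_all add: p(1) W.smult_closed W.x_smult)
      finally show "(c \<odot>\<^bsub>M\<^esub> p) i (k \<odot>\<^bsub>V i\<^esub> u) = k \<odot>\<^bsub>V (Suc i)\<^esub> (c \<odot>\<^bsub>M\<^esub> p) i u"
        using i u by (simp add: hom_gr1_def)
    qed (use i in \<open>simp_all add: hom_gr1_def p(1) W.smult_closed\<close>)
  qed (simp add: hom_gr1_def)
  fix j assume "j \<in> idx"
  then obtain i b a where j: "j = (i, b, a)" "i < m" "b \<in> T (Suc i)" "a \<in> T i" by (auto simp: idx_def)
  interpret W: coordinates "V (Suc i)" "T (Suc i)" "\<epsilon> (Suc i)" using C j by simp
  have ui: "un i a \<in> carrier (V i)" using un j by simp
  show "ent j \<zero>\<^bsub>M\<^esub> = 0" using j ui by (simp add: ent_def hom_gr1_def W.x_zero)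
  show "ent j (p \<oplus>\<^bsub>M\<^esub> q) = ent j p + ent j q" if "p \<in> carrier M" "q \<in> carrier M" for p q
  proof -
    have "(p \<oplus>\<^bsub>M\<^esub> q) i (un i a) = p i (un i a) \<oplus>\<^bsub>V (Suc i)\<^esub> q i (un i a)"
      using j ui by (simp add: hom_gr1_def)
    then show ?thesis using that j ui by (simp add: ent_def W.x_add M_apply_closed)
  qed
  show "ent j (c \<odot>\<^bsub>M\<^esub> p) = c * ent j p" if "p \<in> carrier M" for c p
  proof -
    have "(c \<odot>\<^bsub>M\<^esub> p) i (un i a) = c \<odot>\<^bsub>V (Suc i)\<^esub> p i (un i a)"
      using j ui by (simp add: hom_gr1_def)
    then show ?thesis using that j ui by (simp add: ent_def W.x_smult M_apply_closed)
  qed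
next
  fix p q assume p: "p \<in> carrier M" and q: "q \<in> carrier M" and eq: "\<And>j. j \<in> idx \<Longrightarrow> ent j p = ent j q"
  show "p = q"
  proof (rule extensionalityI[of _ "{..<m}"])
    fix i assume "i \<in> {..<m}"
    then have i: "i < m" by simp
    interpret W: coordinates "V (Suc i)" "T (Suc i)" "\<epsilon> (Suc i)" using C i by simp
    show "p i = q i"
    proof (rule extensionalityI[of _ "carrier (V i)"])
      fix u assume u: "u \<in> carrier (V i)"
      show "p i u = q i u"
      proof (rule W.x_eqI)
        fix b assume b: "b \<in> T (Suc i)"
        show "\<epsilon> (Suc i) b (p i u) = \<epsilon> (Suc i) b (q i u)"
          unfolding comp[OF p i u b] comp[OF q i u b] using i b eq by (intro sum.cong) (auto simp: idx_iff)
      qed (use p q i u M_apply_closed in auto)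
    qed (use M_lin[OF p i] M_lin[OF q i] in \<open>auto simp: lin_hom_iff\<close>)
  qed (use p q in \<open>auto simp: M_carrier_iff\<close>)
next
  fix F
  define f where "f = (\<lambda>i\<in>{..<m}. \<lambda>u\<in>carrier (V i). coordinates.pt (V (Suc i)) (T (Suc i)) (\<epsilon> (Suc i))
    (\<lambda>b. \<Sum>a\<in>T i. F (i, b, a) * \<epsilon> i a u))"
  have f: "f \<in> carrier M"
    unfolding M_carrier_iff using lin_hom_matrix(1)[OF C C, of _ _ "\<lambda>b a. F (_, b, a)"] by (auto simp: f_def)
  have "ent j f = F j" if j_idx: "j \<in> idx" for j
  proof -
    obtain i b a where j: "j = (i, b, a)" "i < m" "b \<in> T (Suc i)" "a \<in> T i" using j_idx by (auto simp: idx_def)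
    have i: "i \<le> m" "Suc i \<le> m" using j by auto
    have "ent j f = (\<Sum>c\<in>T i. F (i, b, c) * \<epsilon> i c (un i a))"
      using lin_hom_matrix(2)[OF C[OF i(1)] C[OF i(2)] un(1)[OF i(1)] j(3)] j by (simp add: ent_def f_def)
    also have "\<dots> = (\<Sum>c\<in>T i. if c = a then F (i, b, c) else 0)"
      using un(2) i by (intro sum.cong) auto
    finally show ?thesis using j finite_T[OF i(1)] by simp
  qed
  then show "\<exists>p\<in>carrier M. \<forall>j\<in>idx. ent j p = F j" using f by blast
qed

sublocale M: coordinates M idx ent by (rule hom_coords)

section \<open>Quadratic equations for complexes\<close>

definition quad :: "nat \<Rightarrow> 'b \<Rightarrow> 'b \<Rightarrow> (nat \<Rightarrow> 'v \<Rightarrow> 'v) \<Rightarrow> 'k" where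
  "quad i c a f = (\<Sum>b\<in>T (Suc i). ent (Suc i, c, b) f * ent (i, b, a) f)"

lemma comp2:
  assumes "f \<in> carrier M" "Suc i < m" "u \<in> carrier (V i)" "c \<in> T (Suc (Suc i))"
  shows "\<epsilon> (Suc (Suc i)) c (f (Suc i) (f i u)) = (\<Sum>a\<in>T i. \<epsilon> i a u * quad i c a f)"
proof -
  have i: "i < m" using assms(2) by simp
  have "\<epsilon> (Suc (Suc i)) c (f (Suc i) (f i u)) = (\<Sum>b\<in>T (Suc i). \<epsilon> (Suc i) b (f i u) * ent (Suc i, c, b) f)"
    by (rule comp[OF assms(1,2) M_apply_closed[OF assms(1) i assms(3)] assms(4)])
  also have "\<dots> = (\<Sum>b\<in>T (Suc i). \<Sum>a\<in>T i. \<epsilon> i a u * (ent (Suc i, c, b) f * ent (i, b, a) f))"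
    by (intro sum.cong refl) (simp add: comp[OF assms(1) i assms(3)] sum_distrib_left sum_distrib_right algebra_simps)
  also have "\<dots> = (\<Sum>a\<in>T i. \<epsilon> i a u * quad i c a f)"
    by (subst sum.swap) (simp add: quad_def sum_distrib_left)
  finally show ?thesis .
qed

lemma complexes_iff:
  "f \<in> complexes m V \<longleftrightarrow> f \<in> carrier M \<and>
    (\<forall>i c a. Suc i < m \<longrightarrow> c \<in> T (Suc (Suc i)) \<longrightarrow> a \<in> T i \<longrightarrow> quad i c a f = 0)"
proof (cases "f \<in> carrier M")
  case True
  have "(\<forall>u\<in>carrier (V i). f (Suc i) (f i u) = \<zero>\<^bsub>V (Suc (Suc i))\<^esub>) \<longleftrightarrow>
    (\<forall>c\<in>T (Suc (Suc i)). \<forall>a\<in>T i. quad i c a f = 0)" if i: "Suc i < m" for i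
  proof -
    interpret W: coordinates "V (Suc (Suc i))" "T (Suc (Suc i))" "\<epsilon> (Suc (Suc i))" using C i by simp
    show ?thesis
    proof (intro iffI ballI)
      fix c a assume z: "\<forall>u\<in>carrier (V i). f (Suc i) (f i u) = \<zero>\<^bsub>V (Suc (Suc i))\<^esub>" and ca: "c \<in> T (Suc (Suc i))" "a \<in> T i"
      have u: "un i a \<in> carrier (V i)" using un i by simp
      have "0 = (\<Sum>b\<in>T i. \<epsilon> i b (un i a) * quad i c b f)"
        using comp2[OF True i u ca(1)] z u W.x_zero[OF ca(1)] by simp
      also have "\<dots> = (\<Sum>b\<in>T i. if b = a then quad i c b f else 0)"
        using un(2) i by (intro sum.cong) auto
      finally show "quad i c a f = 0" using ca finite_T[of i] i by simp
    next
      fix u assume z: "\<forall>c\<in>T (Suc (Suc i)). \<forall>a\<in>T i. quad i c a f = 0" and u: "u \<in> carrier (V i)"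
      have i': "i < m" using i by simp
      show "f (Suc i) (f i u) = \<zero>\<^bsub>V (Suc (Suc i))\<^esub>"
      proof (rule W.x_eqI)
        show "f (Suc i) (f i u) \<in> carrier (V (Suc (Suc i)))"
          using M_apply_closed[OF True i M_apply_closed[OF True i' u]] .
        show "\<epsilon> (Suc (Suc i)) c (f (Suc i) (f i u)) = \<epsilon> (Suc (Suc i)) c \<zero>\<^bsub>V (Suc (Suc i))\<^esub>" if "c \<in> T (Suc (Suc i))" for c
          using comp2[OF True i u that] z that W.x_zero by simp
      qed (rule W.zero_closed)
    qed
  qed
  then show ?thesis using True by (auto simp: complexes_def)
qed (simp add: complexes_def)

definition quad_gens :: "((nat \<Rightarrow> 'v \<Rightarrow> 'v) \<Rightarrow> 'k) set" where
  "quad_gens = {\<lambda>D\<in>carrier M. \<xi> (D (Suc i) (D i x)) | i x \<xi>.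
        Suc i < m \<and> x \<in> carrier (V i) \<and> \<xi> \<in> dual (V (Suc (Suc i)))}"

lemma complexes_ideal_eq: "complexes_ideal m V = Idl\<^bsub>poly_ring M\<^esub> quad_gens"
  by (simp add: complexes_ideal_def quad_gens_def)

lemma quad_poly: "(\<lambda>f\<in>carrier M. quad i c a f) \<in> carrier (poly_ring M)"
  if "Suc i < m" "c \<in> T (Suc (Suc i))" "a \<in> T i"
proof -
  have "(\<lambda>f\<in>carrier M. \<Sum>b\<in>T (Suc i). (\<lambda>f\<in>carrier M. (\<lambda>f\<in>carrier M. ent (Suc i, c, b) f) f * (\<lambda>f\<in>carrier M. ent (i, b, a) f) f) f) \<in> carrier (poly_ring M)"
    using that by (intro M.A_sum M.A_mult M.A_coord) (auto simp: idx_iff)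
  then show ?thesis by (simp add: quad_def cong: restrict_cong)
qed

text \<open>Expanding both the functional and the vector in bases expresses an arbitrary generator
  through the entries of the product matrix.\<close>

lemma quad_gen_expand:
  assumes "g \<in> quad_gens"
  shows "\<exists>i k. Suc i < m \<and>
    g = (\<lambda>f\<in>carrier M. \<Sum>(c, a)\<in>T (Suc (Suc i)) \<times> T i. k c a * quad i c a f)"
proof -
  obtain i x \<xi> where g: "g = (\<lambda>D\<in>carrier M. \<xi> (D (Suc i) (D i x)))" "Suc i < m" "x \<in> carrier (V i)" "\<xi> \<in> dual (V (Suc (Suc i)))"
    using assms by (auto simp: quad_gens_def)
  interpret W: coordinates "V (Suc (Suc i))" "T (Suc (Suc i))" "\<epsilon> (Suc (Suc i))" using C g by simp
  have "\<xi> (f (Suc i) (f i x)) = (\<Sum>(c, a)\<in>T (Suc (Suc i)) \<times> T i. (\<xi> (W.unit_pt c) * \<epsilon> i a x) * quad i c a f)"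
    if f: "f \<in> carrier M" for f
  proof -
    have i': "i < m" using g by simp
    have "\<xi> (f (Suc i) (f i x)) = (\<Sum>c\<in>T (Suc (Suc i)). \<epsilon> (Suc (Suc i)) c (f (Suc i) (f i x)) * \<xi> (W.unit_pt c))"
      using f g i' by (intro W.dual_expand M_apply_closed) auto
    also have "\<dots> = (\<Sum>c\<in>T (Suc (Suc i)). \<Sum>a\<in>T i. (\<xi> (W.unit_pt c) * \<epsilon> i a x) * quad i c a f)"
      using comp2[OF f g(2,3)] by (intro sum.cong refl) (simp add: sum_distrib_left sum_distrib_right algebra_simps)
    finally show ?thesis by (simp add: sum.cartesian_product)
  qed
  then have "g = (\<lambda>f\<in>carrier M. \<Sum>(c, a)\<in>T (Suc (Suc i)) \<times> T i. (\<xi> (W.unit_pt c) * \<epsilon> i a x) * quad i c a f)"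
    unfolding g(1) by (rule restrict_ext)
  with g(2) show ?thesis by (intro exI[of _ i] exI[of _ "\<lambda>c a. \<xi> (W.unit_pt c) * \<epsilon> i a x"] conjI)
qed

lemma quad_smult:
  assumes "f \<in> carrier M" "Suc i < m" "c \<in> T (Suc (Suc i))" "a \<in> T i"
  shows "quad i c a (k \<odot>\<^bsub>M\<^esub> f) = k ^ 2 * quad i c a f"
  unfolding quad_def sum_distrib_left
  using assms by (intro sum.cong refl) (simp add: M.x_smult idx_iff power2_eq_square)

lemma quad_gens_homogeneous: assumes "g \<in> quad_gens" shows "g \<in> homogeneous M 2"
proof -
  obtain i k where ik: "Suc i < m"
    "g = (\<lambda>f\<in>carrier M. \<Sum>(c, a)\<in>T (Suc (Suc i)) \<times> T i. k c a * quad i c a f)"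
    using quad_gen_expand[OF assms] by (elim exE conjE)
  have "(\<lambda>f\<in>carrier M. \<Sum>z\<in>T (Suc (Suc i)) \<times> T i. (\<lambda>f\<in>carrier M. (\<lambda>f\<in>carrier M. k (fst z) (snd z)) f * (\<lambda>f\<in>carrier M. quad i (fst z) (snd z) f) f) f) \<in> carrier (poly_ring M)"
    using ik by (intro M.A_sum M.A_mult M.A_const quad_poly) auto
  then have "g \<in> carrier (poly_ring M)" unfolding ik(2) by (simp add: case_prod_beta cong: restrict_cong)
  moreover have "g (t \<odot>\<^bsub>M\<^esub> f) = t ^ 2 * g f" if "f \<in> carrier M" for t f
    using that ik unfolding ik(2)
    by (auto simp: M.smult_closed sum_distrib_left quad_smult intro!: sum.cong)
  ultimately show ?thesis by (simp add: homogeneous_def)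
qed

lemma quad_gens_poly: "quad_gens \<subseteq> carrier (poly_ring M)"
  using quad_gens_homogeneous by (auto simp: homogeneous_def)

lemma complexes_ideal_homogeneous: "M.homogeneous_ideal (complexes_ideal m V)"
  unfolding complexes_ideal_eq using quad_gens_homogeneous by (intro M.genideal_homogeneous) blast

text \<open>The entry is the generator given by the coordinate functional \<open>c\<close> and the
  basis vector \<open>a\<close>.\<close>

lemma quad_mem:
  assumes "Suc i < m" "c \<in> T (Suc (Suc i))" "a \<in> T i"
  shows "(\<lambda>f\<in>carrier M. quad i c a f) \<in> complexes_ideal m V"
proof -
  interpret W: coordinates "V (Suc (Suc i))" "T (Suc (Suc i))" "\<epsilon> (Suc (Suc i))" using C assms by simp
  define \<xi> where "\<xi> = (\<lambda>u\<in>carrier (V (Suc (Suc i))). \<epsilon> (Suc (Suc i)) c u)"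
  have \<xi>: "\<xi> \<in> dual (V (Suc (Suc i)))" unfolding \<xi>_def by (rule W.x_dual[OF assms(2)])
  have u: "un i a \<in> carrier (V i)" using un assms by simp
  have i': "i < m" using assms by simp
  have "quad i c a f = \<xi> (f (Suc i) (f i (un i a)))" if f: "f \<in> carrier M" for f
  proof -
    have "\<xi> (f (Suc i) (f i (un i a))) = (\<Sum>b\<in>T i. \<epsilon> i b (un i a) * quad i c b f)"
      using comp2[OF f assms(1) u assms(2)] M_apply_closed[OF f assms(1) M_apply_closed[OF f i' u]]
      by (simp add: \<xi>_def)
    also have "\<dots> = (\<Sum>b\<in>T i. if b = a then quad i c b f else 0)"
      using un(2) i' by (intro sum.cong) auto
    finally show ?thesis using assms finite_T[of i] by simp
  qed
  then have "(\<lambda>f\<in>carrier M. quad i c a f) = (\<lambda>D\<in>carrier M. \<xi> (D (Suc i) (D i (un i a))))"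
    by (rule restrict_ext)
  then have "(\<lambda>f\<in>carrier M. quad i c a f) \<in> quad_gens" using assms \<xi> u by (auto simp: quad_gens_def)
  then show ?thesis unfolding complexes_ideal_eq using M.A.genideal_self[OF quad_gens_poly] by blast
qed

text \<open>Serves both passages between a neighbourhood of \<open>D\<close> and the cone: an ideal
  condition is checked on linear combinations of quadratic entries only.\<close>

lemma complexes_ideal_minimal:
  assumes "ideal \<I> (poly_ring M)"
    and "\<And>i k. Suc i < m \<Longrightarrow> (\<lambda>f\<in>carrier M. \<Sum>(c, a)\<in>T (Suc (Suc i)) \<times> T i. k c a * quad i c a f) \<in> \<I>"
  shows "complexes_ideal m V \<subseteq> \<I>"
  unfolding complexes_ideal_eq
proof (rule M.A.genideal_minimal[OF assms(1)], rule subsetI)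
  fix g assume g: "g \<in> quad_gens"
  show "g \<in> \<I>" using quad_gen_expand[OF g] assms(2) by (elim exE conjE) simp
qed

lemma complexes_ideal_vanish: "f \<in> complexes_ideal m V \<Longrightarrow> p \<in> complexes m V \<Longrightarrow> f p = 0"
proof -
  assume fp: "f \<in> complexes_ideal m V" "p \<in> complexes m V"
  have sub: "complexes m V \<subseteq> carrier M" by (auto simp: complexes_def)
  have "complexes_ideal m V \<subseteq> vanishing_ideal M (complexes m V)"
    unfolding complexes_ideal_eq
  proof (rule M.A.genideal_minimal[OF M.vanishing_ideal[OF sub]], rule subsetI)
    fix g assume g: "g \<in> quad_gens"
    obtain i k where ik: "Suc i < m"
      "g = (\<lambda>f\<in>carrier M. \<Sum>(c, a)\<in>T (Suc (Suc i)) \<times> T i. k c a * quad i c a f)"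
      using quad_gen_expand[OF g] by (elim exE conjE)
    have "g q = 0" if "q \<in> complexes m V" for q
      using that ik unfolding ik(2) by (auto simp: complexes_iff intro!: sum.neutral)
    then show "g \<in> vanishing_ideal M (complexes m V)" using g quad_gens_poly by (auto simp: vanishing_ideal_def)
  qed
  then show "f p = 0" using fp by (auto simp: vanishing_ideal_def)
qed

lemma rank_iff:
  assumes "f \<in> carrier M" "i < m"
  shows "lin_rank (V i) (V (Suc i)) (f i) \<le> k \<longleftrightarrow> rk_le (\<lambda>b a. ent (i, b, a) f) (T (Suc i)) (T i) k"
  using lin_rank_le_iff[OF C C M_lin[OF assms], of k] assms(2) by (simp add: ent_def)

subsection \<open>The action of the general linear group\<close>

text \<open>The inverse is restricted to the carrier because \<open>lin_hom\<close> consists of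
  extensional functions.\<close>

lemma gl_inverse:
  assumes "g \<in> gl m V" "i \<le> m"
  shows "g i \<in> lin_hom (V i) (V i)"
    and "restrict (the_inv_into (carrier (V i)) (g i)) (carrier (V i)) \<in> lin_hom (V i) (V i)"
    and "u \<in> carrier (V i) \<Longrightarrow> the_inv_into (carrier (V i)) (g i) (g i u) = u"
    and "u \<in> carrier (V i) \<Longrightarrow> g i (the_inv_into (carrier (V i)) (g i) u) = u"
    and "u \<in> carrier (V i) \<Longrightarrow> the_inv_into (carrier (V i)) (g i) u \<in> carrier (V i)"
proof -
  interpret U: coordinates "V i" "T i" "\<epsilon> i" using C assms by simp
  have g: "g i \<in> lin_hom (V i) (V i)" "bij_betw (g i) (carrier (V i)) (carrier (V i))"
    using assms by (auto simp: gl_def PiE_def Pi_def)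
  show "g i \<in> lin_hom (V i) (V i)" by (rule g(1))
  have inj: "inj_on (g i) (carrier (V i))" and im: "g i ` carrier (V i) = carrier (V i)"
    using g(2) by (auto simp: bij_betw_def)
  show 1: "the_inv_into (carrier (V i)) (g i) (g i u) = u" if "u \<in> carrier (V i)" for u
    by (rule the_inv_into_f_f[OF inj that])
  show 2: "g i (the_inv_into (carrier (V i)) (g i) u) = u" if "u \<in> carrier (V i)" for u
    by (rule f_the_inv_into_f[OF inj]) (use im that in simp)
  show 3: "the_inv_into (carrier (V i)) (g i) u \<in> carrier (V i)" if "u \<in> carrier (V i)" for u
    by (rule the_inv_into_into[OF inj _ subset_refl]) (use im that in simp)
  show "restrict (the_inv_into (carrier (V i)) (g i)) (carrier (V i)) \<in> lin_hom (V i) (V i)"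
  proof (rule lin_homI)
    fix u v assume uv: "u \<in> carrier (V i)" "v \<in> carrier (V i)"
    have "g i (the_inv_into (carrier (V i)) (g i) u \<oplus>\<^bsub>V i\<^esub> the_inv_into (carrier (V i)) (g i) v) = u \<oplus>\<^bsub>V i\<^esub> v"
      using uv by (simp add: lin_hom_apply(2)[OF g(1)] 2 3)
    then have "the_inv_into (carrier (V i)) (g i) (u \<oplus>\<^bsub>V i\<^esub> v) = the_inv_into (carrier (V i)) (g i) u \<oplus>\<^bsub>V i\<^esub> the_inv_into (carrier (V i)) (g i) v"
      using 1[OF U.add_closed[OF 3 3], OF uv] by simp
    then show "restrict (the_inv_into (carrier (V i)) (g i)) (carrier (V i)) (u \<oplus>\<^bsub>V i\<^esub> v)
      = restrict (the_inv_into (carrier (V i)) (g i)) (carrier (V i)) u \<oplus>\<^bsub>V i\<^esub> restrict (the_inv_into (carrier (V i)) (g i)) (carrier (V i)) v"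
      using uv by (simp add: U.add_closed)
  next
    fix c u assume u: "u \<in> carrier (V i)"
    have "g i (c \<odot>\<^bsub>V i\<^esub> the_inv_into (carrier (V i)) (g i) u) = c \<odot>\<^bsub>V i\<^esub> u"
      using u by (simp add: lin_hom_apply(3)[OF g(1)] 2 3)
    then have "the_inv_into (carrier (V i)) (g i) (c \<odot>\<^bsub>V i\<^esub> u) = c \<odot>\<^bsub>V i\<^esub> the_inv_into (carrier (V i)) (g i) u"
      using 1[OF U.smult_closed[OF 3], OF u, of c] by simp
    then show "restrict (the_inv_into (carrier (V i)) (g i)) (carrier (V i)) (c \<odot>\<^bsub>V i\<^esub> u)
      = c \<odot>\<^bsub>V i\<^esub> restrict (the_inv_into (carrier (V i)) (g i)) (carrier (V i)) u"
      using u by (simp add: U.smult_closed)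
  qed (auto simp: 3)
qed

lemma lin_hom_compose:
  assumes "f \<in> lin_hom U W" "h \<in> lin_hom W X"
    and "\<And>u v. u \<in> carrier U \<Longrightarrow> v \<in> carrier U \<Longrightarrow> u \<oplus>\<^bsub>U\<^esub> v \<in> carrier U"
    and "\<And>c u. u \<in> carrier U \<Longrightarrow> c \<odot>\<^bsub>U\<^esub> u \<in> carrier U"
  shows "(\<lambda>u\<in>carrier U. h (f u)) \<in> lin_hom U X"
  using assms by (intro lin_homI) (auto simp: lin_hom_apply)

lemma gl_act_closed:
  assumes "g \<in> gl m V" "f \<in> carrier M" shows "gl_act m V g f \<in> carrier M"
  unfolding M_carrier_iff
proof (intro conjI allI impI)
  fix i assume i: "i < m"
  interpret U: coordinates "V i" "T i" "\<epsilon> i" using C i by simp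
  have il: "i \<le> m" "Suc i \<le> m" using i by auto
  have "(\<lambda>u\<in>carrier (V i). f i (restrict (the_inv_into (carrier (V i)) (g i)) (carrier (V i)) u)) \<in> lin_hom (V i) (V (Suc i))"
    using gl_inverse(2)[OF assms(1) il(1)] M_lin[OF assms(2) i]
    by (rule lin_hom_compose) (rule U.add_closed, assumption+, rule U.smult_closed, assumption)
  from lin_hom_compose[OF this gl_inverse(1)[OF assms(1) il(2)]]
  show "gl_act m V g f i \<in> lin_hom (V i) (V (Suc i))"
    using i by (simp add: gl_act_def U.add_closed U.smult_closed cong: restrict_cong)
qed (simp add: gl_act_def)

lemma gl_act_complex:
  assumes "g \<in> gl m V" "f \<in> complexes m V" shows "gl_act m V g f \<in> complexes m V"
proof -
  have f: "f \<in> carrier M" using assms(2) by (simp add: complexes_def)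
  have "gl_act m V g f (Suc i) (gl_act m V g f i u) = \<zero>\<^bsub>V (Suc (Suc i))\<^esub>" if i: "Suc i < m" and u: "u \<in> carrier (V i)" for i u
  proof -
    have il: "i \<le> m" "Suc i \<le> m" "Suc (Suc i) \<le> m" "i < m" using i by auto
    let ?v = "the_inv_into (carrier (V i)) (g i) u"
    have v: "?v \<in> carrier (V i)" by (rule gl_inverse(5)[OF assms(1) il(1) u])
    have fv: "f i ?v \<in> carrier (V (Suc i))" by (rule M_apply_closed[OF f il(4) v])
    have gfv: "g (Suc i) (f i ?v) \<in> carrier (V (Suc i))" by (rule lin_hom_apply(1)[OF gl_inverse(1)[OF assms(1) il(2)] fv])
    have "gl_act m V g f (Suc i) (gl_act m V g f i u) = g (Suc (Suc i)) (f (Suc i) (f i ?v))"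
      using i il u fv gfv gl_inverse(3)[OF assms(1) il(2) fv] by (simp add: gl_act_def)
    also have "f (Suc i) (f i ?v) = \<zero>\<^bsub>V (Suc (Suc i))\<^esub>" using assms(2) i v by (simp add: complexes_def)
    also have "g (Suc (Suc i)) \<zero>\<^bsub>V (Suc (Suc i))\<^esub> = \<zero>\<^bsub>V (Suc (Suc i))\<^esub>"
      by (rule lin_hom_zero[OF C C gl_inverse(1)[OF assms(1) il(3)]]) (use il in auto)
    finally show ?thesis .
  qed
  then show ?thesis using gl_act_closed[OF assms(1) f] by (simp add: complexes_def)
qed

lemma ent_gl_act:
  assumes g: "g \<in> gl m V" and f: "f \<in> carrier M" and i: "i < m" and ba: "b \<in> T (Suc i)" "a \<in> T i"
  shows "ent (i, b, a) (gl_act m V g f) =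
    (\<Sum>b'\<in>T (Suc i). \<Sum>a'\<in>T i. \<epsilon> (Suc i) b (g (Suc i) (un (Suc i) b')) * ent (i, b', a') f
      * \<epsilon> i a' (the_inv_into (carrier (V i)) (g i) (un i a)))"
proof -
  have il: "i \<le> m" "Suc i \<le> m" using i by auto
  let ?v = "the_inv_into (carrier (V i)) (g i) (un i a)"
  have v: "?v \<in> carrier (V i)" by (rule gl_inverse(5)[OF g il(1) un(1)[OF il(1)]])
  have fv: "f i ?v \<in> carrier (V (Suc i))" by (rule M_apply_closed[OF f i v])
  have "ent (i, b, a) (gl_act m V g f) = \<epsilon> (Suc i) b (g (Suc i) (f i ?v))"
    using i un(1)[OF il(1)] by (simp add: ent_def gl_act_def)
  also have "\<dots> = (\<Sum>b'\<in>T (Suc i). \<epsilon> (Suc i) b' (f i ?v) * \<epsilon> (Suc i) b (g (Suc i) (un (Suc i) b')))"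
    by (rule lin_hom_expand[OF C[OF il(2)] C[OF il(2)] gl_inverse(1)[OF g il(2)] fv ba(1)])
  also have "\<dots> = (\<Sum>b'\<in>T (Suc i). \<Sum>a'\<in>T i. \<epsilon> (Suc i) b (g (Suc i) (un (Suc i) b')) * ent (i, b', a') f * \<epsilon> i a' ?v)"
    by (intro sum.cong refl) (simp add: comp[OF f i v] sum_distrib_left sum_distrib_right algebra_simps)
  finally show ?thesis .
qed

lemma gl_act_rank:
  assumes "g \<in> gl m V" "f \<in> carrier M" "i < m" "rk_le (\<lambda>b a. ent (i, b, a) f) (T (Suc i)) (T i) k"
  shows "rk_le (\<lambda>b a. ent (i, b, a) (gl_act m V g f)) (T (Suc i)) (T i) k"
  using rk_le_mult[OF finite_T finite_T assms(4), of "\<lambda>b b'. \<epsilon> (Suc i) b (g (Suc i) (un (Suc i) b'))"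
      "\<lambda>a' a. \<epsilon> i a' (the_inv_into (carrier (V i)) (g i) (un i a))" "T (Suc i)" "T i"] assms(3)
  by (simp add: ent_gl_act[OF assms(1-3)] cong: rk_le_cong)

text \<open>The inverse matrices are supplied along with the matrices, so the entries of the
  automorphism and of its inverse are both known.\<close>

lemma gl_matrix:
  assumes "\<And>i a b. i \<le> m \<Longrightarrow> a \<in> T i \<Longrightarrow> b \<in> T i \<Longrightarrow> (\<Sum>c\<in>T i. G i a c * G' i c b) = of_bool (a = b)"
    and "\<And>i a b. i \<le> m \<Longrightarrow> a \<in> T i \<Longrightarrow> b \<in> T i \<Longrightarrow> (\<Sum>c\<in>T i. G' i a c * G i c b) = of_bool (a = b)"
  obtains g where "g \<in> gl m V"
    and "\<And>i a b. i \<le> m \<Longrightarrow> a \<in> T i \<Longrightarrow> b \<in> T i \<Longrightarrow> \<epsilon> i b (g i (un i a)) = G i b a"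
    and "\<And>i a b. i \<le> m \<Longrightarrow> a \<in> T i \<Longrightarrow> b \<in> T i \<Longrightarrow>
      \<epsilon> i b (the_inv_into (carrier (V i)) (g i) (un i a)) = G' i b a"
proof -
  define mp where "mp F i = (\<lambda>u\<in>carrier (V i). coordinates.pt (V i) (T i) (\<epsilon> i) (\<lambda>b. \<Sum>a\<in>T i. F b a * \<epsilon> i a u))" for F i
  have lin: "mp F i \<in> lin_hom (V i) (V i)"
    and co: "u \<in> carrier (V i) \<Longrightarrow> b \<in> T i \<Longrightarrow> \<epsilon> i b (mp F i u) = (\<Sum>a\<in>T i. F b a * \<epsilon> i a u)" if "i \<le> m" for F i u b
    using lin_hom_matrix[OF C[OF that] C[OF that], where F = F] unfolding mp_def by blast+
  have inv: "mp F i (mp F' i u) = u"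
    if i: "i \<le> m" and u: "u \<in> carrier (V i)" and FF: "\<And>a b. a \<in> T i \<Longrightarrow> b \<in> T i \<Longrightarrow> (\<Sum>c\<in>T i. F a c * F' c b) = of_bool (a = b)" for F F' i u
  proof -
    interpret U: coordinates "V i" "T i" "\<epsilon> i" using C i by simp
    have c: "mp F' i u \<in> carrier (V i)" using lin_hom_apply(1)[OF lin[OF i] u] .
    show ?thesis
    proof (rule U.x_eqI)
      fix b assume b: "b \<in> T i"
      have "\<epsilon> i b (mp F i (mp F' i u)) = (\<Sum>c\<in>T i. \<Sum>a\<in>T i. F b c * F' c a * \<epsilon> i a u)"
        using co[OF i c b] co[OF i u] by (simp add: sum_distrib_left mult.assoc)
      also have "\<dots> = (\<Sum>a\<in>T i. (\<Sum>c\<in>T i. F b c * F' c a) * \<epsilon> i a u)"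
        by (subst sum.swap) (simp add: sum_distrib_right)
      also have "\<dots> = (\<Sum>a\<in>T i. if a = b then \<epsilon> i a u else 0)"
        using FF[OF b] by (intro sum.cong) auto
      finally show "\<epsilon> i b (mp F i (mp F' i u)) = \<epsilon> i b u" using b U.finite_X by simp
    qed (use lin_hom_apply(1)[OF lin[OF i] c] u in auto)
  qed
  define g where "g = (\<lambda>i\<in>{..m}. mp (G i) i)"
  have bij: "bij_betw (mp (G i) i) (carrier (V i)) (carrier (V i))" if "i \<le> m" for i
    by (rule bij_betw_byWitness[of _ "mp (G' i) i"])
      (use inv assms that lin_hom_apply(1)[OF lin[OF that]] in auto)
  have ggl: "g \<in> gl m V" using lin bij by (auto simp: gl_def g_def)
  have unit: "(\<Sum>c\<in>T i. F c * \<epsilon> i c (un i a)) = F a" if "i \<le> m" "a \<in> T i" for F i a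
  proof -
    have "(\<Sum>c\<in>T i. F c * \<epsilon> i c (un i a)) = (\<Sum>c\<in>T i. if c = a then F c else 0)"
      using un(2) that by (intro sum.cong) auto
    then show ?thesis using that finite_T by simp
  qed
  show ?thesis
  proof (rule that[OF ggl])
    fix i a b assume i: "i \<le> m" and ab: "a \<in> T i" "b \<in> T i"
    show "\<epsilon> i b (g i (un i a)) = G i b a"
      using i ab co[OF i un(1)[OF i] ab(2)] unit[OF i ab(1), of "G i b"] by (simp add: g_def)
    have "the_inv_into (carrier (V i)) (g i) (un i a) = mp (G' i) i (un i a)"
    proof (rule the_inv_into_f_eq)
      show "inj_on (g i) (carrier (V i))" using bij[OF i] i by (simp add: g_def bij_betw_def)
      show "g i (mp (G' i) i (un i a)) = un i a" using inv[OF i un(1)[OF i], of "G i" "G' i"] assms i by (simp add: g_def)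
      show "mp (G' i) i (un i a) \<in> carrier (V i)" by (rule lin_hom_apply(1)[OF lin[OF i] un(1)[OF i]])
    qed
    then show "\<epsilon> i b (the_inv_into (carrier (V i)) (g i) (un i a)) = G' i b a"
      using i ab co[OF i un(1)[OF i] ab(2)] unit[OF i ab(1), of "G' i b"] by simp
  qed
qed

end

section \<open>The slice to an orbit of complexes\<close>

text \<open>The index sets stand for the boundaries, a complement of them in the cycles, and a
  complement of the cycles. In such bases \<open>D\<close> is a partial permutation matrix given by
  \<open>d\<close>. The spaces \<open>W i\<close> stand for the cohomology, with coordinates indexed
  by the same sets \<open>H i\<close>.\<close>

locale split_complex = V: graded_coords m V T \<epsilon> + W: graded_coords m W H \<eta>
  for m and V :: "nat \<Rightarrow> ('k::field_char_0, 'v) module" and T :: "nat \<Rightarrow> 'b set" and \<epsilon>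
    and W :: "nat \<Rightarrow> ('k, 'w) module" and H :: "nat \<Rightarrow> 'b set" and \<eta> +
  fixes B L :: "nat \<Rightarrow> 'b set" and d :: "nat \<Rightarrow> 'b \<Rightarrow> 'b" and D :: "nat \<Rightarrow> 'v \<Rightarrow> 'v"
  assumes T_eq: "i \<le> m \<Longrightarrow> T i = B i \<union> H i \<union> L i"
    and disj: "i \<le> m \<Longrightarrow> B i \<inter> H i = {}" "i \<le> m \<Longrightarrow> B i \<inter> L i = {}" "i \<le> m \<Longrightarrow> H i \<inter> L i = {}"
    and B0: "B 0 = {}" and Lm: "L m = {}"
    and d_bij: "i < m \<Longrightarrow> bij_betw (d i) (L i) (B (Suc i))"
    and D: "D \<in> carrier (hom_gr1 m V)"
    and D_ent: "i < m \<Longrightarrow> b \<in> T (Suc i) \<Longrightarrow> a \<in> T i \<Longrightarrow> V.ent (i, b, a) D = of_bool (a \<in> L i \<and> b = d i a)"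
begin

abbreviation "M \<equiv> hom_gr1 m V"
abbreviation "N \<equiv> hom_gr1 m W"

definition x :: "nat \<Rightarrow> 'b \<Rightarrow> 'b \<Rightarrow> (nat \<Rightarrow> 'v \<Rightarrow> 'v) \<Rightarrow> 'k" where "x i b a p = V.ent (i, b, a) p"
text \<open>Renaming the rows \<open>B (i + 1)\<close> by \<open>d\<close> makes the block square
  over \<open>L i\<close>, and the identity at \<open>D\<close>.\<close>

definition pivot where "pivot i p l' l = x i (d i l') l p"
text \<open>The multiples of the columns \<open>L i\<close> that clear the rows
  \<open>B (i + 1)\<close> of column \<open>h\<close>: the inverse pivot block applied to these
  rows.\<close>

definition elim_coeff where "elim_coeff i l h p = (\<Sum>l'\<in>L i. minv (L i) (pivot i p) l l' * x i (d i l') h p)"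

text \<open>The block of \<open>p\<^sub>i\<close> with the columns \<open>H i\<close> after the elimination of the columns \<open>L i\<close> by the
  pivot block \<open>pivot i p\<close>; its part with rows in \<open>H\<close> is the Schur complement.\<close>

definition elim_col where "elim_col i b h p = x i b h p - (\<Sum>l\<in>L i. x i b l p * elim_coeff i l h p)"
definition S where "S = (\<lambda>(i, b, h) p. elim_col i b h p)"

definition dinv where "dinv i = the_inv_into (L i) (d i)"

text \<open>The matrix of an automorphism that carries \<open>D\<close> to \<open>p\<close> up to terms in the Schur complement
  and in \<open>p\<^sub>i\<^sub>+\<^sub>1p\<^sub>i\<close>.\<close>

definition frame where "frame i p b a = (if a \<in> L i then of_bool (b = a)
    else if a \<in> H i then of_bool (b = a) - (if b \<in> L i then elim_coeff i b a p else 0)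
    else x (i - 1) b (dinv (i - 1) a) p)"
text \<open>An entry of the conjugate of \<open>D\<close> by the frame. The frame times
  \<open>D\<close> has at \<open>l\<close> in \<open>L i\<close> the frame column
  \<open>d i l\<close>, which is column \<open>l\<close> of \<open>p\<close>, and zero columns
  elsewhere.\<close>

definition conj_ent where "conj_ent i b a p = (\<Sum>l\<in>L i. x i b l p * minv (T i) (frame i p) l a)"
definition conj_pt where "conj_pt p = V.M.pt (\<lambda>(i, b, a). conj_ent i b a p)"

definition e where "e E = V.M.pt (\<lambda>(i, b, a). of_bool (a \<in> L i \<and> b = d i a) +
    (if b \<in> H (Suc i) \<and> a \<in> H i then W.ent (i, b, a) E else 0))"

section \<open>Index sets and block sums\<close>

lemma sub_T: "i \<le> m \<Longrightarrow> B i \<subseteq> T i" "i \<le> m \<Longrightarrow> H i \<subseteq> T i" "i \<le> m \<Longrightarrow> L i \<subseteq> T i"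
  using T_eq by auto

lemma fin: "i \<le> m \<Longrightarrow> finite (T i)" "i \<le> m \<Longrightarrow> finite (B i)" "i \<le> m \<Longrightarrow> finite (H i)" "i \<le> m \<Longrightarrow> finite (L i)"
  using V.finite_T sub_T finite_subset by metis+

lemma d_mem: "i < m \<Longrightarrow> l \<in> L i \<Longrightarrow> d i l \<in> B (Suc i)"
  using d_bij bij_betw_apply by metis

lemma d_T: "i < m \<Longrightarrow> l \<in> L i \<Longrightarrow> d i l \<in> T (Suc i)"
  using d_mem sub_T(1)[of "Suc i"] by auto

lemma d_inj: "i < m \<Longrightarrow> l \<in> L i \<Longrightarrow> l' \<in> L i \<Longrightarrow> d i l = d i l' \<longleftrightarrow> l = l'"
  using d_bij[of i] by (auto simp: bij_betw_def dest: inj_onD)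

lemma dinv_d: "i < m \<Longrightarrow> l \<in> L i \<Longrightarrow> dinv i (d i l) = l"
  unfolding dinv_def using d_bij[of i] by (auto simp: bij_betw_def the_inv_into_f_f)

lemma B_dE:
  assumes "a \<in> B i" "i \<le> m"
  obtains j l where "i = Suc j" "j < m" "l \<in> L j" "a = d j l"
proof -
  obtain j where j: "i = Suc j" using assms B0 by (cases i) auto
  then have "a \<in> d j ` L j" using d_bij[of j] assms by (auto simp: bij_betw_def)
  then show ?thesis using that j assms by auto
qed

lemma L_lt: "i \<le> m \<Longrightarrow> l \<in> L i \<Longrightarrow> i < m"
  using Lm by (metis empty_iff le_neq_implies_less)

lemma sum_T: "i \<le> m \<Longrightarrow> (\<Sum>a\<in>T i. f a) = (\<Sum>a\<in>B i. f a) + (\<Sum>a\<in>H i. f a) + (\<Sum>a\<in>L i. f a)"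
  for f :: "'b \<Rightarrow> 'k"
proof -
  assume i: "i \<le> m"
  have "(B i \<union> H i) \<inter> L i = {}" using disj[OF i] by blast
  then show ?thesis unfolding T_eq[OF i] using fin[OF i] disj[OF i] by (simp add: sum.union_disjoint)
qed

lemma sum_B: "i < m \<Longrightarrow> (\<Sum>b\<in>B (Suc i). f b) = (\<Sum>l\<in>L i. f (d i l))" for f :: "'b \<Rightarrow> 'k"
  using sum.reindex_bij_betw[OF d_bij, of i f] by simp

text \<open>The pivot block times its inverse is the identity, so the subtracted sum reproduces
  exactly the entry in a pivot row.\<close>

lemma elim_col_d:
  assumes "i < m" "mdet (L i) (pivot i p) \<noteq> 0" "l \<in> L i"
  shows "elim_col i (d i l) h p = 0"
proof -
  have i: "i \<le> m" using assms by simp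
  have "(\<Sum>l1\<in>L i. x i (d i l) l1 p * elim_coeff i l1 h p)
    = (\<Sum>l1\<in>L i. \<Sum>l2\<in>L i. pivot i p l l1 * minv (L i) (pivot i p) l1 l2 * x i (d i l2) h p)"
    by (simp add: elim_coeff_def pivot_def sum_distrib_left mult.assoc)
  also have "\<dots> = (\<Sum>l2\<in>L i. (\<Sum>l1\<in>L i. pivot i p l l1 * minv (L i) (pivot i p) l1 l2) * x i (d i l2) h p)"
    by (subst sum.swap) (simp add: sum_distrib_right)
  also have "\<dots> = (\<Sum>l2\<in>L i. if l2 = l then x i (d i l2) h p else 0)"
    using minv(1)[OF fin(4)[OF i] assms(2) assms(3)] by (intro sum.cong) auto
  also have "\<dots> = x i (d i l) h p" using assms fin(4)[OF i] by simp
  finally show ?thesis by (simp add: elim_col_def)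
qed

lemma schur:
  assumes "i < m" "mdet (L i) (pivot i p) \<noteq> 0" "rk_le (\<lambda>b a. V.ent (i, b, a) p) (T (Suc i)) (T i) r"
  shows "card (L i) \<le> r" "rk_le (\<lambda>b h. S (i, b, h) p) (H (Suc i)) (H i) (r - card (L i))"
proof -
  have i: "i \<le> m" "Suc i \<le> m" using assms by auto
  note * = rk_le_schur[OF assms(3) fin(4)[OF i(1)] sub_T(3)[OF i(1)] _ fin(3)[OF i(1)] sub_T(2)[OF i(1)],
      of "d i" "minv (L i) (pivot i p)" "\<lambda>b h. elim_col i b h p" "\<lambda>l h. elim_coeff i l h p"]
  have 1: "d i ` L i \<subseteq> T (Suc i)" using d_T assms(1) by blast
  have 2: "(\<Sum>l'\<in>L i. minv (L i) (pivot i p) l l' * V.ent (i, d i l', l'') p) = of_bool (l = l'')"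
    if "l \<in> L i" "l'' \<in> L i" for l l''
    using minv(2)[OF fin(4)[OF i(1)] assms(2) that] by (simp add: pivot_def x_def)
  have y: "elim_col i b h p = V.ent (i, b, h) p - (\<Sum>l\<in>L i. V.ent (i, b, l) p * elim_coeff i l h p)" for b h
    by (simp add: elim_col_def x_def)
  show "card (L i) \<le> r"
    by (rule *(1)[OF 1]) (erule (1) 2, rule y, erule elim_col_d[OF assms(1,2)])
  have "rk_le (\<lambda>b h. elim_col i b h p) (T (Suc i)) (H i) (r - card (L i))"
    by (rule *(2)[OF 1]) (erule (1) 2, rule y, erule elim_col_d[OF assms(1,2)])
  then show "rk_le (\<lambda>b h. S (i, b, h) p) (H (Suc i)) (H i) (r - card (L i))"
    unfolding S_def prod.case by (rule rk_le_mono[OF _ sub_T(2)[OF i(2)] subset_refl])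
qed

text \<open>Elimination is a column operation on \<open>p i\<close>, so it commutes with
  multiplication by the next map and only combines entries of the product.\<close>

lemma quad_elim_col:
  assumes "Suc i < m"
  shows "(\<Sum>b\<in>T (Suc i). x (Suc i) c b p * elim_col i b h p) = V.quad i c h p - (\<Sum>l\<in>L i. V.quad i c l p * elim_coeff i l h p)"
proof -
  have "(\<Sum>b\<in>T (Suc i). x (Suc i) c b p * elim_col i b h p) =
    (\<Sum>b\<in>T (Suc i). x (Suc i) c b p * x i b h p) - (\<Sum>b\<in>T (Suc i). \<Sum>l\<in>L i. x (Suc i) c b p * x i b l p * elim_coeff i l h p)"
    by (simp add: elim_col_def right_diff_distrib sum_subtractf sum_distrib_left mult.assoc)
  also have "(\<Sum>b\<in>T (Suc i). \<Sum>l\<in>L i. x (Suc i) c b p * x i b l p * elim_coeff i l h p) = (\<Sum>l\<in>L i. V.quad i c l p * elim_coeff i l h p)"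
    by (subst sum.swap) (simp add: V.quad_def x_def sum_distrib_right)
  finally show ?thesis by (simp add: V.quad_def x_def)
qed

section \<open>The construction at D\<close>

lemma x_D: "i < m \<Longrightarrow> b \<in> T (Suc i) \<Longrightarrow> a \<in> T i \<Longrightarrow> x i b a D = of_bool (a \<in> L i \<and> b = d i a)"
  by (simp add: x_def D_ent)

lemma pivot_D: "i \<le> m \<Longrightarrow> l \<in> L i \<Longrightarrow> l' \<in> L i \<Longrightarrow> pivot i D l l' = of_bool (l = l')"
  using L_lt[of i l] d_T[of i l] sub_T(3)[of i] d_inj[of i l l'] by (auto simp: pivot_def x_D)

lemma mdet_pivot_D: "i \<le> m \<Longrightarrow> mdet (L i) (pivot i D) = 1"
  by (rule mdet_id) (auto simp: fin pivot_D)

lemma elim_coeff_D: "i \<le> m \<Longrightarrow> h \<in> H i \<Longrightarrow> elim_coeff i l h D = 0"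
  unfolding elim_coeff_def
proof (rule sum.neutral, rule ballI)
  fix l' assume i: "i \<le> m" "h \<in> H i" "l' \<in> L i"
  then have im: "i < m" using L_lt by blast
  have "h \<notin> L i" using i disj(3) by blast
  then show "minv (L i) (pivot i D) l l' * x i (d i l') h D = 0"
    using x_D[OF im d_T[OF im i(3)], of h] i sub_T(2)[of i] by auto
qed

text \<open>At \<open>D\<close> the elimination coefficients vanish, and the frame column at
  \<open>d l\<close> is the image of the basis vector \<open>l\<close>, which is the basis vector
  \<open>d l\<close>. Hence the frame is invertible near \<open>D\<close>.\<close>

lemma frame_D:
  assumes "i \<le> m" "a \<in> T i" "b \<in> T i" shows "frame i D b a = of_bool (b = a)"
proof -
  consider "a \<in> L i" | "a \<in> H i" "a \<notin> L i" | "a \<in> B i" "a \<notin> L i" "a \<notin> H i"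
    using T_eq assms disj[OF assms(1)] by blast
  then show ?thesis
  proof cases
    case 3
    obtain j l where j: "i = Suc j" "j < m" "l \<in> L j" "a = d j l" using B_dE[OF 3(1) assms(1)] by blast
    have "l \<in> T j" using j sub_T(3)[of j] by auto
    then have "x j b l D = of_bool (b = a)" using x_D[of j b l] j assms by simp
    then show ?thesis using 3 j by (simp add: frame_def dinv_d)
  qed (use assms elim_coeff_D in \<open>auto simp: frame_def\<close>)
qed

lemma mdet_frame_D: "i \<le> m \<Longrightarrow> mdet (T i) (frame i D) = 1"
  by (rule mdet_id) (auto simp: fin frame_D)

text \<open>\<open>conj_pt p\<close> is the conjugate of \<open>D\<close> by the frame, computed
  entry by entry; it lies on the orbit even when \<open>p\<close> itself is not a complex.\<close>

lemma conj_pt_stratum: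
  assumes p: "\<And>i. i \<le> m \<Longrightarrow> mdet (T i) (frame i p) \<noteq> 0"
  shows "conj_pt p \<in> stratum m V D"
proof -
  obtain g where g: "g \<in> gl m V"
    "\<And>i a b. i \<le> m \<Longrightarrow> a \<in> T i \<Longrightarrow> b \<in> T i \<Longrightarrow> \<epsilon> i b (g i (V.un i a)) = frame i p b a"
    "\<And>i a b. i \<le> m \<Longrightarrow> a \<in> T i \<Longrightarrow> b \<in> T i \<Longrightarrow>
      \<epsilon> i b (the_inv_into (carrier (V i)) (g i) (V.un i a)) = minv (T i) (frame i p) b a"
    by (rule V.gl_matrix[of "\<lambda>i. frame i p" "\<lambda>i. minv (T i) (frame i p)"])
      (use minv[OF fin(1) p] in blast)+
  have "gl_act m V g D = conj_pt p"
  proof (rule V.M.x_eqI[OF V.gl_act_closed[OF g(1) D]])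
    show "conj_pt p \<in> carrier M" by (simp add: conj_pt_def V.M.pt)
    fix j assume "j \<in> V.idx"
    then obtain i b a where j: "j = (i, b, a)" "i < m" "b \<in> T (Suc i)" "a \<in> T i" by (auto simp: V.idx_def)
    have i: "i \<le> m" "Suc i \<le> m" using j by auto
    have "V.ent j (gl_act m V g D) = (\<Sum>b'\<in>T (Suc i). \<Sum>a'\<in>T i. frame (Suc i) p b b' * V.ent (i, b', a') D * minv (T i) (frame i p) a' a)"
      unfolding j(1) V.ent_gl_act[OF g(1) D j(2-4)] using g(2)[OF i(2) _ j(3)] g(3)[OF i(1) j(4)]
      by (intro sum.cong refl) auto
    also have "\<dots> = (\<Sum>a'\<in>T i. \<Sum>b'\<in>T (Suc i). if a' \<in> L i \<and> b' = d i a' then frame (Suc i) p b b' * minv (T i) (frame i p) a' a else 0)"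
      by (subst sum.swap) (use j in \<open>auto intro!: sum.cong simp: D_ent\<close>)
    also have "\<dots> = (\<Sum>a'\<in>T i. if a' \<in> L i then frame (Suc i) p b (d i a') * minv (T i) (frame i p) a' a else 0)"
    proof (intro sum.cong refl)
      fix a' assume "a' \<in> T i"
      show "(\<Sum>b'\<in>T (Suc i). if a' \<in> L i \<and> b' = d i a' then frame (Suc i) p b b' * minv (T i) (frame i p) a' a else 0)
        = (if a' \<in> L i then frame (Suc i) p b (d i a') * minv (T i) (frame i p) a' a else 0)"
        using fin(1)[OF i(2)] d_T[OF j(2), of a'] by (cases "a' \<in> L i") auto
    qed
    also have "\<dots> = (\<Sum>l\<in>L i. frame (Suc i) p b (d i l) * minv (T i) (frame i p) l a)"
      using fin(1)[OF i(1)] sub_T(3)[OF i(1)] by (intro sum.mono_neutral_cong_right) auto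
    also have "\<dots> = conj_ent i b a p"
      unfolding conj_ent_def
    proof (intro sum.cong refl)
      fix l assume l: "l \<in> L i"
      \<comment> \<open>The frame was built so that its column at \<open>d i l\<close> is the image
        of the basis vector \<open>l\<close> under \<open>p\<close>.\<close>
      have "d i l \<notin> L (Suc i)" "d i l \<notin> H (Suc i)" using d_mem[OF j(2) l] disj[OF i(2)] by blast+
      then have "frame (Suc i) p b (d i l) = x i b l p" using dinv_d[OF j(2) l] by (simp add: frame_def)
      then show "frame (Suc i) p b (d i l) * minv (T i) (frame i p) l a = x i b l p * minv (T i) (frame i p) l a" by simp
    qed
    also have "\<dots> = V.ent j (conj_pt p)" using j V.M.pt(2)[of j] by (simp add: conj_pt_def V.idx_iff)
    finally show "V.ent j (gl_act m V g D) = V.ent j (conj_pt p)" .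
  qed
  then show ?thesis unfolding stratum_def using g(1) by (metis image_eqI)
qed

lemma D_rank: "i < m \<Longrightarrow> rk_le (\<lambda>b a. V.ent (i, b, a) D) (T (Suc i)) (T i) (card (L i))"
proof (rule rk_le_card[of "L i"])
  assume i: "i < m"
  show "finite (L i)" using fin i by simp
  fix b a assume ba: "b \<in> T (Suc i)" "a \<in> T i"
  have "(\<Sum>l\<in>L i. of_bool (b = d i l) * of_bool (l = a)) = (\<Sum>l\<in>L i. if l = a then of_bool (b = d i l) else (0::'k))"
    by (intro sum.cong) auto
  then show "V.ent (i, b, a) D = (\<Sum>l\<in>L i. of_bool (b = d i l) * of_bool (l = a))"
    using D_ent[OF i ba] \<open>finite (L i)\<close> by (auto simp: of_bool_def)
qed simp

text \<open>The lower bound comes from \<open>schur\<close>: an invertible pivot block forces the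
  rank to be at least its size.\<close>

lemma ranks_D: "i < m \<Longrightarrow> ranks m V D (Suc i) = card (L i)"
proof -
  assume i: "i < m"
  have "lin_rank (V i) (V (Suc i)) (D i) \<le> card (L i)" using V.rank_iff[OF D i] D_rank[OF i] by simp
  moreover have "card (L i) \<le> lin_rank (V i) (V (Suc i)) (D i)"
  proof (rule schur(1)[OF i])
    show "mdet (L i) (pivot i D) \<noteq> 0" using mdet_pivot_D[of i] i by simp
    show "rk_le (\<lambda>b a. V.ent (i, b, a) D) (T (Suc i)) (T i) (lin_rank (V i) (V (Suc i)) (D i))"
      using V.rank_iff[OF D i, of "lin_rank (V i) (V (Suc i)) (D i)"] by blast
  qed
  ultimately show ?thesis using i by (simp add: ranks_def)
qed

lemma stratum_carrier: "stratum m V D \<subseteq> carrier M"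
  using V.gl_act_closed D by (auto simp: stratum_def)

lemma stratum_rank:
  "p \<in> stratum m V D \<Longrightarrow> i < m \<Longrightarrow> rk_le (\<lambda>b a. V.ent (i, b, a) p) (T (Suc i)) (T i) (card (L i))"
  using V.gl_act_rank[OF _ D _ D_rank] by (auto simp: stratum_def)

text \<open>The frame at \<open>D\<close> is the identity, so conjugation by it returns
  \<open>D\<close>.\<close>

lemma stratum_self: "D \<in> stratum m V D"
proof -
  have "conj_pt D \<in> stratum m V D" by (rule conj_pt_stratum) (simp add: mdet_frame_D)
  moreover have "conj_pt D = D"
  proof (rule V.M.x_eqI[OF _ D])
    show "conj_pt D \<in> carrier M" by (simp add: conj_pt_def V.M.pt)
    fix j assume "j \<in> V.idx"
    then obtain i b a where j: "j = (i, b, a)" "i < m" "b \<in> T (Suc i)" "a \<in> T i" by (auto simp: V.idx_def)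
    have i: "i \<le> m" using j by simp
    have "conj_ent i b a D = (\<Sum>l\<in>L i. if l = a then of_bool (b = d i l) else 0)"
      unfolding conj_ent_def using j i sub_T(3)[OF i]
      by (intro sum.cong) (auto simp: x_D minv_id[OF fin(1) frame_D] subset_iff)
    also have "\<dots> = V.ent j D" using j D_ent fin(4)[OF i] by auto
    finally show "V.ent j (conj_pt D) = V.ent j D" using j V.M.pt(2)[of j] by (simp add: conj_pt_def V.idx_iff)
  qed
  ultimately show ?thesis by simp
qed

section \<open>The affine slice through D\<close>

lemma e_closed: "e E \<in> carrier M" by (simp add: e_def V.M.pt)

lemma ent_e: "i < m \<Longrightarrow> b \<in> T (Suc i) \<Longrightarrow> a \<in> T i \<Longrightarrow>
  V.ent (i, b, a) (e E) = of_bool (a \<in> L i \<and> b = d i a) + (if b \<in> H (Suc i) \<and> a \<in> H i then W.ent (i, b, a) E else 0)"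
  using V.M.pt(2)[of "(i, b, a)"] by (simp add: e_def V.idx_iff)

lemma e_zero: "e \<zero>\<^bsub>N\<^esub> = D"
proof (rule V.M.x_eqI[OF e_closed D])
  fix j assume "j \<in> V.idx"
  then obtain i b a where j: "j = (i, b, a)" "i < m" "b \<in> T (Suc i)" "a \<in> T i" by (auto simp: V.idx_def)
  have "W.ent (i, b, a) \<zero>\<^bsub>N\<^esub> = 0" if "b \<in> H (Suc i)" "a \<in> H i"
    using that j W.M.x_zero[of "(i, b, a)"] by (simp add: W.idx_iff)
  then show "V.ent j (e \<zero>\<^bsub>N\<^esub>) = V.ent j D" using j ent_e D_ent by simp
qed

text \<open>On the slice the columns \<open>H i\<close> are zero in the rows
  \<open>B (i + 1)\<close>, so nothing has to be eliminated.\<close>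

lemma elim_coeff_e:
  assumes "i < m" "h \<in> H i" shows "elim_coeff i l h (e E) = 0"
  unfolding elim_coeff_def
proof (rule sum.neutral, rule ballI)
  fix l' assume l': "l' \<in> L i"
  have "h \<notin> L i" "h \<in> T i" using assms disj(3)[of i] sub_T(2)[of i] by auto
  moreover have "d i l' \<notin> H (Suc i)" using d_mem[OF assms(1) l'] disj(1)[of "Suc i"] assms(1) by auto
  ultimately have "x i (d i l') h (e E) = 0" using ent_e[OF assms(1) d_T[OF assms(1) l']] by (simp add: x_def)
  then show "minv (L i) (pivot i (e E)) l l' * x i (d i l') h (e E) = 0" by simp
qed

lemma S_e: "(i, b, h) \<in> W.idx \<Longrightarrow> S (i, b, h) (e E) = W.ent (i, b, h) E"
proof -
  assume "(i, b, h) \<in> W.idx"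
  then have i: "i < m" "b \<in> H (Suc i)" "h \<in> H i" by (auto simp: W.idx_iff)
  have "h \<notin> L i" "h \<in> T i" "b \<in> T (Suc i)" using i disj(3)[of i] sub_T(2)[of i] sub_T(2)[of "Suc i"] by auto
  then show ?thesis using i ent_e[OF i(1)] elim_coeff_e[OF i(1,3)] by (simp add: S_def elim_col_def x_def)
qed

text \<open>The block of \<open>D\<close> maps \<open>L i\<close> into \<open>B (i + 1)\<close>, on
  which every map of the slice vanishes, and the block of \<open>E\<close> maps \<open>H i\<close>
  into \<open>H (i + 1)\<close>. Hence only products of two blocks of \<open>E\<close>
  survive.\<close>

lemma quad_e:
  assumes i: "Suc i < m" and ca: "c \<in> T (Suc (Suc i))" "a \<in> T i"
  shows "V.quad i c a (e E) = (if c \<in> H (Suc (Suc i)) \<and> a \<in> H i then W.quad i c a E else 0)"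
proof -
  have im: "i < m" "i \<le> m" "Suc i \<le> m" "Suc (Suc i) \<le> m" using i by auto
  have t: "V.ent (Suc i, c, b) (e E) * V.ent (i, b, a) (e E) =
    (if b \<in> H (Suc i) then (if c \<in> H (Suc (Suc i)) \<and> a \<in> H i then W.ent (Suc i, c, b) E * W.ent (i, b, a) E else 0) else 0)"
    if b: "b \<in> T (Suc i)" for b
  proof (cases "a \<in> L i")
    case True
    then have "a \<notin> H i" using disj(3)[OF im(2)] by blast
    moreover have "d i a \<notin> L (Suc i)" "d i a \<notin> H (Suc i)" using d_mem[OF im(1) True] disj[OF im(3)] by blast+
    ultimately show ?thesis using ent_e[OF i ca(1) b] ent_e[OF im(1) b ca(2)] by auto
  next
    case False
    then show ?thesis using ent_e[OF i ca(1) b] ent_e[OF im(1) b ca(2)] disj(3)[OF im(3)] by auto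
  qed
  have "V.quad i c a (e E) = (\<Sum>b\<in>T (Suc i). if b \<in> H (Suc i) then (if c \<in> H (Suc (Suc i)) \<and> a \<in> H i then W.ent (Suc i, c, b) E * W.ent (i, b, a) E else 0) else 0)"
    unfolding V.quad_def by (rule sum.cong[OF refl t])
  also have "\<dots> = (\<Sum>b\<in>H (Suc i). if c \<in> H (Suc (Suc i)) \<and> a \<in> H i then W.ent (Suc i, c, b) E * W.ent (i, b, a) E else 0)"
    using fin(1)[OF im(3)] sub_T(2)[OF im(3)] by (intro sum.mono_neutral_cong_right) auto
  finally have "V.quad i c a (e E) = (\<Sum>b\<in>H (Suc i). if c \<in> H (Suc (Suc i)) \<and> a \<in> H i then W.ent (Suc i, c, b) E * W.ent (i, b, a) E else 0)" .
  then show ?thesis by (auto simp: W.quad_def)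
qed

text \<open>The matrix is a block sum of a permutation block of size \<open>card (L i)\<close> and
  the block of \<open>E\<close>; their factorizations are joined over the disjoint sum of the index
  sets.\<close>

lemma e_rank:
  assumes i: "i < m" and rk: "rk_le (\<lambda>b a. W.ent (i, b, a) E) (H (Suc i)) (H i) k"
  shows "rk_le (\<lambda>b a. V.ent (i, b, a) (e E)) (T (Suc i)) (T i) (card (L i) + k)"
proof -
  obtain u w where uw: "\<And>b a. b \<in> H (Suc i) \<Longrightarrow> a \<in> H i \<Longrightarrow> W.ent (i, b, a) E = (\<Sum>t<k. u b t * w t a)"
    using rk unfolding rk_le_def by blast
  have finL: "finite (L i)" using fin i by simp
  show ?thesis
  proof (rule rk_le_card)
    show "finite (L i <+> {..<k})" "card (L i <+> {..<k}) \<le> card (L i) + k"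
      using finL by (auto simp: card_Plus)
    fix b a assume ba: "b \<in> T (Suc i)" "a \<in> T i"
    let ?u = "\<lambda>b t. case t of Inl l \<Rightarrow> of_bool (b = d i l) | Inr t \<Rightarrow> if b \<in> H (Suc i) then u b t else 0"
    let ?w = "\<lambda>t a. case t of Inl l \<Rightarrow> of_bool (l = a) | Inr t \<Rightarrow> if a \<in> H i then w t a else 0"
    have "(\<Sum>t\<in>L i <+> {..<k}. ?u b t * ?w t a) = (\<Sum>l\<in>L i. of_bool (b = d i l) * of_bool (l = a))
      + (\<Sum>t<k. (if b \<in> H (Suc i) then u b t else 0) * (if a \<in> H i then w t a else 0))"
      using finL by (simp add: sum.Plus)
    also have "(\<Sum>l\<in>L i. of_bool (b = d i l) * of_bool (l = a)) = (\<Sum>l\<in>L i. if l = a then of_bool (b = d i l) else (0::'k))"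
      by (intro sum.cong) auto
    also have "\<dots> = of_bool (a \<in> L i \<and> b = d i a)" using finL by auto
    also have "(\<Sum>t<k. (if b \<in> H (Suc i) then u b t else 0) * (if a \<in> H i then w t a else 0))
      = (if b \<in> H (Suc i) \<and> a \<in> H i then W.ent (i, b, a) E else 0)"
      using uw by auto
    finally show "V.ent (i, b, a) (e E) = (\<Sum>t\<in>L i <+> {..<k}. ?u b t * ?w t a)"
      using ent_e[OF i ba] by simp
  qed
qed

lemma e_poly:
  assumes "f \<in> carrier (poly_ring M)"
  shows "(\<lambda>q\<in>carrier N. f (e q)) \<in> carrier (poly_ring N)"
  using assms
proof (induction rule: V.M.A_induct)
  case (const c)
  then show ?case using W.M.A_const[of c] by (simp add: e_closed flip: restrict_def)
next
  case (coord j)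
  then obtain i b a where j: "j = (i, b, a)" "i < m" "b \<in> T (Suc i)" "a \<in> T i" by (auto simp: V.idx_def)
  have "(\<lambda>q\<in>carrier N. (\<lambda>q\<in>carrier N. of_bool (a \<in> L i \<and> b = d i a)) q + (\<lambda>q\<in>carrier N. if b \<in> H (Suc i) \<and> a \<in> H i then W.ent (i, b, a) q else 0) q) \<in> carrier (poly_ring N)"
  proof (intro W.M.A_add W.M.A_const)
    show "(\<lambda>q\<in>carrier N. if b \<in> H (Suc i) \<and> a \<in> H i then W.ent (i, b, a) q else 0) \<in> carrier (poly_ring N)"
    proof (cases "b \<in> H (Suc i) \<and> a \<in> H i")
      case True
      then show ?thesis using W.M.A_coord[of "(i, b, a)"] j(2) by (simp add: W.idx_iff flip: restrict_def)
    next
      case False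
      show ?thesis unfolding if_not_P[OF False] by (rule W.M.A_const)
    qed
  qed
  then show ?case using j ent_e by (simp add: e_closed flip: restrict_def cong: restrict_cong)
next
  case (add f g)
  then show ?case using W.M.A_add[OF add(3,4)] by (simp add: e_closed flip: restrict_def cong: restrict_cong)
next
  case (mult f g)
  then show ?case using W.M.A_mult[OF mult(3,4)] by (simp add: e_closed flip: restrict_def cong: restrict_cong)
qed

end

text \<open>What the two cases share: the ideal contains the entries of the product matrices and
  vanishes on the orbit. Through these two facts \<open>I\<close> enters the proof that the Schur
  entries generate the orbit ideal.\<close>

locale split_ideal = split_complex m V T \<epsilon> W H \<eta> B L d D
    + P: local_point "hom_gr1 m V" "graded_coords.idx m T" "graded_coords.ent V T \<epsilon>" I D
  for m and V :: "nat \<Rightarrow> ('k::field_char_0, 'v) module" and T :: "nat \<Rightarrow> 'b set" and \<epsilon>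
    and W :: "nat \<Rightarrow> ('k, 'w) module" and H :: "nat \<Rightarrow> 'b set" and \<eta> and B L d D I +
  assumes quad_I: "Suc i < m \<Longrightarrow> c \<in> T (Suc (Suc i)) \<Longrightarrow> a \<in> T i \<Longrightarrow>
      (\<lambda>f\<in>carrier (hom_gr1 m V). V.quad i c a f) \<in> I"
    and I_stratum: "f \<in> I \<Longrightarrow> p \<in> stratum m V D \<Longrightarrow> f p = 0"
begin

section \<open>Regularity near D\<close>

lemma x_Reg: "i < m \<Longrightarrow> b \<in> T (Suc i) \<Longrightarrow> a \<in> T i \<Longrightarrow> x i b a \<in> P.Reg"
  using P.Reg_coord[of "(i, b, a)"] by (simp add: x_def[abs_def] V.idx_iff)

lemma quad_locI: "Suc i < m \<Longrightarrow> c \<in> T (Suc (Suc i)) \<Longrightarrow> a \<in> T i \<Longrightarrow> V.quad i c a \<in> P.locI"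
  using P.locI_restrict[OF quad_I] by simp

lemma pivot_Reg:
  assumes "i \<le> m" "l \<in> L i" "l' \<in> L i" shows "(\<lambda>p. pivot i p l l') \<in> P.Reg"
  unfolding pivot_def using x_Reg[of i "d i l" l'] L_lt[OF assms(1,2)] d_T sub_T(3)[OF assms(1)] assms by auto

lemma ninv_Reg: "i \<le> m \<Longrightarrow> l \<in> L i \<Longrightarrow> l' \<in> L i \<Longrightarrow> (\<lambda>p. minv (L i) (pivot i p) l l') \<in> P.Reg"
  by (rule P.Reg_minv) (auto simp: fin pivot_Reg mdet_pivot_D)

lemma ok_pivot: "i \<le> m \<Longrightarrow> \<forall>\<^sub>F p in P.zar. mdet (L i) (pivot i p) \<noteq> 0"
  by (rule P.Reg_nonzero[OF P.Reg_mdet]) (auto simp: fin pivot_Reg mdet_pivot_D)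

lemma elim_coeff_Reg:
  assumes "i \<le> m" "l \<in> L i" "h \<in> T i" shows "elim_coeff i l h \<in> P.Reg"
proof -
  have "(\<lambda>p. \<Sum>l'\<in>L i. minv (L i) (pivot i p) l l' * x i (d i l') h p) \<in> P.Reg"
    using assms L_lt by (intro P.Reg_sum P.Reg_mult ninv_Reg x_Reg d_T) auto
  then show ?thesis by (simp add: elim_coeff_def[abs_def])
qed

lemma elim_col_Reg:
  assumes "i < m" "b \<in> T (Suc i)" "h \<in> T i" shows "elim_col i b h \<in> P.Reg"
proof -
  have "(\<lambda>p. x i b h p - (\<Sum>l\<in>L i. x i b l p * elim_coeff i l h p)) \<in> P.Reg"
    using assms sub_T(3)[of i] by (intro P.Reg_diff P.Reg_sum P.Reg_mult x_Reg elim_coeff_Reg) auto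
  then show ?thesis by (simp add: elim_col_def[abs_def])
qed

text \<open>Near \<open>D\<close> the pivot block is invertible over the regular functions, so a
  linear system with this matrix can be solved inside any ideal.\<close>

lemma solve:
  assumes b: "P.reg_ideal b" and i: "i \<le> m"
    and v: "\<And>l. l \<in> L i \<Longrightarrow> (\<lambda>p. \<Sum>l'\<in>L i. pivot i p l l' * v l' p) \<in> b" and l: "l \<in> L i"
  shows "v l \<in> b"
proof (rule P.reg_ideal_cong[OF b])
  show "(\<lambda>p. \<Sum>l1\<in>L i. minv (L i) (pivot i p) l l1 * (\<Sum>l'\<in>L i. pivot i p l1 l' * v l' p)) \<in> b"
    by (rule P.reg_ideal_sum[OF b], rule P.reg_ideal_mult_left[OF b v ninv_Reg[OF i l]])
  show "\<forall>\<^sub>F p in P.zar. (\<Sum>l1\<in>L i. minv (L i) (pivot i p) l l1 * (\<Sum>l'\<in>L i. pivot i p l1 l' * v l' p)) = v l p"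
    using ok_pivot[OF i]
  proof eventually_elim
    fix p assume nz: "mdet (L i) (pivot i p) \<noteq> 0"
    have "(\<Sum>l1\<in>L i. minv (L i) (pivot i p) l l1 * (\<Sum>l'\<in>L i. pivot i p l1 l' * v l' p))
      = (\<Sum>l'\<in>L i. (\<Sum>l1\<in>L i. minv (L i) (pivot i p) l l1 * pivot i p l1 l') * v l' p)"
      by (simp add: sum_distrib_left sum_distrib_right mult.assoc) (rule sum.swap)
    also have "\<dots> = (\<Sum>l'\<in>L i. if l' = l then v l' p else 0)"
      using minv(2)[OF fin(4)[OF i] nz l] by (intro sum.cong) auto
    finally show "(\<Sum>l1\<in>L i. minv (L i) (pivot i p) l l1 * (\<Sum>l'\<in>L i. pivot i p l1 l' * v l' p)) = v l p"
      using l fin(4)[OF i] by simp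
  qed
qed

text \<open>The next map sends an eliminated column to zero modulo \<open>I\<close>, and the rows
  \<open>B (i + 1)\<close> of that column vanish near \<open>D\<close>; the rows in \<open>H\<close>
  and \<open>L\<close> remain.\<close>

lemma E2_locI:
  assumes i: "Suc i < m" and c: "c \<in> T (Suc (Suc i))" and h: "h \<in> T i"
  shows "(\<lambda>p. (\<Sum>b\<in>H (Suc i). x (Suc i) c b p * elim_col i b h p) + (\<Sum>l\<in>L (Suc i). x (Suc i) c l p * elim_col i l h p)) \<in> P.locI"
proof (rule P.locI_cong)
  have im: "i < m" "i \<le> m" "Suc i \<le> m" using i by auto
  show "(\<lambda>p. V.quad i c h p - (\<Sum>l\<in>L i. V.quad i c l p * elim_coeff i l h p)) \<in> P.locI"
    using i c h im sub_T(3)[OF im(2)]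
    by (intro P.reg_ideal_diff[OF P.reg_ideal_locI] P.reg_ideal_sum[OF P.reg_ideal_locI] P.locI_mult quad_locI elim_coeff_Reg) auto
  show "\<forall>\<^sub>F p in P.zar. V.quad i c h p - (\<Sum>l\<in>L i. V.quad i c l p * elim_coeff i l h p)
    = (\<Sum>b\<in>H (Suc i). x (Suc i) c b p * elim_col i b h p) + (\<Sum>l\<in>L (Suc i). x (Suc i) c l p * elim_col i l h p)"
    using ok_pivot[OF im(2)]
  proof eventually_elim
    fix p assume nz: "mdet (L i) (pivot i p) \<noteq> 0"
    have "(\<Sum>b\<in>B (Suc i). x (Suc i) c b p * elim_col i b h p) = 0"
      unfolding sum_B[OF im(1)] using elim_col_d[OF im(1) nz] by simp
    then show "V.quad i c h p - (\<Sum>l\<in>L i. V.quad i c l p * elim_coeff i l h p)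
      = (\<Sum>b\<in>H (Suc i). x (Suc i) c b p * elim_col i b h p) + (\<Sum>l\<in>L (Suc i). x (Suc i) c l p * elim_col i l h p)"
      by (simp add: quad_elim_col[OF i, symmetric] sum_T[OF im(3)])
  qed
qed

text \<open>The relation of \<open>E2_locI\<close> reads \<open>PP c\<close> plus the sum of the
  \<open>x c l * w l\<close>. In the pivot rows \<open>PP\<close> vanishes near \<open>D\<close>, so
  inverting the pivot block puts each \<open>w l\<close> into \<open>locI\<close>; the relation then
  leaves \<open>PP c\<close> in \<open>locI\<close> for every row \<open>c\<close>. The conclusion
  holds modulo \<open>I\<close> and not only at points.\<close>

lemma SS_locI:
  assumes i: "Suc i < m" and c: "c \<in> T (Suc (Suc i))" and h: "h \<in> T i"
  shows "(\<lambda>p. \<Sum>b\<in>H (Suc i). elim_col (Suc i) c b p * elim_col i b h p) \<in> P.locI"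
proof -
  have im: "i < m" "i \<le> m" "Suc i \<le> m" "Suc (Suc i) \<le> m" using i by auto
  define PP where "PP c p = (\<Sum>b\<in>H (Suc i). elim_col (Suc i) c b p * elim_col i b h p)" for c p
  \<comment> \<open>The coefficient of column \<open>l\<close> once each \<open>x c b\<close> with
    \<open>b\<close> in \<open>H (i + 1)\<close> is written as \<open>elim_col c b\<close> plus
    multiples of the columns \<open>L (i + 1)\<close>.\<close>
  define w where "w l p = (\<Sum>b\<in>H (Suc i). elim_coeff (Suc i) l b p * elim_col i b h p) + elim_col i l h p" for l p
  have eq: "PP c p + (\<Sum>l\<in>L (Suc i). x (Suc i) c l p * w l p) =
    (\<Sum>b\<in>H (Suc i). x (Suc i) c b p * elim_col i b h p) + (\<Sum>l\<in>L (Suc i). x (Suc i) c l p * elim_col i l h p)" for c p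
  proof -
    have "(\<Sum>l\<in>L (Suc i). x (Suc i) c l p * (\<Sum>b\<in>H (Suc i). elim_coeff (Suc i) l b p * elim_col i b h p))
      = (\<Sum>b\<in>H (Suc i). (\<Sum>l\<in>L (Suc i). x (Suc i) c l p * elim_coeff (Suc i) l b p) * elim_col i b h p)"
      by (simp add: sum_distrib_left sum_distrib_right mult.assoc) (rule sum.swap)
    then show ?thesis
      by (simp add: PP_def w_def elim_col_def[of "Suc i"] distrib_left left_diff_distrib sum.distrib sum_subtractf)
  qed
  have E: "(\<lambda>p. PP c p + (\<Sum>l\<in>L (Suc i). x (Suc i) c l p * w l p)) \<in> P.locI" if "c \<in> T (Suc (Suc i))" for c
    using E2_locI[OF i that h] by (simp add: eq)
  have w: "w l \<in> P.locI" if "l \<in> L (Suc i)" for l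
  proof (rule solve[OF P.reg_ideal_locI im(3) _ that])
    fix l assume l: "l \<in> L (Suc i)"
    show "(\<lambda>p. \<Sum>l'\<in>L (Suc i). pivot (Suc i) p l l' * w l' p) \<in> P.locI"
    proof (rule P.locI_cong[OF E[OF d_T[OF i l]]])
      show "\<forall>\<^sub>F p in P.zar. PP (d (Suc i) l) p + (\<Sum>l'\<in>L (Suc i). x (Suc i) (d (Suc i) l) l' p * w l' p)
        = (\<Sum>l'\<in>L (Suc i). pivot (Suc i) p l l' * w l' p)"
        using ok_pivot[OF im(3)]
      proof eventually_elim
        fix p assume nz: "mdet (L (Suc i)) (pivot (Suc i) p) \<noteq> 0"
        have "PP (d (Suc i) l) p = 0" unfolding PP_def using elim_col_d[OF i nz l] by simp
        then show "PP (d (Suc i) l) p + (\<Sum>l'\<in>L (Suc i). x (Suc i) (d (Suc i) l) l' p * w l' p)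
          = (\<Sum>l'\<in>L (Suc i). pivot (Suc i) p l l' * w l' p)" by (simp add: pivot_def)
      qed
    qed
  qed
  have "(\<lambda>p. \<Sum>l\<in>L (Suc i). x (Suc i) c l p * w l p) \<in> P.locI"
    using w i c sub_T(3)[OF im(3)] by (intro P.reg_ideal_sum[OF P.reg_ideal_locI] P.reg_ideal_mult_left[OF P.reg_ideal_locI] x_Reg) auto
  from P.reg_ideal_diff[OF P.reg_ideal_locI E[OF c] this] show ?thesis by (simp add: PP_def)
qed

text \<open>In the pivot rows of degree \<open>i + 1\<close>, \<open>E2_locI\<close> expresses the
  pivot block applied to these entries through Schur entries, which lie in \<open>b\<close>.\<close>

lemma T_mem:
  assumes b: "P.reg_ideal b" and S: "\<And>j. j \<in> W.idx \<Longrightarrow> S j \<in> b"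
    and i: "i < m" and l: "l \<in> L (Suc i)" and h: "h \<in> H i"
  shows "elim_col i l h \<in> b"
proof -
  have im: "i \<le> m" "Suc i \<le> m" using i by auto
  have i': "Suc i < m" by (rule L_lt[OF im(2) l])
  show ?thesis
  proof (rule solve[OF b im(2) _ l])
    fix l assume l: "l \<in> L (Suc i)"
    have "(\<lambda>p. \<Sum>b\<in>H (Suc i). x (Suc i) (d (Suc i) l) b p * elim_col i b h p) \<in> b"
    proof (intro P.reg_ideal_sum[OF b] P.reg_ideal_mult_left[OF b])
      fix c assume c: "c \<in> H (Suc i)"
      show "x (Suc i) (d (Suc i) l) c \<in> P.Reg" using x_Reg[OF i' d_T[OF i' l]] c sub_T(2)[OF im(2)] by auto
      show "elim_col i c h \<in> b" using S[of "(i, c, h)"] i c h by (simp add: S_def W.idx_iff)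
    qed
    moreover have "(\<lambda>p. (\<Sum>b\<in>H (Suc i). x (Suc i) (d (Suc i) l) b p * elim_col i b h p) + (\<Sum>l'\<in>L (Suc i). x (Suc i) (d (Suc i) l) l' p * elim_col i l' h p)) \<in> b"
      using P.reg_ideal_locI_le[OF b E2_locI[OF i' d_T[OF i' l]]] h sub_T(2)[OF im(1)] by blast
    ultimately have "(\<lambda>p. ((\<Sum>b\<in>H (Suc i). x (Suc i) (d (Suc i) l) b p * elim_col i b h p) + (\<Sum>l'\<in>L (Suc i). x (Suc i) (d (Suc i) l) l' p * elim_col i l' h p))
       - (\<Sum>b\<in>H (Suc i). x (Suc i) (d (Suc i) l) b p * elim_col i b h p)) \<in> b"
      by (rule P.reg_ideal_diff[OF b, rotated])
    then show "(\<lambda>p. \<Sum>l'\<in>L (Suc i). pivot (Suc i) p l l' * elim_col i l' h p) \<in> b" by (simp add: pivot_def)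
  qed
qed

text \<open>In rows of \<open>B\<close> the entries vanish near \<open>D\<close>, in rows of
  \<open>H\<close> they are Schur entries, and rows of \<open>L\<close> are covered by
  \<open>T_mem\<close>.\<close>

lemma elim_col_mem:
  assumes b: "P.reg_ideal b" and S: "\<And>j. j \<in> W.idx \<Longrightarrow> S j \<in> b"
    and i: "i < m" and c: "c \<in> T (Suc i)" and h: "h \<in> H i"
  shows "elim_col i c h \<in> b"
proof -
  have im: "i \<le> m" "Suc i \<le> m" using i by auto
  consider "c \<in> B (Suc i)" | "c \<in> H (Suc i)" | "c \<in> L (Suc i)" using c T_eq[OF im(2)] by blast
  then show ?thesis
  proof cases
    case 1
    then obtain l where l: "l \<in> L i" "c = d i l" using B_dE[OF 1 im(2)] by auto
    have "elim_col i c h \<in> P.locI"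
      by (rule P.locI_eventually) (use ok_pivot[OF im(1)] elim_col_d[OF i _ l(1)] l in \<open>auto elim: eventually_mono\<close>)
    then show ?thesis by (rule P.reg_ideal_locI_le[OF b])
  next
    case 2
    then show ?thesis using S[of "(i, c, h)"] i h by (simp add: S_def W.idx_iff)
  next
    case 3
    show ?thesis by (rule T_mem[OF b S i 3 h])
  qed
qed

lemma frame_Reg:
  assumes "i \<le> m" "a \<in> T i" "b \<in> T i" shows "(\<lambda>p. frame i p b a) \<in> P.Reg"
proof -
  consider "a \<in> L i" | "a \<in> H i" "a \<notin> L i" | "a \<in> B i" "a \<notin> L i" "a \<notin> H i"
    using T_eq assms disj[OF assms(1)] by blast
  then show ?thesis
  proof cases
    case 1
    then show ?thesis using P.Reg_const by (simp add: frame_def)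
  next
    case 2
    have "(\<lambda>p. if b \<in> L i then elim_coeff i b a p else 0) \<in> P.Reg"
      using elim_coeff_Reg[OF assms(1) _ assms(2), of b] P.Reg_const[of 0] by (cases "b \<in> L i") auto
    from P.Reg_diff[OF P.Reg_const this] show ?thesis using 2 by (simp add: frame_def)
  next
    case 3
    obtain j l where j: "i = Suc j" "j < m" "l \<in> L j" "a = d j l" using B_dE[OF 3(1) assms(1)] by blast
    have "l \<in> T j" using j sub_T(3)[of j] by auto
    then show ?thesis using 3 j x_Reg[of j b l] assms by (simp add: frame_def dinv_d)
  qed
qed

lemma ginv_Reg: "i \<le> m \<Longrightarrow> a \<in> T i \<Longrightarrow> b \<in> T i \<Longrightarrow> (\<lambda>p. minv (T i) (frame i p) a b) \<in> P.Reg"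
  by (rule P.Reg_minv) (auto simp: fin frame_Reg mdet_frame_D)

lemma ok_frame: "i \<le> m \<Longrightarrow> \<forall>\<^sub>F p in P.zar. mdet (T i) (frame i p) \<noteq> 0"
  by (rule P.Reg_nonzero[OF P.Reg_mdet]) (auto simp: fin frame_Reg mdet_frame_D)

lemma conj_ent_Reg:
  assumes "i < m" "b \<in> T (Suc i)" "a \<in> T i" shows "conj_ent i b a \<in> P.Reg"
proof -
  have "(\<lambda>p. \<Sum>l\<in>L i. x i b l p * minv (T i) (frame i p) l a) \<in> P.Reg"
    using assms sub_T(3)[of i] by (intro P.Reg_sum P.Reg_mult x_Reg ginv_Reg) auto
  then show ?thesis by (simp add: conj_ent_def[abs_def])
qed

lemma conj_pt_eventually: "\<forall>\<^sub>F p in P.zar. conj_pt p \<in> stratum m V D"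
proof -
  have "\<forall>\<^sub>F p in P.zar. \<forall>i\<in>{..m}. mdet (T i) (frame i p) \<noteq> 0"
    by (rule eventually_ball_finite) (auto intro: ok_frame)
  then show ?thesis by eventually_elim (rule conj_pt_stratum, simp)
qed

text \<open>The sum is an entry of \<open>p\<close> times the frame, the subtracted term the same
  entry of the next frame times \<open>D\<close>. Columns in \<open>L i\<close> agree; in
  \<open>H i\<close> the difference is an eliminated column; in \<open>B i\<close> it is an entry of
  the product of \<open>p i\<close> with the preceding map.\<close>

lemma Z_mem:
  assumes b: "P.reg_ideal bb" and S: "\<And>j. j \<in> W.idx \<Longrightarrow> S j \<in> bb"
    and i: "i < m" and ba: "b \<in> T (Suc i)" "a \<in> T i"
  shows "(\<lambda>p. (\<Sum>c\<in>T i. x i b c p * frame i p c a) - (if a \<in> L i then x i b a p else 0)) \<in> bb"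
proof -
  have im: "i \<le> m" using i by simp
  consider "a \<in> L i" | "a \<in> H i" "a \<notin> L i" | "a \<in> B i" "a \<notin> L i" "a \<notin> H i"
    using T_eq[OF im] ba disj[OF im] by blast
  then show ?thesis
  proof cases
    case 1
    have "(\<Sum>c\<in>T i. x i b c p * frame i p c a) = (\<Sum>c\<in>T i. if c = a then x i b c p else 0)" for p
      using 1 by (intro sum.cong) (auto simp: frame_def)
    then show ?thesis using 1 ba fin(1)[OF im] P.reg_ideal_zero[OF b] by simp
  next
    case 2
    have "(\<Sum>c\<in>T i. x i b c p * frame i p c a) = elim_col i b a p" for p
    proof -
      have "(\<Sum>c\<in>T i. x i b c p * frame i p c a) = (\<Sum>c\<in>T i. (if c = a then x i b c p else 0) - (if c \<in> L i then x i b c p * elim_coeff i c a p else 0))"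
        using 2 by (intro sum.cong) (auto simp: frame_def algebra_simps)
      also have "\<dots> = x i b a p - (\<Sum>c\<in>T i. if c \<in> L i then x i b c p * elim_coeff i c a p else 0)"
        using ba fin(1)[OF im] by (simp add: sum_subtractf)
      also have "(\<Sum>c\<in>T i. if c \<in> L i then x i b c p * elim_coeff i c a p else 0) = (\<Sum>c\<in>L i. x i b c p * elim_coeff i c a p)"
        using fin(1)[OF im] sub_T(3)[OF im] by (intro sum.mono_neutral_cong_right) auto
      finally show ?thesis by (simp add: elim_col_def)
    qed
    then show ?thesis using 2 elim_col_mem[OF b S i ba(1) 2(1)] by simp
  next
    case 3
    obtain j l where j: "i = Suc j" "j < m" "l \<in> L j" "a = d j l" using B_dE[OF 3(1) im] by blast
    have l: "l \<in> T j" using j sub_T(3)[of j] by auto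
    have "(\<Sum>c\<in>T i. x i b c p * frame i p c a) = V.quad j b l p" for p
      using 3 j dinv_d[OF j(2,3)] by (simp add: frame_def V.quad_def x_def)
    then show ?thesis using 3 P.reg_ideal_locI_le[OF b quad_locI[of j b l]] i ba j l by simp
  qed
qed

text \<open>\<open>Z_mem\<close> multiplied on the right by the inverse frame.\<close>

lemma x_conj_ent_mem:
  assumes b: "P.reg_ideal bb" and S: "\<And>j. j \<in> W.idx \<Longrightarrow> S j \<in> bb"
    and i: "i < m" and ba: "b \<in> T (Suc i)" "a \<in> T i"
  shows "(\<lambda>p. x i b a p - conj_ent i b a p) \<in> bb"
proof (rule P.reg_ideal_cong[OF b])
  have im: "i \<le> m" using i by simp
  let ?Z = "\<lambda>c p. (\<Sum>c'\<in>T i. x i b c' p * frame i p c' c) - (if c \<in> L i then x i b c p else 0)"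
  show "(\<lambda>p. \<Sum>c\<in>T i. ?Z c p * minv (T i) (frame i p) c a) \<in> bb"
    using Z_mem[OF b S i ba(1)] ginv_Reg[OF im _ ba(2)]
    by (intro P.reg_ideal_sum[OF b] P.reg_ideal_mult[OF b]) auto
  show "\<forall>\<^sub>F p in P.zar. (\<Sum>c\<in>T i. ?Z c p * minv (T i) (frame i p) c a) = x i b a p - conj_ent i b a p"
    using ok_frame[OF im]
  proof eventually_elim
    fix p assume nz: "mdet (T i) (frame i p) \<noteq> 0"
    have "(\<Sum>c\<in>T i. (\<Sum>c'\<in>T i. x i b c' p * frame i p c' c) * minv (T i) (frame i p) c a)
      = (\<Sum>c'\<in>T i. x i b c' p * (\<Sum>c\<in>T i. frame i p c' c * minv (T i) (frame i p) c a))"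
      by (simp add: sum_distrib_left sum_distrib_right mult.assoc) (rule sum.swap)
    also have "\<dots> = (\<Sum>c'\<in>T i. if c' = a then x i b c' p else 0)"
      using minv(1)[OF fin(1)[OF im] nz _ ba(2)] by (intro sum.cong) auto
    also have "\<dots> = x i b a p" using ba fin(1)[OF im] by simp
    finally have 1: "(\<Sum>c\<in>T i. (\<Sum>c'\<in>T i. x i b c' p * frame i p c' c) * minv (T i) (frame i p) c a) = x i b a p" .
    have 2: "(\<Sum>c\<in>T i. (if c \<in> L i then x i b c p else 0) * minv (T i) (frame i p) c a) = conj_ent i b a p"
      unfolding conj_ent_def using fin(1)[OF im] sub_T(3)[OF im] by (intro sum.mono_neutral_cong_right) auto
    show "(\<Sum>c\<in>T i. ?Z c p * minv (T i) (frame i p) c a) = x i b a p - conj_ent i b a p"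
      by (simp add: left_diff_distrib sum_subtractf 1 2)
  qed
qed

text \<open>Polynomials in congruent entries are congruent. Regularity is carried along because in
  the product case a difference is multiplied by \<open>f (conj_pt p)\<close>.\<close>

lemma poly_conj_pt:
  assumes b: "P.reg_ideal b" and S: "\<And>j. j \<in> W.idx \<Longrightarrow> S j \<in> b" and f: "f \<in> carrier (poly_ring M)"
  shows "(\<lambda>p. f (conj_pt p)) \<in> P.Reg \<and> (\<lambda>p. f p - f (conj_pt p)) \<in> b"
  using f
proof (induction rule: V.M.A_induct)
  case (const c)
  have r: "conj_pt p \<in> carrier M" for p by (simp add: conj_pt_def V.M.pt)
  have "(\<lambda>p. (\<lambda>p\<in>carrier M. c) p - c) \<in> b"
    by (rule P.reg_ideal_cong[OF b P.reg_ideal_zero[OF b]]) (use P.eventually_carrier in \<open>eventually_elim, simp\<close>)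
  then show ?case using r P.Reg_const[of c] by simp
next
  case (coord j)
  have r: "conj_pt p \<in> carrier M" for p by (simp add: conj_pt_def V.M.pt)
  obtain i c a where j: "j = (i, c, a)" "i < m" "c \<in> T (Suc i)" "a \<in> T i" using coord by (auto simp: V.idx_def)
  have e: "V.ent j (conj_pt p) = conj_ent i c a p" for p using V.M.pt(2)[OF coord] j by (simp add: conj_pt_def)
  have "(\<lambda>p. (\<lambda>p\<in>carrier M. V.ent j p) p - conj_ent i c a p) \<in> b"
  proof (rule P.reg_ideal_cong[OF b x_conj_ent_mem[OF b S j(2-4)]])
    show "\<forall>\<^sub>F p in P.zar. x i c a p - conj_ent i c a p = (\<lambda>p\<in>carrier M. V.ent j p) p - conj_ent i c a p"
      using P.eventually_carrier by eventually_elim (simp add: x_def j)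
  qed
  then show ?case using r e conj_ent_Reg[OF j(2-4)] by simp
next
  case (add f g)
  have r: "conj_pt p \<in> carrier M" for p by (simp add: conj_pt_def V.M.pt)
  have "(\<lambda>p. (\<lambda>p\<in>carrier M. f p + g p) p - (f (conj_pt p) + g (conj_pt p))) \<in> b"
  proof (rule P.reg_ideal_cong[OF b P.reg_ideal_add[OF b conjunct2[OF add(3)] conjunct2[OF add(4)]]])
    show "\<forall>\<^sub>F p in P.zar. (f p - f (conj_pt p)) + (g p - g (conj_pt p)) = (\<lambda>p\<in>carrier M. f p + g p) p - (f (conj_pt p) + g (conj_pt p))"
      using P.eventually_carrier by eventually_elim simp
  qed
  then show ?case using r P.Reg_add[OF conjunct1[OF add(3)] conjunct1[OF add(4)]] by simp
next
  case (mult f g)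
  have r: "conj_pt p \<in> carrier M" for p by (simp add: conj_pt_def V.M.pt)
  have "(\<lambda>p. (\<lambda>p\<in>carrier M. f p * g p) p - (f (conj_pt p) * g (conj_pt p))) \<in> b"
  proof (rule P.reg_ideal_cong[OF b P.reg_ideal_add[OF b P.reg_ideal_mult[OF b conjunct2[OF mult(3)] P.Reg_poly[OF mult(2)]]
        P.reg_ideal_mult[OF b conjunct2[OF mult(4)] conjunct1[OF mult(3)]]]])
    show "\<forall>\<^sub>F p in P.zar. (f p - f (conj_pt p)) * g p + (g p - g (conj_pt p)) * f (conj_pt p) = (\<lambda>p\<in>carrier M. f p * g p) p - (f (conj_pt p) * g (conj_pt p))"
      using P.eventually_carrier by eventually_elim (simp add: algebra_simps)
  qed
  then show ?case using r P.Reg_mult[OF conjunct1[OF mult(3)] conjunct1[OF mult(4)]] by simp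
qed

text \<open>A polynomial \<open>q\<close> that vanishes on the orbit vanishes at
  \<open>conj_pt p\<close>, so near \<open>D\<close> it equals \<open>q p - q (conj_pt p)\<close>,
  which is in \<open>b\<close>. This puts the ideal of the reduced orbit into every ideal that
  contains the Schur entries.\<close>

lemma vanY_mem:
  assumes b: "P.reg_ideal b" and S: "\<And>j. j \<in> W.idx \<Longrightarrow> S j \<in> b" and f: "f \<in> P.vanY (stratum m V D)"
  shows "f \<in> b"
proof -
  have fR: "f \<in> P.Reg" and fY: "\<forall>\<^sub>F p in P.zar. p \<in> stratum m V D \<longrightarrow> f p = 0"
    using f by (auto simp: P.vanY_def)
  obtain a s where as: "a \<in> carrier (poly_ring M)" "s \<in> carrier (poly_ring M)" "s D \<noteq> 0" "\<And>p. p \<in> carrier M \<Longrightarrow> f p * s p = a p"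
    using P.RegE[OF fR] by blast
  obtain w where w: "w \<in> carrier (poly_ring M)" "w D \<noteq> 0" "\<And>p. p \<in> carrier M \<Longrightarrow> w p \<noteq> 0 \<Longrightarrow> p \<in> stratum m V D \<Longrightarrow> f p = 0"
    using fY unfolding P.eventually_zar by blast
  \<comment> \<open>The numerator \<open>a\<close> is known to vanish on the orbit only where
    \<open>w \<noteq> 0\<close>; the factor \<open>w\<close> makes it vanish on the whole orbit,
    hence at \<open>conj_pt p\<close>.\<close>
  define q where "q = (\<lambda>p\<in>carrier M. w p * a p)"
  have q: "q \<in> carrier (poly_ring M)" unfolding q_def by (rule V.M.A_mult[OF w(1) as(1)])
  have q0: "q p = 0" if "p \<in> stratum m V D" for p
  proof -
    have p: "p \<in> carrier M" using that stratum_carrier by blast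
    show ?thesis using w(3)[OF p _ that] as(4)[OF p, symmetric] p by (cases "w p = 0") (auto simp: q_def)
  qed
  have "q \<in> b"
  proof (rule P.reg_ideal_cong[OF b conjunct2[OF poly_conj_pt[OF b S q]]])
    show "\<forall>\<^sub>F p in P.zar. q p - q (conj_pt p) = q p" using conj_pt_eventually by eventually_elim (simp add: q0)
  qed
  from P.reg_ideal_mult[OF b this P.Reg_mult[OF P.Reg_inverse[OF P.Reg_poly[OF w(1)] w(2)] P.Reg_inverse[OF P.Reg_poly[OF as(2)] as(3)]]]
  show ?thesis
  proof (rule P.reg_ideal_cong[OF b])
    show "\<forall>\<^sub>F p in P.zar. q p * (inverse (w p) * inverse (s p)) = f p"
      using P.Reg_nonzero[OF P.Reg_poly[OF w(1)] w(2)] P.Reg_nonzero[OF P.Reg_poly[OF as(2)] as(3)] P.eventually_carrier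
      by eventually_elim (simp add: q_def field_simps flip: as(4))
  qed
qed

section \<open>The Schur entries as local generators\<close>

lemma S_Reg: "j \<in> W.idx \<Longrightarrow> S j \<in> P.Reg"
proof -
  assume "j \<in> W.idx"
  then obtain i b h where j: "j = (i, b, h)" "i < m" "b \<in> H (Suc i)" "h \<in> H i" by (auto simp: W.idx_def)
  then show ?thesis using elim_col_Reg[of i b h] sub_T(2)[of i] sub_T(2)[of "Suc i"] by (auto simp: S_def)
qed

text \<open>On the orbit the ranks are bounded by those of \<open>D\<close>, so \<open>schur\<close>
  bounds the rank of the Schur complement by \<open>card (L i) - card (L i) = 0\<close>.\<close>

lemma S_vanY: "j \<in> W.idx \<Longrightarrow> S j \<in> P.vanY (stratum m V D)"
proof -
  assume jW: "j \<in> W.idx"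
  then obtain i b h where j: "j = (i, b, h)" "i < m" "b \<in> H (Suc i)" "h \<in> H i" by (auto simp: W.idx_def)
  have "\<forall>\<^sub>F p in P.zar. p \<in> stratum m V D \<longrightarrow> S j p = 0"
    using ok_pivot[OF less_imp_le[OF j(2)]]
  proof eventually_elim
    fix p assume nz: "mdet (L i) (pivot i p) \<noteq> 0"
    show "p \<in> stratum m V D \<longrightarrow> S j p = 0"
      using schur(2)[OF j(2) nz stratum_rank[OF _ j(2)]] j by (auto simp: rk_le_zero)
  qed
  then show ?thesis using S_Reg[OF jW] by (simp add: P.vanY_def)
qed

text \<open>The smallest ideal to which \<open>vanY_mem\<close> applies; membership in it is the
  generation statement \<open>van_S\<close> of the slice.\<close>

definition S_ideal where
  "S_ideal = {f \<in> P.Reg. \<exists>c. (\<forall>j\<in>W.idx. c j \<in> P.Reg) \<and> (\<lambda>p. f p - (\<Sum>j\<in>W.idx. c j p * S j p)) \<in> P.locI}"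

lemma S_ideal: "P.reg_ideal S_ideal"
  unfolding P.reg_ideal_def
proof (intro conjI ballI subsetI)
  show "f \<in> P.Reg" if "f \<in> S_ideal" for f using that by (simp add: S_ideal_def)
  show "f \<in> S_ideal" if "f \<in> P.locI" for f
    using that P.locI_Reg[OF that] P.Reg_const[of 0] by (auto simp: S_ideal_def intro!: exI[of _ "\<lambda>j p. 0"])
  fix f g assume f: "f \<in> S_ideal"
  then obtain c where c: "\<And>j. j \<in> W.idx \<Longrightarrow> c j \<in> P.Reg" "(\<lambda>p. f p - (\<Sum>j\<in>W.idx. c j p * S j p)) \<in> P.locI"
    and fR: "f \<in> P.Reg" by (auto simp: S_ideal_def)
  {
    assume g: "g \<in> S_ideal"
    then obtain c' where c': "\<And>j. j \<in> W.idx \<Longrightarrow> c' j \<in> P.Reg" "(\<lambda>p. g p - (\<Sum>j\<in>W.idx. c' j p * S j p)) \<in> P.locI"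
      and gR: "g \<in> P.Reg" by (auto simp: S_ideal_def)
    have "(\<lambda>p. f p + g p - (\<Sum>j\<in>W.idx. (c j p + c' j p) * S j p)) \<in> P.locI"
      using P.locI_add[OF c(2) c'(2)] by (simp add: algebra_simps sum.distrib)
    then show "(\<lambda>p. f p + g p) \<in> S_ideal" using c c' P.Reg_add fR gR
      by (auto simp: S_ideal_def intro!: exI[of _ "\<lambda>j p. c j p + c' j p"])
  next
    assume g: "g \<in> P.Reg"
    have "(\<lambda>p. f p * g p - (\<Sum>j\<in>W.idx. (c j p * g p) * S j p)) \<in> P.locI"
      using P.locI_mult[OF c(2) g] by (simp add: algebra_simps sum_distrib_left)
    then show "(\<lambda>p. f p * g p) \<in> S_ideal" using c P.Reg_mult fR g
      by (auto simp: S_ideal_def intro!: exI[of _ "\<lambda>j p. c j p * g p"])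
  }
qed

lemma S_mem: "j \<in> W.idx \<Longrightarrow> S j \<in> S_ideal"
proof -
  assume j: "j \<in> W.idx"
  have "(\<Sum>i\<in>W.idx. of_bool (i = j) * S i p) = (\<Sum>i\<in>W.idx. if i = j then S i p else 0)" for p
    by (intro sum.cong) auto
  then have "(\<lambda>p. S j p - (\<Sum>i\<in>W.idx. of_bool (i = j) * S i p)) \<in> P.locI"
    using j W.finite_idx P.locI_zero by simp
  then show ?thesis using S_Reg[OF j] P.Reg_const
    by (auto simp: S_ideal_def intro!: exI[of _ "\<lambda>i p. of_bool (i = j)"])
qed

lemma normal_cone_slice:
  assumes IN: "W.M.homogeneous_ideal IN"
    and IN_S: "\<And>f. f \<in> IN \<Longrightarrow> (\<lambda>p. f (W.M.pt (\<lambda>j. S j p))) \<in> P.locI"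
    and e_I: "\<And>f. f \<in> I \<Longrightarrow> (\<lambda>q\<in>carrier N. f (e q)) \<in> IN"
  shows "normal_cone_fiber M I (stratum m V D) D \<cong>\<^sub>g\<^sub>r subcone N IN"
proof -
  have "normal_slice M V.idx V.ent I D N W.idx W.ent IN (stratum m V D) S e"
  proof (intro normal_slice.intro normal_slice_axioms.intro)
    show "local_point M V.idx V.ent I D" by (rule P.local_point_axioms)
    show "coordinates N W.idx W.ent" by (rule W.hom_coords)
    show "\<exists>c. (\<forall>j\<in>W.idx. c j \<in> P.Reg) \<and> (\<lambda>p. f p - (\<Sum>j\<in>W.idx. c j p * S j p)) \<in> P.locI"
      if "f \<in> P.vanY (stratum m V D)" for f
      using vanY_mem[OF S_ideal S_mem that] by (simp add: S_ideal_def)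
    show "S j (e q) = W.ent j q" if "j \<in> W.idx" for q j
      using that S_e by (cases j) auto
  qed (use IN IN_S e_I I_stratum stratum_carrier stratum_self S_vanY e_zero e_closed e_poly in auto)
  then show ?thesis by (rule normal_slice.normal_cone_iso)
qed

lemma quad_S_locI:
  assumes "Suc i < m" "c \<in> H (Suc (Suc i))" "a \<in> H i"
  shows "(\<lambda>p. W.quad i c a (W.M.pt (\<lambda>j. S j p))) \<in> P.locI"
proof -
  have "W.quad i c a (W.M.pt (\<lambda>j. S j p)) = (\<Sum>b\<in>H (Suc i). elim_col (Suc i) c b p * elim_col i b a p)" for p
    unfolding W.quad_def using assms by (intro sum.cong) (auto simp: W.M.pt W.idx_iff S_def)
  then show ?thesis
    using SS_locI[OF assms(1), of c a] assms sub_T(2)[of "Suc (Suc i)"] sub_T(2)[of i] by auto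
qed

lemma poly_S_Reg:
  assumes "f \<in> carrier (poly_ring N)" shows "(\<lambda>p. f (W.M.pt (\<lambda>j. S j p))) \<in> P.Reg"
  using assms
proof (induction rule: W.M.A_induct)
  case (const c) then show ?case using P.Reg_const[of c] by (simp add: W.M.pt)
next
  case (coord j) then show ?case using S_Reg[of j] by (simp add: W.M.pt)
next
  case (add f g) then show ?case using P.Reg_add by (simp add: W.M.pt)
next
  case (mult f g) then show ?case using P.Reg_mult by (simp add: W.M.pt)
qed

end

section \<open>Stability under scalars\<close>

lemma (in graded_coords) complexes_smult:
  "f \<in> complexes m V \<Longrightarrow> c \<odot>\<^bsub>M\<^esub> f \<in> complexes m V"
  using quad_smult[of f] by (auto simp: complexes_iff M.smult_closed)

lemma (in graded_coords) complexes_le_iff: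
  "f \<in> complexes_le m V r \<longleftrightarrow> f \<in> complexes m V \<and>
    (\<forall>i<m. rk_le (\<lambda>b a. ent (i, b, a) f) (T (Suc i)) (T i) (r (Suc i)))"
  using rank_iff[of f] by (auto simp: complexes_le_def hom_gr1_le_def complexes_def)

lemma (in graded_coords) complexes_le_carrier: "complexes_le m V r \<subseteq> carrier M"
  by (auto simp: complexes_le_def complexes_def)

lemma (in graded_coords) complexes_le_smult:
  assumes "f \<in> complexes_le m V r" shows "c \<odot>\<^bsub>M\<^esub> f \<in> complexes_le m V r"
proof -
  have f: "f \<in> complexes m V" "f \<in> carrier M"
    and rk: "\<And>i. i < m \<Longrightarrow> rk_le (\<lambda>b a. ent (i, b, a) f) (T (Suc i)) (T i) (r (Suc i))"
    using assms by (auto simp: complexes_le_iff complexes_def)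
  have "rk_le (\<lambda>b a. ent (i, b, a) (c \<odot>\<^bsub>M\<^esub> f)) (T (Suc i)) (T i) (r (Suc i))" if i: "i < m" for i
  proof -
    have "rk_le (\<lambda>b a. ent (i, b, a) (c \<odot>\<^bsub>M\<^esub> f)) (T (Suc i)) (T i) (r (Suc i))
      \<longleftrightarrow> rk_le (\<lambda>b a. c * ent (i, b, a) f) (T (Suc i)) (T i) (r (Suc i))"
      using i f by (intro rk_le_cong) (simp add: M.x_smult idx_iff)
    then show ?thesis using rk_le_smult[OF rk[OF i], of c] by simp
  qed
  then show ?thesis using complexes_smult[OF f(1), of c] by (simp add: complexes_le_iff)
qed

section \<open>The two normal cones\<close>

context split_complex
begin

lemma stratum_complexes: "D \<in> complexes m V \<Longrightarrow> stratum m V D \<subseteq> complexes m V"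
  using V.gl_act_complex by (auto simp: stratum_def)

theorem normal_cone_complexes:
  assumes DC: "D \<in> complexes m V"
  shows "normal_cone_fiber M (complexes_ideal m V) (stratum m V D) D \<cong>\<^sub>g\<^sub>r subcone N (complexes_ideal m W)"
proof -
  interpret split_ideal m V T \<epsilon> W H \<eta> B L d D "complexes_ideal m V"
  proof (intro split_ideal.intro local_point.intro local_point_axioms.intro split_ideal_axioms.intro)
    show "split_complex m V T \<epsilon> W H \<eta> B L d D" by (rule split_complex_axioms)
    show "coordinates M V.idx V.ent" by (rule V.hom_coords)
    show "ideal (complexes_ideal m V) (poly_ring M)"
      using V.complexes_ideal_homogeneous by (simp add: V.M.homogeneous_ideal_def)
    show "D \<in> carrier M" by (rule D)
    show "f D = 0" if "f \<in> complexes_ideal m V" for f by (rule V.complexes_ideal_vanish[OF that DC])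
    show "f p = 0" if "f \<in> complexes_ideal m V" "p \<in> stratum m V D" for f p
      using V.complexes_ideal_vanish[OF that(1)] stratum_complexes[OF DC] that(2) by blast
  qed (rule V.quad_mem)
  show ?thesis
  proof (rule normal_cone_slice[OF W.complexes_ideal_homogeneous])
    let ?S = "\<lambda>p. W.M.pt (\<lambda>j. S j p)"
    \<comment> \<open>That \<open>f\<close> composed with the Schur map lies in \<open>locI\<close>
      is an ideal condition on \<open>f\<close>, so it is checked on the quadratic generators, where
      it is \<open>quad_S_locI\<close>.\<close>
    let ?I = "{f \<in> carrier (poly_ring N). (\<lambda>p. f (?S p)) \<in> P.locI}"
    have Sc: "?S p \<in> carrier N" for p by (rule W.M.pt)
    have "complexes_ideal m W \<subseteq> ?I"
    proof (rule W.complexes_ideal_minimal)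
      show "ideal ?I (poly_ring N)"
      proof (rule idealI)
        show "ring (poly_ring N)" ..
        show "subgroup ?I (add_monoid (poly_ring N))"
        proof (rule W.M.A.add.subgroupI)
          have "\<zero>\<^bsub>poly_ring N\<^esub> \<in> ?I" using Sc P.locI_zero by (simp add: W.M.A_ops(4)) (metis W.M.A.zero_closed W.M.A_ops(4))
          then show "?I \<noteq> {}" by blast
          fix f g assume f: "f \<in> ?I" and g: "g \<in> ?I"
          show "\<ominus>\<^bsub>poly_ring N\<^esub> f \<in> ?I"
            using f Sc P.reg_ideal_uminus[OF P.reg_ideal_locI] W.M.A.a_inv_closed[of f] by (simp add: W.M.A_uminus)
          show "f \<oplus>\<^bsub>poly_ring N\<^esub> g \<in> ?I"
            using f g Sc P.locI_add[of "\<lambda>p. f (?S p)" "\<lambda>p. g (?S p)"] W.M.A_add[of f g] by (simp add: W.M.A_ops(1))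
        qed auto
        fix f g assume f: "f \<in> ?I" and g: "g \<in> carrier (poly_ring N)"
        then show fg: "f \<otimes>\<^bsub>poly_ring N\<^esub> g \<in> ?I"
          using Sc P.locI_mult[OF _ poly_S_Reg[OF g], of "\<lambda>p. f (?S p)"] W.M.A_mult[of f g] by (simp add: W.M.A_ops(2))
        show "g \<otimes>\<^bsub>poly_ring N\<^esub> f \<in> ?I"
          using fg f g W.M.A.m_comm[of g f] by simp
      qed
      fix i k assume i: "Suc i < m"
      let ?g = "\<lambda>f\<in>carrier N. \<Sum>(c, a)\<in>H (Suc (Suc i)) \<times> H i. k c a * W.quad i c a f"
      have "(\<lambda>p. \<Sum>z\<in>H (Suc (Suc i)) \<times> H i. k (fst z) (snd z) * W.quad i (fst z) (snd z) (?S p)) \<in> P.locI"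
        using i by (intro P.reg_ideal_sum[OF P.reg_ideal_locI] P.reg_ideal_mult_left[OF P.reg_ideal_locI _ P.Reg_const] quad_S_locI) auto
      moreover have "?g \<in> carrier (poly_ring N)"
      proof -
        have "(\<lambda>f\<in>carrier N. \<Sum>z\<in>H (Suc (Suc i)) \<times> H i. (\<lambda>f\<in>carrier N. (\<lambda>f\<in>carrier N. k (fst z) (snd z)) f * (\<lambda>f\<in>carrier N. W.quad i (fst z) (snd z) f) f) f) \<in> carrier (poly_ring N)"
          using i by (intro W.M.A_sum W.M.A_mult W.M.A_const W.quad_poly) auto
        then show ?thesis by (simp add: case_prod_beta cong: restrict_cong)
      qed
      ultimately show "?g \<in> ?I" using Sc by (simp add: case_prod_beta)
    qed
    then show "(\<lambda>p. f (?S p)) \<in> P.locI" if "f \<in> complexes_ideal m W" for f using that by blast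
  next
    let ?e = "\<lambda>f. \<lambda>q\<in>carrier N. f (e q)"
    \<comment> \<open>The same device in the other direction: restriction to the slice respects the
      ring operations, and by \<open>quad_e\<close> it sends a quadratic entry to a quadratic entry
      or to 0.\<close>
    let ?I = "{f \<in> carrier (poly_ring M). ?e f \<in> complexes_ideal m W}"
    interpret IN: ideal "complexes_ideal m W" "poly_ring N"
      using W.complexes_ideal_homogeneous by (simp add: W.M.homogeneous_ideal_def)
    have e_ops: "?e (f \<oplus>\<^bsub>poly_ring M\<^esub> g) = ?e f \<oplus>\<^bsub>poly_ring N\<^esub> ?e g" "?e (f \<otimes>\<^bsub>poly_ring M\<^esub> g) = ?e f \<otimes>\<^bsub>poly_ring N\<^esub> ?e g"
      "?e \<zero>\<^bsub>poly_ring M\<^esub> = \<zero>\<^bsub>poly_ring N\<^esub>" for f g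
      unfolding V.M.A_ops W.M.A_ops by (simp_all add: e_closed cong: restrict_cong)
    have e_un: "?e (\<ominus>\<^bsub>poly_ring M\<^esub> f) = \<ominus>\<^bsub>poly_ring N\<^esub> ?e f" if "f \<in> carrier (poly_ring M)" for f
      unfolding V.M.A_uminus[OF that] W.M.A_uminus[OF e_poly[OF that]] by (simp add: e_closed cong: restrict_cong)
    have "complexes_ideal m V \<subseteq> ?I"
    proof (rule V.complexes_ideal_minimal)
      show "ideal ?I (poly_ring M)"
      proof (rule idealI)
        show "ring (poly_ring M)" ..
        show "subgroup ?I (add_monoid (poly_ring M))"
        proof (rule V.M.A.add.subgroupI)
          have "\<zero>\<^bsub>poly_ring M\<^esub> \<in> ?I" unfolding mem_Collect_eq e_ops using IN.zero_closed by blast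
          then show "?I \<noteq> {}" by blast
          fix f g assume f: "f \<in> ?I" and g: "g \<in> ?I"
          show "\<ominus>\<^bsub>poly_ring M\<^esub> f \<in> ?I"
          proof -
            have fM: "f \<in> carrier (poly_ring M)" and fI: "?e f \<in> complexes_ideal m W" using f by blast+
            show ?thesis unfolding mem_Collect_eq e_un[OF fM]
              by (rule conjI[OF V.M.A.a_inv_closed[OF fM] IN.a_inv_closed[OF fI]])
          qed
          show "f \<oplus>\<^bsub>poly_ring M\<^esub> g \<in> ?I"
            using f g IN.a_closed V.M.A.a_closed[of f g] unfolding mem_Collect_eq e_ops by blast
        qed blast
        fix f g assume f: "f \<in> ?I" and g: "g \<in> carrier (poly_ring M)"
        then show fg: "f \<otimes>\<^bsub>poly_ring M\<^esub> g \<in> ?I"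
          using IN.I_r_closed[OF _ e_poly[OF g]] V.M.A.m_closed[of f g] unfolding mem_Collect_eq e_ops by blast
        show "g \<otimes>\<^bsub>poly_ring M\<^esub> f \<in> ?I"
        proof -
          have fM: "f \<in> carrier (poly_ring M)" using f by blast
          show ?thesis unfolding V.M.A.m_comm[OF g fM] by (rule fg)
        qed
      qed
      fix i k assume i: "Suc i < m"
      let ?g = "\<lambda>f\<in>carrier M. \<Sum>(c, a)\<in>T (Suc (Suc i)) \<times> T i. k c a * V.quad i c a f"
      have gM: "?g \<in> carrier (poly_ring M)"
      proof -
        have "(\<lambda>f\<in>carrier M. \<Sum>z\<in>T (Suc (Suc i)) \<times> T i. (\<lambda>f\<in>carrier M. (\<lambda>f\<in>carrier M. k (fst z) (snd z)) f * (\<lambda>f\<in>carrier M. V.quad i (fst z) (snd z) f) f) f) \<in> carrier (poly_ring M)"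
          using i by (intro V.M.A_sum V.M.A_mult V.M.A_const V.quad_poly) auto
        then show ?thesis by (simp add: case_prod_beta cong: restrict_cong)
      qed
      have fs: "finsum (poly_ring N) h A \<in> complexes_ideal m W" if "finite A" "\<And>a. a \<in> A \<Longrightarrow> h a \<in> complexes_ideal m W" for h and A :: "('b \<times> 'b) set"
        using that
      proof induction
        case (insert a A)
        then have "h \<in> A \<rightarrow> carrier (poly_ring N)" "h a \<in> carrier (poly_ring N)" using IN.Icarr by auto
        then show ?case using insert by simp
      qed simp
      let ?h = "\<lambda>z. (\<lambda>q\<in>carrier N. k (fst z) (snd z)) \<otimes>\<^bsub>poly_ring N\<^esub> (\<lambda>q\<in>carrier N. W.quad i (fst z) (snd z) q)"
      have hI: "?h z \<in> complexes_ideal m W" if "z \<in> H (Suc (Suc i)) \<times> H i" for z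
        using that i by (intro IN.I_l_closed W.M.A_const W.quad_mem) auto
      have "?e ?g = finsum (poly_ring N) ?h (H (Suc (Suc i)) \<times> H i)"
      proof -
        have "finsum (poly_ring N) ?h (H (Suc (Suc i)) \<times> H i) = (\<lambda>q\<in>carrier N. \<Sum>z\<in>H (Suc (Suc i)) \<times> H i. ?h z q)"
          using hI IN.Icarr by (intro W.M.A_finsum) blast
        also have "\<dots> = ?e ?g"
        proof (rule restrict_ext)
          fix q assume q: "q \<in> carrier N"
          have "?g (e q) = (\<Sum>z\<in>T (Suc (Suc i)) \<times> T i. if z \<in> H (Suc (Suc i)) \<times> H i then k (fst z) (snd z) * W.quad i (fst z) (snd z) q else 0)"
            using e_closed quad_e[OF i] by (auto simp: case_prod_beta intro!: sum.cong)
          also have "\<dots> = (\<Sum>z\<in>H (Suc (Suc i)) \<times> H i. k (fst z) (snd z) * W.quad i (fst z) (snd z) q)"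
            using fin(1)[of i] fin(1)[of "Suc (Suc i)"] sub_T(2)[of i] sub_T(2)[of "Suc (Suc i)"] i
            by (intro sum.mono_neutral_cong_right) auto
          finally show "(\<Sum>z\<in>H (Suc (Suc i)) \<times> H i. ?h z q) = ?g (e q)" using q by (simp add: W.M.A_ops)
        qed
        finally show ?thesis ..
      qed
      moreover have "finite (H (Suc (Suc i)) \<times> H i)" using fin(3) i by simp
      ultimately have "?e ?g \<in> complexes_ideal m W" using fs[of "H (Suc (Suc i)) \<times> H i" ?h] hI by simp
      then show "?g \<in> ?I" using gM by blast
    qed
    then show "?e f \<in> complexes_ideal m W" if "f \<in> complexes_ideal m V" for f using that by blast
  qed
qed

theorem normal_cone_complexes_le:
  assumes DC: "D \<in> complexes_le m V r"
  shows "normal_cone_fiber M (complexes_le_ideal m V r) (stratum m V D) D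
    \<cong>\<^sub>g\<^sub>r subcone N (complexes_le_ideal m W (\<lambda>j. r j - ranks m V D j))"
proof -
  let ?r = "\<lambda>j. r j - ranks m V D j"
  have DC': "D \<in> complexes m V" using DC by (simp add: V.complexes_le_iff)
  \<comment> \<open>Hence the truncated subtraction in \<open>?r\<close> is a true difference at the
    indices of the maps.\<close>
  have cardL: "card (L i) \<le> r (Suc i)" if "i < m" for i
    using schur(1)[OF that, of D "r (Suc i)"] mdet_pivot_D[of i] DC that by (simp add: V.complexes_le_iff)
  have strat: "stratum m V D \<subseteq> complexes_le m V r"
  proof
    fix p assume "p \<in> stratum m V D"
    then obtain g where g: "g \<in> gl m V" "p = gl_act m V g D" by (auto simp: stratum_def)
    then show "p \<in> complexes_le m V r"
      using DC V.gl_act_complex[OF g(1) DC'] V.gl_act_rank[OF g(1) D] by (simp add: V.complexes_le_iff)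
  qed
  interpret split_ideal m V T \<epsilon> W H \<eta> B L d D "complexes_le_ideal m V r"
  proof (intro split_ideal.intro local_point.intro local_point_axioms.intro split_ideal_axioms.intro)
    show "split_complex m V T \<epsilon> W H \<eta> B L d D" by (rule split_complex_axioms)
    show "coordinates M V.idx V.ent" by (rule V.hom_coords)
    show "ideal (complexes_le_ideal m V r) (poly_ring M)"
      unfolding complexes_le_ideal_def by (rule V.M.vanishing_ideal[OF V.complexes_le_carrier])
    show "D \<in> carrier M" by (rule D)
    show "f D = 0" if "f \<in> complexes_le_ideal m V r" for f
      using that DC by (simp add: complexes_le_ideal_def vanishing_ideal_def)
    show "f p = 0" if "f \<in> complexes_le_ideal m V r" "p \<in> stratum m V D" for f p
      using that strat by (auto simp: complexes_le_ideal_def vanishing_ideal_def)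
    show "(\<lambda>f\<in>carrier M. V.quad i c a f) \<in> complexes_le_ideal m V r"
      if "Suc i < m" "c \<in> T (Suc (Suc i))" "a \<in> T i" for i c a
      using V.quad_poly[OF that] that V.complexes_le_carrier
      by (auto simp: complexes_le_ideal_def vanishing_ideal_def V.complexes_le_iff V.complexes_iff)
  qed
  have locI_vanish: "\<forall>\<^sub>F p in P.zar. p \<in> complexes_le m V r \<longrightarrow> f p = 0" if fI: "f \<in> P.locI" for f
  proof -
    obtain a s where as: "a \<in> complexes_le_ideal m V r" "s \<in> carrier (poly_ring M)" "s D \<noteq> 0" "\<And>p. p \<in> carrier M \<Longrightarrow> f p * s p = a p"
      by (rule P.locIE[OF fI]) (rule that)
    show ?thesis
    proof (rule P.eventually_zarI[OF as(2,3)], intro impI)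
      fix p assume p: "p \<in> carrier M" "s p \<noteq> 0" "p \<in> complexes_le m V r"
      have "\<forall>p\<in>complexes_le m V r. a p = 0"
        using as(1) unfolding complexes_le_ideal_def vanishing_ideal_def mem_Collect_eq by (rule conjunct2)
      then have "f p * s p = 0" unfolding as(4)[OF p(1)] using p(3) by (rule bspec)
      then show "f p = 0" using p(2) by simp
    qed
  qed
  let ?S = "\<lambda>p. W.M.pt (\<lambda>j. S j p)"
  \<comment> \<open>Here points suffice: near \<open>D\<close> the composites vanish on the variety
    because they lie in \<open>locI\<close>, and the ranks drop by \<open>schur\<close>.\<close>
  have S_mem: "\<forall>\<^sub>F p in P.zar. p \<in> complexes_le m V r \<longrightarrow> ?S p \<in> complexes_le m W ?r"
  proof -
    \<comment> \<open>Each entry of a composite has its own neighbourhood of \<open>D\<close>; as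
      these triples are finitely many, one neighbourhood serves them all.\<close>
    let ?Q = "{(i, c, a). Suc i < m \<and> c \<in> H (Suc (Suc i)) \<and> a \<in> H i}"
    have "?Q \<subseteq> (SIGMA i:{..<m}. (if Suc i < m then H (Suc (Suc i)) \<times> H i else {}))" by auto
    moreover have "finite (SIGMA i:{..<m}. (if Suc i < m then H (Suc (Suc i)) \<times> H i else {}))"
      using fin(3) by (intro finite_SigmaI) auto
    ultimately have finQ: "finite ?Q" by (rule finite_subset)
    have "\<forall>\<^sub>F p in P.zar. \<forall>z\<in>?Q. p \<in> complexes_le m V r \<longrightarrow> W.quad (fst z) (fst (snd z)) (snd (snd z)) (?S p) = 0"
    proof (rule eventually_ball_finite[OF finQ], rule ballI)
      fix z assume "z \<in> ?Q"
      then show "\<forall>\<^sub>F p in P.zar. p \<in> complexes_le m V r \<longrightarrow> W.quad (fst z) (fst (snd z)) (snd (snd z)) (?S p) = 0"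
        by (intro locI_vanish quad_S_locI) auto
    qed
    moreover have "\<forall>\<^sub>F p in P.zar. \<forall>i\<in>{..m}. mdet (L i) (pivot i p) \<noteq> 0"
      by (rule eventually_ball_finite) (auto intro: ok_pivot)
    ultimately show ?thesis
    proof eventually_elim
      fix p assume q: "\<forall>z\<in>?Q. p \<in> complexes_le m V r \<longrightarrow> W.quad (fst z) (fst (snd z)) (snd (snd z)) (?S p) = 0"
        and nz: "\<forall>i\<in>{..m}. mdet (L i) (pivot i p) \<noteq> 0"
      show "p \<in> complexes_le m V r \<longrightarrow> ?S p \<in> complexes_le m W ?r"
      proof
        assume p: "p \<in> complexes_le m V r"
        have "?S p \<in> complexes m W" using q p by (auto simp: W.complexes_iff W.M.pt)
        moreover have "rk_le (\<lambda>b a. W.ent (i, b, a) (?S p)) (H (Suc i)) (H i) (?r (Suc i))" if i: "i < m" for i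
        proof -
          have "rk_le (\<lambda>b h. S (i, b, h) p) (H (Suc i)) (H i) (?r (Suc i))"
            using schur(2)[OF i, of p "r (Suc i)"] nz i p by (simp add: V.complexes_le_iff ranks_D)
          moreover have "W.ent (i, b, a) (?S p) = S (i, b, a) p" if "b \<in> H (Suc i)" "a \<in> H i" for b a
            using that i by (simp add: W.M.pt W.idx_iff)
          ultimately show ?thesis using rk_le_cong[of "H (Suc i)" "H i" "\<lambda>b a. W.ent (i, b, a) (?S p)" "\<lambda>b h. S (i, b, h) p"] by blast
        qed
        ultimately show "?S p \<in> complexes_le m W ?r" by (simp add: W.complexes_le_iff)
      qed
    qed
  qed
  show ?thesis
  proof (rule normal_cone_slice)
    show "W.M.homogeneous_ideal (complexes_le_ideal m W ?r)"
      unfolding complexes_le_ideal_def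
      by (rule W.M.vanishing_ideal_homogeneous[OF W.complexes_le_carrier W.complexes_le_smult])
  next
    fix f assume f: "f \<in> complexes_le_ideal m W ?r"
    then have fN: "f \<in> carrier (poly_ring N)" and f0: "\<And>q. q \<in> complexes_le m W ?r \<Longrightarrow> f q = 0"
      by (auto simp: complexes_le_ideal_def vanishing_ideal_def)
    obtain a s where as: "a \<in> carrier (poly_ring M)" "s \<in> carrier (poly_ring M)" "s D \<noteq> 0"
      "\<And>p. p \<in> carrier M \<Longrightarrow> f (?S p) * s p = a p"
      by (rule P.RegE[OF poly_S_Reg[OF fN]]) (rule that)
    obtain w where w: "w \<in> carrier (poly_ring M)" "w D \<noteq> 0"
      "\<And>p. p \<in> carrier M \<Longrightarrow> w p \<noteq> 0 \<Longrightarrow> p \<in> complexes_le m V r \<Longrightarrow> ?S p \<in> complexes_le m W ?r"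
      using S_mem unfolding P.eventually_zar by blast
    show "(\<lambda>p. f (?S p)) \<in> P.locI"
    proof (rule P.locI_I)
      \<comment> \<open>The ideal consists of all polynomials vanishing on the variety, so a check
        at points is enough. The factor \<open>w\<close> covers the points where the Schur
        complement is not known to lie in the cone.\<close>
      have wa: "(\<lambda>p\<in>carrier M. w p * a p) p = 0" if p: "p \<in> complexes_le m V r" for p
      proof -
        have pM: "p \<in> carrier M" using p V.complexes_le_carrier by blast
        show ?thesis using f0[OF w(3)[OF pM _ p]] as(4)[OF pM, symmetric] pM by (cases "w p = 0") auto
      qed
      show "(\<lambda>p\<in>carrier M. w p * a p) \<in> complexes_le_ideal m V r"
        unfolding complexes_le_ideal_def vanishing_ideal_def mem_Collect_eq
        by (intro conjI ballI V.M.A_mult[OF w(1) as(1)] wa)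
      show "(\<lambda>p\<in>carrier M. w p * s p) \<in> carrier (poly_ring M)" by (rule V.M.A_mult[OF w(1) as(2)])
      show "(\<lambda>p\<in>carrier M. w p * s p) D \<noteq> 0" using w(2) as(3) D by simp
      show "f (?S p) * (\<lambda>p\<in>carrier M. w p * s p) p = (\<lambda>p\<in>carrier M. w p * a p) p" if "p \<in> carrier M" for p
        using that as(4)[OF that, symmetric] by simp
    qed
  next
    fix f assume "f \<in> complexes_le_ideal m V r"
    then have f: "f \<in> carrier (poly_ring M) \<and> (\<forall>q\<in>complexes_le m V r. f q = 0)"
      unfolding complexes_le_ideal_def vanishing_ideal_def mem_Collect_eq .
    note fM = conjunct1[OF f] and f0 = bspec[OF conjunct2[OF f]]
    have eE: "e E \<in> complexes_le m V r" if E: "E \<in> complexes_le m W ?r" for E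
    proof -
      have "e E \<in> complexes m V"
        using E quad_e by (auto simp: V.complexes_iff W.complexes_le_iff W.complexes_iff e_closed)
      moreover have "rk_le (\<lambda>b a. V.ent (i, b, a) (e E)) (T (Suc i)) (T i) (r (Suc i))" if i: "i < m" for i
      proof -
        have "rk_le (\<lambda>b a. W.ent (i, b, a) E) (H (Suc i)) (H i) (r (Suc i) - card (L i))"
          using E i by (simp add: W.complexes_le_iff ranks_D)
        from e_rank[OF i this] show ?thesis using cardL[OF i] by simp
      qed
      ultimately show ?thesis by (simp add: V.complexes_le_iff)
    qed
    show "(\<lambda>q\<in>carrier N. f (e q)) \<in> complexes_le_ideal m W ?r"
      unfolding complexes_le_ideal_def vanishing_ideal_def mem_Collect_eq
    proof (intro conjI ballI e_poly[OF fM])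
      fix E assume E: "E \<in> complexes_le m W ?r"
      then have "E \<in> carrier N" using W.complexes_le_carrier by blast
      then show "(\<lambda>q\<in>carrier N. f (e q)) E = 0" using f0[OF eE[OF E]] by simp
    qed
  qed
qed

end

section \<open>Adapted bases and cohomology\<close>

text \<open>The basis of the subspace is part of the basis \<open>b\<close>, so the remaining
  coordinates are its equations.\<close>

lemma subspace_coords:
  assumes S: "basis_coords (V\<lparr>carrier := S\<rparr>) b1 \<epsilon>1" "S \<subseteq> carrier V" and V: "basis_coords V b \<epsilon>" and sub: "b1 \<subseteq> b"
  shows "u \<in> S \<longleftrightarrow> u \<in> carrier V \<and> (\<forall>v\<in>b - b1. \<epsilon> v u = 0)"
proof -
  interpret S: coordinates "V\<lparr>carrier := S\<rparr>" b1 \<epsilon>1 using S by (simp add: basis_coords_def)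
  interpret V: coordinates V b \<epsilon> using V by (simp add: basis_coords_def)
  have \<epsilon>: "\<epsilon> u v = of_bool (u = v)" if "u \<in> b" "v \<in> b" for u v using V that by (simp add: basis_coords_def)
  have ex: "\<epsilon> v u = (\<Sum>w\<in>b1. \<epsilon>1 w u * \<epsilon> v w)" if "u \<in> S" "v \<in> b" for u v
    by (rule basis_coords_expand[OF S(1)]) (use that S(2) in \<open>auto simp: V.x_add V.x_smult subset_iff\<close>)
  have zero: "\<epsilon> v u = 0" if "u \<in> S" "v \<in> b - b1" for u v
    unfolding ex[OF that(1) DiffD1[OF that(2)]] using that sub \<epsilon> by (intro sum.neutral) (auto simp: subset_iff)
  have same: "\<epsilon> v u = \<epsilon>1 v u" if "u \<in> S" "v \<in> b1" for u v
  proof -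
    have "\<epsilon> v u = (\<Sum>w\<in>b1. if w = v then \<epsilon>1 w u else 0)"
      using ex[OF that(1), of v] that sub \<epsilon> by (auto simp: subset_iff intro!: sum.cong)
    then show ?thesis using that S.finite_X by simp
  qed
  show ?thesis
  proof
    assume "u \<in> S" then show "u \<in> carrier V \<and> (\<forall>v\<in>b - b1. \<epsilon> v u = 0)" using zero S(2) by blast
  next
    assume u: "u \<in> carrier V \<and> (\<forall>v\<in>b - b1. \<epsilon> v u = 0)"
    define z where "z = S.pt (\<lambda>v. \<epsilon> v u)"
    have z: "z \<in> S" "\<And>v. v \<in> b1 \<Longrightarrow> \<epsilon>1 v z = \<epsilon> v u" using S.pt by (auto simp: z_def)
    have "z = u"
    proof (rule V.x_eqI)
      show "\<epsilon> j z = \<epsilon> j u" if "j \<in> b" for j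
        using that same[OF z(1), of j] z(2)[of j] zero[OF z(1), of j] u by (cases "j \<in> b1") auto
    qed (use z S(2) u in auto)
    then show "u \<in> S" using z by simp
  qed
qed

text \<open>Rank-nullity with explicit bases: \<open>L\<close> spans a complement of the kernel,
  which \<open>f\<close> maps isomorphically onto the image.\<close>

lemma image_basis:
  assumes V: "basis_coords V b \<epsilon>" and W: "coordinates W Z y" and f: "f \<in> lin_hom V W"
    and ker: "basis_coords (V\<lparr>carrier := S\<rparr>) b1 \<epsilon>1" "S = {u \<in> carrier V. f u = \<zero>\<^bsub>W\<^esub>}"
    and L: "b = b1 \<union> L" "b1 \<inter> L = {}"
  shows "inj_on f L" "\<exists>\<epsilon>'. basis_coords (W\<lparr>carrier := f ` carrier V\<rparr>) (f ` L) \<epsilon>'"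
proof -
  interpret V: coordinates V b \<epsilon> using V by (simp add: basis_coords_def)
  interpret W: coordinates W Z y by (rule W)
  note f_apply = lin_hom_apply[OF f]
  have \<epsilon>: "\<epsilon> u v = of_bool (u = v)" if "u \<in> b" "v \<in> b" for u v using V that by (simp add: basis_coords_def)
  have bV: "b \<subseteq> carrier V" using V by (simp add: basis_coords_def)
  have bL: "b - b1 = L" using L by auto
  have S_iff: "u \<in> S \<longleftrightarrow> u \<in> carrier V \<and> (\<forall>v\<in>L. \<epsilon> v u = 0)" for u
    using subspace_coords[OF ker(1) _ V, of u] L bL ker(2) by auto
  have eq_iff: "f u = f v \<longleftrightarrow> (\<forall>l\<in>L. \<epsilon> l u = \<epsilon> l v)" if uv: "u \<in> carrier V" "v \<in> carrier V" for u v
  proof -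
    \<comment> \<open>The difference of \<open>u\<close> and \<open>v\<close>, formed with the
      scalar -1; it lies in the kernel exactly if the values agree.\<close>
    let ?w = "u \<oplus>\<^bsub>V\<^esub> (-1) \<odot>\<^bsub>V\<^esub> v"
    have w: "?w \<in> carrier V" using uv by (simp add: V.add_closed V.smult_closed)
    have "f ?w = f u \<oplus>\<^bsub>W\<^esub> (-1) \<odot>\<^bsub>W\<^esub> f v" using uv by (simp add: f_apply V.smult_closed)
    moreover have "f u \<oplus>\<^bsub>W\<^esub> (-1) \<odot>\<^bsub>W\<^esub> f v = \<zero>\<^bsub>W\<^esub> \<longleftrightarrow> f u = f v"
    proof
      have c: "f u \<in> carrier W" "f v \<in> carrier W" using uv f_apply(1) by auto
      show "f u = f v" if eq: "f u \<oplus>\<^bsub>W\<^esub> (-1) \<odot>\<^bsub>W\<^esub> f v = \<zero>\<^bsub>W\<^esub>"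
      proof (rule W.x_eqI[OF c])
        fix j assume j: "j \<in> Z"
        have "y j (f u \<oplus>\<^bsub>W\<^esub> (-1) \<odot>\<^bsub>W\<^esub> f v) = y j (f u) - y j (f v)"
          using j c by (simp add: W.x_add W.x_smult W.smult_closed)
        then show "y j (f u) = y j (f v)" using eq W.x_zero[OF j] by simp
      qed
      show "f u \<oplus>\<^bsub>W\<^esub> (-1) \<odot>\<^bsub>W\<^esub> f v = \<zero>\<^bsub>W\<^esub>" if "f u = f v"
        using that c by (intro W.x_eqI) (auto simp: W.x_add W.x_smult W.smult_closed W.add_closed W.zero_closed W.x_zero)
    qed
    ultimately have "f u = f v \<longleftrightarrow> ?w \<in> S" using w by (simp add: ker(2))
    also have "\<dots> \<longleftrightarrow> (\<forall>l\<in>L. \<epsilon> l u = \<epsilon> l v)"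
      using w uv L(1) by (auto simp: S_iff V.x_add V.x_smult V.smult_closed)
    finally show ?thesis .
  qed
  show inj: "inj_on f L"
  proof (rule inj_onI)
    fix l l' assume l: "l \<in> L" "l' \<in> L" "f l = f l'"
    then have "\<epsilon> l l = \<epsilon> l l'" using eq_iff[of l l'] bV L(1) by auto
    then show "l = l'" using \<epsilon>[of l l] \<epsilon>[of l l'] l L(1) by auto
  qed
  define pre where "pre w = (SOME u. u \<in> carrier V \<and> f u = w)" for w
  have pre: "pre w \<in> carrier V" "f (pre w) = w" if "w \<in> f ` carrier V" for w
    using someI_ex[of "\<lambda>u. u \<in> carrier V \<and> f u = w"] that by (auto simp: pre_def)
  \<comment> \<open>Coordinates on the image are read off from some preimage; by
    \<open>eq_iff\<close> all preimages have the same coordinates in \<open>L\<close>.\<close>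
  define \<epsilon>' where "\<epsilon>' v w = \<epsilon> (the_inv_into L f v) (pre w)" for v w
  have \<epsilon>'_eq: "\<epsilon>' (f l) (f u) = \<epsilon> l u" if "l \<in> L" "u \<in> carrier V" for l u
  proof -
    have "f (pre (f u)) = f u" "pre (f u) \<in> carrier V" using pre that by auto
    then show ?thesis using eq_iff[of "pre (f u)" u] that the_inv_into_f_f[OF inj] by (simp add: \<epsilon>'_def)
  qed
  have "coordinates (W\<lparr>carrier := f ` carrier V\<rparr>) (f ` L) \<epsilon>'"
  proof (rule coordinates.intro)
    show "finite (f ` L)" using V.finite_X L by auto
    show "\<zero>\<^bsub>W\<lparr>carrier := f ` carrier V\<rparr>\<^esub> \<in> carrier (W\<lparr>carrier := f ` carrier V\<rparr>)"
      using lin_hom_zero[OF V.coordinates_axioms W f] V.zero_closed by (auto simp: image_iff intro!: bexI[of _ "\<zero>\<^bsub>V\<^esub>"])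
    show "p \<oplus>\<^bsub>W\<lparr>carrier := f ` carrier V\<rparr>\<^esub> q \<in> carrier (W\<lparr>carrier := f ` carrier V\<rparr>)"
      if "p \<in> carrier (W\<lparr>carrier := f ` carrier V\<rparr>)" "q \<in> carrier (W\<lparr>carrier := f ` carrier V\<rparr>)" for p q
      using that f_apply(2)[symmetric] V.add_closed by auto
    show "c \<odot>\<^bsub>W\<lparr>carrier := f ` carrier V\<rparr>\<^esub> p \<in> carrier (W\<lparr>carrier := f ` carrier V\<rparr>)"
      if "p \<in> carrier (W\<lparr>carrier := f ` carrier V\<rparr>)" for c p
      using that f_apply(3)[symmetric] V.smult_closed by auto
    show "\<epsilon>' j \<zero>\<^bsub>W\<lparr>carrier := f ` carrier V\<rparr>\<^esub> = 0" if "j \<in> f ` L" for j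
      using that \<epsilon>'_eq[OF _ V.zero_closed] lin_hom_zero[OF V.coordinates_axioms W f] V.x_zero L by auto
    show "\<epsilon>' j (p \<oplus>\<^bsub>W\<lparr>carrier := f ` carrier V\<rparr>\<^esub> q) = \<epsilon>' j p + \<epsilon>' j q"
      if jpq: "j \<in> f ` L" "p \<in> carrier (W\<lparr>carrier := f ` carrier V\<rparr>)" "q \<in> carrier (W\<lparr>carrier := f ` carrier V\<rparr>)" for j p q
    proof -
      obtain l u v where luv: "j = f l" "l \<in> L" "p = f u" "u \<in> carrier V" "q = f v" "v \<in> carrier V" using jpq by auto
      have "\<epsilon>' (f l) (f (u \<oplus>\<^bsub>V\<^esub> v)) = \<epsilon> l (u \<oplus>\<^bsub>V\<^esub> v)" using luv V.add_closed by (intro \<epsilon>'_eq) auto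
      then show ?thesis using luv \<epsilon>'_eq L by (simp add: f_apply(2) V.x_add)
    qed
    show "\<epsilon>' j (c \<odot>\<^bsub>W\<lparr>carrier := f ` carrier V\<rparr>\<^esub> p) = c * \<epsilon>' j p"
      if jp: "j \<in> f ` L" "p \<in> carrier (W\<lparr>carrier := f ` carrier V\<rparr>)" for j p c
    proof -
      obtain l u where lu: "j = f l" "l \<in> L" "p = f u" "u \<in> carrier V" using jp by auto
      have "\<epsilon>' (f l) (f (c \<odot>\<^bsub>V\<^esub> u)) = \<epsilon> l (c \<odot>\<^bsub>V\<^esub> u)" using lu V.smult_closed by (intro \<epsilon>'_eq) auto
      then show ?thesis using lu \<epsilon>'_eq L by (simp add: f_apply(3) V.x_smult)
    qed
    show "p = q" if pq: "p \<in> carrier (W\<lparr>carrier := f ` carrier V\<rparr>)" "q \<in> carrier (W\<lparr>carrier := f ` carrier V\<rparr>)"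
      and eq: "\<And>j. j \<in> f ` L \<Longrightarrow> \<epsilon>' j p = \<epsilon>' j q" for p q
    proof -
      obtain u v where uv: "p = f u" "u \<in> carrier V" "q = f v" "v \<in> carrier V" using pq by auto
      have "\<epsilon> l u = \<epsilon> l v" if "l \<in> L" for l using eq[of "f l"] that uv \<epsilon>'_eq by auto
      then show ?thesis using eq_iff uv by auto
    qed
    show "\<exists>p\<in>carrier (W\<lparr>carrier := f ` carrier V\<rparr>). \<forall>j\<in>f ` L. \<epsilon>' j p = F j" for F
      using \<epsilon>'_eq V.pt(1)[of "\<lambda>l. F (f l)"] V.pt(2)[of _ "\<lambda>l. F (f l)"] L by (intro bexI[of _ "f (V.pt (\<lambda>l. F (f l)))"]) auto
  qed
  moreover have "\<epsilon>' (f l) (f l') = of_bool (f l = f l')" if "l \<in> L" "l' \<in> L" for l l'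
    using \<epsilon>'_eq[OF that(1), of l'] \<epsilon>[of l l'] that bV L inj_on_eq_iff[OF inj that] by auto
  moreover have "f ` L \<subseteq> f ` carrier V" using bV L by blast
  ultimately show "\<exists>\<epsilon>'. basis_coords (W\<lparr>carrier := f ` carrier V\<rparr>) (f ` L) \<epsilon>'"
    by (auto simp: basis_coords_def)
qed

section \<open>Adapted bases of a finite complex\<close>

locale fin_complex =
  fixes m :: nat and V :: "nat \<Rightarrow> ('k::field_char_0, 'v) module" and D :: "nat \<Rightarrow> 'v \<Rightarrow> 'v"
  assumes V: "graded_space m V" and D: "D \<in> complexes m V"
begin

lemma V_coords: "i \<le> m \<Longrightarrow> \<exists>X x. coordinates (V i) (X :: 'v set) x"
  using V vectorspace_coordinates by (auto simp: graded_space_def)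

lemma D_lin: "i < m \<Longrightarrow> D i \<in> lin_hom (V i) (V (Suc i))"
  using D by (auto simp: complexes_def hom_gr1_def PiE_def)

lemma D_zero: "i < m \<Longrightarrow> D i \<zero>\<^bsub>V i\<^esub> = \<zero>\<^bsub>V (Suc i)\<^esub>"
  using V_coords[of i] V_coords[of "Suc i"] lin_hom_zero[OF _ _ D_lin] by auto

lemma cycles_carrier: "cycles m V D i \<subseteq> carrier (V i)"
  by (auto simp: cycles_def)

lemma cycles_lin_sub: assumes i: "i \<le> m" shows "lin_sub (V i) (cycles m V D i)"
proof -
  obtain X x where "coordinates (V i) (X :: 'v set) x" using V_coords[OF i] by blast
  then interpret U: coordinates "V i" X x .
  show ?thesis
  proof (cases "i < m")
    case True
    obtain Z y where "coordinates (V (Suc i)) (Z :: 'v set) y" using V_coords[of "Suc i"] True by auto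
    then interpret W: coordinates "V (Suc i)" Z y .
    have "\<zero>\<^bsub>V (Suc i)\<^esub> \<oplus>\<^bsub>V (Suc i)\<^esub> \<zero>\<^bsub>V (Suc i)\<^esub> = \<zero>\<^bsub>V (Suc i)\<^esub>"
      "c \<odot>\<^bsub>V (Suc i)\<^esub> \<zero>\<^bsub>V (Suc i)\<^esub> = \<zero>\<^bsub>V (Suc i)\<^esub>" for c
      by (auto intro!: W.x_eqI simp: W.zero_closed W.add_closed W.smult_closed W.x_zero W.x_add W.x_smult)
    then show ?thesis using True D_zero[OF True] lin_hom_apply[OF D_lin[OF True]]
      by (auto simp: lin_sub_def cycles_def U.zero_closed U.add_closed U.smult_closed)
  qed (auto simp: lin_sub_def cycles_def U.zero_closed U.add_closed U.smult_closed)
qed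

lemma boundaries_cycles: assumes "i \<le> m" shows "boundaries V D i \<subseteq> cycles m V D i"
proof (cases i)
  case 0
  then show ?thesis using cycles_lin_sub[OF assms] by (simp add: boundaries_def lin_sub_def)
next
  case (Suc j)
  then have j: "j < m" using assms by simp
  have "D j u \<in> carrier (V (Suc j))" if "u \<in> carrier (V j)" for u using lin_hom_apply(1)[OF D_lin[OF j] that] .
  then show ?thesis using D Suc by (auto simp: boundaries_def cycles_def complexes_def)
qed

definition adapted :: "nat \<Rightarrow> 'v set \<times> 'v set \<times> 'v set \<Rightarrow> bool" where
  "adapted i = (\<lambda>(Bs, Hs, Ls).
    (\<exists>\<epsilon>. basis_coords ((V i)\<lparr>carrier := boundaries V D i\<rparr>) Bs \<epsilon>) \<and>
    (\<exists>\<epsilon>. basis_coords ((V i)\<lparr>carrier := cycles m V D i\<rparr>) (Bs \<union> Hs) \<epsilon>) \<and>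
    (\<exists>\<epsilon>. basis_coords (V i) (Bs \<union> Hs \<union> Ls) \<epsilon>) \<and>
    Bs \<inter> Hs = {} \<and> Bs \<inter> Ls = {} \<and> Hs \<inter> Ls = {})"

text \<open>The basis of the boundaries is an input, because the preceding degree imposes it; it is
  extended first to the cycles and then to the whole space.\<close>

lemma adapted_ex:
  assumes i: "i \<le> m" and B: "basis_coords ((V i)\<lparr>carrier := boundaries V D i\<rparr>) Bs \<epsilon>0"
  shows "\<exists>Hs Ls. adapted i (Bs, Hs, Ls)"
proof -
  obtain X x where "coordinates (V i) (X :: 'v set) x" using V_coords[OF i] by blast
  then interpret U: coordinates "V i" X x .
  obtain b1 \<epsilon>1 where b1: "Bs \<subseteq> b1" "basis_coords ((V i)\<lparr>carrier := cycles m V D i\<rparr>) b1 \<epsilon>1"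
    using U.subspace_basis[OF cycles_lin_sub[OF i] boundaries_cycles[OF i] B] by blast
  have "lin_sub (V i) (carrier (V i))" by (simp add: lin_sub_def U.zero_closed U.add_closed U.smult_closed)
  from U.subspace_basis[OF this cycles_carrier b1(2)]
  obtain b2 \<epsilon>2 where b2: "b1 \<subseteq> b2" "basis_coords (V i) b2 \<epsilon>2" by auto
  have "Bs \<union> (b1 - Bs) = b1" "Bs \<union> (b1 - Bs) \<union> (b2 - b1) = b2" using b1(1) b2(1) by auto
  then have "adapted i (Bs, b1 - Bs, b2 - b1)"
    using B b1 b2 unfolding adapted_def by auto
  then show ?thesis by blast
qed

lemma adapted_step:
  assumes i: "i < m" and ad: "adapted i (Bs, Hs, Ls)"
  shows "inj_on (D i) Ls" "\<exists>\<epsilon>. basis_coords ((V (Suc i))\<lparr>carrier := boundaries V D (Suc i)\<rparr>) (D i ` Ls) \<epsilon>"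
proof -
  obtain Z y where W: "coordinates (V (Suc i)) (Z :: 'v set) y" using V_coords[of "Suc i"] i by auto
  have "\<exists>\<epsilon>. basis_coords ((V i)\<lparr>carrier := cycles m V D i\<rparr>) (Bs \<union> Hs) \<epsilon>"
    "\<exists>\<epsilon>. basis_coords (V i) (Bs \<union> Hs \<union> Ls) \<epsilon>" and disj: "(Bs \<union> Hs) \<inter> Ls = {}"
    using ad by (simp_all add: adapted_def Int_Un_distrib2)
  then obtain \<epsilon>1 \<epsilon>2 where e: "basis_coords ((V i)\<lparr>carrier := cycles m V D i\<rparr>) (Bs \<union> Hs) \<epsilon>1"
    "basis_coords (V i) (Bs \<union> Hs \<union> Ls) \<epsilon>2" by metis
  have c: "cycles m V D i = {u \<in> carrier (V i). D i u = \<zero>\<^bsub>V (Suc i)\<^esub>}" using i by (simp add: cycles_def)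
  note * = image_basis[OF e(2) W D_lin[OF i] e(1) c refl disj]
  show "inj_on (D i) Ls" by (rule *(1))
  show "\<exists>\<epsilon>. basis_coords ((V (Suc i))\<lparr>carrier := boundaries V D (Suc i)\<rparr>) (D i ` Ls) \<epsilon>"
    using *(2) by (simp add: boundaries_def)
qed

text \<open>The bases are chosen degree by degree: the boundary basis in degree \<open>i + 1\<close>
  must be the image of the complement already chosen in degree \<open>i\<close>.\<close>

lemma adapted_seq:
  "\<exists>F. \<forall>i. (i \<le> m \<longrightarrow> adapted i (F i)) \<and> (i < m \<longrightarrow> fst (F (Suc i)) = D i ` snd (snd (F i)))
     \<and> fst (F 0) = {}"
proof -
  have "\<exists>F. \<forall>i. ((i \<le> m \<longrightarrow> adapted i (F i)) \<and> (i = 0 \<longrightarrow> fst (F i) = {})) \<and>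
    (i < m \<longrightarrow> fst (F (Suc i)) = D i ` snd (snd (F i)))"
  proof (rule dependent_nat_choice)
    obtain X x where "coordinates (V 0) (X :: 'v set) x" using V_coords[of 0] by blast
    from basis_coords_empty[OF this]
    have "\<exists>Hs Ls. adapted 0 ({}, Hs, Ls)" by (intro adapted_ex) (auto simp: boundaries_def)
    then show "\<exists>F. (0 \<le> m \<longrightarrow> adapted 0 F) \<and> ((0::nat) = 0 \<longrightarrow> fst F = {})" by auto
  next
    fix F i assume F: "(i \<le> m \<longrightarrow> adapted i F) \<and> (i = 0 \<longrightarrow> fst F = {})"
    show "\<exists>G. ((Suc i \<le> m \<longrightarrow> adapted (Suc i) G) \<and> (Suc i = 0 \<longrightarrow> fst G = {})) \<and>
      (i < m \<longrightarrow> fst G = D i ` snd (snd F))"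
    proof (cases "i < m")
      case True
      obtain Bs Hs Ls where BHL: "F = (Bs, Hs, Ls)" by (cases F)
      then have "\<exists>Hs' Ls'. adapted (Suc i) (D i ` Ls, Hs', Ls')"
        using adapted_step(2)[OF True, of Bs Hs Ls] F True adapted_ex[of "Suc i"] by auto
      then show ?thesis using BHL by auto
    qed auto
  qed
  then obtain F where F: "\<forall>i. ((i \<le> m \<longrightarrow> adapted i (F i)) \<and> (i = 0 \<longrightarrow> fst (F i) = {})) \<and>
    (i < m \<longrightarrow> fst (F (Suc i)) = D i ` snd (snd (F i)))" by blast
  then show ?thesis by (intro exI[of _ F]) auto
qed

text \<open>The coordinate of a cohomology class, taken from some representative; representatives
  differ by boundaries, whose coordinates in \<open>H\<close> vanish.\<close>

definition rep :: "('v \<Rightarrow> 'v \<Rightarrow> 'k) \<Rightarrow> 'v \<Rightarrow> 'v set \<Rightarrow> 'k" where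
  "rep \<epsilon> h X = \<epsilon> h (SOME u. u \<in> X)"

lemma cohomology_coords:
  assumes i: "i \<le> m" and B: "basis_coords ((V i)\<lparr>carrier := boundaries V D i\<rparr>) Bs \<epsilon>0"
    and Z: "basis_coords ((V i)\<lparr>carrier := cycles m V D i\<rparr>) (Bs \<union> Hs) \<epsilon>1"
    and T: "basis_coords (V i) (Bs \<union> Hs \<union> Ls) \<epsilon>"
    and disj: "Bs \<inter> Hs = {}" "Bs \<inter> Ls = {}" "Hs \<inter> Ls = {}"
  shows "coordinates (cohomology m V D i) Hs (rep \<epsilon>)"
proof -
  let ?T = "Bs \<union> Hs \<union> Ls" and ?Z = "cycles m V D i" and ?B = "boundaries V D i"
  interpret U: coordinates "V i" ?T \<epsilon> using T by (simp add: basis_coords_def)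
  have ZV: "?Z \<subseteq> carrier (V i)" by (rule cycles_carrier)
  have BV: "?B \<subseteq> carrier (V i)" using boundaries_cycles[OF i] ZV by blast
  have "?T - (Bs \<union> Hs) = Ls" "?T - Bs = Hs \<union> Ls" using disj by auto
  then have Z_iff: "u \<in> ?Z \<longleftrightarrow> u \<in> carrier (V i) \<and> (\<forall>v\<in>Ls. \<epsilon> v u = 0)"
    and B_iff: "u \<in> ?B \<longleftrightarrow> u \<in> carrier (V i) \<and> (\<forall>v\<in>Hs \<union> Ls. \<epsilon> v u = 0)" for u
    using subspace_coords[OF Z ZV T, of u] subspace_coords[OF B BV T, of u] by auto
  \<comment> \<open>The cosets are exactly the sets of cycles with prescribed coordinates in
    \<open>Hs\<close>. This turns the set operations of \<open>quot_module\<close> into operations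
    on coordinate functions.\<close>
  define cl where "cl f = {u \<in> ?Z. \<forall>h\<in>Hs. \<epsilon> h u = f h}" for f
  have cl_ne: "\<exists>u. u \<in> cl f" for f
  proof -
    have "U.pt (\<lambda>v. if v \<in> Hs then f v else 0) \<in> cl f"
      using U.pt disj by (auto simp: cl_def Z_iff)
    then show ?thesis by blast
  qed
  have rep_cl: "rep \<epsilon> h (cl f) = f h" if "h \<in> Hs" for h f
    using someI_ex[OF cl_ne[of f]] that by (simp add: rep_def cl_def)
  have coset: "?B +>\<^bsub>(V i)\<lparr>carrier := S\<rparr>\<^esub> u = cl (\<lambda>h. \<epsilon> h u)" if u: "u \<in> ?Z" for u S
  proof
    have uV: "u \<in> carrier (V i)" using u ZV by blast
    show "?B +>\<^bsub>(V i)\<lparr>carrier := S\<rparr>\<^esub> u \<subseteq> cl (\<lambda>h. \<epsilon> h u)"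
      using u uV by (auto simp: a_r_coset_def' cl_def Z_iff B_iff U.x_add U.add_closed)
    show "cl (\<lambda>h. \<epsilon> h u) \<subseteq> ?B +>\<^bsub>(V i)\<lparr>carrier := S\<rparr>\<^esub> u"
    proof
      fix w assume w: "w \<in> cl (\<lambda>h. \<epsilon> h u)"
      then have wV: "w \<in> carrier (V i)" using ZV by (auto simp: cl_def)
      let ?b = "w \<oplus>\<^bsub>V i\<^esub> (-1) \<odot>\<^bsub>V i\<^esub> u"
      have "?b \<in> ?B" using w u uV wV
        by (auto simp: B_iff cl_def Z_iff U.x_add U.x_smult U.smult_closed U.add_closed)
      moreover have "w = ?b \<oplus>\<^bsub>V i\<^esub> u"
        using uV wV by (intro U.x_eqI) (auto simp: U.x_add U.x_smult U.smult_closed U.add_closed)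
      ultimately show "w \<in> ?B +>\<^bsub>(V i)\<lparr>carrier := S\<rparr>\<^esub> u" by (auto simp: a_r_coset_def')
    qed
  qed
  let ?W = "cohomology m V D i"
  have carrier: "carrier ?W = range cl"
  proof
    have "carrier ?W = (\<lambda>u. ?B +>\<^bsub>(V i)\<lparr>carrier := ?Z\<rparr>\<^esub> u) ` ?Z"
      by (auto simp: cohomology_def quot_module_def A_RCOSETS_def')
    also have "\<dots> = (\<lambda>u. cl (\<lambda>h. \<epsilon> h u)) ` ?Z" by (rule image_cong[OF refl coset])
    finally have c: "carrier ?W = (\<lambda>u. cl (\<lambda>h. \<epsilon> h u)) ` ?Z" .
    then show "carrier ?W \<subseteq> range cl" by auto
    show "range cl \<subseteq> carrier ?W"
    proof
      fix X assume "X \<in> range cl"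
      then obtain f where f: "X = cl f" by blast
      obtain u where u: "u \<in> cl f" using cl_ne by blast
      then have "cl f = cl (\<lambda>h. \<epsilon> h u)" by (auto simp: cl_def)
      then show "X \<in> carrier ?W" using u f c by (auto simp: cl_def)
    qed
  qed
  have zero: "\<zero>\<^bsub>?W\<^esub> = cl (\<lambda>h. 0)"
    by (auto simp: cohomology_def quot_module_def cl_def B_iff Z_iff)
  have add: "cl f \<oplus>\<^bsub>?W\<^esub> cl g = cl (\<lambda>h. f h + g h)" for f g
  proof -
    have "cl f \<oplus>\<^bsub>?W\<^esub> cl g = (\<Union>u\<in>cl f. \<Union>v\<in>cl g. {u \<oplus>\<^bsub>V i\<^esub> v})"
      by (simp add: cohomology_def quot_module_def set_add_def')
    also have "\<dots> = cl (\<lambda>h. f h + g h)"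
    proof
      show "(\<Union>u\<in>cl f. \<Union>v\<in>cl g. {u \<oplus>\<^bsub>V i\<^esub> v}) \<subseteq> cl (\<lambda>h. f h + g h)"
        by (auto simp: cl_def Z_iff U.x_add U.add_closed)
      show "cl (\<lambda>h. f h + g h) \<subseteq> (\<Union>u\<in>cl f. \<Union>v\<in>cl g. {u \<oplus>\<^bsub>V i\<^esub> v})"
      proof
        fix w assume w: "w \<in> cl (\<lambda>h. f h + g h)"
        obtain u where u: "u \<in> cl f" using cl_ne by blast
        let ?v = "w \<oplus>\<^bsub>V i\<^esub> (-1) \<odot>\<^bsub>V i\<^esub> u"
        have uw: "u \<in> carrier (V i)" "w \<in> carrier (V i)" using u w ZV by (auto simp: cl_def)
        have "?v \<in> cl g" using u w uw by (auto simp: cl_def Z_iff U.x_add U.x_smult U.smult_closed U.add_closed)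
        moreover have "w = u \<oplus>\<^bsub>V i\<^esub> ?v"
          using uw by (intro U.x_eqI) (auto simp: U.x_add U.x_smult U.smult_closed U.add_closed)
        ultimately show "w \<in> (\<Union>u\<in>cl f. \<Union>v\<in>cl g. {u \<oplus>\<^bsub>V i\<^esub> v})" using u by blast
      qed
    qed
    finally show ?thesis .
  qed
  have smult: "c \<odot>\<^bsub>?W\<^esub> cl f = cl (\<lambda>h. c * f h)" for c f
  proof -
    have "c \<odot>\<^bsub>?W\<^esub> cl f = (\<Union>u\<in>cl f. ?B +>\<^bsub>(V i)\<lparr>carrier := ?Z\<rparr>\<^esub> (c \<odot>\<^bsub>V i\<^esub> u))"
      by (simp add: cohomology_def quot_module_def)
    also have "\<dots> = (\<Union>u\<in>cl f. cl (\<lambda>h. c * f h))"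
    proof (rule SUP_cong[OF refl])
      fix u assume u: "u \<in> cl f"
      then have "c \<odot>\<^bsub>V i\<^esub> u \<in> ?Z" by (auto simp: cl_def Z_iff U.x_smult U.smult_closed)
      from coset[OF this] have "?B +>\<^bsub>(V i)\<lparr>carrier := ?Z\<rparr>\<^esub> (c \<odot>\<^bsub>V i\<^esub> u) = cl (\<lambda>h. \<epsilon> h (c \<odot>\<^bsub>V i\<^esub> u))" .
      also have "\<dots> = cl (\<lambda>h. c * f h)" using u by (auto simp: cl_def Z_iff U.x_smult)
      finally show "?B +>\<^bsub>(V i)\<lparr>carrier := ?Z\<rparr>\<^esub> (c \<odot>\<^bsub>V i\<^esub> u) = cl (\<lambda>h. c * f h)" .
    qed
    \<comment> \<open>The members of this union are all equal, so it collapses once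
      \<open>cl f\<close> has an element.\<close>
    also have "\<dots> = cl (\<lambda>h. c * f h)" using cl_ne[of f] by auto
    finally show ?thesis .
  qed
  show ?thesis
  proof (rule coordinates.intro)
    show "finite Hs" using U.finite_X by simp
    show "p = q" if pq: "p \<in> carrier ?W" "q \<in> carrier ?W" and eq: "\<And>j. j \<in> Hs \<Longrightarrow> rep \<epsilon> j p = rep \<epsilon> j q" for p q
    proof -
      obtain f g where fg: "p = cl f" "q = cl g" using pq carrier by auto
      then have "f h = g h" if "h \<in> Hs" for h using eq[OF that] rep_cl[OF that] by simp
      then show ?thesis using fg by (auto simp: cl_def)
    qed
    show "\<exists>p\<in>carrier ?W. \<forall>j\<in>Hs. rep \<epsilon> j p = f j" for f using rep_cl carrier by blast
  qed (auto simp: carrier zero add smult rep_cl)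
qed

text \<open>The indices are the basis vectors, so the bijection \<open>d\<close> from
  \<open>L i\<close> to \<open>B (i + 1)\<close> is \<open>D i\<close> itself.\<close>

lemma split:
  "\<exists>T \<epsilon> H \<eta> B L. split_complex m V T \<epsilon> (cohomology m V D) H \<eta> B L D D"
proof -
  obtain F where F: "\<forall>i. (i \<le> m \<longrightarrow> adapted i (F i)) \<and> (i < m \<longrightarrow> fst (F (Suc i)) = D i ` snd (snd (F i))) \<and> fst (F 0) = {}"
    using adapted_seq by (rule exE)
  define B where "B i = fst (F i)" for i
  define H where "H i = fst (snd (F i))" for i
  define L where "L i = snd (snd (F i))" for i
  define T where "T i = B i \<union> H i \<union> L i" for i
  have ad: "adapted i (B i, H i, L i)" if "i \<le> m" for i using F that by (simp add: B_def H_def L_def)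
  have "\<exists>\<epsilon>. basis_coords (V i) (T i) \<epsilon>" if "i \<le> m" for i using ad[OF that] by (simp add: adapted_def T_def)
  then obtain \<epsilon> where \<epsilon>: "\<And>i. i \<le> m \<Longrightarrow> basis_coords (V i) (T i) (\<epsilon> i)" by metis
  have disj: "B i \<inter> H i = {}" "B i \<inter> L i = {}" "H i \<inter> L i = {}" if "i \<le> m" for i
    using ad[OF that] by (auto simp: adapted_def)
  have BD: "B (Suc i) = D i ` L i" if "i < m" for i using F that by (simp add: B_def L_def)
  have Z: "\<exists>\<epsilon>1. basis_coords ((V i)\<lparr>carrier := cycles m V D i\<rparr>) (B i \<union> H i) \<epsilon>1" if "i \<le> m" for i
    using ad[OF that] by (simp add: adapted_def)
  have coords: "graded_coords m V T \<epsilon>"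
    using \<epsilon> by (intro graded_coords.intro) (simp_all add: basis_coords_def)
  interpret V: graded_coords m V T \<epsilon> by (rule coords)
  have coh: "graded_coords m (cohomology m V D) H (\<lambda>i. rep (\<epsilon> i))"
  proof (rule graded_coords.intro)
    fix i assume i: "i \<le> m"
    obtain \<epsilon>0 \<epsilon>1 where e: "basis_coords ((V i)\<lparr>carrier := boundaries V D i\<rparr>) (B i) \<epsilon>0"
      "basis_coords ((V i)\<lparr>carrier := cycles m V D i\<rparr>) (B i \<union> H i) \<epsilon>1"
      using ad[OF i] by (auto simp: adapted_def)
    show "coordinates (cohomology m V D i) (H i) (rep (\<epsilon> i))"
      by (rule cohomology_coords[OF i e \<epsilon>[OF i, unfolded T_def] disj[OF i]])
  qed
  have TZ: "u \<in> cycles m V D i \<longleftrightarrow> u \<in> carrier (V i) \<and> (\<forall>v\<in>L i. \<epsilon> i v u = 0)" if i: "i \<le> m" for i u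
  proof -
    obtain \<epsilon>1 where e: "basis_coords ((V i)\<lparr>carrier := cycles m V D i\<rparr>) (B i \<union> H i) \<epsilon>1" using Z[OF i] by blast
    have "B i \<union> H i \<subseteq> T i" by (auto simp: T_def)
    moreover have "T i - (B i \<union> H i) = L i" using disj[OF i] by (auto simp: T_def)
    ultimately show ?thesis using subspace_coords[OF e cycles_carrier \<epsilon>[OF i], of u] by simp
  qed
  have TV: "T i \<subseteq> carrier (V i)" if "i \<le> m" for i using \<epsilon>[OF that] by (simp add: basis_coords_def)
  have \<epsilon>T: "\<epsilon> i u v = of_bool (u = v)" if "i \<le> m" "u \<in> T i" "v \<in> T i" for i u v
    using \<epsilon>[OF that(1)] that by (simp add: basis_coords_def)
  have "split_complex m V T \<epsilon> (cohomology m V D) H (\<lambda>i. rep (\<epsilon> i)) B L D D"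
  proof (intro split_complex.intro split_complex_axioms.intro coords coh)
    show "T i = B i \<union> H i \<union> L i" for i by (rule T_def)
    show "B i \<inter> H i = {}" "B i \<inter> L i = {}" "H i \<inter> L i = {}" if "i \<le> m" for i using disj[OF that] by auto
    show "B 0 = {}" using F by (simp add: B_def)
    \<comment> \<open>In the top degree every vector is a cycle, so the complement of the cycles is
      empty.\<close>
    show "L m = {}"
    proof (rule ccontr)
      assume "L m \<noteq> {}"
      then obtain l where l: "l \<in> L m" by blast
      then have lT: "l \<in> T m" by (simp add: T_def)
      then have "l \<in> cycles m V D m" using TV[of m] by (auto simp: cycles_def)
      then have "\<epsilon> m l l = 0" using TZ[of m l] l by simp
      then show False using \<epsilon>T[of m l l] lT by simp
    qed
    show "bij_betw (D i) (L i) (B (Suc i))" if i: "i < m" for i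
      unfolding bij_betw_def using BD[OF i] adapted_step(1)[OF i ad] i by simp
    show "D \<in> carrier (hom_gr1 m V)" using D by (simp add: complexes_def)
    show "V.ent (i, b, a) D = of_bool (a \<in> L i \<and> b = D i a)"
      if i: "i < m" and ba: "b \<in> T (Suc i)" "a \<in> T i" for i b a
    proof -
      have il: "i \<le> m" "Suc i \<le> m" using i by auto
      have "V.un i a = a" by (rule basis_coords_unit[OF \<epsilon>[OF il(1)] ba(2)])
      then have e: "V.ent (i, b, a) D = \<epsilon> (Suc i) b (D i a)" by (simp add: V.ent_def)
      show ?thesis
      proof (cases "a \<in> L i")
        case True
        then have "D i a \<in> T (Suc i)" using BD[OF i] by (auto simp: T_def)
        then show ?thesis using e \<epsilon>T[OF il(2) ba(1)] True by simp
      next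
        case False
        have "\<forall>v\<in>L i. \<epsilon> i v a = 0" using \<epsilon>T[OF il(1) _ ba(2)] False by (auto simp: T_def)
        then have "a \<in> cycles m V D i" using TZ[OF il(1), of a] TV[OF il(1)] ba(2) by blast
        then have "D i a = \<zero>\<^bsub>V (Suc i)\<^esub>" using i by (simp add: cycles_def)
        moreover have "\<epsilon> (Suc i) b \<zero>\<^bsub>V (Suc i)\<^esub> = 0"
          using coordinates.x_zero[OF V.C[OF il(2)] ba(1)] .
        ultimately show ?thesis using e False by simp
      qed
    qed
  qed
  then show ?thesis by blast
qed

end

theorem proposition2p9:
  fixes V :: "nat \<Rightarrow> ('k::{alg_closed_field, field_char_0}, 'v) module"
    and m :: nat
    and D :: "nat \<Rightarrow> 'v \<Rightarrow> 'v"
  assumes "graded_space m V"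
    and "D \<in> complexes m V"
  shows
    "normal_cone_fiber (hom_gr1 m V) (complexes_ideal m V) (stratum m V D) D
       \<cong>\<^sub>g\<^sub>r subcone (hom_gr1 m (cohomology m V D)) (complexes_ideal m (cohomology m V D))
     \<and>
     (\<forall>r\<in>rank_bounds m V. D \<in> complexes_le m V r \<longrightarrow>
       normal_cone_fiber (hom_gr1 m V) (complexes_le_ideal m V r) (stratum m V D) D
         \<cong>\<^sub>g\<^sub>r subcone (hom_gr1 m (cohomology m V D))
               (complexes_le_ideal m (cohomology m V D) (\<lambda>j. r j - ranks m V D j)))"
proof -
  interpret fin_complex m V D by (rule fin_complex.intro[OF assms])
  obtain T \<epsilon> H \<eta> B L where "split_complex m V T \<epsilon> (cohomology m V D) H \<eta> B L D D"
    using split by blast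
  then interpret split_complex m V T \<epsilon> "cohomology m V D" H \<eta> B L D D .
  show ?thesis using normal_cone_complexes[OF assms(2)] normal_cone_complexes_le by blast
qed

end
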